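(* Let $\boldsymbol{X}=(\boldsymbol{X}_t)_{t\geqslant 0}$, $\boldsymbol{X}_t=\int_{-\infty}^t\big(\Phi(t-u)-\Psi(-u)\big)\,\mathrm{d}\boldsymbol{L}_u$, be the $\mathbb{R}^d$-valued moving average process with kernel functions $\Phi,\Psi$ and driving two-sided Lévy process $\boldsymbol{L}$ with characteristic triplet $(\boldsymbol{b},\mathfrak{S},\Lambda)$ described in the context. Suppose that $\boldsymbol{L}$ is a non-degenerate Brownian motion, that is, $\det(\mathfrak{S})\neq 0$ and $\Lambda=0$. Assume, further, that the processes $\boldsymbol{X}$ and $\boldsymbol{A}^{t_0}=(\boldsymbol{A}^{t_0}_t)_{t\geqslant t_0}$, $\boldsymbol{A}^{t_0}_t=\int_{-\infty}^{t_0}\big(\Phi(t-u)-\Phi(t_0-u)\big)\,\mathrm{d}\boldsymbol{L}_u$, for any $t_0\geqslant 0$, are continuous (modulo taking modifications). If $$0\in \operatorname{ess\,supp}\,\mathrm{det}^*(\Phi),$$ then $(\boldsymbol{X}_t)_{t\in[0,T]}$ has conditional full support (CFS) with respect to $\big(\mathscr{F}^{\boldsymbol{L},\mathrm{inc}}_t\big)_{t\in[0,T]}$ for any $T>0$.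
   Context: Setting. $d\in\mathbb{N}$; $\mathbb{M}_d$ is the space of real $d\times d$ matrices; $\|\cdot\|$ is the Euclidean/Frobenius norm. $(\boldsymbol{L}_t)_{t\geqslant0}$ is a càdlàg Lévy process in $\mathbb{R}^d$ on a probability space $(\Omega,\mathscr{F},\mathbf{P})$ with characteristic triplet $(\boldsymbol{b},\mathfrak{S},\Lambda)$ with respect to the truncation $\boldsymbol{x}\mapsto\boldsymbol{x}\mathbf{1}_{\{\|\boldsymbol{x}\|\leqslant1\}}$: $\boldsymbol{b}\in\mathbb{R}^d$ is the drift, $\mathfrak{S}\in\mathbb{M}_d$ (symmetric positive semidefinite) is the Gaussian covariance, $\Lambda$ is the Lévy measure. It is extended to a two-sided càdlàg process $(\boldsymbol{L}_t)_{t\in\mathbb{R}}$ by $\boldsymbol{L}_t=-\boldsymbol{L}'_{(-t)-}$ for $t<0$, where $\boldsymbol{L}'$ is an independent copy of $(\boldsymbol{L}_t)_{t\geqslant 0}$. $\Phi,\Psi:\mathbb{R}\to\mathbb{M}_d$ are measurable with $\Phi(t)=0=\Psi(t)$ for $t<0$, and $K(t,u)=\Phi(t-u)-\Psi(-u)$, with $i$-th row vector $\boldsymbol{k}_i(t,u)\in\mathbb{R}^d$. Stochastic integrals of deterministic functions are in the sense of Rajput and Rosiński: they are limits in probability of integrals of simple functions (a measurable $\boldsymbol{g}:\mathbb{R}\to\mathbb{R}^d$ is integrable if there are simple $\boldsymbol{g}_n\to\boldsymbol{g}$ a.e. such that $\int_B \langle\boldsymbol{g}_n,\mathrm{d}\boldsymbol{L}\rangle$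 converges in probability for every Borel $B\subset\mathbb{R}$). Standing integrability assumption: for all $i=1,\dots,d$ and $t\geqslant0$, $$\int_{-\infty}^t\langle\boldsymbol{k}_i(t,u),\mathfrak{S}\boldsymbol{k}_i(t,u)\rangle\mathrm{d}u<\infty,\qquad \int_{-\infty}^t\int_{\mathbb{R}^d}\min\{1,\langle\boldsymbol{k}_i(t,u),\boldsymbol{x}\rangle^2\}\Lambda(\mathrm{d}\boldsymbol{x})\mathrm{d}u<\infty,$$ $$\int_{-\infty}^t\Big|\langle\boldsymbol{k}_i(t,u),\boldsymbol{b}\rangle+\int_{\mathbb{R}^d}\big(\tau_1(\langle\boldsymbol{k}_i(t,u),\boldsymbol{x}\rangle)-\langle\boldsymbol{k}_i(t,u),\tau_d(\boldsymbol{x})\rangle\big)\Lambda(\mathrm{d}\boldsymbol{x})\Big|\mathrm{d}u<\infty,$$ where $\tau_1(x)=x\mathbf{1}_{\{|x|\leqslant1\}}$ and $\tau_d(\boldsymbol{x})=\boldsymbol{x}\mathbf{1}_{\{\|\boldsymbol{x}\|\leqslant1\}}$. Then all integrals in the claim exist. Filtration: $\mathscr{F}^{\boldsymbol{L},\mathrm{inc}}_t=\sigma(\boldsymbol{L}_u-\boldsymbol{L}_v:-\infty<v<u\leqslant t)$. CFS: a continuous $\mathbb{R}^d$-valued process $\boldsymbol{Y}=(\boldsymbol{Y}_t)_{t\in[0,T]}$ has conditional full support with respect to a filtration $(\mathscr{F}_t)_{t\in[0,T]}$ if it is adapted to it and, for any $t_0\in[0,T)$, any continuous $\boldsymbol{f}:[t_0,T]\to\mathbb{R}^d$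 with $\boldsymbol{f}(t_0)=\boldsymbol{0}$ and any $\varepsilon>0$, $\mathbf{P}\big[\sup_{t\in[t_0,T]}\|\boldsymbol{Y}_t-\boldsymbol{Y}_{t_0}-\boldsymbol{f}(t)\|<\varepsilon\,\big|\,\mathscr{F}_{t_0}\big]>0$ almost surely. Convolution determinant: for locally integrable $g,h$ on $\mathbb{R}_+=[0,\infty)$, $(g*h)(t)=\int_0^tg(t-u)h(u)\mathrm{d}u$. For $G:\mathbb{R}_+\to\mathbb{M}_n$ with locally integrable entries, $\mathrm{det}^*(G)(t)=\sum_{\sigma\in S_n}\mathrm{sgn}(\sigma)\big(G_{1,\sigma(1)}*\cdots*G_{n,\sigma(n)}\big)(t)$, $t\geqslant0$. The essential support $\operatorname{ess\,supp}f$ of a measurable function $f$ on $\mathbb{R}_+$ (extended by $0$ to $\mathbb{R}$) is the smallest closed subset of $\mathbb{R}$ such that $f=0$ almost everywhere in its complement. *)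

theory Defs
  imports "HOL-Probability.Probability"
begin

subsection \<open>Processes\<close>

definition tendsto_in_prob ::
    "'w measure \<Rightarrow> (nat \<Rightarrow> 'w \<Rightarrow> 'a::real_normed_vector) \<Rightarrow> ('w \<Rightarrow> 'a) \<Rightarrow> bool" where
  "tendsto_in_prob P Z Z' \<longleftrightarrow>
     (\<forall>\<epsilon>>0. (\<lambda>n. measure P {\<omega> \<in> space P. norm (Z n \<omega> - Z' \<omega>) > \<epsilon>}) \<longlonglongrightarrow> 0)"

definition modification :: "'w measure \<Rightarrow> real set \<Rightarrow> (real \<Rightarrow> 'w \<Rightarrow> 'a) \<Rightarrow> (real \<Rightarrow> 'w \<Rightarrow> 'a) \<Rightarrow> bool" where
  "modification P I X Y \<longleftrightarrow> (\<forall>t\<in>I. AE \<omega> in P. Y t \<omega> = X t \<omega>)"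

text \<open>Path properties are required for almost every \<open>\<omega>\<close>: \<open>P\<close> need not be complete, and
  filtrations below are not augmented by null sets.\<close>

definition continuous_process ::
    "'w measure \<Rightarrow> real set \<Rightarrow> (real \<Rightarrow> 'w \<Rightarrow> 'a::topological_space) \<Rightarrow> bool" where
  "continuous_process P I Y \<longleftrightarrow>
     (\<forall>t\<in>I. Y t \<in> borel_measurable P) \<and> (AE \<omega> in P. continuous_on I (\<lambda>t. Y t \<omega>))"

definition has_continuous_modification ::
    "'w measure \<Rightarrow> real set \<Rightarrow> (real \<Rightarrow> 'w \<Rightarrow> 'a::topological_space) \<Rightarrow> bool" where
  "has_continuous_modification P I X \<longleftrightarrow> (\<exists>Y. modification P I X Y \<and> continuous_process P I Y)"

definition adapted_process ::
    "(real \<Rightarrow> 'w measure) \<Rightarrow> real set \<Rightarrow> (real \<Rightarrow> 'w \<Rightarrow> 'a::topological_space) \<Rightarrow> bool" where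
  "adapted_process F I Y \<longleftrightarrow> (\<forall>t\<in>I. Y t \<in> borel_measurable (F t))"

subsection \<open>Levy processes\<close>

definition cadlag :: "(real \<Rightarrow> 'a::topological_space) \<Rightarrow> bool" where
  "cadlag x \<longleftrightarrow> (\<forall>t\<ge>0. (x \<longlongrightarrow> x t) (at_right t)) \<and> (\<forall>t>0. \<exists>l. (x \<longlongrightarrow> l) (at_left t))"

text \<open>Only the restriction of \<open>L\<close> to times \<open>t \<ge> 0\<close> matters here.\<close>

definition levy_process :: "'w measure \<Rightarrow> (real \<Rightarrow> 'w \<Rightarrow> real^'d) \<Rightarrow> bool" where
  "levy_process P L \<longleftrightarrow>
     (\<forall>t\<ge>0. L t \<in> borel_measurable P) \<and>
     (AE \<omega> in P. L 0 \<omega> = 0) \<and>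
     (AE \<omega> in P. cadlag (\<lambda>t. L t \<omega>)) \<and>
     (\<forall>(n::nat) s. 0 \<le> s 0 \<and> (\<forall>k<n. s k < s (Suc k)) \<longrightarrow>
        prob_space.indep_vars P (\<lambda>_. borel) (\<lambda>k \<omega>. L (s (Suc k)) \<omega> - L (s k) \<omega>) {..<n}) \<and>
     (\<forall>s\<ge>0. \<forall>h\<ge>0. distr P borel (\<lambda>\<omega>. L (s + h) \<omega> - L s \<omega>) = distr P borel (L h))"

definition trunc :: "'a::real_normed_vector \<Rightarrow> 'a" where
  "trunc x = (if norm x \<le> 1 then x else 0)"

definition levy_measure :: "(real^'d) measure \<Rightarrow> bool" where
  "levy_measure \<Lambda> \<longleftrightarrow> sets \<Lambda> = sets borel \<and> emeasure \<Lambda> {0} = 0 \<and>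
     (\<integral>\<^sup>+x. ennreal (min 1 ((norm x)\<^sup>2)) \<partial>\<Lambda>) < \<infinity>"

definition levy_exponent :: "real^'d \<Rightarrow> real^'d^'d \<Rightarrow> (real^'d) measure \<Rightarrow> real^'d \<Rightarrow> complex" where
  "levy_exponent b S \<Lambda> \<theta> =
     \<i> * complex_of_real (\<theta> \<bullet> b) - complex_of_real (\<theta> \<bullet> (S *v \<theta>)) / 2
       + (CLINT x|\<Lambda>. (iexp (\<theta> \<bullet> x) - 1 - \<i> * complex_of_real (\<theta> \<bullet> trunc x)))"

definition levy_triplet ::
    "'w measure \<Rightarrow> (real \<Rightarrow> 'w \<Rightarrow> real^'d) \<Rightarrow> real^'d \<Rightarrow> real^'d^'d \<Rightarrow> (real^'d) measure \<Rightarrow> bool" where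
  "levy_triplet P L b S \<Lambda> \<longleftrightarrow>
     transpose S = S \<and> (\<forall>x. 0 \<le> x \<bullet> (S *v x)) \<and> levy_measure \<Lambda> \<and>
     (\<forall>t\<ge>0. \<forall>\<theta>. (CLINT \<omega>|P. iexp (\<theta> \<bullet> L t \<omega>)) = exp (complex_of_real t * levy_exponent b S \<Lambda> \<theta>))"

text \<open>\<open>half_path L\<close> is the process \<open>(L\<^sub>t)\<close>, \<open>t \<ge> 0\<close>, as one random element of the product
  space, so that laws and independence of whole processes can be expressed.\<close>

definition half_path :: "(real \<Rightarrow> 'w \<Rightarrow> 'a) \<Rightarrow> 'w \<Rightarrow> real \<Rightarrow> 'a" where
  "half_path L \<omega> = (\<lambda>t\<in>{0..}. L t \<omega>)"

definition independent_copy ::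
    "'w measure \<Rightarrow> (real \<Rightarrow> 'w \<Rightarrow> real^'d) \<Rightarrow> (real \<Rightarrow> 'w \<Rightarrow> real^'d) \<Rightarrow> bool" where
  "independent_copy P L L' \<longleftrightarrow>
     (let E = (\<Pi>\<^sub>M t\<in>{0..}. borel) in
        prob_space.indep_var P E (half_path L) E (half_path L') \<and>
        distr P E (half_path L') = distr P E (half_path L))"

text \<open>For \<open>t < 0\<close> the value \<open>L t\<close> is minus the left limit of \<open>L'\<close> at \<open>- t\<close>.\<close>

definition two_sided_levy ::
    "'w measure \<Rightarrow> (real \<Rightarrow> 'w \<Rightarrow> real^'d) \<Rightarrow> real^'d \<Rightarrow> real^'d^'d \<Rightarrow> (real^'d) measure \<Rightarrow> bool" where
  "two_sided_levy P L b S \<Lambda> \<longleftrightarrow>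
     (\<forall>t. L t \<in> borel_measurable P) \<and> levy_process P L \<and> levy_triplet P L b S \<Lambda> \<and>
     (\<exists>L'. levy_process P L' \<and> independent_copy P L L' \<and>
        (AE \<omega> in P. \<forall>t<0. ((\<lambda>s. L' s \<omega>) \<longlongrightarrow> - L t \<omega>) (at_left (- t))))"

definition incr_filtration :: "'w measure \<Rightarrow> (real \<Rightarrow> 'w \<Rightarrow> real^'d) \<Rightarrow> real \<Rightarrow> 'w measure" where
  "incr_filtration P L t =
     sigma (space P)
       {(\<lambda>\<omega>. L u \<omega> - L v \<omega>) -` B \<inter> space P | u v B. v < u \<and> u \<le> t \<and> B \<in> sets borel}"

subsection \<open>Stochastic integrals of deterministic functions\<close>

text \<open>The independently scattered random measure on the bounded Borel sets generated by the
  increments of \<open>L\<close>; it is unique up to null sets.\<close>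

definition levy_random_measure ::
    "'w measure \<Rightarrow> (real \<Rightarrow> 'w \<Rightarrow> real^'d) \<Rightarrow> (real set \<Rightarrow> 'w \<Rightarrow> real^'d) \<Rightarrow> bool" where
  "levy_random_measure P L N \<longleftrightarrow>
     (\<forall>A\<in>sets borel. bounded A \<longrightarrow> N A \<in> borel_measurable P) \<and>
     (\<forall>u v. v < u \<longrightarrow> (AE \<omega> in P. N {v<..u} \<omega> = L u \<omega> - L v \<omega>)) \<and>
     (\<forall>A :: nat \<Rightarrow> real set. disjoint_family A \<and> (\<forall>k. A k \<in> sets borel \<and> bounded (A k)) \<longrightarrow>
        prob_space.indep_vars P (\<lambda>_. borel) (\<lambda>k. N (A k)) UNIV \<and>
        (bounded (\<Union>k. A k) \<longrightarrow> (AE \<omega> in P. (\<lambda>k. N (A k) \<omega>) sums N (\<Union>k. A k) \<omega>)))"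

definition simple_integrand :: "(real \<Rightarrow> real^'d) \<Rightarrow> bool" where
  "simple_integrand g \<longleftrightarrow> simple_function borel g \<and> bounded {u. g u \<noteq> 0}"

definition simple_integral ::
    "(real set \<Rightarrow> 'w \<Rightarrow> real^'d) \<Rightarrow> real set \<Rightarrow> (real \<Rightarrow> real^'d) \<Rightarrow> 'w \<Rightarrow> real" where
  "simple_integral N B g \<omega> = (\<Sum>x\<in>range g - {0}. x \<bullet> N (g -` {x} \<inter> B) \<omega>)"

text \<open>\<open>g\<close> is \<open>L\<close>-integrable over the real line in the sense of Rajput and Rosinski, and \<open>Z\<close> is
  a version of its integral.\<close>

definition has_levy_integral ::
    "'w measure \<Rightarrow> (real \<Rightarrow> 'w \<Rightarrow> real^'d) \<Rightarrow> (real \<Rightarrow> real^'d) \<Rightarrow> ('w \<Rightarrow> real) \<Rightarrow> bool" where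
  "has_levy_integral P L g Z \<longleftrightarrow>
     Z \<in> borel_measurable P \<and>
     (\<exists>N h. levy_random_measure P L N \<and>
        (\<forall>n. simple_integrand (h n)) \<and>
        (AE u in lborel. (\<lambda>n. h n u) \<longlonglongrightarrow> g u) \<and>
        (\<forall>B\<in>sets borel. \<exists>Z'\<in>borel_measurable P.
            tendsto_in_prob P (\<lambda>n. simple_integral N B (h n)) Z') \<and>
        tendsto_in_prob P (\<lambda>n. simple_integral N UNIV (h n)) Z)"

text \<open>\<open>Z\<close> is a version of \<open>\<integral>\<^bsub>D\<^esub> G(u) dL\<^sub>u\<close> for matrix-valued \<open>G\<close>: integrate row by row.\<close>

definition has_matrix_levy_integral ::
    "'w measure \<Rightarrow> (real \<Rightarrow> 'w \<Rightarrow> real^'d) \<Rightarrow> real set \<Rightarrow> (real \<Rightarrow> real^'d^'d) \<Rightarrow> ('w \<Rightarrow> real^'d) \<Rightarrow> bool"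
  where
  "has_matrix_levy_integral P L D G Z \<longleftrightarrow>
     (\<forall>i. has_levy_integral P L (\<lambda>u. indicator D u *\<^sub>R row i (G u)) (\<lambda>\<omega>. Z \<omega> $ i))"

subsection \<open>Moving averages\<close>

definition ma_kernel :: "(real \<Rightarrow> real^'d^'d) \<Rightarrow> (real \<Rightarrow> real^'d^'d) \<Rightarrow> real \<Rightarrow> real \<Rightarrow> real^'d^'d" where
  "ma_kernel \<Phi> \<Psi> t u = \<Phi> (t - u) - \<Psi> (- u)"

definition ma_integrable ::
    "real^'d \<Rightarrow> real^'d^'d \<Rightarrow> (real^'d) measure \<Rightarrow>
     (real \<Rightarrow> real^'d^'d) \<Rightarrow> (real \<Rightarrow> real^'d^'d) \<Rightarrow> bool" where
  "ma_integrable b S \<Lambda> \<Phi> \<Psi> \<longleftrightarrow>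
     (\<forall>i. \<forall>t\<ge>0. let k = (\<lambda>u. row i (ma_kernel \<Phi> \<Psi> t u)) in
        (\<integral>\<^sup>+u\<in>{..t}. ennreal (k u \<bullet> (S *v k u)) \<partial>lborel) < \<infinity> \<and>
        (\<integral>\<^sup>+u\<in>{..t}. (\<integral>\<^sup>+x. ennreal (min 1 ((k u \<bullet> x)\<^sup>2)) \<partial>\<Lambda>) \<partial>lborel) < \<infinity> \<and>
        (\<integral>\<^sup>+u\<in>{..t}. ennreal \<bar>k u \<bullet> b + (\<integral>x. (trunc (k u \<bullet> x) - k u \<bullet> trunc x) \<partial>\<Lambda>)\<bar> \<partial>lborel)
          < \<infinity>)"

definition moving_average ::
    "'w measure \<Rightarrow> (real \<Rightarrow> 'w \<Rightarrow> real^'d) \<Rightarrow> (real \<Rightarrow> real^'d^'d) \<Rightarrow> (real \<Rightarrow> real^'d^'d) \<Rightarrow>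
     (real \<Rightarrow> 'w \<Rightarrow> real^'d) \<Rightarrow> bool" where
  "moving_average P L \<Phi> \<Psi> X \<longleftrightarrow>
     (\<forall>t\<ge>0. has_matrix_levy_integral P L {..t} (ma_kernel \<Phi> \<Psi> t) (X t))"

subsection \<open>Conditional full support\<close>

text \<open>Since the paths of \<open>Y\<close> are continuous only almost surely, the event below is in general
  measurable only with respect to the completion of \<open>P\<close>. (\<open>real_cond_exp\<close> of a function that is
  not measurable is a dummy value.)\<close>

definition conditional_full_support ::
    "'w measure \<Rightarrow> (real \<Rightarrow> 'w measure) \<Rightarrow> real \<Rightarrow> (real \<Rightarrow> 'w \<Rightarrow> real^'d) \<Rightarrow> bool" where
  "conditional_full_support P F T Y \<longleftrightarrow>
     continuous_process P {0..T} Y \<and> adapted_process F {0..T} Y \<and>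
     (\<forall>t0\<in>{0..<T}. \<forall>f. continuous_on {t0..T} f \<and> f t0 = 0 \<longrightarrow> (\<forall>\<epsilon>>0.
        AE \<omega> in P. real_cond_exp (completion P) (F t0)
          (indicator {\<omega>' \<in> space P. (SUP t\<in>{t0..T}. norm (Y t \<omega>' - Y t0 \<omega>' - f t)) < \<epsilon>}) \<omega> > 0))"

subsection \<open>Convolution determinant and essential support\<close>

definition conv :: "(real \<Rightarrow> real) \<Rightarrow> (real \<Rightarrow> real) \<Rightarrow> real \<Rightarrow> real" where
  "conv g h t = (LINT u:{0..t}|lborel. g (t - u) * h u)"

fun conv_list :: "(real \<Rightarrow> real) list \<Rightarrow> real \<Rightarrow> real" where
  "conv_list [] = (\<lambda>_. 0)"
| "conv_list [g] = g"
| "conv_list (g # h # gs) = conv g (conv_list (h # gs))"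

text \<open>The linear order on the index type only fixes the order of the factors (rows
  \<open>1, \<dots>, n\<close>). The function is extended by \<open>0\<close> to negative arguments.\<close>

definition conv_det :: "(real \<Rightarrow> real^'n::{finite,linorder}^'n::{finite,linorder}) \<Rightarrow> real \<Rightarrow> real" where
  "conv_det G t =
     (if t < 0 then 0
      else \<Sum>p | p permutes (UNIV :: 'n::{finite,linorder} set).
        of_int (sign p) * conv_list (map (\<lambda>i u. G u $ i $ p i) (sorted_list_of_set UNIV)) t)"

definition ess_supp :: "(real \<Rightarrow> real) \<Rightarrow> real set" where
  "ess_supp f = \<Inter>{C. closed C \<and> (AE x in lborel. x \<notin> C \<longrightarrow> f x = 0)}"

lemma ess_supp_smallest:
  shows "closed (ess_supp f)"
    and "AE x in lborel. x \<notin> ess_supp f \<longrightarrow> f x = 0"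
    and "closed C \<Longrightarrow> (AE x in lborel. x \<notin> C \<longrightarrow> f x = 0) \<Longrightarrow> ess_supp f \<subseteq> C"
proof -
  show "closed (ess_supp f)" unfolding ess_supp_def by (intro closed_Inter) auto
  show "closed C \<Longrightarrow> (AE x in lborel. x \<notin> C \<longrightarrow> f x = 0) \<Longrightarrow> ess_supp f \<subseteq> C"
    unfolding ess_supp_def by auto
  define U where "U = {- C | C. closed C \<and> (AE x in lborel. x \<notin> C \<longrightarrow> f x = 0)}"
  have "\<And>S. S \<in> U \<Longrightarrow> open S" by (auto simp: U_def)
  then obtain V where V: "V \<subseteq> U" "countable V" "\<Union>V = \<Union>U" using Lindelof[of U] by blast
  have "\<forall>S\<in>V. AE x in lborel. x \<in> S \<longrightarrow> f x = 0" using V(1) by (auto simp: U_def)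
  then have "AE x in lborel. \<forall>S\<in>V. x \<in> S \<longrightarrow> f x = 0" 
    by (subst AE_ball_countable[OF V(2)])
  moreover have "- ess_supp f = \<Union>U" by (auto simp: ess_supp_def U_def)
  then have "- ess_supp f = \<Union>V" using V(3) by simp
  then have "x \<notin> ess_supp f \<longleftrightarrow> (\<exists>S\<in>V. x \<in> S)" for x by blast
  ultimately show "AE x in lborel. x \<notin> ess_supp f \<longrightarrow> f x = 0" by auto
qed

end

theory Submission
  imports Defs "HOL-Real_Asymp.Real_Asymp"
begin

text \<open>Translating the Brownian motion after time \<open>t0\<close> by \<open>\<integral> S w\<close>, with a step function \<open>w\<close> on
  \<open>(t0, T]\<close>, changes its law to an equivalent one, does not affect the past up to \<open>t0\<close>, and moves the
  path of \<open>Y\<^sub>t - Y\<^bsub>t0\<^esub>\<close> by the convolution of \<open>\<Phi>\<close> with \<open>S w\<close>. On any past event of positive probability the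
  path stays near some continuous function with positive probability, so it suffices that the
  paths \<open>\<Phi> * h\<close>, \<open>h\<close> a step function, are uniformly dense in the continuous functions vanishing at \<open>0\<close>.
  A vector \<open>r\<close> that is orthogonal to all \<open>\<Phi> * h\<close> in \<open>L\<^sup>2\<close> solves a system of convolution equations.
  Eliminating with the adjugate of the matrix of Laplace transforms, one finds that the convolution
  of \<open>det\<^sup>* \<Phi>\<close> with each component of the time reversal of \<open>r\<close> vanishes before \<open>T\<close>, and Titchmarsh's
  theorem gives \<open>r = 0\<close>.\<close>

subsection \<open>Laplace transforms and Titchmarsh's theorem\<close>

text \<open>No conditional law is ever formed: a conditional probability is positive almost surely
  once the event meets every past event of positive probability with positive probability. Three
  obstacles shape the rest. Local integrability of \<open>\<Phi>\<close> has to be extracted from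
  the existence of the integrals, and \<open>det S \<noteq> 0\<close> is what lets each entry be
  tested. Only times up to \<open>T\<close> are visible, so convolution identities hold up to errors
  whose Laplace transforms are of order \<open>exp (- T * x)\<close>; hence the argument works with
  decay rates on the real half line, where decay at rate \<open>a\<close> means vanishing before
  \<open>a\<close>, and uses no analyticity. Finally, convergence in probability of integrals of
  simple functions controls the integrand in mean square but not its drift, so versions of an
  integral are compared up to an additive constant, which affects neither covariances nor
  measurability. As paths are continuous only almost surely and the filtration is not completed,
  path events become countable conditions at rational times.\<close>

definition laplace :: "(real \<Rightarrow> real) \<Rightarrow> real \<Rightarrow> real" where
  "laplace f x = (\<integral>t. exp (- x * t) * f t \<partial>lborel)"

text \<open>The positive and the negative part of \<open>f\<close> are densities of two finite
  measures that agree on all half lines \<open>{..<s}\<close>, an intersection-stable generator of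
  the Borel sets; hence the measures, and so the densities, coincide.\<close>

lemma AE_zero_if_integral_lessThan_zero:
  fixes f :: "real \<Rightarrow> real"
  assumes f: "integrable lborel f" and z: "\<And>s. (\<integral>t. indicator {..<s} t * f t \<partial>lborel) = 0"
  shows "AE t in lborel. f t = 0"
proof -
  define p where "p = (\<lambda>t. max 0 (f t))"
  define n where "n = (\<lambda>t. max 0 (- f t))"
  have [measurable]: "f \<in> borel_measurable borel" using f by auto
  have ip: "integrable lborel p" and "in": "integrable lborel n"
    using f unfolding p_def n_def by auto
  have pm[measurable]: "p \<in> borel_measurable borel" "n \<in> borel_measurable borel"
    unfolding p_def n_def by auto
  have int_ind: "integrable lborel (\<lambda>t. indicator {..<s} t * g t)"
    if "integrable lborel g" for s :: real and g :: "real \<Rightarrow> real"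
    using integrable_real_mult_indicator[OF _ that, of "{..<s}"] by (simp add: mult.commute)
  let ?P = "density lborel (\<lambda>t. ennreal (p t))" and ?N = "density lborel (\<lambda>t. ennreal (n t))"
  have em: "emeasure (density lborel (\<lambda>t. ennreal (g t))) {..<s} = ennreal (\<integral>t. indicator {..<s} t * g t \<partial>lborel)"
    if "integrable lborel g" "\<And>t. g t \<ge> 0" for g :: "real \<Rightarrow> real" and s :: real
  proof -
    have [measurable]: "g \<in> borel_measurable borel" using that by auto
    have "emeasure (density lborel (\<lambda>t. ennreal (g t))) {..<s} = (\<integral>\<^sup>+t. ennreal (g t) * indicator {..<s} t \<partial>lborel)"
      by (subst emeasure_density) auto
    also have "\<dots> = (\<integral>\<^sup>+t. ennreal (indicator {..<s} t * g t) \<partial>lborel)"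
      by (intro nn_integral_cong) (auto simp: indicator_def)
    also have "\<dots> = ennreal (\<integral>t. indicator {..<s} t * g t \<partial>lborel)"
      using int_ind[OF that(1)] that(2) by (subst nn_integral_eq_integral) auto
    finally show ?thesis .
  qed
  have eq: "emeasure ?P {..<s} = emeasure ?N {..<s}" for s
  proof -
    have "(\<integral>t. indicator {..<s} t * p t \<partial>lborel) - (\<integral>t. indicator {..<s} t * n t \<partial>lborel)
        = (\<integral>t. indicator {..<s} t * p t - indicator {..<s} t * n t \<partial>lborel)"
      by (subst Bochner_Integration.integral_diff[OF int_ind[OF ip] int_ind[OF "in"]]) simp
    also have "\<dots> = (\<integral>t. indicator {..<s} t * f t \<partial>lborel)"
      by (intro Bochner_Integration.integral_cong) (auto simp: p_def n_def indicator_def)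
    also have "\<dots> = 0" by (rule z)
    finally show ?thesis using em[OF ip, of s] em[OF "in", of s] by (simp add: p_def n_def)
  qed
  have "?P = ?N"
  proof (rule measure_eqI_generator_eq[where E="range (\<lambda>s::real. {..<s})" and \<Omega>=UNIV and A="\<lambda>n. {..<real n}"])
    show "Int_stable (range (\<lambda>s::real. {..<s}))"
    proof -
      have "{..<a} \<inter> {..<b} = {..<min a b}" for a b :: real by auto
      then show ?thesis by (auto simp: Int_stable_def)
    qed
    show "sets ?P = sigma_sets UNIV (range (\<lambda>s::real. {..<s}))"
      by (simp add: borel_Iio)
    show "sets ?N = sigma_sets UNIV (range (\<lambda>s::real. {..<s}))"
      by (simp add: borel_Iio)
    show "emeasure ?P X = emeasure ?N X" if "X \<in> range (\<lambda>s::real. {..<s})" for X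
      using that eq by auto
    show "(\<Union>i. {..<real i}) = UNIV" by (auto intro: reals_Archimedean2)
    show "emeasure ?P {..<real i} \<noteq> \<infinity>" for i
      by (subst em[OF ip]) (auto simp: p_def)
  qed auto
  then have "AE t in lborel. ennreal (p t) = ennreal (n t)"
    by (subst (asm) sigma_finite_measure.density_unique_iff[OF sigma_finite_lborel]) auto
  then show ?thesis
    by eventually_elim (auto simp: p_def n_def max_def split: if_splits)
qed

lemma integrable_exp_mult:
  fixes f :: "real \<Rightarrow> real"
  assumes f: "integrable lborel f" and neg: "\<And>t. t < 0 \<Longrightarrow> f t = 0" and "x \<ge> 0"
  shows "integrable lborel (\<lambda>t. exp (- x * t) * f t)"
proof (rule Bochner_Integration.integrable_bound[OF f])
  have [measurable]: "f \<in> borel_measurable borel" using f by auto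
  show "(\<lambda>t. exp (- x * t) * f t) \<in> borel_measurable lborel" by measurable
  show "AE t in lborel. norm (exp (- x * t) * f t) \<le> norm (f t)"
  proof (intro AE_I2)
    fix t
    show "norm (exp (- x * t) * f t) \<le> norm (f t)"
      using neg[of t] \<open>x \<ge> 0\<close> mult_left_le_one_le[of "\<bar>f t\<bar>" "exp (- x * t)"]
      by (cases "t < 0") (auto simp: abs_mult)
  qed
qed

text \<open>For \<open>t \<ge> a\<close> the exponential is at most \<open>exp (- a * x)\<close>.
  Together with the converse \<open>vanish_if_laplace_le\<close> this turns vanishing near the
  origin into a decay rate, and such rates add up under convolution.\<close>

lemma laplace_abs_le:
  fixes f :: "real \<Rightarrow> real"
  assumes f: "integrable lborel f" and neg: "\<And>t. t < 0 \<Longrightarrow> f t = 0" and "x \<ge> 0"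
    and v: "AE t in lborel. t < a \<longrightarrow> f t = 0"
  shows "\<bar>laplace f x\<bar> \<le> exp (- a * x) * (\<integral>t. \<bar>f t\<bar> \<partial>lborel)"
proof -
  have "\<bar>laplace f x\<bar> \<le> (\<integral>t. \<bar>exp (- x * t) * f t\<bar> \<partial>lborel)"
    unfolding laplace_def by (rule integral_abs_bound)
  also have "\<dots> \<le> (\<integral>t. exp (- a * x) * \<bar>f t\<bar> \<partial>lborel)"
  proof (rule integral_mono_AE)
    show "AE t in lborel. \<bar>exp (- x * t) * f t\<bar> \<le> exp (- a * x) * \<bar>f t\<bar>"
      using v
    proof eventually_elim
      case (elim t)
      have "exp (- x * t) \<le> exp (- a * x)" if "t \<ge> a"
        using mult_right_mono[OF that \<open>x \<ge> 0\<close>] by (simp add: mult.commute)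
      then show ?case using elim by (cases "t < a") (auto simp: abs_mult intro!: mult_right_mono)
    qed
  qed (use f integrable_exp_mult[OF f neg \<open>x \<ge> 0\<close>] in auto)
  finally show ?thesis by simp
qed

text \<open>The function \<open>1 - exp (- exp (n (s - t)))\<close> tends to the indicator of \<open>t < s\<close>, and expanding
  the outer exponential expresses its integral against \<open>f\<close> by values of the Laplace transform.\<close>

lemma vanish_if_laplace_le:
  fixes f :: "real \<Rightarrow> real"
  assumes f: "integrable lborel f" and neg: "\<And>t. t < 0 \<Longrightarrow> f t = 0"
    and le: "\<And>x. x \<ge> 0 \<Longrightarrow> \<bar>laplace f x\<bar> \<le> C * exp (- a * x)"
  shows "AE t in lborel. t < a \<longrightarrow> f t = 0"
proof -
  have [measurable]: "f \<in> borel_measurable borel" using f by auto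
  have C: "C \<ge> 0" using le[of 0] abs_ge_zero[of "laplace f 0"] by simp
  have z: "(\<integral>t. indicator {..<s} t * f t \<partial>lborel) = 0" if "s < a" for s
  proof -
    define y where "y = (\<lambda>(n::nat) t. exp (real n * (s - t)))"
    have ym[measurable]: "y n \<in> borel_measurable borel" for n unfolding y_def by measurable
    define I where "I = (\<lambda>n. \<integral>t. (1 - exp (- y n t)) * f t \<partial>lborel)"
    have lim1: "I \<longlonglongrightarrow> (\<integral>t. indicator {..<s} t * f t \<partial>lborel)"
      unfolding I_def
    proof (rule integral_dominated_convergence[where w="\<lambda>t. \<bar>f t\<bar>"])
      show "AE t in lborel. (\<lambda>n. (1 - exp (- y n t)) * f t) \<longlonglongrightarrow> indicator {..<s} t * f t"
        \<comment> \<open>At \<open>t = s\<close> the weight is \<open>1 - exp (- 1)\<close> for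
          every \<open>n\<close>, so this null set is excluded.\<close>
        using AE_lborel_singleton[of s]
      proof eventually_elim
        case (elim t)
        consider "t < s" | "t > s" using elim by linarith
        then have "(\<lambda>n. 1 - exp (- y n t)) \<longlonglongrightarrow> indicator {..<s} t"
        proof cases
          case 1
          then have "(\<lambda>n::nat. 1 - exp (- exp (real n * (s - t)))) \<longlonglongrightarrow> 1"
            by (real_asymp)
          then show ?thesis using 1 by (simp add: y_def)
        next
          case 2
          then have "(\<lambda>n::nat. 1 - exp (- exp (real n * (s - t)))) \<longlonglongrightarrow> 0"
            by (real_asymp)
          then show ?thesis using 2 by (simp add: y_def)
        qed
        then show ?case by (intro tendsto_mult tendsto_const)
      qed
      fix n
      show "AE t in lborel. norm ((1 - exp (- y n t)) * f t) \<le> \<bar>f t\<bar>"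
      proof (intro AE_I2)
        fix t
        have "y n t \<ge> 0" by (simp add: y_def)
        then have "0 \<le> 1 - exp (- y n t)" "1 - exp (- y n t) \<le> 1" by auto
        then show "norm ((1 - exp (- y n t)) * f t) \<le> \<bar>f t\<bar>"
          using mult_left_le_one_le[of "\<bar>f t\<bar>" "1 - exp (- y n t)"] by (simp add: abs_mult)
      qed
    qed (use f in auto)
    \<comment> \<open>The leading \<open>1\<close> cancels the term \<open>k = 0\<close> of the
      exponential series. For \<open>k \<ge> 1\<close> the growth \<open>exp (k n s)\<close> meets
      the decay \<open>C * exp (- a k n)\<close> of the transform at \<open>k n\<close>, leaving
      \<open>C * z ^ k / fact k\<close> with \<open>z = exp (- n (a - s))\<close>; this tends to
      \<open>0\<close> because \<open>s < a\<close>.\<close>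
    have bnd: "\<bar>I n\<bar> \<le> C * (exp (exp (- (real n * (a - s)))) - 1)" for n
    proof -
      define c where "c = (\<lambda>k::nat. (-1)^k / fact k * exp (real k * (real n * s)))"
      define e where "e = (\<lambda>(k::nat) t. c k * (exp (- (real k * real n) * t) * f t))"
      have eint: "integrable lborel (e k)" for k
        unfolding e_def by (intro integrable_mult_right integrable_exp_mult f neg) auto
      have eform: "e k t = (- y n t)^k /\<^sub>R fact k * f t" for k t
      proof -
        have "exp (real k * (real n * s)) * exp (- (real k * real n) * t) = y n t ^ k"
          unfolding y_def exp_of_nat_mult[symmetric] exp_add[symmetric] by (simp add: algebra_simps)
        then have "e k t = (-1)^k / fact k * y n t ^ k * f t"
          unfolding e_def c_def by (metis mult.assoc)
        moreover have "(- y n t)^k = (-1)^k * y n t ^ k" by (rule power_minus)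
        ultimately show ?thesis by (simp add: divide_inverse mult_ac)
      qed
      have esums: "(\<lambda>k. e k t) sums (exp (- y n t) * f t)" for t
        unfolding eform by (intro sums_mult2 exp_converges)
      have ebd: "norm (e k t) \<le> exp (real n * s)^k / fact k * \<bar>f t\<bar>" for k t
      proof (cases "t < 0")
        case True then show ?thesis using neg by (simp add: e_def)
      next
        case False
        then have "real n * (s - t) \<le> real n * s" by (intro mult_left_mono) auto
        then have "y n t ^ k \<le> exp (real n * s) ^ k" unfolding y_def by (intro power_mono) auto
        then have "y n t ^ k / fact k * \<bar>f t\<bar> \<le> exp (real n * s)^k / fact k * \<bar>f t\<bar>"
          by (intro mult_right_mono divide_right_mono) auto
        moreover have "norm (e k t) = y n t ^ k / fact k * \<bar>f t\<bar>"
          unfolding eform by (simp add: abs_mult power_abs divide_inverse mult_ac y_def)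
        ultimately show ?thesis by simp
      qed
      have sfac: "summable (\<lambda>k. x^k / fact k)" for x :: real
        using summable_exp[of x] by (simp add: divide_inverse mult.commute)
      have "(\<lambda>k. integral\<^sup>L lborel (e k)) sums (\<integral>t. (\<Sum>k. e k t) \<partial>lborel)"
      proof (rule sums_integral[OF eint])
        have "summable (\<lambda>k. norm (e k t))" for t
          by (rule summable_comparison_test'[OF summable_mult2[OF sfac]])
            (use ebd[of _ t] in simp)
        then show "AE t in lborel. summable (\<lambda>k. norm (e k t))" by simp
        show "summable (\<lambda>k. \<integral>t. norm (e k t) \<partial>lborel)"
        proof (rule summable_comparison_test')
          show "summable (\<lambda>k. exp (real n * s)^k / fact k * (\<integral>t. \<bar>f t\<bar> \<partial>lborel))"
            by (rule summable_mult2[OF sfac])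
          fix k
          have "(\<integral>t. norm (e k t) \<partial>lborel) \<le> (\<integral>t. exp (real n * s)^k / fact k * \<bar>f t\<bar> \<partial>lborel)"
            using eint[of k] f ebd by (intro integral_mono) auto
          then show "norm (\<integral>t. norm (e k t) \<partial>lborel) \<le> exp (real n * s)^k / fact k * (\<integral>t. \<bar>f t\<bar> \<partial>lborel)"
            by simp
        qed
      qed
      then have "(\<lambda>k. c k * laplace f (real k * real n)) sums (\<integral>t. exp (- y n t) * f t \<partial>lborel)"
        using esums by (simp add: sums_iff laplace_def e_def)
      then have "(\<lambda>k. c (Suc k) * laplace f (real (Suc k) * real n)) sums
          ((\<integral>t. exp (- y n t) * f t \<partial>lborel) - c 0 * laplace f 0)"
        by (subst sums_Suc_iff) simp
      moreover have "(\<integral>t. exp (- y n t) * f t \<partial>lborel) - c 0 * laplace f 0 = - I n"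
      proof -
        have "integrable lborel (\<lambda>t. exp (- y n t) * f t)"
          by (rule Bochner_Integration.integrable_bound[OF f])
            (auto simp: abs_mult y_def intro!: AE_I2 mult_left_le_one_le)
        then show ?thesis using f
          by (simp add: I_def c_def laplace_def algebra_simps Bochner_Integration.integral_diff)
      qed
      ultimately have s1: "(\<lambda>k. c (Suc k) * laplace f (real (Suc k) * real n)) sums (- I n)" by simp
      define z where "z = exp (- (real n * (a - s)))"
      have s2: "(\<lambda>k. C * (z ^ Suc k / fact (Suc k))) sums (C * (exp z - 1))"
      proof -
        have "(\<lambda>k. z^k / fact k) sums exp z"
          using exp_converges[of z] by (simp add: divide_inverse mult.commute)
        then have "(\<lambda>k. z ^ Suc k / fact (Suc k)) sums (exp z - 1)"
          by (subst sums_Suc_iff) simp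
        then show ?thesis by (rule sums_mult)
      qed
      have t: "norm (c (Suc k) * laplace f (real (Suc k) * real n)) \<le> C * (z ^ Suc k / fact (Suc k))" for k
      proof -
        let ?m = "Suc k"
        have "norm (c ?m * laplace f (real ?m * real n)) = exp (real ?m * (real n * s)) / fact ?m * \<bar>laplace f (real ?m * real n)\<bar>"
          unfolding c_def by (simp add: abs_mult power_abs)
        also have "\<dots> \<le> exp (real ?m * (real n * s)) / fact ?m * (C * exp (- a * (real ?m * real n)))"
          by (intro mult_left_mono le) auto
        also have "\<dots> = C * ((exp (real ?m * (real n * s)) * exp (- a * (real ?m * real n))) / fact ?m)" by simp
        also have "exp (real ?m * (real n * s)) * exp (- a * (real ?m * real n)) = z ^ ?m"
          unfolding z_def exp_of_nat_mult[symmetric] exp_add[symmetric] by (simp add: algebra_simps)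
        finally show ?thesis .
      qed
      show ?thesis using norm_sums_le[OF s1 s2 t] by (simp add: z_def)
    qed
    have lim2: "I \<longlonglongrightarrow> 0"
    proof (rule tendsto_0_le)
      show "(\<lambda>n. C * (exp (exp (- (real n * (a - s)))) - 1)) \<longlonglongrightarrow> 0"
      proof -
        have "(\<lambda>n::nat. exp (exp (- (real n * (a - s)))) - 1) \<longlonglongrightarrow> 0" using that by real_asymp
        then show ?thesis by (rule tendsto_mult_right_zero)
      qed
      show "\<forall>\<^sub>F n in sequentially. norm (I n) \<le> norm (C * (exp (exp (- (real n * (a - s)))) - 1)) * 1"
        using bnd by (intro always_eventually allI) (simp, meson abs_ge_self order_trans)
    qed
    show ?thesis using LIMSEQ_unique[OF lim1 lim2] .
  qed
  \<comment> \<open>The series bound needs \<open>s < a\<close>; the boundary value follows because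
    \<open>{..<a}\<close> is the increasing union of the smaller half lines.\<close>
  have za: "(\<integral>t. indicator {..<a} t * f t \<partial>lborel) = 0"
  proof -
    have "(\<lambda>n. \<integral>t. indicator {..<a - 1 / real (Suc n)} t * f t \<partial>lborel) \<longlonglongrightarrow> (\<integral>t. indicator {..<a} t * f t \<partial>lborel)"
    proof (rule integral_dominated_convergence[where w="\<lambda>t. \<bar>f t\<bar>"])
      show "AE t in lborel. (\<lambda>n. indicator {..<a - 1 / real (Suc n)} t * f t) \<longlonglongrightarrow> indicator {..<a} t * f t"
      proof (intro AE_I2 tendsto_mult tendsto_const)
        fix t :: real
        show "(\<lambda>n. indicator {..<a - 1 / real (Suc n)} t :: real) \<longlonglongrightarrow> indicator {..<a} t"
        proof (cases "t < a")
          case True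
          have "(\<lambda>n. a - 1 / real (Suc n)) \<longlonglongrightarrow> a - 0"
            by (intro tendsto_diff tendsto_const LIMSEQ_Suc[OF lim_1_over_n])
          then have "\<forall>\<^sub>F n in sequentially. t < a - 1 / real (Suc n)"
            using True by (intro order_tendstoD) auto
          then have "\<forall>\<^sub>F n in sequentially. indicator {..<a - 1 / real (Suc n)} t = (indicator {..<a} t :: real)"
            by eventually_elim (use True in auto)
          then show ?thesis by (rule tendsto_eventually)
        next
          case False
          then have "\<not> t < a - 1 / real (Suc n)" for n
            by (smt (verit) divide_nonneg_nonneg of_nat_0_le_iff)
          then show ?thesis using False by simp
        qed
      qed
    qed (use f in \<open>auto simp: abs_mult indicator_def\<close>)
    moreover have "(\<integral>t. indicator {..<a - 1 / real (Suc n)} t * f t \<partial>lborel) = 0" for n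
      by (rule z) simp
    ultimately show ?thesis by (simp add: LIMSEQ_const_iff)
  qed
  \<comment> \<open>Cutting \<open>f\<close> off at \<open>a\<close> makes the integrals over all
    half lines vanish: those reaching beyond \<open>a\<close> reduce to \<open>za\<close>.\<close>
  have "AE t in lborel. indicator {..<a} t * f t = 0"
  proof (rule AE_zero_if_integral_lessThan_zero)
    show "integrable lborel (\<lambda>t. indicator {..<a} t * f t)"
      using integrable_real_mult_indicator[OF _ f, of "{..<a}"] by (simp add: mult.commute)
    fix s
    have "(\<integral>t. indicator {..<s} t * (indicator {..<a} t * f t) \<partial>lborel) = (\<integral>t. indicator {..<min s a} t * f t \<partial>lborel)"
      by (intro Bochner_Integration.integral_cong) (auto simp: indicator_def)
    also have "\<dots> = 0" using z[of s] za by (cases "s < a") (auto simp: min_def)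
    finally show "(\<integral>t. indicator {..<s} t * (indicator {..<a} t * f t) \<partial>lborel) = 0" .
  qed
  then show ?thesis by eventually_elim (auto simp: indicator_def split: if_splits)
qed

section \<open>Convolution over the line and its Laplace transform\<close>

definition convolve :: "(real \<Rightarrow> real) \<Rightarrow> (real \<Rightarrow> real) \<Rightarrow> real \<Rightarrow> real" where
  "convolve f g t = (\<integral>u. f (t - u) * g u \<partial>lborel)"

lemma integrable_shift:
  fixes f :: "real \<Rightarrow> real"
  assumes "integrable lborel f"
  shows "integrable lborel (\<lambda>t. f (t - u))"
  using lborel_integrable_real_affine[OF assms, of 1 "- u"] by simp

lemma integral_shift:
  fixes f :: "real \<Rightarrow> real"
  shows "(\<integral>t. f (t - u) \<partial>lborel) = (\<integral>t. f t \<partial>lborel)"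
  using lborel_integral_real_affine[of 1 f "- u"] by simp

lemma convolve_pair_integrable:
  fixes f g :: "real \<Rightarrow> real"
  assumes f: "integrable lborel f" and g: "integrable lborel g"
  shows "integrable (lborel \<Otimes>\<^sub>M lborel) (\<lambda>(u, t). f (t - u) * g u)"
proof (rule lborel_pair.Fubini_integrable)
  have [measurable]: "f \<in> borel_measurable borel" "g \<in> borel_measurable borel" using f g by auto
  show "(\<lambda>(u, t). f (t - u) * g u) \<in> borel_measurable (lborel \<Otimes>\<^sub>M lborel)" by measurable
  have "(\<integral>t. norm (f (t - u) * g u) \<partial>lborel) = (\<integral>t. \<bar>f t\<bar> \<partial>lborel) * \<bar>g u\<bar>" for u
    using integral_shift[of "\<lambda>t. \<bar>f t\<bar>" u] by (simp add: abs_mult)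
  then show "integrable lborel (\<lambda>u. \<integral>t. norm (case (u, t) of (u, t) \<Rightarrow> f (t - u) * g u) \<partial>lborel)"
    using g by simp
  show "AE u in lborel. integrable lborel (\<lambda>t. case (u, t) of (u, t) \<Rightarrow> f (t - u) * g u)"
    using integrable_shift[OF f] by simp
qed

lemma convolve_pair_integrable':
  fixes f g :: "real \<Rightarrow> real"
  assumes f: "integrable lborel f" and g: "integrable lborel g"
  shows "integrable (lborel \<Otimes>\<^sub>M lborel) (\<lambda>(t, u). f (t - u) * g u)"
  using lborel_pair.integrable_product_swap[OF convolve_pair_integrable[OF f g]] by simp

lemma AE_convolve_integrable:
  fixes f g :: "real \<Rightarrow> real"
  assumes f: "integrable lborel f" and g: "integrable lborel g"
  shows "AE t in lborel. integrable lborel (\<lambda>u. f (t - u) * g u)"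
  using lborel_pair.AE_integrable_fst'[OF convolve_pair_integrable'[OF f g]] by simp

lemma integrable_convolve:
  fixes f g :: "real \<Rightarrow> real"
  assumes f: "integrable lborel f" and g: "integrable lborel g"
  shows "integrable lborel (convolve f g)"
  using lborel_pair.integrable_fst'[OF convolve_pair_integrable'[OF f g]]
  by (simp add: convolve_def[abs_def])

lemma integral_convolve:
  fixes f g :: "real \<Rightarrow> real"
  assumes f: "integrable lborel f" and g: "integrable lborel g"
  shows "(\<integral>t. convolve f g t \<partial>lborel) = (\<integral>t. f t \<partial>lborel) * (\<integral>t. g t \<partial>lborel)"
proof -
  have "(\<integral>t. convolve f g t \<partial>lborel) = (\<integral>u. (\<integral>t. f (t - u) * g u \<partial>lborel) \<partial>lborel)"
    using lborel_pair.Fubini_integral[OF convolve_pair_integrable[OF f g]]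
    by (simp add: convolve_def)
  also have "\<dots> = (\<integral>u. (\<integral>t. f t \<partial>lborel) * g u \<partial>lborel)"
    by (simp add: integral_shift)
  finally show ?thesis by simp
qed

text \<open>The right end point \<open>M\<close> keeps all moments finite: the class is stable under
  multiplication by powers of \<open>t\<close> and, with a larger bound, under convolution.\<close>

definition causal :: "real \<Rightarrow> (real \<Rightarrow> real) \<Rightarrow> bool" where
  "causal M f \<longleftrightarrow> integrable lborel f \<and> (\<forall>t. f t \<noteq> 0 \<longrightarrow> 0 \<le> t \<and> t \<le> M)"

lemma causalD:
  assumes "causal M f"
  shows "integrable lborel f" "t < 0 \<Longrightarrow> f t = 0" "M < t \<Longrightarrow> f t = 0" "f \<in> borel_measurable borel"
  using assms by (force simp: causal_def)+

lemma causal_power_mult: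
  assumes "causal M f"
  shows "causal M (\<lambda>t. t ^ n * f t)"
proof -
  note c = causalD[OF assms]
  have [measurable]: "f \<in> borel_measurable borel" by (rule c)
  have "integrable lborel (\<lambda>t. t ^ n * f t)"
  proof (rule Bochner_Integration.integrable_bound[of _ "\<lambda>t. \<bar>M\<bar> ^ n * f t"])
    show "AE t in lborel. norm (t ^ n * f t) \<le> norm (\<bar>M\<bar> ^ n * f t)"
    proof (intro AE_I2)
      fix t
      show "norm (t ^ n * f t) \<le> norm (\<bar>M\<bar> ^ n * f t)"
      proof (cases "f t = 0")
        case False
        then have "0 \<le> t" "t \<le> M" using assms by (auto simp: causal_def)
        then have "t ^ n \<le> \<bar>M\<bar> ^ n" by (intro power_mono) auto
        then show ?thesis using \<open>0 \<le> t\<close> by (simp add: abs_mult power_abs mult_right_mono)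
      qed simp
    qed
  qed (use c in auto)
  then show ?thesis using assms by (auto simp: causal_def)
qed

lemma causal_convolve:
  assumes "causal M f" "causal N g"
  shows "causal (M + N) (convolve f g)"
proof -
  have "f (t - u) * g u = 0" if "\<not> (0 \<le> t \<and> t \<le> M + N)" for t u
  proof (rule ccontr)
    assume "f (t - u) * g u \<noteq> 0"
    then have "0 \<le> t - u" "t - u \<le> M" "0 \<le> u" "u \<le> N" using assms by (auto simp: causal_def)
    then show False using that by linarith
  qed
  then have "convolve f g t = 0" if "\<not> (0 \<le> t \<and> t \<le> M + N)" for t
    using that unfolding convolve_def by (metis (no_types, lifting) Bochner_Integration.integral_cong integral_zero)
  then show ?thesis using integrable_convolve[OF causalD(1)[OF assms(1)] causalD(1)[OF assms(2)]]
    by (auto simp: causal_def)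
qed

lemma laplace_convolve:
  fixes f g :: "real \<Rightarrow> real"
  assumes f: "integrable lborel f" "\<And>t. t < 0 \<Longrightarrow> f t = 0"
    and g: "integrable lborel g" "\<And>t. t < 0 \<Longrightarrow> g t = 0" and "x \<ge> 0"
  shows "laplace (convolve f g) x = laplace f x * laplace g x"
proof -
  let ?f = "\<lambda>t. exp (- x * t) * f t" and ?g = "\<lambda>t. exp (- x * t) * g t"
  have "exp (- x * t) * convolve f g t = convolve ?f ?g t" for t
  proof -
    have "exp (- x * t) * (f (t - u) * g u) = ?f (t - u) * ?g u" for u
    proof -
      have "exp (- x * t) = exp (- x * (t - u)) * exp (- x * u)"
        by (simp add: exp_add[symmetric] algebra_simps)
      then show ?thesis by simp
    qed
    then show ?thesis unfolding convolve_def integral_mult_right_zero[symmetric]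
      by (intro Bochner_Integration.integral_cong) blast+
  qed
  then have "laplace (convolve f g) x = (\<integral>t. convolve ?f ?g t \<partial>lborel)"
    unfolding laplace_def by simp
  also have "\<dots> = laplace f x * laplace g x"
    unfolding laplace_def using assms by (intro integral_convolve integrable_exp_mult)
  finally show ?thesis .
qed

text \<open>Write \<open>t = (t - u) + u\<close> under the integral sign. The identity holds only
  almost everywhere because both convolution integrals have to converge at \<open>t\<close>.\<close>

lemma AE_mult_convolve:
  assumes f: "causal M f" and g: "causal N g"
  shows "AE t in lborel. t * convolve f g t = convolve (\<lambda>s. s * f s) g t + convolve f (\<lambda>s. s * g s) t"
proof -
  note f1 = causal_power_mult[OF f, of 1, simplified] and g1 = causal_power_mult[OF g, of 1, simplified]
  show ?thesis
    using AE_convolve_integrable[OF causalD(1)[OF f1] causalD(1)[OF g]]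
      AE_convolve_integrable[OF causalD(1)[OF f] causalD(1)[OF g1]]
  proof eventually_elim
    case (elim t)
    have "convolve (\<lambda>s. s * f s) g t + convolve f (\<lambda>s. s * g s) t =
        (\<integral>u. (t - u) * f (t - u) * g u + f (t - u) * (u * g u) \<partial>lborel)"
      unfolding convolve_def by (rule Bochner_Integration.integral_add[symmetric]) (use elim in auto)
    also have "\<dots> = (\<integral>u. t * (f (t - u) * g u) \<partial>lborel)"
      by (intro Bochner_Integration.integral_cong) (auto simp: algebra_simps)
    finally show ?case by (simp add: convolve_def)
  qed
qed

lemma laplace_mult_convolve:
  assumes f: "causal M f" and g: "causal N g" and "x \<ge> 0"
  shows "laplace (\<lambda>t. t * convolve f g t) x =
    laplace (\<lambda>s. s * f s) x * laplace g x + laplace f x * laplace (\<lambda>s. s * g s) x"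
proof -
  note f1 = causal_power_mult[OF f, of 1, simplified] and g1 = causal_power_mult[OF g, of 1, simplified]
  note c1 = causal_convolve[OF f1 g] and c2 = causal_convolve[OF f g1]
  have [measurable]: "convolve f g \<in> borel_measurable borel" "convolve (\<lambda>s. s * f s) g \<in> borel_measurable borel"
    "convolve f (\<lambda>s. s * g s) \<in> borel_measurable borel"
    using causalD(4)[OF causal_convolve[OF f g]] causalD(4)[OF c1] causalD(4)[OF c2] by auto
  have "laplace (\<lambda>t. t * convolve f g t) x =
      (\<integral>t. exp (- x * t) * convolve (\<lambda>s. s * f s) g t + exp (- x * t) * convolve f (\<lambda>s. s * g s) t \<partial>lborel)"
    unfolding laplace_def
  proof (rule integral_cong_AE)
    show "AE t in lborel. exp (- x * t) * (t * convolve f g t) =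
        exp (- x * t) * convolve (\<lambda>s. s * f s) g t + exp (- x * t) * convolve f (\<lambda>s. s * g s) t"
      using AE_mult_convolve[OF f g] by eventually_elim (simp only: distrib_left)
  qed measurable
  also have "\<dots> = laplace (convolve (\<lambda>s. s * f s) g) x + laplace (convolve f (\<lambda>s. s * g s)) x"
    unfolding laplace_def
    by (intro Bochner_Integration.integral_add integrable_exp_mult causalD[OF c1] causalD[OF c2] \<open>x \<ge> 0\<close>)
  finally show ?thesis
    using causalD[OF f] causalD[OF g] causalD[OF f1] causalD[OF g1] \<open>x \<ge> 0\<close>
    by (simp add: laplace_convolve)
qed

section \<open>Titchmarsh's convolution theorem\<close>

lemma antimono_concave_imp_const:
  fixes A :: "nat \<Rightarrow> real"
  assumes anti: "\<And>n. A (Suc n) \<le> A n" and nonneg: "\<And>n. A n \<ge> 0"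
    and conc: "\<And>n. A n + A (Suc (Suc n)) \<le> 2 * A (Suc n)"
  shows "A n = A 0"
proof -
  have "A n \<le> A (Suc n)" for n
  proof (rule ccontr)
    assume "\<not> A n \<le> A (Suc n)"
    define d where "d = A n - A (Suc n)"
    have d: "d > 0" using \<open>\<not> A n \<le> A (Suc n)\<close> by (simp add: d_def)
    \<comment> \<open>Concavity says that successive drops never shrink, so one drop
      \<open>d > 0\<close> recurs at every later index and drives the sequence below
      \<open>0\<close>.\<close>
    have step: "A (n + k) - A (Suc (n + k)) \<ge> d" for k
    proof (induction k)
      case (Suc k)
      then show ?case using conc[of "n + k"] by simp
    qed (simp add: d_def)
    have "A (n + k) \<le> A n - real k * d" for k
    proof (induction k)
      case (Suc k)
      then show ?case using step[of k] by (simp add: algebra_simps)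
    qed simp
    moreover obtain k where "real k > A n / d" using reals_Archimedean2 by blast
    then have "real k * d > A n" using d by (simp add: field_simps)
    ultimately show False using nonneg[of "n + k"] by (smt (verit))
  qed
  then have "A (Suc n) = A n" for n using anti by (intro antisym)
  then show ?thesis by (induction n) auto
qed

text \<open>Bounded support lets the exponential series be integrated term by term, so the Laplace
  transform is a power series in the moments and vanishes identically.\<close>

lemma AE_zero_if_moments_zero:
  assumes q: "causal M q" and z: "\<And>n. (\<integral>u. u ^ n * q u \<partial>lborel) = 0"
  shows "AE u in lborel. q u = 0"
proof -
  note c = causalD[OF q]
  have "laplace q x = 0" if "x \<ge> 0" for x
  proof -
    define e where "e = (\<lambda>(n::nat) u. (- x) ^ n / fact n * (u ^ n * q u))"
    have eint: "integrable lborel (e n)" for n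
      unfolding e_def using causalD(1)[OF causal_power_mult[OF q]] by simp
    have ebd: "norm (e n u) \<le> (x * \<bar>M\<bar>) ^ n / fact n * \<bar>q u\<bar>" for n u
    proof (cases "q u = 0")
      case False
      then have "0 \<le> u" "u \<le> \<bar>M\<bar>" using q by (auto simp: causal_def)
      then have "u ^ n \<le> \<bar>M\<bar> ^ n" by (intro power_mono) auto
      then have "x ^ n * u ^ n \<le> (x * \<bar>M\<bar>) ^ n" using that by (simp add: power_mult_distrib mult_left_mono)
      then have "x ^ n * u ^ n / fact n * \<bar>q u\<bar> \<le> (x * \<bar>M\<bar>) ^ n / fact n * \<bar>q u\<bar>"
        by (intro mult_right_mono divide_right_mono) auto
      then show ?thesis using that \<open>0 \<le> u\<close> by (simp add: e_def abs_mult power_abs mult_ac)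
    qed (simp add: e_def)
    have sfac: "summable (\<lambda>k. y^k / fact k)" for y :: real
      using summable_exp[of y] by (simp add: divide_inverse mult.commute)
    have "(\<lambda>n. integral\<^sup>L lborel (e n)) sums (\<integral>u. (\<Sum>n. e n u) \<partial>lborel)"
    proof (rule sums_integral[OF eint])
      have "summable (\<lambda>n. norm (e n u))" for u
        by (rule summable_comparison_test'[OF summable_mult2[OF sfac]])
          (use ebd[of _ u] in simp)
      then show "AE u in lborel. summable (\<lambda>n. norm (e n u))" by simp
      show "summable (\<lambda>n. \<integral>u. norm (e n u) \<partial>lborel)"
      proof (rule summable_comparison_test')
        show "summable (\<lambda>n. (x * \<bar>M\<bar>) ^ n / fact n * (\<integral>u. \<bar>q u\<bar> \<partial>lborel))"
          by (rule summable_mult2[OF sfac])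
        fix n
        have "(\<integral>u. norm (e n u) \<partial>lborel) \<le> (\<integral>u. (x * \<bar>M\<bar>) ^ n / fact n * \<bar>q u\<bar> \<partial>lborel)"
          using eint[of n] c ebd by (intro integral_mono) auto
        then show "norm (\<integral>u. norm (e n u) \<partial>lborel) \<le> (x * \<bar>M\<bar>) ^ n / fact n * (\<integral>u. \<bar>q u\<bar> \<partial>lborel)"
          by simp
      qed
    qed
    moreover have "integral\<^sup>L lborel (e n) = 0" for n unfolding e_def using z[of n] by simp
    moreover have "(\<Sum>n. e n u) = exp (- x * u) * q u" for u
    proof -
      have "(\<lambda>n. (- x * u) ^ n /\<^sub>R fact n * q u) sums (exp (- x * u) * q u)"
        by (intro sums_mult2 exp_converges)
      moreover have "(- x * u) ^ n /\<^sub>R fact n * q u = e n u" for n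
        unfolding e_def power_mult_distrib by (simp add: divide_inverse)
      ultimately show ?thesis by (simp add: sums_iff)
    qed
    ultimately have "(\<lambda>n::nat. 0) sums laplace q x" by (simp add: laplace_def)
    then show ?thesis by (simp add: sums_iff)
  qed
  \<comment> \<open>With \<open>C = 0\<close> any rate is admissible; \<open>M + 1\<close> lies to
    the right of the support.\<close>
  then have "AE u in lborel. u < M + 1 \<longrightarrow> q u = 0"
    by (intro vanish_if_laplace_le[where C=0]) (use c in auto)
  then show ?thesis by eventually_elim (use c(3) in force)
qed

definition vanish_before :: "real \<Rightarrow> (real \<Rightarrow> real) \<Rightarrow> bool" where
  "vanish_before a f \<longleftrightarrow> (AE t in lborel. t < a \<longrightarrow> f t = 0)"

lemma vanish_before_mono: "vanish_before a f \<Longrightarrow> b \<le> a \<Longrightarrow> vanish_before b f"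
  unfolding vanish_before_def by (erule eventually_mono) auto

lemma vanish_before_mult: "vanish_before a f \<Longrightarrow> vanish_before a (\<lambda>t. t * f t)"
  unfolding vanish_before_def by (erule eventually_mono) auto

text \<open>Countably many null sets suffice, one for each \<open>a - 1 / (n + 1)\<close>. This
  makes suprema of orders of vanishing attained.\<close>

lemma vanish_before_closed:
  assumes "\<And>b. b < a \<Longrightarrow> vanish_before b f"
  shows "vanish_before a f"
proof -
  have "AE t in lborel. \<forall>n. t < a - 1 / real (Suc n) \<longrightarrow> f t = 0"
    using assms[of "a - 1 / real (Suc n)" for n] by (subst AE_all_countable) (auto simp: vanish_before_def)
  then show ?thesis unfolding vanish_before_def
  proof eventually_elim
    case (elim t)
    show ?case
    proof
      assume "t < a"
      then obtain n where "1 / real (Suc n) < a - t"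
        using reals_Archimedean[of "a - t"] by (auto simp: inverse_eq_divide)
      then show "f t = 0" using elim by (metis less_diff_eq add.commute)
    qed
  qed
qed

text \<open>Write \<open>D\<close> for
  multiplication by \<open>t\<close>, a derivation for convolution. The functions \<open>F n = f * D\<^sup>n g\<close> satisfy
  \<open>F n * F n = F n * D (F (n-1)) - D (F n) * F (n-1) + F (n+1) * F (n-1)\<close>. Hence the
  orders of vanishing of the \<open>F n\<close> at the origin form, up to running minima, a concave and
  decreasing nonnegative sequence, which must be constant.\<close>

theorem titchmarsh_vanish:
  assumes f: "causal M f" and g: "causal M g" and c: "c \<ge> 0"
    and le: "\<And>x. x \<ge> 0 \<Longrightarrow> \<bar>laplace f x * laplace g x\<bar> \<le> C * exp (- c * x)"
    and nz: "\<And>\<delta>. \<delta> > 0 \<Longrightarrow> \<not> vanish_before \<delta> f"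
  shows "vanish_before c g"
proof -
  define G where "G = (\<lambda>n t. t ^ n * g t)"
  define F where "F = (\<lambda>n. convolve f (G n))"
  define f1 where "f1 = (\<lambda>t. t * f t)"
  have Gc: "causal M (G n)" for n unfolding G_def by (rule causal_power_mult[OF g])
  have Fc: "causal (M + M) (F n)" for n unfolding F_def by (rule causal_convolve[OF f Gc])
  have DFc: "causal (M + M) (\<lambda>t. t * F n t)" for n using causal_power_mult[OF Fc, of 1 n] by simp
  have Gs: "(\<lambda>s. s * G n s) = G (Suc n)" for n by (auto simp: G_def)
  have LF: "laplace (F n) x = laplace f x * laplace (G n) x" if "x \<ge> 0" for n x
    unfolding F_def using causalD[OF f] causalD[OF Gc] that by (simp add: laplace_convolve)
  have LDF: "laplace (\<lambda>t. t * F n t) x = laplace f1 x * laplace (G n) x + laplace f x * laplace (G (Suc n)) x"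
    if "x \<ge> 0" for n x
    unfolding F_def f1_def using laplace_mult_convolve[OF f Gc that, of n] by (simp add: Gs)
  define N where "N = (\<lambda>h::real \<Rightarrow> real. \<integral>t. \<bar>h t\<bar> \<partial>lborel)"
  have N0: "N h \<ge> 0" for h unfolding N_def by (rule Bochner_Integration.integral_nonneg) simp
  have up: "\<bar>laplace h x\<bar> \<le> N h * exp (- a * x)"
    if "causal K h" "vanish_before a h" "x \<ge> 0" for K h a x
    using laplace_abs_le[OF causalD(1,2)[OF that(1)] that(3), of a] that(2)
    by (simp add: vanish_before_def N_def mult.commute)
  \<comment> \<open>Each product on the right of \<open>eq\<close> pairs a factor vanishing before
    \<open>b\<close> with one vanishing before \<open>a\<close>. The square of the transform thus
    decays like \<open>exp (- (a + b) * x)\<close>, and the square root halves the exponent.\<close>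
  have key: "vanish_before ((a + b) / 2) (F (Suc n))"
    if a: "vanish_before a (F n)" and b: "vanish_before b (F (Suc n))" and b': "vanish_before b (F (Suc (Suc n)))"
    for a b n
  proof -
    let ?D = "\<lambda>n t. t * F n t"
    define K where "K = N (F (Suc n)) * N (?D n) + N (?D (Suc n)) * N (F n) + N (F (Suc (Suc n))) * N (F n)"
    have "\<bar>laplace (F (Suc n)) x\<bar> \<le> sqrt K * exp (- ((a + b) / 2) * x)" if x: "x \<ge> 0" for x
    proof -
      let ?L = "\<lambda>h. laplace h x"
      have pr: "\<bar>?L h * ?L k\<bar> \<le> N h * N k * exp (- (a + b) * x)"
        if "causal (M + M) h" "vanish_before b h" "causal (M + M) k" "vanish_before a k" for h k
      proof -
        have "\<bar>?L h * ?L k\<bar> \<le> (N h * exp (- b * x)) * (N k * exp (- a * x))"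
          unfolding abs_mult
          by (rule mult_mono[OF up[OF that(1,2) x] up[OF that(3,4) x]]) (simp_all add: N0)
        also have "\<dots> = N h * N k * (exp (- b * x) * exp (- a * x))" by simp
        also have "exp (- b * x) * exp (- a * x) = exp (- (a + b) * x)"
          by (simp add: exp_add[symmetric] algebra_simps)
        finally show ?thesis .
      qed
      \<comment> \<open>Written with transforms, the contributions containing \<open>f1\<close>
        cancel, and so do those containing \<open>G (n + 2)\<close>; only the square of
        \<open>laplace f * laplace (G (n + 1))\<close> is left.\<close>
      have eq: "(?L (F (Suc n)))\<^sup>2 = ?L (F (Suc n)) * ?L (?D n) - ?L (?D (Suc n)) * ?L (F n) + ?L (F (Suc (Suc n))) * ?L (F n)"
        unfolding LF[OF x] LDF[OF x] by (simp add: algebra_simps power2_eq_square)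
      have "(?L (F (Suc n)))\<^sup>2 \<le> \<bar>?L (F (Suc n)) * ?L (?D n)\<bar> + \<bar>?L (?D (Suc n)) * ?L (F n)\<bar> + \<bar>?L (F (Suc (Suc n))) * ?L (F n)\<bar>"
        unfolding eq by linarith
      also have "\<dots> \<le> N (F (Suc n)) * N (?D n) * exp (- (a + b) * x) + N (?D (Suc n)) * N (F n) * exp (- (a + b) * x)
          + N (F (Suc (Suc n))) * N (F n) * exp (- (a + b) * x)"
        by (intro add_mono pr Fc DFc a b b' vanish_before_mult)
      also have "\<dots> = K * exp (- (a + b) * x)" unfolding K_def distrib_right ..
      finally have "sqrt ((?L (F (Suc n)))\<^sup>2) \<le> sqrt (K * exp (- (a + b) * x))"
        by (rule real_sqrt_le_mono)
      also have "exp (- (a + b) * x) = (exp (- ((a + b) / 2) * x))\<^sup>2"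
      proof -
        have "- (a + b) * x = 2 * (- ((a + b) / 2) * x)" by (simp add: algebra_simps)
        then show ?thesis by (simp only: exp_double)
      qed
      finally show ?thesis by (simp add: real_sqrt_mult)
    qed
    then show ?thesis unfolding vanish_before_def
      by (intro vanish_if_laplace_le causalD[OF Fc]) auto
  qed
  \<comment> \<open>Quantifying over all \<open>l \<le> n\<close> builds the running minimum, so
    that \<open>A\<close> decreases. The cap \<open>c\<close> keeps the sets bounded, as an order of
    vanishing may be infinite, and makes the initial value equal to \<open>c\<close>.\<close>
  define S where "S = (\<lambda>n. {a \<in> {0..c}. \<forall>l\<le>n. vanish_before a (F l)})"
  define A where "A = (\<lambda>n. Sup (S n))"
  have v0: "vanish_before 0 (F n)" for n
    unfolding vanish_before_def using causalD(2)[OF Fc] by simp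
  have S0: "0 \<in> S n" for n unfolding S_def using v0 c by auto
  have Sb: "bdd_above (S n)" for n unfolding S_def by (intro bdd_aboveI[of _ c]) auto
  have AS: "A n \<in> S n" for n
  proof -
    have "0 \<le> A n" unfolding A_def by (rule cSup_upper[OF S0 Sb])
    moreover have "A n \<le> c" unfolding A_def using S0 by (intro cSup_least) (auto simp: S_def)
    moreover have "vanish_before (A n) (F l)" if "l \<le> n" for l
    proof (rule vanish_before_closed)
      fix b assume "b < A n"
      then obtain a where "a \<in> S n" "b < a" unfolding A_def using less_cSup_iff[OF _ Sb] S0 by (metis empty_iff)
      then have "vanish_before a (F l)" using that by (simp add: S_def)
      then show "vanish_before b (F l)" by (rule vanish_before_mono) (use \<open>b < a\<close> in simp)
    qed
    ultimately show ?thesis by (simp add: S_def)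
  qed
  have "A n = A 0" for n
  proof (rule antimono_concave_imp_const)
    fix n
    show "A (Suc n) \<le> A n"
      unfolding A_def using S0 Sb by (intro cSup_subset_mono) (auto simp: S_def)
    then have AA: "A (Suc n) \<le> A n" .
    show "A n \<ge> 0" using AS[of n] by (simp add: S_def)
    have A2: "A (Suc (Suc n)) \<le> A (Suc n)"
      unfolding A_def using S0 Sb by (intro cSup_subset_mono) (auto simp: S_def)
    \<comment> \<open>\<open>key\<close> with \<open>a = A n\<close> and
      \<open>b = A (n + 2)\<close> puts the midpoint into \<open>S (n + 1)\<close>, which is the
      concavity of \<open>A\<close>.\<close>
    let ?m = "(A n + A (Suc (Suc n))) / 2"
    have "vanish_before ?m (F (Suc n))"
      by (rule key) (use AS[of n] AS[of "Suc (Suc n)"] in \<open>simp_all add: S_def\<close>)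
    moreover have "vanish_before ?m (F l)" if "l \<le> n" for l
      by (rule vanish_before_mono[of "A n"]) (use AS[of n] that A2 AA in \<open>simp_all add: S_def\<close>)
    ultimately have "?m \<in> S (Suc n)"
      using AS[of n] AS[of "Suc (Suc n)"] by (auto simp: S_def le_Suc_eq)
    then show "A n + A (Suc (Suc n)) \<le> 2 * A (Suc n)"
      using cSup_upper[OF _ Sb, of ?m "Suc n"] by (simp add: A_def)
  qed
  moreover have "A 0 = c"
  proof -
    have "vanish_before c (F 0)" unfolding vanish_before_def
    proof (rule vanish_if_laplace_le)
      show "\<bar>laplace (F 0) x\<bar> \<le> C * exp (- c * x)" if "x \<ge> 0" for x
        using le[OF that] LF[OF that, of 0] by (simp add: G_def)
    qed (use causalD[OF Fc] in auto)
    then have "c \<in> S 0" using c by (auto simp: S_def)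
    then show ?thesis using cSup_upper[OF _ Sb, of c 0] AS[of 0] by (auto simp: A_def S_def)
  qed
  ultimately have vF: "vanish_before c (F n)" for n using AS[of n] by (auto simp: S_def)
  have "AE t in lborel. \<forall>n. t < c \<longrightarrow> F n t = 0"
    using vF by (subst AE_all_countable) (simp add: vanish_before_def)
  \<comment> \<open>For almost every \<open>t < c\<close> all moments of the function sending
    \<open>u\<close> to \<open>f (t - u) * g u\<close> vanish, since they are the values
    \<open>F n t\<close>. Hence the integrand itself is zero, not merely its integral.\<close>
  then have "AE t in lborel. AE u in lborel. t < c \<longrightarrow> f (t - u) * g u = 0"
    using AE_convolve_integrable[OF causalD(1)[OF f] causalD(1)[OF g]]
  proof eventually_elim
    case (elim t)
    show ?case
    proof (cases "t < c")
      case True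
      have "causal M (\<lambda>u. f (t - u) * g u)" using elim(2) g by (auto simp: causal_def)
      moreover have "(\<integral>u. u ^ n * (f (t - u) * g u) \<partial>lborel) = 0" for n
        using elim(1) True by (simp add: F_def convolve_def G_def mult_ac)
      ultimately show ?thesis by (auto dest: AE_zero_if_moments_zero)
    qed simp
  qed
  moreover have [measurable]: "f \<in> borel_measurable borel" "g \<in> borel_measurable borel"
    using causalD(4)[OF f] causalD(4)[OF g] by auto
  \<comment> \<open>After exchanging the null sets, any \<open>u < c\<close> outside a null set with
    \<open>g u \<noteq> 0\<close> would make \<open>f\<close> vanish before
    \<open>c - u > 0\<close>, against \<open>nz\<close>.\<close>
  ultimately have "AE u in lborel. AE t in lborel. t < c \<longrightarrow> f (t - u) * g u = 0"
    by (subst lborel_pair.AE_commute) measurable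
  then show ?thesis unfolding vanish_before_def
  proof eventually_elim
    case (elim u)
    show ?case
    proof (intro impI, rule ccontr)
      assume u: "u < c" "g u \<noteq> 0"
      then have "AE t in lborel. t < c \<longrightarrow> f (t - u) = 0" using elim by simp
      then have "AE t in lborel. u + t < c \<longrightarrow> f (u + t - u) = 0"
        using AE_borel_affine[of 1 "\<lambda>t. t < c \<longrightarrow> f (t - u) = 0" u] by simp
      then have "vanish_before (c - u) f"
        unfolding vanish_before_def by eventually_elim auto
      then show False using nz[of "c - u"] u by simp
    qed
  qed
qed

subsection \<open>Density of the range of a matrix convolution\<close>

lemma integral_zero_fun: "(\<And>x. f x = 0) \<Longrightarrow> integral\<^sup>L M f = (0::real)"
  by (metis (no_types, lifting) Bochner_Integration.integral_cong integral_zero)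

lemma integrable_indicator_mult:
  fixes f :: "real \<Rightarrow> real"
  assumes "integrable lborel f" "A \<in> sets borel"
  shows "integrable lborel (\<lambda>t. indicator A t * f t)"
  using integrable_real_mult_indicator[OF _ assms(1), of A] assms(2) by (simp add: mult.commute)

text \<open>The integrand is zero unless \<open>0 \<le> u \<le> t\<close>. This links the
  convolution determinant to integrals over the whole line, where Fubini needs no moving
  limits.\<close>

lemma conv_eq_convolve:
  assumes "\<And>t. t < 0 \<Longrightarrow> g t = 0" "\<And>t. t < 0 \<Longrightarrow> h t = 0"
  shows "conv g h = convolve g h"
proof
  fix t
  show "conv g h t = convolve g h t"
    unfolding conv_def convolve_def set_lebesgue_integral_def
  proof (intro Bochner_Integration.integral_cong refl)
    fix u
    show "indicat_real {0..t} u *\<^sub>R (g (t - u) * h u) = g (t - u) * h u"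
      using assms(1)[of "t - u"] assms(2)[of u] by (cases "u < 0"; cases "t < u") auto
  qed
qed

section \<open>Laplace transform of the convolution determinant and Cramer's rule\<close>

lemma conv_list_laplace:
  assumes "is \<noteq> []"
    and "\<And>i. i \<in> set is \<Longrightarrow> integrable lborel (g i)" "\<And>i t. i \<in> set is \<Longrightarrow> t < 0 \<Longrightarrow> g i t = 0"
  shows "integrable lborel (conv_list (map g is)) \<and> (\<forall>t<0. conv_list (map g is) t = 0) \<and>
    (\<forall>x\<ge>0. laplace (conv_list (map g is)) x = prod_list (map (\<lambda>i. laplace (g i) x) is))"
  using assms
proof (induction "is" rule: induct_list012)
  case (3 i j ks)
  let ?h = "conv_list (map g (j # ks))"
  have IH: "integrable lborel ?h" "\<And>t. t < 0 \<Longrightarrow> ?h t = 0"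
      "\<And>x. x \<ge> 0 \<Longrightarrow> laplace ?h x = prod_list (map (\<lambda>i. laplace (g i) x) (j # ks))"
    using 3 by auto
  have gi: "integrable lborel (g i)" "\<And>t. t < 0 \<Longrightarrow> g i t = 0" using 3 by auto
  have eq: "conv_list (map g (i # j # ks)) = convolve (g i) ?h"
    using conv_eq_convolve[OF gi(2) IH(2)] by simp
  have "convolve (g i) ?h t = 0" if "t < 0" for t
  proof -
    have "g i (t - u) * ?h u = 0" for u using gi(2)[of "t - u"] IH(2)[of u] that by (cases "u < 0") auto
    then show ?thesis unfolding convolve_def by (rule integral_zero_fun)
  qed
  moreover have "laplace (convolve (g i) ?h) x = prod_list (map (\<lambda>i. laplace (g i) x) (i # j # ks))" if "x \<ge> 0" for x
    using laplace_convolve[OF gi IH(1,2) that] IH(3)[OF that] by (simp only: list.map prod_list.Cons)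
  ultimately show ?case unfolding eq using integrable_convolve[OF gi(1) IH(1)] by blast
qed auto

text \<open>A convolution at time \<open>t\<close> reads its factors on \<open>[0, t]\<close> only.
  Hence a kernel may be cut off beyond \<open>T\<close> without changing its convolution determinant
  before \<open>T\<close>.\<close>

lemma conv_list_cong:
  assumes "\<And>i t. i \<in> set is \<Longrightarrow> 0 \<le> t \<Longrightarrow> t \<le> T \<Longrightarrow> g i t = h i t" and "0 \<le> t" "t \<le> T"
  shows "conv_list (map g is) t = conv_list (map h is) t"
  using assms
proof (induction "is" arbitrary: t rule: induct_list012)
  case (3 i j ks)
  have "conv_list (map g (j # ks)) s = conv_list (map h (j # ks)) s" if "0 \<le> s" "s \<le> T" for s
    by (rule 3(2)) (use 3 that in auto)
  then show ?case
    using 3(3,4,5) by (auto simp: conv_def intro!: set_lebesgue_integral_cong)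
qed auto

text \<open>The transform is linear and turns each convolution product of the Leibniz sum into an
  ordinary product, so that linear algebra over the reals becomes available at every fixed
  \<open>x\<close>.\<close>

lemma conv_det_laplace:
  fixes \<phi> :: "real \<Rightarrow> real^'n::{finite,linorder}^'n::{finite,linorder}"
  assumes i: "\<And>i j. integrable lborel (\<lambda>t. \<phi> t $ i $ j)" and z: "\<And>t. t < 0 \<Longrightarrow> \<phi> t = 0"
  shows "integrable lborel (conv_det \<phi>)"
    and "x \<ge> 0 \<Longrightarrow> laplace (conv_det \<phi>) x = det (\<chi> i j. laplace (\<lambda>t. \<phi> t $ i $ j) x)"
proof -
  let ?xs = "sorted_list_of_set (UNIV :: 'n set)"
  define k where "k = (\<lambda>p. conv_list (map (\<lambda>i u. \<phi> u $ i $ p i) ?xs))"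
  have ne: "?xs \<noteq> []" by simp
  have k: "integrable lborel (k p)" "\<And>t. t < 0 \<Longrightarrow> k p t = 0"
    "\<And>x. x \<ge> 0 \<Longrightarrow> laplace (k p) x = (\<Prod>i\<in>UNIV. laplace (\<lambda>t. \<phi> t $ i $ p i) x)" for p
  proof -
    have *: "integrable lborel (k p) \<and> (\<forall>t<0. k p t = 0) \<and>
        (\<forall>x\<ge>0. laplace (k p) x = prod_list (map (\<lambda>i. laplace (\<lambda>u. \<phi> u $ i $ p i) x) ?xs))"
      unfolding k_def by (rule conv_list_laplace) (use i z ne in auto)
    then show "integrable lborel (k p)" "\<And>t. t < 0 \<Longrightarrow> k p t = 0" by auto
    show "laplace (k p) x = (\<Prod>i\<in>UNIV. laplace (\<lambda>t. \<phi> t $ i $ p i) x)" if "x \<ge> 0" for x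
      using * that by (simp add: prod.distinct_set_conv_list[symmetric])
  qed
  let ?P = "{p. p permutes (UNIV :: 'n set)}"
  have eq: "conv_det \<phi> = (\<lambda>t. \<Sum>p\<in>?P. of_int (sign p) * k p t)"
    unfolding conv_det_def fun_eq_iff using k(2) by (auto simp: k_def)
  show "integrable lborel (conv_det \<phi>)" unfolding eq using k(1) by auto
  show "laplace (conv_det \<phi>) x = det (\<chi> i j. laplace (\<lambda>t. \<phi> t $ i $ j) x)" if "x \<ge> 0"
  proof -
    have ii: "integrable lborel (\<lambda>t. of_int (sign p) * (exp (- x * t) * k p t))" for p
      using integrable_exp_mult[OF k(1) k(2) that] by simp
    have "laplace (conv_det \<phi>) x = (\<integral>t. (\<Sum>p\<in>?P. of_int (sign p) * (exp (- x * t) * k p t)) \<partial>lborel)"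
      unfolding laplace_def eq by (simp add: sum_distrib_left mult_ac)
    also have "\<dots> = (\<Sum>p\<in>?P. of_int (sign p) * laplace (k p) x)"
      unfolding laplace_def by (subst Bochner_Integration.integral_sum[OF ii]) simp
    finally show ?thesis by (simp add: det_def k(3)[OF that])
  qed
qed

text \<open>Cramer's rule for rows: the new matrix is \<open>M\<close> multiplied from the left by
  the identity matrix with row \<open>m\<close> replaced by \<open>v\<close>, and that factor has
  determinant \<open>v $ m\<close>.\<close>

lemma det_replace_row:
  fixes M :: "real^'n^'n"
  shows "det (\<chi> i. if i = m then v v* M else M $ i) = v $ m * det M"
proof -
  let ?B = "(\<chi> i. if i = m then v else axis i 1) :: real^'n^'n"
  have eq: "?B ** M = (\<chi> i. if i = m then v v* M else M $ i)"
  proof (intro vec_eq_iff[THEN iffD2] allI)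
    fix i j
    have "(\<Sum>k\<in>UNIV. axis i (1::real) $ k * M $ k $ j) = (\<Sum>k\<in>UNIV. if k = i then M $ k $ j else 0)"
      by (intro sum.cong) (auto simp: axis_def)
    also have "\<dots> = M $ i $ j" by simp
    finally show "(?B ** M) $ i $ j = (\<chi> i. if i = m then v v* M else M $ i) $ i $ j"
      by (simp add: matrix_matrix_mult_def vector_matrix_mult_def mult.commute)
  qed
  have "det ?B = v $ m"
  proof -
    have "(\<Prod>i\<in>UNIV. ?B $ i $ p i) = (if p = id then v $ m else 0)" if "p permutes UNIV" for p
    proof (cases "p = id")
      case True
      have "(\<Prod>i\<in>UNIV. ?B $ i $ i) = (\<Prod>i\<in>UNIV. if i = m then v $ m else 1)"
        by (intro prod.cong) (auto simp: axis_def)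
      then show ?thesis using True by simp
    next
      case False
      \<comment> \<open>No permutation moves \<open>m\<close> alone, so one different from the
        identity meets a zero entry in some unchanged row.\<close>
      have "\<exists>i. i \<noteq> m \<and> p i \<noteq> i"
      proof (rule ccontr)
        assume "\<not> ?thesis"
        then have fx: "\<And>i. i \<noteq> m \<Longrightarrow> p i = i" by auto
        have "p m = m"
          using fx[of "p m"] permutes_inj[OF that] by (auto dest: injD)
        then have "p = id" using fx by (metis eq_id_iff)
        then show False using False by simp
      qed
      then obtain i where "i \<noteq> m" "p i \<noteq> i" by auto
      then have "?B $ i $ p i = 0" by (simp add: axis_def)
      then have "(\<Prod>i\<in>UNIV. ?B $ i $ p i) = 0" by (intro prod_zero bexI[of _ i]) auto
      then show ?thesis using False by simp
    qed
    then have "det ?B = (\<Sum>p\<in>{p. p permutes (UNIV :: 'n set)}. of_int (sign p) * (if p = id then v $ m else 0))"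
      unfolding det_def by (intro sum.cong) auto
    also have "\<dots> = (\<Sum>p\<in>{p. p permutes (UNIV :: 'n set)}. if p = id then v $ m else 0)"
      by (intro sum.cong) auto
    also have "\<dots> = (if id \<in> {p. p permutes (UNIV :: 'n set)} then v $ m else 0)"
      by (rule sum.delta) (rule finite_permutations, rule finite)
    finally show ?thesis by (simp add: permutes_id)
  qed
  then show ?thesis unfolding eq[symmetric] det_mul by simp
qed

text \<open>Each Leibniz term contains exactly one entry of row \<open>m\<close>. Combined with
  \<open>det_replace_row\<close> it bounds \<open>v $ m * det M\<close> by the entries of
  \<open>v v* M\<close> without writing down the adjugate.\<close>

lemma abs_det_le_row:
  fixes A :: "real^'n^'n"
  assumes K: "\<And>i j. i \<noteq> m \<Longrightarrow> \<bar>A $ i $ j\<bar> \<le> K" and e: "\<And>j. \<bar>A $ m $ j\<bar> \<le> e"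
  shows "\<bar>det A\<bar> \<le> fact CARD('n) * K ^ (CARD('n) - 1) * e"
proof -
  have "\<bar>det A\<bar> \<le> (\<Sum>p\<in>{p. p permutes (UNIV::'n set)}. \<bar>of_int (sign p) * (\<Prod>i\<in>UNIV. A $ i $ p i)\<bar>)"
    unfolding det_def by (rule sum_abs)
  also have "\<dots> \<le> (\<Sum>p\<in>{p. p permutes (UNIV::'n set)}. K ^ (CARD('n) - 1) * e)"
  proof (rule sum_mono)
    fix p :: "'n \<Rightarrow> 'n"
    have "\<bar>of_int (sign p) * (\<Prod>i\<in>UNIV. A $ i $ p i)\<bar> = (\<Prod>i\<in>UNIV. \<bar>A $ i $ p i\<bar>)"
      by (simp add: abs_mult abs_prod sign_def)
    also have "\<dots> = \<bar>A $ m $ p m\<bar> * (\<Prod>i\<in>UNIV - {m}. \<bar>A $ i $ p i\<bar>)"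
      by (rule prod.remove) auto
    also have "\<dots> \<le> e * (\<Prod>i\<in>UNIV - {m}. K)"
      by (intro mult_mono e prod_mono) (use K order_trans[OF abs_ge_zero e] in \<open>auto intro: prod_nonneg\<close>)
    finally show "\<bar>of_int (sign p) * (\<Prod>i\<in>UNIV. A $ i $ p i)\<bar> \<le> K ^ (CARD('n) - 1) * e"
      by (simp add: card_Diff_singleton mult.commute)
  qed
  also have "\<dots> = fact CARD('n) * K ^ (CARD('n) - 1) * e"
    by (simp add: card_permutations)
  finally show ?thesis .
qed

lemma integrable_reflect:
  fixes f :: "real \<Rightarrow> real"
  assumes "integrable lborel f"
  shows "integrable lborel (\<lambda>t. f (T - t))"
  using lborel_integrable_real_affine[OF assms, of "-1" T] by simp

lemma integral_reflect:
  fixes f :: "real \<Rightarrow> real"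
  shows "(\<integral>t. f (T - t) \<partial>lborel) = (\<integral>t. f t \<partial>lborel)"
  using lborel_integral_real_affine[of "-1" f T] by simp

lemma correlation_pair_integrable:
  fixes p r :: "real \<Rightarrow> real"
  assumes p: "integrable lborel p" and r: "integrable lborel r"
    and [measurable]: "E \<in> borel_measurable borel" and E: "\<And>u. \<bar>E u\<bar> \<le> (B::real)"
  shows "integrable (lborel \<Otimes>\<^sub>M lborel) (\<lambda>(t, u). r t * p (t - u) * E u)"
proof -
  have [measurable]: "p \<in> borel_measurable borel" "r \<in> borel_measurable borel" using p r by auto
  have "integrable (lborel \<Otimes>\<^sub>M lborel) (\<lambda>(t, u). r t * p (t - u))"
  proof (rule lborel_pair.Fubini_integrable)
    have "(\<integral>u. norm (r t * p (t - u)) \<partial>lborel) = \<bar>r t\<bar> * (\<integral>u. \<bar>p u\<bar> \<partial>lborel)" for t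
      using integral_reflect[of "\<lambda>t. \<bar>p t\<bar>" t] by (simp add: abs_mult)
    then show "integrable lborel (\<lambda>t. \<integral>u. norm (case (t, u) of (t, u) \<Rightarrow> r t * p (t - u)) \<partial>lborel)"
      using r by simp
    show "AE t in lborel. integrable lborel (\<lambda>u. case (t, u) of (t, u) \<Rightarrow> r t * p (t - u))"
      using integrable_reflect[OF p] by simp
  qed measurable
  then have "integrable (lborel \<Otimes>\<^sub>M lborel) (\<lambda>x. B * (case x of (t, u) \<Rightarrow> r t * p (t - u)))" by simp
  then show ?thesis
  proof (rule Bochner_Integration.integrable_bound)
    show "AE x in lborel \<Otimes>\<^sub>M lborel. norm (case x of (t, u) \<Rightarrow> r t * p (t - u) * E u)
        \<le> norm (B * (case x of (t, u) \<Rightarrow> r t * p (t - u)))"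
    proof (intro AE_I2)
      fix x :: "real \<times> real"
      obtain t u where x: "x = (t, u)" by fastforce
      have "\<bar>r t * p (t - u)\<bar> * \<bar>E u\<bar> \<le> \<bar>r t * p (t - u)\<bar> * \<bar>B\<bar>"
        by (intro mult_left_mono) (use E[of u] in auto)
      then show "norm (case x of (t, u) \<Rightarrow> r t * p (t - u) * E u) \<le> norm (B * (case x of (t, u) \<Rightarrow> r t * p (t - u)))"
        by (simp add: x abs_mult mult_ac)
    qed
  qed measurable
qed

text \<open>The test function is chosen so that, by Fubini and the reversal \<open>T - u\<close>,
  the pairing of \<open>r\<close> with the range of the convolution becomes a Laplace integral,
  stopped at \<open>T\<close>, of \<open>p\<close> convolved with the reversed
  \<open>r\<close>.\<close>

lemma integral_mult_convolve_reflect: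
  fixes p r :: "real \<Rightarrow> real"
  assumes p: "causal T p" and r: "causal T r" and x: "x \<ge> 0"
  shows "(\<integral>t. r t * convolve p (\<lambda>u. indicator {0..T} u * exp (- x * (T - u))) t \<partial>lborel)
    = (\<integral>t. indicator {..T} t * (exp (- x * t) * convolve p (\<lambda>s. r (T - s)) t) \<partial>lborel)"
proof -
  define E where "E = (\<lambda>u. indicator {0..T} u * exp (- x * (T - u)))"
  have Em[measurable]: "E \<in> borel_measurable borel" unfolding E_def by measurable
  have EB: "\<bar>E u\<bar> \<le> 1" for u using x by (auto simp: E_def indicator_def abs_mult)
  note int = correlation_pair_integrable[OF causalD(1)[OF p] causalD(1)[OF r] Em EB]
  have "(\<integral>t. r t * convolve p E t \<partial>lborel) = (\<integral>t. (\<integral>u. r t * p (t - u) * E u \<partial>lborel) \<partial>lborel)"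
    unfolding convolve_def by (simp add: mult.assoc)
  also have "\<dots> = (\<integral>u. (\<integral>t. r t * p (t - u) * E u \<partial>lborel) \<partial>lborel)"
    using lborel_pair.Fubini_integral[OF int] by simp
  also have "\<dots> = (\<integral>u. (indicator {..T} (T - u) * (exp (- x * (T - u)) * convolve p (\<lambda>s. r (T - s)) (T - u))) \<partial>lborel)"
  proof (intro Bochner_Integration.integral_cong refl)
    fix u
    have c: "convolve p (\<lambda>s. r (T - s)) (T - u) = (\<integral>t. r t * p (t - u) \<partial>lborel)"
      unfolding convolve_def using integral_reflect[of "\<lambda>t. r t * p (t - u)" T] by (simp add: algebra_simps)
    have "(\<integral>t. r t * p (t - u) \<partial>lborel) = 0" if "u > T"
    proof -
      have "r t * p (t - u) = 0" for t
        using causalD(2)[OF p, of "t - u"] causalD(3)[OF r, of t] that by (cases "t > T") auto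
      then show ?thesis by (rule integral_zero_fun)
    qed
    then show "(\<integral>t. r t * p (t - u) * E u \<partial>lborel) = indicator {..T} (T - u) * (exp (- x * (T - u)) * convolve p (\<lambda>s. r (T - s)) (T - u))"
      by (auto simp: c E_def indicator_def)
  qed
  also have "\<dots> = (\<integral>t. indicator {..T} t * (exp (- x * t) * convolve p (\<lambda>s. r (T - s)) t) \<partial>lborel)"
    by (rule integral_reflect)
  finally show ?thesis by (simp add: E_def)
qed

lemma causal_reflect: "causal T r \<Longrightarrow> causal T (\<lambda>s. r (T - s))"
  using integrable_reflect[of r T] unfolding causal_def by force

lemma abs_laplace_le:
  assumes "causal M f" "x \<ge> 0"
  shows "\<bar>laplace f x\<bar> \<le> (\<integral>t. \<bar>f t\<bar> \<partial>lborel)"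
  using laplace_abs_le[OF causalD(1,2)[OF assms(1)] assms(2), of 0] causalD(2)[OF assms(1)] by simp

text \<open>Orthogonality, tested on exponentials alone, removes the part over
  \<open>t \<le> T\<close> of the Laplace integral of \<open>G j\<close>, the entries of the row
  vector \<open>\<rho>\<close> convolved with \<open>\<phi>\<close>. What remains is a tail of order
  \<open>exp (- T * x)\<close>, and Cramer's rule passes this rate on to the product of the
  transforms of \<open>conv_det \<phi>\<close> and \<open>\<rho> m\<close>.\<close>

theorem orthogonal_convolution_range_zero:
  fixes \<phi> :: "real \<Rightarrow> real^'n::{finite,linorder}^'n::{finite,linorder}" and r :: "'n \<Rightarrow> real \<Rightarrow> real"
  assumes T: "T > 0"
    and \<phi>: "\<And>i j. causal T (\<lambda>t. \<phi> t $ i $ j)"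
    and r: "\<And>i. causal T (r i)"
    and orth: "\<And>j h. continuous_on UNIV h \<Longrightarrow>
      (\<Sum>i\<in>UNIV. \<integral>t. r i t * convolve (\<lambda>t. \<phi> t $ i $ j) (\<lambda>u. indicator {0..T} u * h u) t \<partial>lborel) = 0"
    and nz: "\<And>\<delta>. \<delta> > 0 \<Longrightarrow> \<not> vanish_before \<delta> (conv_det \<phi>)"
  shows "AE t in lborel. r m t = 0"
proof -
  define \<rho> where "\<rho> = (\<lambda>i s. r i (T - s))"
  have \<rho>: "causal T (\<rho> i)" for i unfolding \<rho>_def by (rule causal_reflect[OF r])
  let ?\<phi> = "\<lambda>i j t. \<phi> t $ i $ j"
  define G where "G = (\<lambda>j t. \<Sum>i\<in>UNIV. convolve (?\<phi> i j) (\<rho> i) t)"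
  have cc: "causal (T + T) (convolve (?\<phi> i j) (\<rho> i))" for i j by (rule causal_convolve[OF \<phi> \<rho>])
  have Gi: "integrable lborel (G j)" for j
    unfolding G_def by (rule Bochner_Integration.integrable_sum) (rule causalD(1)[OF cc])
  have G0: "G j t = 0" if "t < 0" for j t
    unfolding G_def by (rule sum.neutral) (use causalD(2)[OF cc that] in blast)
  have LG: "laplace (G j) x = (\<Sum>i\<in>UNIV. laplace (?\<phi> i j) x * laplace (\<rho> i) x)" if "x \<ge> 0" for j x
  proof -
    have "laplace (G j) x = (\<integral>t. (\<Sum>i\<in>UNIV. exp (- x * t) * convolve (?\<phi> i j) (\<rho> i) t) \<partial>lborel)"
      unfolding laplace_def G_def by (simp add: sum_distrib_left)
    also have "\<dots> = (\<Sum>i\<in>UNIV. laplace (convolve (?\<phi> i j) (\<rho> i)) x)"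
      unfolding laplace_def
      by (rule Bochner_Integration.integral_sum) (rule integrable_exp_mult[OF causalD(1,2)[OF cc] that])
    also have "\<dots> = (\<Sum>i\<in>UNIV. laplace (?\<phi> i j) x * laplace (\<rho> i) x)"
      by (intro sum.cong refl laplace_convolve[OF causalD(1,2)[OF \<phi>] causalD(1,2)[OF \<rho>] that])
    finally show ?thesis .
  qed
  have split: "laplace f x = (\<integral>t. indicator {..T} t * (exp (- x * t) * f t) \<partial>lborel) + laplace (\<lambda>t. indicator {T<..} t * f t) x"
    if "integrable lborel f" "\<And>t. t < 0 \<Longrightarrow> f t = 0" "x \<ge> 0" for f x
  proof -
    note e = integrable_exp_mult[OF that(1,2,3)]
    have "laplace f x = (\<integral>t. indicator {..T} t * (exp (- x * t) * f t) + indicator {T<..} t * (exp (- x * t) * f t) \<partial>lborel)"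
      unfolding laplace_def by (intro Bochner_Integration.integral_cong) (auto simp: indicator_def)
    also have "\<dots> = (\<integral>t. indicator {..T} t * (exp (- x * t) * f t) \<partial>lborel) + (\<integral>t. indicator {T<..} t * (exp (- x * t) * f t) \<partial>lborel)"
      by (intro Bochner_Integration.integral_add integrable_indicator_mult e) simp_all
    also have "(\<integral>t. indicator {T<..} t * (exp (- x * t) * f t) \<partial>lborel) = laplace (\<lambda>t. indicator {T<..} t * f t) x"
      unfolding laplace_def by (simp only: mult.left_commute)
    finally show ?thesis .
  qed
  have tail: "\<bar>laplace (\<lambda>t. indicator {T<..} t * f t) x\<bar> \<le> (\<integral>t. \<bar>f t\<bar> \<partial>lborel) * exp (- T * x)"
    if "integrable lborel f" "x \<ge> 0" for f x
  proof -
    have i: "integrable lborel (\<lambda>t. indicator {T<..} t * f t)"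
      by (rule integrable_indicator_mult[OF that(1)]) simp
    have "\<bar>laplace (\<lambda>t. indicator {T<..} t * f t) x\<bar> \<le> exp (- T * x) * (\<integral>t. \<bar>indicator {T<..} t * f t\<bar> \<partial>lborel)"
      by (rule laplace_abs_le[OF i _ that(2)]) (use T in \<open>auto simp: indicator_def\<close>)
    also have "\<dots> \<le> exp (- T * x) * (\<integral>t. \<bar>f t\<bar> \<partial>lborel)"
      using i that(1) by (intro mult_left_mono integral_mono) (auto simp: indicator_def)
    finally show ?thesis by (simp add: mult.commute)
  qed
  define NG where "NG = (\<lambda>j. \<integral>t. \<bar>G j t\<bar> \<partial>lborel)"
  have NG0: "NG j \<ge> 0" for j unfolding NG_def by (rule Bochner_Integration.integral_nonneg) simp
  have GE: "\<bar>laplace (G j) x\<bar> \<le> NG j * exp (- T * x)" if x: "x \<ge> 0" for j x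
  proof -
    have "(\<integral>t. indicator {..T} t * (exp (- x * t) * G j t) \<partial>lborel) =
        (\<integral>t. (\<Sum>i\<in>UNIV. indicator {..T} t * (exp (- x * t) * convolve (?\<phi> i j) (\<rho> i) t)) \<partial>lborel)"
      unfolding G_def by (simp add: sum_distrib_left)
    also have "\<dots> = (\<Sum>i\<in>UNIV. \<integral>t. indicator {..T} t * (exp (- x * t) * convolve (?\<phi> i j) (\<rho> i) t) \<partial>lborel)"
    proof (rule Bochner_Integration.integral_sum)
      fix i
      show "integrable lborel (\<lambda>t. indicator {..T} t * (exp (- x * t) * convolve (?\<phi> i j) (\<rho> i) t))"
        by (rule integrable_indicator_mult[OF integrable_exp_mult[OF causalD(1,2)[OF cc] x]]) simp_all
    qed
    also have "\<dots> = (\<Sum>i\<in>UNIV. \<integral>t. r i t * convolve (?\<phi> i j) (\<lambda>u. indicator {0..T} u * exp (- x * (T - u))) t \<partial>lborel)"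
    proof (rule sum.cong[OF refl])
      fix i
      show "(\<integral>t. indicator {..T} t * (exp (- x * t) * convolve (?\<phi> i j) (\<rho> i) t) \<partial>lborel) =
          (\<integral>t. r i t * convolve (?\<phi> i j) (\<lambda>u. indicator {0..T} u * exp (- x * (T - u))) t \<partial>lborel)"
        unfolding \<rho>_def by (rule integral_mult_convolve_reflect[OF \<phi>[of i j] r[of i] x, symmetric])
    qed
    also have "\<dots> = 0" by (rule orth) (intro continuous_intros)
    finally have "laplace (G j) x = laplace (\<lambda>t. indicator {T<..} t * G j t) x"
      using split[OF Gi G0 x, of j] by linarith
    then show ?thesis using tail[OF Gi x, of j] by (simp only: NG_def)
  qed
  define K where "K = 1 + (\<Sum>i\<in>UNIV. \<Sum>j\<in>UNIV. \<integral>t. \<bar>?\<phi> i j t\<bar> \<partial>lborel)"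
  have K: "\<bar>laplace (?\<phi> i j) x\<bar> \<le> K" if "x \<ge> 0" for i j x
  proof -
    have nn: "0 \<le> (\<integral>t. \<bar>?\<phi> i j t\<bar> \<partial>lborel)" for i j by simp
    have "(\<integral>t. \<bar>?\<phi> i j t\<bar> \<partial>lborel) \<le> (\<Sum>j\<in>UNIV. \<integral>t. \<bar>?\<phi> i j t\<bar> \<partial>lborel)"
      by (rule member_le_sum) (use nn in auto)
    also have "\<dots> \<le> (\<Sum>i\<in>UNIV. \<Sum>j\<in>UNIV. \<integral>t. \<bar>?\<phi> i j t\<bar> \<partial>lborel)"
      by (rule member_le_sum[where f="\<lambda>i. \<Sum>j\<in>UNIV. \<integral>t. \<bar>?\<phi> i j t\<bar> \<partial>lborel"]) (use nn in \<open>auto intro: sum_nonneg\<close>)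
    finally show ?thesis using abs_laplace_le[OF \<phi> that, of i j] by (simp add: K_def)
  qed
  let ?k = "conv_det \<phi>"
  have \<phi>z: "\<And>t. t < 0 \<Longrightarrow> \<phi> t = 0" using causalD(2)[OF \<phi>] by (simp add: vec_eq_iff)
  have kL: "integrable lborel ?k" by (rule conv_det_laplace(1)[OF causalD(1)[OF \<phi>] \<phi>z])
  have kLx: "laplace ?k x = det (\<chi> i j. laplace (?\<phi> i j) x)" if "x \<ge> 0" for x
    by (rule conv_det_laplace(2)[OF causalD(1)[OF \<phi>] \<phi>z that])
  have k0: "?k t = 0" if "t < 0" for t using that by (simp add: conv_det_def)
  define NGm where "NGm = (\<Sum>j\<in>UNIV. NG j)"
  define C where "C = fact CARD('n) * K ^ (CARD('n) - 1) * NGm"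
  have kr: "\<bar>laplace ?k x * laplace (\<rho> m) x\<bar> \<le> C * exp (- T * x)" if x: "x \<ge> 0" for x
  proof -
    let ?M = "\<chi> i j. laplace (?\<phi> i j) x" and ?v = "\<chi> i. laplace (\<rho> i) x"
    let ?A = "\<chi> i. if i = m then ?v v* ?M else ?M $ i"
    have row: "(?v v* ?M) $ j = laplace (G j) x" for j
      by (simp add: vector_matrix_mult_def LG[OF x] mult.commute)
    have "\<bar>det ?A\<bar> \<le> fact CARD('n) * K ^ (CARD('n) - 1) * (NGm * exp (- T * x))"
    proof (rule abs_det_le_row)
      show "\<bar>?A $ i $ j\<bar> \<le> K" if "i \<noteq> m" for i j using that K[OF x] by simp
      fix j
      have "NG j \<le> NGm" unfolding NGm_def by (rule member_le_sum) (use NG0 in auto)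
      then have e: "NG j * exp (- T * x) \<le> NGm * exp (- T * x)" by (intro mult_right_mono) auto
      have "?A $ m $ j = laplace (G j) x" by (simp add: row)
      then show "\<bar>?A $ m $ j\<bar> \<le> NGm * exp (- T * x)" using order_trans[OF GE[OF x] e] by simp
    qed
    moreover have "det ?A = laplace (\<rho> m) x * laplace ?k x"
      unfolding det_replace_row kLx[OF x] by simp
    ultimately show ?thesis by (simp add: C_def mult_ac)
  qed
  \<comment> \<open>Titchmarsh's theorem is formulated for bounded support, while
    \<open>conv_det \<phi>\<close> may extend beyond \<open>T\<close>. The transform of the
    discarded tail is again of order \<open>exp (- T * x)\<close>, so the bound survives.\<close>
  define k' where "k' = (\<lambda>t. indicator {..T} t * ?k t)"
  have ik': "causal T k'"
  proof -
    have "integrable lborel k'"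
      unfolding k'_def by (rule integrable_indicator_mult[OF kL]) simp
    moreover have "0 \<le> t \<and> t \<le> T" if "k' t \<noteq> 0" for t
      using that k0[of t] by (cases "t < 0") (auto simp: k'_def indicator_def split: if_splits)
    ultimately show ?thesis by (simp add: causal_def)
  qed
  define N\<rho> where "N\<rho> = (\<integral>t. \<bar>\<rho> m t\<bar> \<partial>lborel)"
  define Nk where "Nk = (\<integral>t. \<bar>?k t\<bar> \<partial>lborel)"
  have "vanish_before T (\<rho> m)"
  proof (rule titchmarsh_vanish[OF ik' \<rho>])
    fix x :: real assume x: "x \<ge> 0"
    have "laplace ?k x = laplace k' x + laplace (\<lambda>t. indicator {T<..} t * ?k t) x"
      using split[OF kL k0 x] unfolding laplace_def k'_def by (simp only: mult.left_commute)
    then have "laplace k' x * laplace (\<rho> m) x = laplace ?k x * laplace (\<rho> m) x - laplace (\<lambda>t. indicator {T<..} t * ?k t) x * laplace (\<rho> m) x"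
      by (simp add: algebra_simps)
    then have "\<bar>laplace k' x * laplace (\<rho> m) x\<bar> \<le> \<bar>laplace ?k x * laplace (\<rho> m) x\<bar> + \<bar>laplace (\<lambda>t. indicator {T<..} t * ?k t) x\<bar> * \<bar>laplace (\<rho> m) x\<bar>"
      by (metis abs_mult abs_triangle_ineq4)
    also have "\<dots> \<le> C * exp (- T * x) + (Nk * exp (- T * x)) * N\<rho>"
      unfolding Nk_def N\<rho>_def
      by (intro add_mono mult_mono kr[OF x] tail[OF kL x] abs_laplace_le[OF \<rho> x]) auto
    finally show "\<bar>laplace k' x * laplace (\<rho> m) x\<bar> \<le> (C + Nk * N\<rho>) * exp (- T * x)"
      by (simp add: algebra_simps)
  next
    fix \<delta> :: real assume d: "\<delta> > 0"
    show "\<not> vanish_before \<delta> k'"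
    proof
      assume "vanish_before \<delta> k'"
      then have "vanish_before (min \<delta> T) ?k"
        unfolding vanish_before_def by eventually_elim (auto simp: k'_def)
      then show False using nz[of "min \<delta> T"] d T by simp
    qed
  qed (use T in auto)
  \<comment> \<open>Undoing the time reversal gives \<open>r m = 0\<close> almost everywhere on
    \<open>t > 0\<close>; the point \<open>0\<close> is null and causality covers
    \<open>t < 0\<close>.\<close>
  then have "AE t in lborel. t < T \<longrightarrow> r m (T - t) = 0" by (simp add: vanish_before_def \<rho>_def)
  then have "AE t in lborel. T + - 1 * t < T \<longrightarrow> r m (T - (T + - 1 * t)) = 0"
  proof (intro AE_borel_affine)
    have [measurable]: "r m \<in> borel_measurable borel" by (rule causalD(4)[OF r])
    show "Measurable.pred borel (\<lambda>t. t < T \<longrightarrow> r m (T - t) = 0)" by measurable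
  qed auto
  then show ?thesis
    using AE_lborel_singleton[of 0]
  proof eventually_elim
    case (elim t)
    then show ?case using causalD(2)[OF r, of t] by (cases "t > 0") auto
  qed
qed

section \<open>Orthogonal approximation in L^2\<close>

definition square_integrable :: "'b measure \<Rightarrow> ('b \<Rightarrow> 'a::euclidean_space) \<Rightarrow> bool" where
  "square_integrable M f \<longleftrightarrow> f \<in> borel_measurable M \<and> integrable M (\<lambda>x. (norm (f x))\<^sup>2)"

lemma square_integrable_bound:
  assumes "integrable M g" "f \<in> borel_measurable M" "AE x in M. (norm (f x))\<^sup>2 \<le> g x"
  shows "square_integrable M f"
  unfolding square_integrable_def
proof
  show "integrable M (\<lambda>x. (norm (f x))\<^sup>2)"
    by (rule Bochner_Integration.integrable_bound[OF assms(1)])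
      (use assms(2,3) in \<open>auto elim!: eventually_mono\<close>)
qed (fact assms(2))

lemma norm_add_power2_le:
  fixes x y :: "'a::real_inner"
  shows "(norm (x + y))\<^sup>2 \<le> 2 * (norm x)\<^sup>2 + 2 * (norm y)\<^sup>2"
proof -
  have "(norm (x + y))\<^sup>2 + (norm (x - y))\<^sup>2 = 2 * (norm x)\<^sup>2 + 2 * (norm y)\<^sup>2"
    by (simp add: power2_norm_eq_inner algebra_simps inner_commute)
  then show ?thesis using zero_le_power2[of "norm (x - y)"] by linarith
qed

lemma square_integrable_lincomb:
  assumes f: "square_integrable M f" and g: "square_integrable M g"
  shows "square_integrable M (\<lambda>x. a *\<^sub>R f x + b *\<^sub>R g x)"
proof (rule square_integrable_bound)
  show "integrable M (\<lambda>x. 2 * (a\<^sup>2 * (norm (f x))\<^sup>2) + 2 * (b\<^sup>2 * (norm (g x))\<^sup>2))"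
    using f g by (auto simp: square_integrable_def)
  show "AE x in M. (norm (a *\<^sub>R f x + b *\<^sub>R g x))\<^sup>2 \<le> 2 * (a\<^sup>2 * (norm (f x))\<^sup>2) + 2 * (b\<^sup>2 * (norm (g x))\<^sup>2)"
  proof (intro AE_I2)
    fix x
    show "(norm (a *\<^sub>R f x + b *\<^sub>R g x))\<^sup>2 \<le> 2 * (a\<^sup>2 * (norm (f x))\<^sup>2) + 2 * (b\<^sup>2 * (norm (g x))\<^sup>2)"
      using norm_add_power2_le[of "a *\<^sub>R f x" "b *\<^sub>R g x"] by (simp add: power_mult_distrib)
  qed
qed (use f g in \<open>auto simp: square_integrable_def\<close>)

lemma square_integrable_diff:
  assumes "square_integrable M f" "square_integrable M g"
  shows "square_integrable M (\<lambda>x. f x - g x)"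
  using square_integrable_lincomb[OF assms, of 1 "-1"] by simp

text \<open>Young's inequality with a free weight: choosing \<open>K\<close> afterwards replaces the
  Cauchy-Schwarz inequality for integrals and avoids square roots of integrals.\<close>

lemma two_abs_inner_le:
  fixes x y :: "'a::real_inner"
  assumes "K > 0"
  shows "2 * \<bar>x \<bullet> y\<bar> \<le> K * (norm x)\<^sup>2 + (norm y)\<^sup>2 / K"
proof -
  have "0 \<le> (norm x * sqrt K - norm y / sqrt K)\<^sup>2" by simp
  also have "\<dots> = K * (norm x)\<^sup>2 + (norm y)\<^sup>2 / K - 2 * (norm x * norm y)"
    using assms by (simp add: power2_diff power_mult_distrib power_divide)
  finally show ?thesis using Cauchy_Schwarz_ineq2[of x y] by linarith
qed

lemma integrable_inner_square:
  assumes f: "square_integrable M f" and g: "square_integrable M g"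
  shows "integrable M (\<lambda>x. f x \<bullet> g x)"
proof (rule Bochner_Integration.integrable_bound)
  show "integrable M (\<lambda>x. (norm (f x))\<^sup>2 + (norm (g x))\<^sup>2)"
    using f g by (auto simp: square_integrable_def)
  show "AE x in M. norm (f x \<bullet> g x) \<le> norm ((norm (f x))\<^sup>2 + (norm (g x))\<^sup>2)"
  proof (intro AE_I2)
    fix x
    show "norm (f x \<bullet> g x) \<le> norm ((norm (f x))\<^sup>2 + (norm (g x))\<^sup>2)"
      using two_abs_inner_le[of 1 "f x" "g x"] by simp
  qed
qed (use f g in \<open>auto simp: square_integrable_def\<close>)

lemma abs_integral_inner_le:
  assumes f: "square_integrable M f" and g: "square_integrable M g" and K: "K > 0"
  shows "2 * \<bar>\<integral>x. f x \<bullet> g x \<partial>M\<bar> \<le> K * (\<integral>x. (norm (f x))\<^sup>2 \<partial>M) + (\<integral>x. (norm (g x))\<^sup>2 \<partial>M) / K"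
proof -
  have "2 * \<bar>\<integral>x. f x \<bullet> g x \<partial>M\<bar> \<le> 2 * (\<integral>x. \<bar>f x \<bullet> g x\<bar> \<partial>M)"
    using integral_abs_bound[of M "\<lambda>x. f x \<bullet> g x"] by simp
  also have "\<dots> = (\<integral>x. 2 * \<bar>f x \<bullet> g x\<bar> \<partial>M)" by simp
  also have "\<dots> \<le> (\<integral>x. K * (norm (f x))\<^sup>2 + (norm (g x))\<^sup>2 / K \<partial>M)"
    using two_abs_inner_le[OF K] integrable_inner_square[OF f g] f g
    by (intro integral_mono) (auto simp: square_integrable_def)
  also have "\<dots> = K * (\<integral>x. (norm (f x))\<^sup>2 \<partial>M) + (\<integral>x. (norm (g x))\<^sup>2 \<partial>M) / K"
    using f g by (simp add: square_integrable_def)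
  finally show ?thesis .
qed

text \<open>A minimizing sequence is Cauchy by
  the parallelogram law, and the residual of its limit is orthogonal to the subspace.\<close>

lemma L2_dense_if_orthogonal_trivial:
  fixes V :: "('b \<Rightarrow> 'a::euclidean_space) set"
  assumes V0: "V \<noteq> {}" and V: "\<And>v. v \<in> V \<Longrightarrow> square_integrable M v"
    and lin: "\<And>v w a b. v \<in> V \<Longrightarrow> w \<in> V \<Longrightarrow> (\<lambda>x. a *\<^sub>R v x + b *\<^sub>R w x) \<in> V"
    and f: "square_integrable M f"
    and D: "D \<in> sets M" "\<And>x. x \<notin> D \<Longrightarrow> f x = 0" "\<And>v x. v \<in> V \<Longrightarrow> x \<notin> D \<Longrightarrow> v x = 0"
    and orth: "\<And>r. square_integrable M r \<Longrightarrow> (\<And>x. x \<notin> D \<Longrightarrow> r x = 0) \<Longrightarrow>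
      (\<And>v. v \<in> V \<Longrightarrow> (\<integral>x. r x \<bullet> v x \<partial>M) = 0) \<Longrightarrow> AE x in M. r x = 0"
    and \<epsilon>: "\<epsilon> > 0"
  shows "\<exists>v\<in>V. (\<integral>x. (norm (f x - v x))\<^sup>2 \<partial>M) < \<epsilon>"
proof -
  define N where "N = (\<lambda>g. \<integral>x. (norm (g x :: 'a))\<^sup>2 \<partial>M)"
  define E where "E = (\<lambda>v. N (\<lambda>x. f x - v x))"
  have N0: "N g \<ge> 0" for g unfolding N_def by simp
  define \<delta> where "\<delta> = Inf (E ` V)"
  have bb: "bdd_below (E ` V)" by (intro bdd_belowI[of _ 0]) (auto simp: E_def N0)
  have E\<delta>: "\<delta> \<le> E v" if "v \<in> V" for v
    unfolding \<delta>_def by (rule cInf_lower) (use that bb in auto)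
  \<comment> \<open>The rate \<open>(1/8)^n\<close> survives two losses: the factor
    \<open>2^n\<close> in the series that yields pointwise convergence, and the division by
    \<open>(1/2)^n\<close> in the variational inequality \<open>b1\<close>.\<close>
  have "\<exists>v\<in>V. E v < \<delta> + (1/8)^n" for n :: nat
  proof -
    have "Inf (E ` V) < \<delta> + (1/8)^n" by (simp add: \<delta>_def)
    then show ?thesis using cInf_less_iff[OF _ bb] V0 by auto
  qed
  then obtain v where vV: "\<And>n. v n \<in> V" and vE: "\<And>n. E (v n) < \<delta> + (1/8)^n" by metis
  have sv: "square_integrable M (v n)" for n by (rule V[OF vV])
  \<comment> \<open>Parallelogram law with the midpoint \<open>?w\<close>, which lies in
    \<open>V\<close> and therefore has squared distance at least \<open>\<delta>\<close> from
    \<open>f\<close>.\<close>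
  have par: "N (\<lambda>x. v m x - v n x) \<le> 2 * (1/8)^n + 2 * (1/8)^m" for m n
  proof -
    let ?w = "\<lambda>x. (1/2) *\<^sub>R v m x + (1/2) *\<^sub>R v n x"
    have w: "?w \<in> V" by (rule lin[OF vV vV])
    have "(norm (v m x - v n x))\<^sup>2 = 2 * (norm (f x - v m x))\<^sup>2 + 2 * (norm (f x - v n x))\<^sup>2 - 4 * (norm (f x - ?w x))\<^sup>2" for x
      by (simp add: power2_norm_eq_inner algebra_simps inner_commute)
    then have "N (\<lambda>x. v m x - v n x) = (\<integral>x. 2 * (norm (f x - v m x))\<^sup>2 + 2 * (norm (f x - v n x))\<^sup>2 - 4 * (norm (f x - ?w x))\<^sup>2 \<partial>M)"
      unfolding N_def by simp
    also have "\<dots> = 2 * E (v m) + 2 * E (v n) - 4 * E ?w"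
      using square_integrable_diff[OF f sv[of m]] square_integrable_diff[OF f sv[of n]] square_integrable_diff[OF f V[OF w]]
      unfolding E_def N_def square_integrable_def by simp
    finally show ?thesis using E\<delta>[OF w] vE[of n] vE[of m] by linarith
  qed
  have nnN: "(\<integral>\<^sup>+x. ennreal ((norm (g x))\<^sup>2) \<partial>M) = ennreal (N g)" if "square_integrable M g" for g
    unfolding N_def using that by (intro nn_integral_eq_integral) (auto simp: square_integrable_def)
  have meas[measurable]: "v n \<in> borel_measurable M" "f \<in> borel_measurable M" for n
    using sv f by (auto simp: square_integrable_def)
  \<comment> \<open>Summability with the weights \<open>2^n\<close> makes the increments decay
    geometrically at almost every point, so the whole sequence converges there without passing to a
    subsequence.\<close>
  have "AE x in M. (\<Sum>n. ennreal (2^n * (norm (v (Suc n) x - v n x))\<^sup>2)) \<noteq> \<infinity>"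
  proof (rule nn_integral_PInf_AE)
    have "(\<integral>\<^sup>+x. (\<Sum>n. ennreal (2^n * (norm (v (Suc n) x - v n x))\<^sup>2)) \<partial>M) =
        (\<Sum>n. \<integral>\<^sup>+x. ennreal (2^n * (norm (v (Suc n) x - v n x))\<^sup>2) \<partial>M)"
      by (rule nn_integral_suminf) measurable
    also have "\<dots> = (\<Sum>n. ennreal (2^n * N (\<lambda>x. v (Suc n) x - v n x)))"
      by (intro arg_cong[where f=suminf] ext)
        (simp add: ennreal_mult N0 nnN square_integrable_diff sv nn_integral_cmult)
    also have "\<dots> \<le> (\<Sum>n. ennreal (4 * (1/4)^n))"
    proof (rule suminf_le)
      fix n
      have "(0::real) \<le> (1/8)^n" by simp
      then have "N (\<lambda>x. v (Suc n) x - v n x) \<le> 4 * (1/8)^n"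
        using par[of "Suc n" n] unfolding power_Suc by linarith
      then have "2^n * N (\<lambda>x. v (Suc n) x - v n x) \<le> 2^n * (4 * (1/8)^n)" by (intro mult_left_mono) auto
      also have "\<dots> = 4 * (1/4 :: real)^n" by (simp flip: power_mult_distrib)
      finally show "ennreal (2^n * N (\<lambda>x. v (Suc n) x - v n x)) \<le> ennreal (4 * (1/4)^n)" by (rule ennreal_leI)
    qed auto
    also have "\<dots> = ennreal (\<Sum>n. 4 * (1/4)^n)"
      by (rule suminf_ennreal2) (auto intro!: summable_mult summable_geometric)
    finally show "(\<integral>\<^sup>+x. (\<Sum>n. ennreal (2^n * (norm (v (Suc n) x - v n x))\<^sup>2)) \<partial>M) \<noteq> \<infinity>"
      by (auto simp: top_unique)
  qed measurable
  then have conv: "AE x in M. convergent (\<lambda>n. v n x)"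
  proof eventually_elim
    case (elim x)
    define d where "d = (\<lambda>n. v (Suc n) x - v n x)"
    obtain C where C: "(\<Sum>n. ennreal (2^n * (norm (d n))\<^sup>2)) = ennreal C" "C \<ge> 0"
    proof (cases "\<Sum>n. ennreal (2^n * (norm (v (Suc n) x - v n x))\<^sup>2)" rule: ennreal_cases)
      case (real q)
      then show ?thesis using that unfolding d_def by blast
    next
      case top
      then show ?thesis using elim unfolding infinity_ennreal_def by blast
    qed
    have "norm (d n) \<le> sqrt C * (sqrt (1/2))^n" for n
    proof -
      define g where "g = (\<lambda>n. ennreal (2^n * (norm (d n))\<^sup>2))"
      have "g n \<le> suminf g"
        using sum_le_suminf[OF summableI, of "{n}" g] by simp
      then have "ennreal (2^n * (norm (d n))\<^sup>2) \<le> (\<Sum>n. ennreal (2^n * (norm (d n))\<^sup>2))"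
        unfolding g_def .
      then have "2^n * (norm (d n))\<^sup>2 \<le> C" unfolding C(1) by (simp only: ennreal_le_iff[OF C(2)])
      then have "(norm (d n))\<^sup>2 \<le> C * (1/2)^n" by (simp add: field_simps power_divide)
      then have "sqrt ((norm (d n))\<^sup>2) \<le> sqrt (C * (1/2)^n)" by (rule real_sqrt_le_mono)
      then show ?thesis by (simp add: real_sqrt_mult real_sqrt_power)
    qed
    then have "summable d"
    proof (rule summable_comparison_test'[where N=0, rotated])
      have "sqrt (1/2) < (1::real)" by (simp add: real_sqrt_divide)
      then show "summable (\<lambda>n. sqrt C * (sqrt (1/2))^n)"
        by (intro summable_mult summable_geometric) simp
    qed
    then have "convergent (\<lambda>n. \<Sum>i<n. d i)" by (simp add: summable_iff_convergent)
    then have "convergent (\<lambda>n. v 0 x + (\<Sum>i<n. d i))" by (intro convergent_add convergent_const)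
    moreover have "v 0 x + (\<Sum>i<n. d i) = v n x" for n
      unfolding d_def by (subst sum_lessThan_telescope) simp
    ultimately show ?case by simp
  qed
  \<comment> \<open>The indicator makes \<open>r\<close> vanish everywhere outside \<open>D\<close>,
    as \<open>orth\<close> demands, and not merely almost everywhere; \<open>f\<close> and all
    \<open>v n\<close> are zero there anyway.\<close>
  define r where "r = (\<lambda>x. indicator D x *\<^sub>R (f x - lim (\<lambda>n. v n x)))"
  have rm[measurable]: "r \<in> borel_measurable M"
  proof -
    have "(\<lambda>x. lim (\<lambda>n. v n x)) \<in> borel_measurable M" by measurable
    then show ?thesis unfolding r_def using D(1) by measurable
  qed
  have conv': "AE x in M. (\<lambda>m. v m x - v n x) \<longlonglongrightarrow> (f x - v n x) - r x" for n
    using conv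
  proof eventually_elim
    case (elim x)
    show ?case
    proof (cases "x \<in> D")
      case True
      then show ?thesis using elim by (auto simp: r_def convergent_LIMSEQ_iff intro!: tendsto_diff)
    next
      case False
      then show ?thesis using D(2)[OF False] D(3)[OF vV False] by (simp add: r_def)
    qed
  qed
  have fatou: "(\<integral>\<^sup>+x. ennreal ((norm ((f x - v n x) - r x))\<^sup>2) \<partial>M) \<le> ennreal (4 * (1/8)^n)" for n
  proof -
    have "(\<integral>\<^sup>+x. ennreal ((norm ((f x - v n x) - r x))\<^sup>2) \<partial>M) = (\<integral>\<^sup>+x. liminf (\<lambda>m. ennreal ((norm (v m x - v n x))\<^sup>2)) \<partial>M)"
      using conv'[of n]
    proof (intro nn_integral_cong_AE, eventually_elim)
      case (elim x)
      then have "(\<lambda>m. ennreal ((norm (v m x - v n x))\<^sup>2)) \<longlonglongrightarrow> ennreal ((norm ((f x - v n x) - r x))\<^sup>2)"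
        by (intro tendsto_ennrealI tendsto_power tendsto_norm)
      then show ?case by (intro lim_imp_Liminf[symmetric]) auto
    qed
    also have "\<dots> \<le> liminf (\<lambda>m. \<integral>\<^sup>+x. ennreal ((norm (v m x - v n x))\<^sup>2) \<partial>M)"
      by (rule nn_integral_liminf) measurable
    also have "\<dots> \<le> liminf (\<lambda>m. ennreal (4 * (1/8)^n))"
    proof (rule Liminf_mono)
      show "\<forall>\<^sub>F m in sequentially. (\<integral>\<^sup>+x. ennreal ((norm (v m x - v n x))\<^sup>2) \<partial>M) \<le> ennreal (4 * (1/8)^n)"
        using eventually_ge_at_top[of n]
      proof eventually_elim
        case (elim m)
        have "(1/8 :: real)^m \<le> (1/8)^n" by (rule power_decreasing) (use elim in auto)
        then show ?case unfolding nnN[OF square_integrable_diff[OF sv sv]]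
          using par[of m n] by (intro ennreal_leI) linarith
      qed
    qed
    also have "\<dots> = ennreal (4 * (1/8)^n)" by (simp add: Liminf_const)
    finally show ?thesis .
  qed
  have sdr: "square_integrable M (\<lambda>x. (f x - v n x) - r x)" for n
    unfolding square_integrable_def
  proof
    show "integrable M (\<lambda>x. (norm ((f x - v n x) - r x))\<^sup>2)"
      by (rule integrableI_bounded) (use le_less_trans[OF fatou[of n]] in auto)
  qed measurable
  have Ndr: "N (\<lambda>x. (f x - v n x) - r x) \<le> 4 * (1/8)^n" for n
    using fatou[of n] unfolding nnN[OF sdr] by (simp add: ennreal_le_iff)
  have sr: "square_integrable M r"
    using square_integrable_diff[OF square_integrable_diff[OF f sv[of 0]] sdr[of 0]] by simp
  have r0: "AE x in M. r x = 0"
  proof (rule orth[OF sr])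
    show "r x = 0" if "x \<notin> D" for x using that by (simp add: r_def)
    fix w assume w: "w \<in> V"
    note sw = V[OF w]
    let ?rn = "\<lambda>n x. f x - v n x"
    have srn: "square_integrable M (?rn n)" for n by (rule square_integrable_diff[OF f sv])
    \<comment> \<open>First variation: the error of \<open>v n + s w\<close> is at least
      \<open>\<delta>\<close>, while that of \<open>v n\<close> exceeds \<open>\<delta>\<close> by
      less than \<open>(1/8)^n\<close>. Taking \<open>s\<close> to be plus or minus
      \<open>(1/2)^n\<close> bounds the absolute value of the linear term and leaves errors that
      tend to \<open>0\<close> after division by \<open>(1/2)^n\<close>.\<close>
    have b1: "2 * \<bar>\<integral>x. ?rn n x \<bullet> w x \<partial>M\<bar> \<le> (1/4)^n + (1/2)^n * N w" for n
    proof -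
      have "2 * (s * (\<integral>x. ?rn n x \<bullet> w x \<partial>M)) \<le> (1/8)^n + s\<^sup>2 * N w" for s
      proof -
        have sV: "(\<lambda>x. 1 *\<^sub>R v n x + s *\<^sub>R w x) \<in> V" by (rule lin[OF vV w])
        have "E (\<lambda>x. 1 *\<^sub>R v n x + s *\<^sub>R w x) = (\<integral>x. (norm (?rn n x))\<^sup>2 - 2 * s * (?rn n x \<bullet> w x) + s\<^sup>2 * (norm (w x))\<^sup>2 \<partial>M)"
          unfolding E_def N_def
          by (intro Bochner_Integration.integral_cong refl)
            (simp only: power2_norm_eq_inner, simp add: algebra_simps inner_commute power2_eq_square)
        also have "\<dots> = E (v n) - 2 * s * (\<integral>x. ?rn n x \<bullet> w x \<partial>M) + s\<^sup>2 * N w"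
          unfolding E_def N_def using srn[of n] sw integrable_inner_square[OF srn[of n] sw]
          by (simp add: square_integrable_def)
        finally show ?thesis using E\<delta>[OF sV] vE[of n] by linarith
      qed
      from this[of "(1/2)^n"] this[of "- ((1/2)^n)"]
      have "(1/2)^n * (2 * \<bar>\<integral>x. ?rn n x \<bullet> w x \<partial>M\<bar>) \<le> (1/8)^n + ((1/2)^n)\<^sup>2 * N w"
        by (auto simp: abs_if algebra_simps)
      also have "(1/8 :: real)^n = (1/2)^n * (1/4)^n" by (simp flip: power_mult_distrib)
      finally have "(1/2)^n * (2 * \<bar>\<integral>x. ?rn n x \<bullet> w x \<partial>M\<bar>) \<le> (1/2)^n * ((1/4)^n + (1/2)^n * N w)"
        by (simp add: algebra_simps power2_eq_square)
      then show ?thesis by (rule mult_left_le_imp_le) simp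
    qed
    have b2: "2 * \<bar>\<integral>x. (?rn n x - r x) \<bullet> w x \<partial>M\<bar> \<le> 4 * (1/4)^n + (1/2)^n * N w" for n
    proof -
      have "2 * \<bar>\<integral>x. (?rn n x - r x) \<bullet> w x \<partial>M\<bar> \<le> 2^n * N (\<lambda>x. ?rn n x - r x) + N w / 2^n"
        unfolding N_def by (rule abs_integral_inner_le[OF sdr sw]) simp
      also have "\<dots> \<le> 2^n * (4 * (1/8)^n) + N w / 2^n"
        by (intro add_right_mono mult_left_mono Ndr) auto
      also have "2^n * (4 * (1/8 :: real)^n) = 4 * (1/4)^n" by (simp flip: power_mult_distrib)
      also have "N w / 2^n = (1/2)^n * N w" by (simp add: power_divide)
      finally show ?thesis .
    qed
    have "2 * \<bar>\<integral>x. r x \<bullet> w x \<partial>M\<bar> \<le> 5 * (1/4)^n + 2 * ((1/2)^n * N w)" for n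
    proof -
      have "(\<integral>x. r x \<bullet> w x \<partial>M) = (\<integral>x. ?rn n x \<bullet> w x - (?rn n x - r x) \<bullet> w x \<partial>M)"
        by (intro Bochner_Integration.integral_cong refl) (simp add: inner_diff_left)
      also have "\<dots> = (\<integral>x. ?rn n x \<bullet> w x \<partial>M) - (\<integral>x. (?rn n x - r x) \<bullet> w x \<partial>M)"
        by (intro Bochner_Integration.integral_diff integrable_inner_square srn sdr sw)
      finally show ?thesis using b1[of n] b2[of n] by linarith
    qed
    moreover have "(\<lambda>n. 5 * (1/4)^n + 2 * ((1/2)^n * N w)) \<longlonglongrightarrow> 5 * 0 + 2 * (0 * N w)"
      by (intro tendsto_intros LIMSEQ_power_zero) auto
    ultimately have "2 * \<bar>\<integral>x. r x \<bullet> w x \<partial>M\<bar> \<le> 5 * 0 + 2 * (0 * N w)"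
      by (intro LIMSEQ_le_const) auto
    then show "(\<integral>x. r x \<bullet> w x \<partial>M) = 0" by simp
  qed
  \<comment> \<open>As the residual is zero almost everywhere, the squared distance of
    \<open>v n\<close> to its limit, already of order \<open>(1/8)^n\<close>, is its squared
    distance to \<open>f\<close>.\<close>
  have NE: "N (\<lambda>x. (f x - v n x) - r x) = E (v n)" for n
    unfolding E_def N_def
  proof (rule integral_cong_AE)
    show "AE x in M. (norm (f x - v n x - r x))\<^sup>2 = (norm (f x - v n x))\<^sup>2"
      using r0 by eventually_elim simp
  qed measurable
  obtain n where "(1/8 :: real)^n < \<epsilon> / 4"
    using real_arch_pow_inv[of "\<epsilon>/4" "1/8"] \<epsilon> by auto
  then have "E (v n) < \<epsilon>" using Ndr[of n] unfolding NE by linarith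
  then show ?thesis using vV[of n] by (auto simp: E_def N_def)
qed

section \<open>From mean square to uniform density\<close>

lemma integrable_convolve_bounded:
  fixes p g :: "real \<Rightarrow> real"
  assumes p: "integrable lborel p" and [measurable]: "g \<in> borel_measurable borel" and g: "\<And>u. \<bar>g u\<bar> \<le> B"
  shows "integrable lborel (\<lambda>u. p (t - u) * g u)"
proof (rule Bochner_Integration.integrable_bound)
  have [measurable]: "p \<in> borel_measurable borel" using p by auto
  show "integrable lborel (\<lambda>u. B * p (t - u))" using integrable_reflect[OF p] by simp
  show "(\<lambda>u. p (t - u) * g u) \<in> borel_measurable lborel" by measurable
  show "AE u in lborel. norm (p (t - u) * g u) \<le> norm (B * p (t - u))"
  proof (intro AE_I2)
    fix u
    have "\<bar>g u\<bar> * \<bar>p (t - u)\<bar> \<le> \<bar>B\<bar> * \<bar>p (t - u)\<bar>" using g[of u] by (intro mult_right_mono) auto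
    then show "norm (p (t - u) * g u) \<le> norm (B * p (t - u))" by (simp add: abs_mult mult.commute)
  qed
qed

lemma abs_convolve_le:
  fixes p g :: "real \<Rightarrow> real"
  assumes p: "integrable lborel p" and gm: "g \<in> borel_measurable borel" and g: "\<And>u. \<bar>g u\<bar> \<le> B"
  shows "\<bar>convolve p g t\<bar> \<le> B * (\<integral>u. \<bar>p u\<bar> \<partial>lborel)"
proof -
  have "\<bar>convolve p g t\<bar> \<le> (\<integral>u. \<bar>p (t - u) * g u\<bar> \<partial>lborel)"
    unfolding convolve_def by (rule integral_abs_bound)
  also have "\<dots> \<le> (\<integral>u. B * \<bar>p (t - u)\<bar> \<partial>lborel)"
  proof (rule integral_mono)
    show "integrable lborel (\<lambda>u. \<bar>p (t - u) * g u\<bar>)" using integrable_convolve_bounded[OF p gm g] by simp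
    show "integrable lborel (\<lambda>u. B * \<bar>p (t - u)\<bar>)" using integrable_reflect[OF p] by simp
    show "\<bar>p (t - u) * g u\<bar> \<le> B * \<bar>p (t - u)\<bar>" for u
      using mult_right_mono[OF g[of u], of "\<bar>p (t - u)\<bar>"] by (simp add: abs_mult mult.commute)
  qed
  also have "\<dots> = B * (\<integral>u. \<bar>p u\<bar> \<partial>lborel)" using integral_reflect[of "\<lambda>u. \<bar>p u\<bar>" t] by simp
  finally show ?thesis .
qed

lemma borel_measurable_convolve[measurable]:
  fixes p g :: "real \<Rightarrow> real"
  assumes [measurable]: "p \<in> borel_measurable borel" "g \<in> borel_measurable borel"
  shows "convolve p g \<in> borel_measurable borel"
  unfolding convolve_def by measurable

lemma convolve_commute: "convolve f g = convolve g f"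
proof
  fix t
  show "convolve f g t = convolve g f t"
    unfolding convolve_def using integral_reflect[of "\<lambda>u. f (t - u) * g u" t] by (simp add: mult.commute)
qed

text \<open>Boundedness of the middle factor justifies Fubini at every \<open>t\<close>. For three
  merely integrable functions associativity holds in general only almost everywhere, too little for
  uniform approximation.\<close>

lemma convolve_assoc_bounded:
  fixes p e g :: "real \<Rightarrow> real"
  assumes p: "integrable lborel p" and e: "integrable lborel e"
    and [measurable]: "g \<in> borel_measurable borel" and g: "\<And>u. \<bar>g u\<bar> \<le> B"
  shows "convolve (convolve p g) e t = convolve p (convolve g e) t"
proof -
  have [measurable]: "p \<in> borel_measurable borel" "e \<in> borel_measurable borel" using p e by auto
  have int: "integrable (lborel \<Otimes>\<^sub>M lborel) (\<lambda>(s, v). p (t - v) * (g (v - s) * e s))"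
  proof (rule Bochner_Integration.integrable_bound)
    show "integrable (lborel \<Otimes>\<^sub>M lborel) (\<lambda>(s, v). B * (p (t - v) * e s))"
    proof (rule lborel_pair.Fubini_integrable)
      have "(\<integral>v. norm (B * (p (t - v) * e s)) \<partial>lborel) = \<bar>B\<bar> * (\<integral>v. \<bar>p v\<bar> \<partial>lborel) * \<bar>e s\<bar>" for s
        using integral_reflect[of "\<lambda>v. \<bar>p v\<bar>" t] by (simp add: abs_mult)
      then show "integrable lborel (\<lambda>s. \<integral>v. norm (case (s, v) of (s, v) \<Rightarrow> B * (p (t - v) * e s)) \<partial>lborel)"
        using e by simp
      show "AE s in lborel. integrable lborel (\<lambda>v. case (s, v) of (s, v) \<Rightarrow> B * (p (t - v) * e s))"
        using integrable_reflect[OF p] by simp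
    qed measurable
    show "AE x in lborel \<Otimes>\<^sub>M lborel. norm (case x of (s, v) \<Rightarrow> p (t - v) * (g (v - s) * e s))
        \<le> norm (case x of (s, v) \<Rightarrow> B * (p (t - v) * e s))"
    proof (intro AE_I2)
      fix x :: "real \<times> real"
      obtain s v where x: "x = (s, v)" by fastforce
      have "\<bar>g (v - s)\<bar> * \<bar>p (t - v) * e s\<bar> \<le> \<bar>B\<bar> * \<bar>p (t - v) * e s\<bar>"
        using g[of "v - s"] by (intro mult_right_mono) auto
      then show "norm (case x of (s, v) \<Rightarrow> p (t - v) * (g (v - s) * e s)) \<le> norm (case x of (s, v) \<Rightarrow> B * (p (t - v) * e s))"
        by (simp add: x abs_mult mult_ac)
    qed
  qed measurable
  have "convolve (convolve p g) e t = (\<integral>s. (\<integral>v. p (t - v) * (g (v - s) * e s) \<partial>lborel) \<partial>lborel)"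
    unfolding convolve_def[of "convolve p g"]
  proof (intro Bochner_Integration.integral_cong refl)
    fix s
    have "convolve p g (t - s) = (\<integral>v. p (t - v) * g (v - s) \<partial>lborel)"
      unfolding convolve_def using integral_shift[of "\<lambda>u. p (t - s - u) * g u" s] by simp
    then show "convolve p g (t - s) * e s = (\<integral>v. p (t - v) * (g (v - s) * e s) \<partial>lborel)"
      by (simp flip: mult.assoc)
  qed
  also have "\<dots> = (\<integral>v. (\<integral>s. p (t - v) * (g (v - s) * e s) \<partial>lborel) \<partial>lborel)"
    using lborel_pair.Fubini_integral[OF int] by simp
  also have "\<dots> = convolve p (convolve g e) t"
    unfolding convolve_def by simp
  finally show ?thesis .
qed

lemma borel_measurable_vec_nth:
  fixes f :: "'b \<Rightarrow> real^'n"
  assumes "f \<in> borel_measurable M"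
  shows "(\<lambda>x. f x $ i) \<in> borel_measurable M"
proof -
  have "(\<lambda>v::real^'n. v $ i) \<in> borel_measurable borel"
    by (intro borel_measurable_continuous_onI continuous_intros)
  then show ?thesis using assms by (rule measurable_compose_rev)
qed

lemma borel_measurable_vec:
  fixes f :: "'b \<Rightarrow> real^'n"
  assumes "\<And>i. (\<lambda>x. f x $ i) \<in> borel_measurable M"
  shows "f \<in> borel_measurable M"
  unfolding borel_measurable_euclidean_space[of f]
  using assms by (auto simp: Basis_vec_def inner_axis)

lemma integrable_indicator_Icc: "integrable lborel (indicator {a..b::real} :: real \<Rightarrow> real)"
  by (intro integrable_real_indicator) (simp_all add: emeasure_lborel_Icc_eq)

lemma continuous_bounded_indicator:
  fixes h :: "real \<Rightarrow> real"
  assumes "continuous_on UNIV h"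
  shows "\<exists>B\<ge>0. \<forall>u. \<bar>indicator {0..T} u * h u\<bar> \<le> B"
proof -
  have "bounded (h ` {0..T})"
    by (intro compact_imp_bounded compact_continuous_image continuous_on_subset[OF assms]) auto
  then obtain B where B: "\<And>u. u \<in> {0..T} \<Longrightarrow> \<bar>h u\<bar> \<le> B" unfolding bounded_iff by force
  show ?thesis
  proof (intro exI[of _ "max 0 B"] conjI allI)
    show "\<bar>indicator {0..T} u * h u\<bar> \<le> max 0 B" for u
      using B[of u] by (auto simp: indicator_def)
  qed simp
qed

text \<open>A continuous \<open>h\<close> is bounded on \<open>[0, T]\<close>, so its convolution
  with the merely integrable entries of \<open>\<phi>\<close> is bounded too. The range therefore
  lies in L^2, where triviality of its orthogonal complement can be used.\<close>

lemma L2_dense_convolution_range: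
  fixes \<phi> :: "real \<Rightarrow> real^'n::{finite,linorder}^'n::{finite,linorder}" and f :: "real \<Rightarrow> real^'n::{finite,linorder}"
  assumes T: "T > 0" and \<phi>: "\<And>i j. causal T (\<lambda>t. \<phi> t $ i $ j)"
    and nz: "\<And>\<delta>. \<delta> > 0 \<Longrightarrow> \<not> vanish_before \<delta> (conv_det \<phi>)"
    and f: "square_integrable lborel f" "\<And>t. t \<notin> {0..T} \<Longrightarrow> f t = 0" and \<epsilon>: "\<epsilon> > 0"
  shows "\<exists>h v. (\<forall>j. continuous_on UNIV (h j)) \<and> square_integrable lborel v \<and>
    v = (\<lambda>t. indicator {0..T} t *\<^sub>R (\<chi> i. \<Sum>j\<in>UNIV. convolve (\<lambda>t. \<phi> t $ i $ j) (\<lambda>u. indicator {0..T} u * h j u) t)) \<and>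
    (\<integral>t. (norm (f t - v t))\<^sup>2 \<partial>lborel) < \<epsilon>"
proof -
  let ?\<phi> = "\<lambda>i j t. \<phi> t $ i $ j"
  let ?I = "\<lambda>(h::real \<Rightarrow> real) u. indicator {0..T} u * h u"
  define R where "R = (\<lambda>h t. indicator {0..T} t *\<^sub>R (\<chi> i. \<Sum>j\<in>UNIV. convolve (?\<phi> i j) (?I (h j)) t) :: real^'n::{finite,linorder})"
  define V where "V = {R h | h. \<forall>j. continuous_on UNIV (h j)}"
  note \<phi>i = causalD(1)[OF \<phi>]
  have [measurable]: "?\<phi> i j \<in> borel_measurable borel" for i j by (rule causalD(4)[OF \<phi>])
  have Im: "?I h \<in> borel_measurable borel" if "continuous_on UNIV h" for h
  proof -
    have [measurable]: "h \<in> borel_measurable borel" by (rule borel_measurable_continuous_onI[OF that])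
    show ?thesis by measurable
  qed
  have Vsq: "square_integrable lborel (R h)" if h: "\<forall>j. continuous_on UNIV (h j)" for h
  proof -
    have "\<forall>j. \<exists>B\<ge>0. \<forall>u. \<bar>?I (h j) u\<bar> \<le> B" using continuous_bounded_indicator h by simp
    then obtain B where B: "\<And>j. B j \<ge> 0" "\<And>j u. \<bar>?I (h j) u\<bar> \<le> B j" by metis
    define C where "C = (\<Sum>i\<in>UNIV. \<Sum>j\<in>UNIV. B j * (\<integral>u. \<bar>?\<phi> i j u\<bar> \<partial>lborel))"
    have [measurable]: "?I (h j) \<in> borel_measurable borel" for j using Im h by auto
    have bd: "norm (\<chi> i. \<Sum>j\<in>UNIV. convolve (?\<phi> i j) (?I (h j)) t) \<le> C" for t
    proof -
      have "norm (\<chi> i. \<Sum>j\<in>UNIV. convolve (?\<phi> i j) (?I (h j)) t) \<le> (\<Sum>i\<in>UNIV. \<bar>\<Sum>j\<in>UNIV. convolve (?\<phi> i j) (?I (h j)) t\<bar>)"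
        by (rule order_trans[OF norm_le_l1_cart]) simp
      also have "\<dots> \<le> (\<Sum>i\<in>UNIV. \<Sum>j\<in>UNIV. \<bar>convolve (?\<phi> i j) (?I (h j)) t\<bar>)"
        by (intro sum_mono sum_abs)
      also have "\<dots> \<le> C" unfolding C_def
      proof (intro sum_mono)
        fix i j
        show "\<bar>convolve (?\<phi> i j) (?I (h j)) t\<bar> \<le> B j * (\<integral>u. \<bar>?\<phi> i j u\<bar> \<partial>lborel)"
          by (rule abs_convolve_le[OF \<phi>i]) (use B in auto)
      qed
      finally show ?thesis .
    qed
    show ?thesis
    proof (rule square_integrable_bound[where g="\<lambda>t. indicator {0..T} t * C\<^sup>2"])
      have "(\<lambda>t. \<chi> i. \<Sum>j\<in>UNIV. convolve (?\<phi> i j) (?I (h j)) t) \<in> borel_measurable borel"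
        by (rule borel_measurable_vec) simp
      then show "R h \<in> borel_measurable lborel" unfolding R_def by simp
      show "integrable lborel (\<lambda>t. indicator {0..T} t * C\<^sup>2)"
        by (intro integrable_mult_left integrable_indicator_Icc)
      show "AE t in lborel. (norm (R h t))\<^sup>2 \<le> indicator {0..T} t * C\<^sup>2"
        using bd by (intro AE_I2) (auto simp: R_def indicator_def intro!: power_mono)
    qed
  qed
  have lin: "(\<lambda>x. a *\<^sub>R R h x + b *\<^sub>R R h' x) = R (\<lambda>j u. a * h j u + b * h' j u)"
    if h: "\<forall>j. continuous_on UNIV (h j)" "\<forall>j. continuous_on UNIV (h' j)" for h h' a b
  proof
    fix t
    have "convolve (?\<phi> i j) (?I (\<lambda>u. a * h j u + b * h' j u)) t = a * convolve (?\<phi> i j) (?I (h j)) t + b * convolve (?\<phi> i j) (?I (h' j)) t" for i j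
    proof -
      have ii: "integrable lborel (\<lambda>u. ?\<phi> i j (t - u) * ?I k u)" if kc: "continuous_on UNIV k" for k
      proof -
        obtain B where B: "\<And>u. \<bar>?I k u\<bar> \<le> B" using continuous_bounded_indicator[OF kc, of T] by blast
        show ?thesis by (rule integrable_convolve_bounded[OF \<phi>i Im[OF kc] B])
      qed
      have "convolve (?\<phi> i j) (?I (\<lambda>u. a * h j u + b * h' j u)) t =
          (\<integral>u. a * (?\<phi> i j (t - u) * ?I (h j) u) + b * (?\<phi> i j (t - u) * ?I (h' j) u) \<partial>lborel)"
        unfolding convolve_def by (intro Bochner_Integration.integral_cong refl) (simp add: algebra_simps)
      also have "\<dots> = a * convolve (?\<phi> i j) (?I (h j)) t + b * convolve (?\<phi> i j) (?I (h' j)) t"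
        unfolding convolve_def using ii[of "h j"] ii[of "h' j"] h by simp
      finally show ?thesis .
    qed
    then show "a *\<^sub>R R h t + b *\<^sub>R R h' t = R (\<lambda>j u. a * h j u + b * h' j u) t"
      unfolding R_def vec_eq_iff by (auto simp: sum.distrib sum_distrib_left indicator_def)
  qed
  have "\<exists>v\<in>V. (\<integral>t. (norm (f t - v t))\<^sup>2 \<partial>lborel) < \<epsilon>"
  proof (rule L2_dense_if_orthogonal_trivial[where D="{0..T}"])
    show "V \<noteq> {}" unfolding V_def by (auto intro!: exI[of _ "\<lambda>j u. 0"])
    show "square_integrable lborel v" if "v \<in> V" for v using that Vsq by (auto simp: V_def)
    show "v x = 0" if "v \<in> V" "x \<notin> {0..T}" for v x using that by (auto simp: V_def R_def)
    show "(\<lambda>x. a *\<^sub>R v x + b *\<^sub>R w x) \<in> V" if vw: "v \<in> V" "w \<in> V" for v w a b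
    proof -
      obtain h h' where h: "v = R h" "w = R h'" "\<forall>j. continuous_on UNIV (h j)" "\<forall>j. continuous_on UNIV (h' j)"
        using vw by (auto simp: V_def)
      have "\<forall>j. continuous_on UNIV (\<lambda>u. a * h j u + b * h' j u)"
        using h by (auto intro!: continuous_intros)
      then show ?thesis unfolding h(1,2) lin[OF h(3,4)] V_def by blast
    qed
    show "AE t in lborel. r t = 0"
      if rs: "square_integrable lborel r" and r0: "\<And>t. t \<notin> {0..T} \<Longrightarrow> r t = 0"
        and ro: "\<And>v. v \<in> V \<Longrightarrow> (\<integral>t. r t \<bullet> v t \<partial>lborel) = 0" for r
    proof -
      have rm[measurable]: "r \<in> borel_measurable borel" using rs by (simp add: square_integrable_def)
      have rc: "causal T (\<lambda>t. r t $ i)" for i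
        unfolding causal_def
      proof
        show "integrable lborel (\<lambda>t. r t $ i)"
        proof (rule Bochner_Integration.integrable_bound)
          show "integrable lborel (\<lambda>t. (norm (r t))\<^sup>2 + indicator {0..T} t :: real)"
            using rs by (intro Bochner_Integration.integrable_add integrable_indicator_Icc)
              (simp add: square_integrable_def)
          show "AE t in lborel. norm (r t $ i) \<le> norm ((norm (r t))\<^sup>2 + indicator {0..T} t :: real)"
          proof (intro AE_I2)
            fix t
            show "norm (r t $ i) \<le> norm ((norm (r t))\<^sup>2 + indicator {0..T} t :: real)"
            proof (cases "t \<in> {0..T}")
              case True
              have "2 * norm (r t) \<le> (norm (r t))\<^sup>2 + 1" by (rule sum_squares_bound[of "norm (r t)" 1, simplified])
              then show ?thesis using component_le_norm_cart[of "r t" i] norm_ge_zero[of "r t"] True by simp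
            qed (simp add: r0)
          qed
          show "(\<lambda>t. r t $ i) \<in> borel_measurable lborel" using borel_measurable_vec_nth[OF rm, of i] by simp
        qed
        show "\<forall>t. r t $ i \<noteq> 0 \<longrightarrow> 0 \<le> t \<and> t \<le> T" using r0 by force
      qed
      have orth: "(\<Sum>i\<in>UNIV. \<integral>t. r t $ i * convolve (?\<phi> i j) (?I h) t \<partial>lborel) = 0"
        if h: "continuous_on UNIV h" for h j
      proof -
        \<comment> \<open>Switching off all components but \<open>j\<close> isolates one column of
          \<open>\<phi>\<close>, which is the form of orthogonality required.\<close>
        let ?h = "\<lambda>j'. if j' = j then h else (\<lambda>u. 0)"
        have "\<forall>j. continuous_on UNIV (?h j)" using h by auto
        then have "R ?h \<in> V" unfolding V_def by blast
        then have 0: "(\<integral>t. r t \<bullet> R ?h t \<partial>lborel) = 0" by (rule ro)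
        obtain B where B: "\<And>u. \<bar>?I h u\<bar> \<le> B" using continuous_bounded_indicator[OF h, of T] by blast
        have z: "convolve p (?I (?h j')) t = (if j' = j then convolve p (?I h) t else 0)" for p j' t
          by (simp add: convolve_def)
        have ii: "integrable lborel (\<lambda>t. r t $ i * convolve (?\<phi> i j) (?I h) t)" for i
        proof (rule Bochner_Integration.integrable_bound)
          have [measurable]: "?I h \<in> borel_measurable borel" by (rule Im[OF h])
          show "integrable lborel (\<lambda>t. (B * (\<integral>u. \<bar>?\<phi> i j u\<bar> \<partial>lborel)) * r t $ i)" using causalD(1)[OF rc] by simp
          show "AE t in lborel. norm (r t $ i * convolve (?\<phi> i j) (?I h) t) \<le> norm ((B * (\<integral>u. \<bar>?\<phi> i j u\<bar> \<partial>lborel)) * r t $ i)"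
          proof (intro AE_I2)
            fix t
            have "\<bar>convolve (?\<phi> i j) (?I h) t\<bar> * \<bar>r t $ i\<bar> \<le> \<bar>B * (\<integral>u. \<bar>?\<phi> i j u\<bar> \<partial>lborel)\<bar> * \<bar>r t $ i\<bar>"
              using abs_convolve_le[OF \<phi>i Im[OF h] B, of i j t] by (intro mult_right_mono) auto
            then show "norm (r t $ i * convolve (?\<phi> i j) (?I h) t) \<le> norm ((B * (\<integral>u. \<bar>?\<phi> i j u\<bar> \<partial>lborel)) * r t $ i)"
              by (simp add: abs_mult mult.commute)
          qed
          show "(\<lambda>t. r t $ i * convolve (?\<phi> i j) (?I h) t) \<in> borel_measurable lborel"
            using borel_measurable_vec_nth[OF rm, of i] by measurable
        qed
        have "(\<Sum>i\<in>UNIV. \<integral>t. r t $ i * convolve (?\<phi> i j) (?I h) t \<partial>lborel) =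
            (\<integral>t. (\<Sum>i\<in>UNIV. r t $ i * convolve (?\<phi> i j) (?I h) t) \<partial>lborel)"
          by (rule Bochner_Integration.integral_sum[symmetric]) (rule ii)
        also have "\<dots> = (\<integral>t. r t \<bullet> R ?h t \<partial>lborel)"
        proof (intro Bochner_Integration.integral_cong refl)
          fix t
          show "(\<Sum>i\<in>UNIV. r t $ i * convolve (?\<phi> i j) (?I h) t) = r t \<bullet> R ?h t"
          proof (cases "t \<in> {0..T}")
            case True
            then show ?thesis unfolding R_def inner_vec_def by (simp add: z)
          qed (simp add: r0)
        qed
        finally show ?thesis using 0 by simp
      qed
      have "AE t in lborel. r t $ m = 0" for m
        by (rule orthogonal_convolution_range_zero[OF T \<phi> rc orth nz, of m])
      then have "AE t in lborel. \<forall>m. r t $ m = 0" by (subst AE_all_countable) auto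
      then show ?thesis by eventually_elim (simp add: vec_eq_iff)
    qed
  qed (use f \<epsilon> in auto)
  then obtain h where "\<forall>j. continuous_on UNIV (h j)" "(\<integral>t. (norm (f t - R h t))\<^sup>2 \<partial>lborel) < \<epsilon>"
    by (auto simp: V_def)
  then show ?thesis using Vsq[of h] unfolding R_def by blast
qed


lemma convolve_indicator_eq:
  fixes g :: "real \<Rightarrow> real"
  assumes "\<And>u. u < 0 \<Longrightarrow> g u = 0" and "t \<le> T"
  shows "convolve g (indicator {0..T}) t = (\<integral>s. indicator {0..t} s * g s \<partial>lborel)"
  unfolding convolve_commute[of g] unfolding convolve_def
proof (intro Bochner_Integration.integral_cong refl)
  fix s
  show "indicator {0..T} (t - s) * g s = indicator {0..t} s * g s"
    using assms(1)[of s] assms(2) by (cases "s < 0") (auto simp: indicator_def)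
qed

lemma integral_indicator_lipschitz:
  fixes g :: "real \<Rightarrow> real"
  assumes g: "integrable lborel g" and B: "\<And>u. \<bar>g u\<bar> \<le> B" and ab: "0 \<le> a" "a \<le> b"
  shows "\<bar>(\<integral>s. indicator {0..b} s * g s \<partial>lborel) - (\<integral>s. indicator {0..a} s * g s \<partial>lborel)\<bar> \<le> B * (b - a)"
proof -
  have B0: "B \<ge> 0" using B[of 0] by simp
  have i: "integrable lborel (\<lambda>s. indicator {0..b} s * g s)" "integrable lborel (\<lambda>s. indicator {0..a} s * g s)"
    by (rule integrable_indicator_mult[OF g], simp)+
  have "(\<integral>s. indicator {0..b} s * g s \<partial>lborel) - (\<integral>s. indicator {0..a} s * g s \<partial>lborel) =
      (\<integral>s. indicator {0..b} s * g s - indicator {0..a} s * g s \<partial>lborel)"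
    using i by simp
  also have "\<bar>\<dots>\<bar> \<le> (\<integral>s. \<bar>indicator {0..b} s * g s - indicator {0..a} s * g s\<bar> \<partial>lborel)"
    by (rule integral_abs_bound)
  also have "\<dots> \<le> (\<integral>s. indicator {a..b} s * B \<partial>lborel)"
  proof (rule integral_mono)
    show "integrable lborel (\<lambda>s. indicator {a..b} s * B)"
      by (intro integrable_mult_left integrable_indicator_Icc)
    show "\<bar>indicator {0..b} s * g s - indicator {0..a} s * g s\<bar> \<le> indicator {a..b} s * B" for s
      using ab B[of s] B0 by (auto simp: indicator_def)
  qed (use i in simp)
  also have "\<dots> = B * (b - a)" using ab by simp
  finally show ?thesis .
qed

text \<open>With \<open>1\<close> the indicator of \<open>{0..T}\<close>, uniform density follows from density in \<open>L\<^sup>2\<close> since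
  \<open>1 * (\<phi> * h) = \<phi> * (1 * h)\<close>; the Lipschitz function \<open>1 * h\<close> is then replaced by a step function.\<close>

theorem uniform_dense_convolution_range:
  fixes \<phi> :: "real \<Rightarrow> real^'n::{finite,linorder}^'n::{finite,linorder}" and f :: "real \<Rightarrow> real^'n::{finite,linorder}"
  assumes T: "T > 0" and \<phi>: "\<And>i j. causal T (\<lambda>t. \<phi> t $ i $ j)"
    and nz: "\<And>\<delta>. \<delta> > 0 \<Longrightarrow> \<not> vanish_before \<delta> (conv_det \<phi>)"
    and f: "continuous_on {0..T} f" "f 0 = 0" and \<epsilon>: "\<epsilon> > 0"
  shows "\<exists>(n::nat) x. n > 0 \<and> (\<forall>t\<in>{0..T}. norm (f t - (\<chi> i. \<Sum>j\<in>UNIV. convolve (\<lambda>t. \<phi> t $ i $ j)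
     (\<lambda>u. \<Sum>k<n. indicator {real k * T / n<..real (Suc k) * T / n} u * x k $ j) t)) < \<epsilon>)"
proof -
  let ?\<phi> = "\<lambda>i j t. \<phi> t $ i $ j"
  let ?one = "indicator {0..T} :: real \<Rightarrow> real"
  note \<phi>i = causalD(1)[OF \<phi>]
  have one: "integrable lborel ?one" by (rule integrable_indicator_Icc)
  \<comment> \<open>A polynomial in place of \<open>f\<close> has a derivative. It is this
    derivative that gets approximated in L^2; integration from \<open>0\<close> then leads back to
    uniform estimates.\<close>
  obtain p where p: "polynomial_function p" "\<And>t. t \<in> {0..T} \<Longrightarrow> norm (f t - p t) < \<epsilon> / 8"
    using Stone_Weierstrass_polynomial_function[OF _ f(1), of "\<epsilon>/8"] \<epsilon> by auto
  obtain p' where p': "polynomial_function p'" "\<And>t. (p has_vector_derivative p' t) (at t)"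
    using has_vector_derivative_polynomial_function[OF p(1)] by blast
  have p'c: "continuous_on A p'" for A by (rule continuous_on_polymonial_function[OF p'(1)])
  define g where "g = (\<lambda>t. indicator {0..T} t *\<^sub>R p' t)"
  have "bounded (p' ` {0..T})"
    by (intro compact_imp_bounded compact_continuous_image p'c) auto
  then obtain G where G: "\<And>t. t \<in> {0..T} \<Longrightarrow> norm (p' t) \<le> G" unfolding bounded_iff by force
  have p'm[measurable]: "p' \<in> borel_measurable borel" by (rule borel_measurable_continuous_onI[OF p'c])
  have gsq: "square_integrable lborel g"
  proof (rule square_integrable_bound[where g="\<lambda>t. indicator {0..T} t * G\<^sup>2"])
    show "integrable lborel (\<lambda>t. indicator {0..T} t * G\<^sup>2)" by (intro integrable_mult_left one)
    show "g \<in> borel_measurable lborel" unfolding g_def by measurable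
    show "AE t in lborel. (norm (g t))\<^sup>2 \<le> indicator {0..T} t * G\<^sup>2"
      using G by (intro AE_I2) (auto simp: g_def indicator_def intro!: power_mono)
  qed
  \<comment> \<open>By Young's inequality the L^1 error is at most
    \<open>K * \<eta> + T / K\<close>; with this choice both terms equal
    \<open>\<epsilon> / 8\<close>.\<close>
  define K where "K = 8 * T / \<epsilon>"
  have K: "K > 0" using T \<epsilon> by (simp add: K_def)
  define \<eta> where "\<eta> = \<epsilon> / (8 * K)"
  have \<eta>: "\<eta> > 0" using K \<epsilon> by (simp add: \<eta>_def)
  obtain h v where h: "\<And>j. continuous_on UNIV (h j)" and v: "square_integrable lborel v"
    and v_def: "v = (\<lambda>t. indicator {0..T} t *\<^sub>R (\<chi> i. \<Sum>j\<in>UNIV. convolve (?\<phi> i j) (\<lambda>u. indicator {0..T} u * h j u) t))"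
    and vlt: "(\<integral>t. (norm (g t - v t))\<^sup>2 \<partial>lborel) < \<eta>"
    using L2_dense_convolution_range[OF T \<phi> nz gsq _ \<eta>] by (auto simp: g_def)
  define H where "H = (\<lambda>j u. indicator {0..T} u * h j u)"
  obtain B where B: "\<And>j. B j \<ge> 0" "\<And>j u. \<bar>H j u\<bar> \<le> B j"
    using continuous_bounded_indicator[OF h, of T] unfolding H_def by metis
  have Hm[measurable]: "H j \<in> borel_measurable borel" for j
  proof -
    have [measurable]: "h j \<in> borel_measurable borel" by (rule borel_measurable_continuous_onI[OF h])
    show ?thesis unfolding H_def by measurable
  qed
  have Hneg: "H j u = 0" if "u < 0" for j u using that by (simp add: H_def)
  have Hi: "integrable lborel (H j)" for j
  proof (rule Bochner_Integration.integrable_bound)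
    show "integrable lborel (\<lambda>u. ?one u * B j)" by (intro integrable_mult_left one)
    show "AE u in lborel. norm (H j u) \<le> norm (?one u * B j)"
    proof (intro AE_I2)
      fix u
      show "norm (H j u) \<le> norm (?one u * B j)"
        using B(2)[of j u] B(1)[of j] by (cases "u \<in> {0..T}") (auto simp: H_def)
    qed
  qed measurable
  have Hc: "causal T (H j)" for j
  proof -
    have "0 \<le> u \<and> u \<le> T" if "H j u \<noteq> 0" for u
      using that by (cases "u \<in> {0..T}") (auto simp: H_def)
    then show ?thesis using Hi by (simp add: causal_def)
  qed
  have vH: "v = (\<lambda>t. indicator {0..T} t *\<^sub>R (\<chi> i. \<Sum>j\<in>UNIV. convolve (?\<phi> i j) (H j) t))"
    unfolding v_def H_def ..
  \<comment> \<open>The running integral of \<open>H j\<close>: Lipschitz on \<open>[0, T]\<close>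
    with constant \<open>B j\<close>, hence suitable for sampling on a grid.\<close>
  define W where "W = (\<lambda>j. convolve (H j) ?one)"
  have W: "W j t = (\<integral>s. indicator {0..t} s * H j s \<partial>lborel)" if "t \<le> T" for j t
    unfolding W_def by (rule convolve_indicator_eq[OF Hneg that])
  have Wneg: "W j t = 0" if "t \<le> 0" for j t
  proof -
    have "W j t = (\<integral>s. indicator {0..t} s * H j s \<partial>lborel)" using W that T by simp
    also have "\<dots> = (\<integral>s. 0 \<partial>(lborel::real measure))"
      by (rule integral_cong_AE) (use AE_lborel_singleton[of 0] that in \<open>auto simp: indicator_def elim!: eventually_mono\<close>)
    finally show ?thesis by simp
  qed
  have Wlip: "\<bar>W j b - W j a\<bar> \<le> B j * (b - a)" if "0 \<le> a" "a \<le> b" "b \<le> T" for a b j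
    using integral_indicator_lipschitz[OF Hi B(2) that(1,2), of j] W[of a j] W[of b j] that by simp
  have Wm[measurable]: "W j \<in> borel_measurable borel" for j unfolding W_def by measurable
  have step1: "norm (f t - (\<chi> i. \<Sum>j\<in>UNIV. convolve (?\<phi> i j) (W j) t)) < \<epsilon> / 2" if t: "t \<in> {0..T}" for t
  proof -
    have gi: "integrable lborel (\<lambda>s. indicator {0..t} s *\<^sub>R g s)" "integrable lborel (\<lambda>s. indicator {0..t} s *\<^sub>R v s)"
    proof -
      have *: "integrable lborel (\<lambda>s. indicator {0..t} s *\<^sub>R w s)" if w: "square_integrable lborel w" for w :: "real \<Rightarrow> real^'n::{finite,linorder}"
      proof (rule Bochner_Integration.integrable_bound)
        show "integrable lborel (\<lambda>s. (norm (w s))\<^sup>2 + indicator {0..t} s :: real)"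
          using w by (intro Bochner_Integration.integrable_add integrable_indicator_Icc) (simp add: square_integrable_def)
        have [measurable]: "w \<in> borel_measurable borel" using w by (simp add: square_integrable_def)
        show "(\<lambda>s. indicator {0..t} s *\<^sub>R w s) \<in> borel_measurable lborel" by measurable
        show "AE s in lborel. norm (indicator {0..t} s *\<^sub>R w s) \<le> norm ((norm (w s))\<^sup>2 + indicator {0..t} s :: real)"
        proof (intro AE_I2)
          fix s
          have "2 * norm (w s) \<le> (norm (w s))\<^sup>2 + 1" by (rule sum_squares_bound[of "norm (w s)" 1, simplified])
          then have "norm (w s) \<le> (norm (w s))\<^sup>2 + 1" using norm_ge_zero[of "w s"] by linarith
          then show "norm (indicator {0..t} s *\<^sub>R w s) \<le> norm ((norm (w s))\<^sup>2 + indicator {0..t} s :: real)"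
            by (cases "s \<in> {0..t}") auto
        qed
      qed
      show "integrable lborel (\<lambda>s. indicator {0..t} s *\<^sub>R g s)" "integrable lborel (\<lambda>s. indicator {0..t} s *\<^sub>R v s)"
        by (rule *[OF gsq], rule *[OF v])
    qed
    have 1: "(\<integral>s. indicator {0..t} s *\<^sub>R g s \<partial>lborel) = p t - p 0"
    proof -
      have "(\<integral>s. indicator {0..t} s *\<^sub>R g s \<partial>lborel) = (\<integral>s. indicator {0..t} s *\<^sub>R p' s \<partial>lborel)"
        using t by (intro Bochner_Integration.integral_cong) (auto simp: g_def indicator_def)
      also have "\<dots> = p t - p 0"
        by (rule integral_FTC_atLeastAtMost) (use t p'(2) p'c in \<open>auto intro: has_vector_derivative_at_within\<close>)
      finally show ?thesis .
    qed
    have 2: "(\<integral>s. indicator {0..t} s *\<^sub>R v s \<partial>lborel) = (\<chi> i. \<Sum>j\<in>UNIV. convolve (?\<phi> i j) (W j) t)"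
    proof (rule vec_eq_iff[THEN iffD2], intro allI)
      fix i
      have ci: "causal (T + T) (convolve (?\<phi> i j) (H j))" for j
        by (rule causal_convolve[OF \<phi> Hc])
      have "(\<integral>s. indicator {0..t} s *\<^sub>R v s \<partial>lborel) $ i = (\<integral>s. (indicator {0..t} s *\<^sub>R v s) $ i \<partial>lborel)"
        using integral_bounded_linear[OF bounded_linear_vec_nth gi(2), of i] by simp
      also have "\<dots> = (\<integral>s. (\<Sum>j\<in>UNIV. indicator {0..t} s * convolve (?\<phi> i j) (H j) s) \<partial>lborel)"
        using t by (intro Bochner_Integration.integral_cong refl)
          (auto simp: vH indicator_def sum_distrib_left)
      also have "\<dots> = (\<Sum>j\<in>UNIV. \<integral>s. indicator {0..t} s * convolve (?\<phi> i j) (H j) s \<partial>lborel)"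
        by (rule Bochner_Integration.integral_sum) (rule integrable_indicator_mult[OF causalD(1)[OF ci]], simp)
      also have "\<dots> = (\<Sum>j\<in>UNIV. convolve (?\<phi> i j) (W j) t)"
      proof (rule sum.cong[OF refl])
        fix j
        have "(\<integral>s. indicator {0..t} s * convolve (?\<phi> i j) (H j) s \<partial>lborel) = convolve (convolve (?\<phi> i j) (H j)) ?one t"
          by (rule convolve_indicator_eq[OF causalD(2)[OF ci], symmetric]) (use t in auto)
        then show "(\<integral>s. indicator {0..t} s * convolve (?\<phi> i j) (H j) s \<partial>lborel) = convolve (?\<phi> i j) (W j) t"
          unfolding W_def using convolve_assoc_bounded[OF \<phi>i[of i j] one Hm B(2)] by simp
      qed
      finally show "(\<integral>s. indicator {0..t} s *\<^sub>R v s \<partial>lborel) $ i = (\<chi> i. \<Sum>j\<in>UNIV. convolve (?\<phi> i j) (W j) t) $ i" by simp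
    qed
    have sgv: "square_integrable lborel (\<lambda>s. g s - v s)" by (rule square_integrable_diff[OF gsq v])
    have "norm ((p t - p 0) - (\<chi> i. \<Sum>j\<in>UNIV. convolve (?\<phi> i j) (W j) t)) =
        norm (\<integral>s. indicator {0..t} s *\<^sub>R g s - indicator {0..t} s *\<^sub>R v s \<partial>lborel)"
      unfolding 1[symmetric] 2[symmetric] using gi by simp
    also have "\<dots> \<le> (\<integral>s. norm (indicator {0..t} s *\<^sub>R g s - indicator {0..t} s *\<^sub>R v s) \<partial>lborel)"
      by (rule integral_norm_bound)
    also have "\<dots> \<le> (\<integral>s. K * (norm (g s - v s))\<^sup>2 + (1 / K) * indicator {0..T} s \<partial>lborel)"
    proof (rule integral_mono)
      show "integrable lborel (\<lambda>s. norm (indicator {0..t} s *\<^sub>R g s - indicator {0..t} s *\<^sub>R v s))" using gi by simp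
      show "integrable lborel (\<lambda>s. K * (norm (g s - v s))\<^sup>2 + (1 / K) * indicator {0..T} s)"
        using sgv one by (simp add: square_integrable_def)
      fix s
      have "2 * norm (g s - v s) \<le> K * (norm (g s - v s))\<^sup>2 + 1 / K"
        using two_abs_inner_le[OF K, of "norm (g s - v s)" "1::real"] by simp
      then have "norm (g s - v s) \<le> K * (norm (g s - v s))\<^sup>2 + 1 / K" using norm_ge_zero[of "g s - v s"] by linarith
      then show "norm (indicator {0..t} s *\<^sub>R g s - indicator {0..t} s *\<^sub>R v s) \<le> K * (norm (g s - v s))\<^sup>2 + (1 / K) * indicator {0..T} s"
        using t K by (auto simp: indicator_def)
    qed
    also have "\<dots> = K * (\<integral>s. (norm (g s - v s))\<^sup>2 \<partial>lborel) + (1 / K) * T"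
      using sgv one T by (simp add: square_integrable_def)
    also have "\<dots> < K * \<eta> + (1 / K) * T" using vlt K by simp
    also have "K * \<eta> + (1 / K) * T = \<epsilon> / 4"
      using T \<epsilon> K by (simp add: \<eta>_def K_def field_simps)
    finally have a: "norm ((p t - p 0) - (\<chi> i. \<Sum>j\<in>UNIV. convolve (?\<phi> i j) (W j) t)) < \<epsilon> / 4" by simp
    have b: "norm (f t - p t) < \<epsilon> / 8" "norm (f 0 - p 0) < \<epsilon> / 8" using p(2) t T by auto
    let ?X = "\<chi> i. \<Sum>j\<in>UNIV. convolve (?\<phi> i j) (W j) t"
    have "f t - ?X = (f t - p t) - (f 0 - p 0) + ((p t - p 0) - ?X)" by (simp add: f(2))
    also have "norm \<dots> \<le> norm (f t - p t) + norm (f 0 - p 0) + norm ((p t - p 0) - ?X)"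
      by (meson add_mono norm_triangle_ineq norm_triangle_ineq4 order_trans order_refl)
    finally show ?thesis using a b by simp
  qed
  define C where "C = (\<Sum>i\<in>UNIV. \<Sum>j\<in>UNIV. B j * T * (\<integral>u. \<bar>?\<phi> i j u\<bar> \<partial>lborel))"
  have C0: "C \<ge> 0" unfolding C_def using B(1) T by (intro sum_nonneg mult_nonneg_nonneg) auto
  obtain n :: nat where n: "real n > 2 * C / \<epsilon>" using reals_Archimedean2 by blast
  have n0: "n > 0" using n C0 \<epsilon> by (metis divide_nonneg_pos gr0I less_le_not_le mult_nonneg_nonneg of_nat_0 zero_le_numeral)
  \<comment> \<open>Samples at the left end points of the cells. The cells are left-open because an
    increment \<open>L u - L v\<close> belongs to \<open>{v<..u}\<close>.\<close>
  define x where "x = (\<lambda>k. (\<chi> j. W j (real k * T / n)) :: real^'n::{finite,linorder})"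
  define w where "w = (\<lambda>j u. \<Sum>k<n. indicator {real k * T / n<..real (Suc k) * T / n} u * x k $ j)"
  have w0: "w j u = 0" if "u \<le> 0" for j u
    unfolding w_def
  proof (rule sum.neutral, rule ballI)
    fix k
    have "0 \<le> real k * T / n" using T by simp
    then have "u \<notin> {real k * T / n<..real (Suc k) * T / n}" using that by auto
    then show "indicator {real k * T / n<..real (Suc k) * T / n} u * x k $ j = 0" by simp
  qed
  have w1: "\<bar>W j u - w j u\<bar> \<le> B j * (T / n)" if u: "0 < u" "u \<le> T" for j u
  proof -
    define y where "y = u * n / T"
    have y: "0 < y" "y \<le> n" using u T n0 by (auto simp: y_def field_simps)
    \<comment> \<open>The cells are closed on the right, so a grid point belongs to the cell on its
      left: hence the ceiling minus one and not the floor.\<close>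
    define k where "k = nat (\<lceil>y\<rceil> - 1)"
    have ky: "real k < y" "y \<le> real (Suc k)" using y(1) unfolding k_def by linarith+
    have kn: "k < n" using ky(1) y(2) by linarith
    have mem: "u \<in> {real k' * T / n<..real (Suc k') * T / n} \<longleftrightarrow> real k' < y \<and> y \<le> real (Suc k')" for k'
      using T n0 by (auto simp: y_def field_simps)
    have uniq: "real k' < y \<and> y \<le> real (Suc k') \<longleftrightarrow> k' = k" for k'
      using ky by auto
    have "w j u = (\<Sum>k'<n. if k' = k then x k' $ j else 0)"
      unfolding w_def by (intro sum.cong refl) (simp only: indicator_def mem uniq, simp)
    also have "\<dots> = W j (real k * T / n)" using kn by (simp add: x_def)
    finally have "\<bar>W j u - w j u\<bar> = \<bar>W j u - W j (real k * T / n)\<bar>" by simp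
    also have "\<dots> \<le> B j * (u - real k * T / n)"
      by (rule Wlip) (use u T mem[of k] ky in auto)
    also have "\<dots> \<le> B j * (T / n)"
    proof (rule mult_left_mono[OF _ B(1)])
      have "real (Suc k) * T / n = real k * T / n + T / n" by (simp add: algebra_simps add_divide_distrib)
      moreover have "u \<le> real (Suc k) * T / n" using mem[of k] ky by auto
      ultimately show "u - real k * T / n \<le> T / n" by linarith
    qed
    finally show ?thesis .
  qed
  have step2: "\<bar>convolve (?\<phi> i j) (W j) t - convolve (?\<phi> i j) (w j) t\<bar> \<le> B j * (T / n) * (\<integral>u. \<bar>?\<phi> i j u\<bar> \<partial>lborel)"
    if t: "t \<in> {0..T}" for i j t
  proof -
    \<comment> \<open>Restriction to \<open>{0<..T}\<close> is harmless inside the convolution: to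
      the left both \<open>W j\<close> and \<open>w j\<close> are zero, to the right the kernel at
      \<open>t - u\<close> is.\<close>
    define d where "d = (\<lambda>u. indicator {0<..T} u * (W j u - w j u))"
    have wm[measurable]: "w j \<in> borel_measurable borel" unfolding w_def by measurable
    have dm: "d \<in> borel_measurable borel" unfolding d_def by measurable
    have db: "\<bar>d u\<bar> \<le> B j * (T / n)" for u
      using w1[of u j] B(1)[of j] T by (cases "u \<in> {0<..T}") (auto simp: d_def)
    have Wb: "\<bar>W j u\<bar> \<le> B j * (\<integral>u. \<bar>?one u\<bar> \<partial>lborel)" for u
      unfolding W_def convolve_commute[of "H j"] by (rule abs_convolve_le[OF one Hm B(2)])
    have wb: "\<bar>w j u\<bar> \<le> (\<Sum>k<n. \<bar>x k $ j\<bar>)" for u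
      unfolding w_def by (rule order_trans[OF sum_abs]) (intro sum_mono, auto simp: indicator_def)
    have "convolve (?\<phi> i j) (W j) t - convolve (?\<phi> i j) (w j) t = (\<integral>u. ?\<phi> i j (t - u) * W j u - ?\<phi> i j (t - u) * w j u \<partial>lborel)"
      unfolding convolve_def
      by (rule Bochner_Integration.integral_diff[symmetric]) (rule integrable_convolve_bounded[OF \<phi>i Wm Wb] integrable_convolve_bounded[OF \<phi>i wm wb])+
    also have "\<dots> = convolve (?\<phi> i j) d t"
      unfolding convolve_def
    proof (intro Bochner_Integration.integral_cong refl)
      fix u
      show "?\<phi> i j (t - u) * W j u - ?\<phi> i j (t - u) * w j u = ?\<phi> i j (t - u) * d u"
        using Wneg[of u j] w0[of u j] causalD(2)[OF \<phi>, of "t - u" i j] t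
        by (cases "u \<le> 0"; cases "u \<le> T") (auto simp: d_def algebra_simps)
    qed
    finally show ?thesis using abs_convolve_le[OF \<phi>i dm db, of i j t] by simp
  qed
  have "norm (f t - (\<chi> i. \<Sum>j\<in>UNIV. convolve (?\<phi> i j) (w j) t)) < \<epsilon>" if t: "t \<in> {0..T}" for t
  proof -
    let ?X = "\<chi> i. \<Sum>j\<in>UNIV. convolve (?\<phi> i j) (W j) t" and ?x = "\<chi> i. \<Sum>j\<in>UNIV. convolve (?\<phi> i j) (w j) t"
    have "norm (?X - ?x) \<le> (\<Sum>i\<in>UNIV. \<bar>(?X - ?x) $ i\<bar>)" by (rule norm_le_l1_cart)
    also have "\<dots> = (\<Sum>i\<in>UNIV. \<bar>\<Sum>j\<in>UNIV. convolve (?\<phi> i j) (W j) t - convolve (?\<phi> i j) (w j) t\<bar>)"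
      by (simp add: sum_subtractf)
    also have "\<dots> \<le> (\<Sum>i\<in>UNIV. \<Sum>j\<in>UNIV. B j * (T / n) * (\<integral>u. \<bar>?\<phi> i j u\<bar> \<partial>lborel))"
      by (intro sum_mono order_trans[OF sum_abs] step2[OF t])
    also have "\<dots> = C / n" by (simp add: C_def sum_divide_distrib)
    also have "\<dots> < \<epsilon> / 2" using n n0 \<epsilon> by (simp add: field_simps)
    finally have "norm (?X - ?x) < \<epsilon> / 2" .
    then show ?thesis using step1[OF t] norm_triangle_ineq[of "f t - ?X" "?X - ?x"] by simp
  qed
  then show ?thesis using n0 unfolding w_def by blast
qed

subsection \<open>Characteristic functions and independence\<close>

text \<open>Normalised to a probability law, so that the one-dimensional uniqueness theorem for
  characteristic functions applies to weighted measures.\<close>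

definition weighted_law :: "'a measure \<Rightarrow> ('a \<Rightarrow> real) \<Rightarrow> ('a \<Rightarrow> real) \<Rightarrow> real measure" where
  "weighted_law M w X = distr (density M (\<lambda>x. ennreal (w x / (\<integral>x. w x \<partial>M)))) borel X"

lemma integral_weighted_law:
  fixes F :: "real \<Rightarrow> 'd::{banach, second_countable_topology}"
  assumes [measurable]: "X \<in> borel_measurable M" "w \<in> borel_measurable M" "F \<in> borel_measurable borel"
    and w: "\<And>x. w x \<ge> 0"
  shows "integral\<^sup>L (weighted_law M w X) F = (1 / (\<integral>x. w x \<partial>M)) *\<^sub>R (\<integral>x. w x *\<^sub>R F (X x) \<partial>M)"
proof -
  let ?c = "\<integral>x. w x \<partial>M"
  have "integral\<^sup>L (weighted_law M w X) F = integral\<^sup>L (density M (\<lambda>x. ennreal (w x / ?c))) (\<lambda>x. F (X x))"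
    unfolding weighted_law_def by (rule integral_distr) measurable
  also have "\<dots> = (\<integral>x. (w x / ?c) *\<^sub>R F (X x) \<partial>M)"
    by (rule integral_density) (use w in auto)
  also have "\<dots> = (\<integral>x. (1 / ?c) *\<^sub>R (w x *\<^sub>R F (X x)) \<partial>M)" by simp
  finally show ?thesis by (simp only: integral_scaleR_right)
qed

lemma real_distribution_weighted_law:
  assumes [measurable]: "X \<in> borel_measurable M"
    and w: "integrable M w" "\<And>x. w x \<ge> 0" "(\<integral>x. w x \<partial>M) > 0"
  shows "real_distribution (weighted_law M w X)"
proof -
  let ?c = "\<integral>x. w x \<partial>M"
  have [measurable]: "w \<in> borel_measurable M" using w by auto
  have "emeasure (density M (\<lambda>x. ennreal (w x / ?c))) (space M) = (\<integral>\<^sup>+x. ennreal (w x / ?c) \<partial>M)"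
    by (subst emeasure_density) (auto intro!: nn_integral_cong)
  also have "\<dots> = ennreal (\<integral>x. w x / ?c \<partial>M)"
    by (rule nn_integral_eq_integral) (use w in auto)
  also have "\<dots> = 1" using w by simp
  finally have "prob_space (density M (\<lambda>x. ennreal (w x / ?c)))" by (intro prob_spaceI) simp
  then have "prob_space (weighted_law M w X)" unfolding weighted_law_def by (rule prob_space.prob_space_distr) measurable
  then show ?thesis unfolding real_distribution_def real_distribution_axioms_def by (simp add: weighted_law_def)
qed

text \<open>The choice \<open>\<theta> = 0\<close> shows that both weights have the same total mass,
  so the normalising constants agree. If that mass is zero, both sides vanish.\<close>

lemma weighted_char_unique:
  fixes X1 :: "'a \<Rightarrow> real" and X2 :: "'b \<Rightarrow> real"
  assumes [measurable]: "X1 \<in> borel_measurable M1" "X2 \<in> borel_measurable M2"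
    and w1: "integrable M1 w1" "\<And>x. w1 x \<ge> 0" and w2: "integrable M2 w2" "\<And>x. w2 x \<ge> 0"
    and eq: "\<And>\<theta>. (CLINT x|M1. w1 x *\<^sub>R iexp (\<theta> * X1 x)) = (CLINT x|M2. w2 x *\<^sub>R iexp (\<theta> * X2 x))"
    and A: "A \<in> sets borel"
  shows "(\<integral>x. w1 x * indicator A (X1 x) \<partial>M1) = (\<integral>x. w2 x * indicator A (X2 x) \<partial>M2)"
proof -
  have [measurable]: "w1 \<in> borel_measurable M1" "w2 \<in> borel_measurable M2" using w1 w2 by auto
  define c where "c = (\<integral>x. w1 x \<partial>M1)"
  have c2: "(\<integral>x. w2 x \<partial>M2) = c"
  proof -
    have "complex_of_real (\<integral>x. w1 x \<partial>M1) = complex_of_real (\<integral>x. w2 x \<partial>M2)"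
      using eq[of 0] by (simp add: scaleR_conv_of_real)
    then show ?thesis by (simp add: c_def)
  qed
  have c0: "c \<ge> 0" unfolding c_def using w1 by simp
  show ?thesis
  proof (cases "c = 0")
    case True
    then have "AE x in M1. w1 x = 0" "AE x in M2. w2 x = 0"
      using integral_nonneg_eq_0_iff_AE[of M1 w1] integral_nonneg_eq_0_iff_AE[of M2 w2] w1 w2 c2 by (auto simp: c_def)
    then have "AE x in M1. w1 x * indicator A (X1 x) = 0" "AE x in M2. w2 x * indicator A (X2 x) = 0" by auto
    then show ?thesis
      using integral_eq_zero_AE[of "\<lambda>x. w1 x * indicator A (X1 x)" M1] integral_eq_zero_AE[of "\<lambda>x. w2 x * indicator A (X2 x)" M2] by simp
  next
    case False
    with c0 have c: "c > 0" by simp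
    have t1r: "integral\<^sup>L (weighted_law M1 w1 X1) (indicator A) = (1 / c) * (\<integral>x. w1 x * indicator A (X1 x) \<partial>M1)"
      and t2r: "integral\<^sup>L (weighted_law M2 w2 X2) (indicator A) = (1 / c) * (\<integral>x. w2 x * indicator A (X2 x) \<partial>M2)"
      using integral_weighted_law[OF assms(1) _ _ w1(2), where F="indicator A :: real \<Rightarrow> real"]
        integral_weighted_law[OF assms(2) _ _ w2(2), where F="indicator A :: real \<Rightarrow> real"] c2 A
      by (simp_all add: c_def)
    have rd1: "real_distribution (weighted_law M1 w1 X1)" by (rule real_distribution_weighted_law) (use w1 c in \<open>auto simp: c_def\<close>)
    have rd2: "real_distribution (weighted_law M2 w2 X2)" by (rule real_distribution_weighted_law) (use w2 c c2 in auto)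
    have "char (weighted_law M1 w1 X1) \<theta> = char (weighted_law M2 w2 X2) \<theta>" for \<theta>
    proof -
      have "char (weighted_law M1 w1 X1) \<theta> = (1 / (\<integral>x. w1 x \<partial>M1)) *\<^sub>R (CLINT x|M1. w1 x *\<^sub>R iexp (\<theta> * X1 x))"
        unfolding char_def by (rule integral_weighted_law) (use w1 in auto)
      also have "\<dots> = (1 / (\<integral>x. w2 x \<partial>M2)) *\<^sub>R (CLINT x|M2. w2 x *\<^sub>R iexp (\<theta> * X2 x))"
        by (simp only: eq c2 c_def)
      also have "\<dots> = char (weighted_law M2 w2 X2) \<theta>"
        unfolding char_def by (rule integral_weighted_law[symmetric]) (use w2 in auto)
      finally show ?thesis .
    qed
    then have "weighted_law M1 w1 X1 = weighted_law M2 w2 X2" by (intro Levy_uniqueness rd1 rd2) auto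
    then show ?thesis using c t1r t2r by simp
  qed
qed

lemma sum_insert_fun_upd:
  fixes X :: "'i \<Rightarrow> 'z \<Rightarrow> real"
  assumes "finite J" "j \<notin> J"
  shows "(\<Sum>i\<in>insert j J. ((\<lambda>i. s * a i)(j := \<theta>)) i * X i x) = \<theta> * X j x + s * (\<Sum>i\<in>J. a i * X i x)"
proof -
  have "(\<Sum>i\<in>insert j J. ((\<lambda>i. s * a i)(j := \<theta>)) i * X i x) = \<theta> * X j x + (\<Sum>i\<in>J. ((\<lambda>i. s * a i)(j := \<theta>)) i * X i x)"
    using assms by simp
  also have "(\<Sum>i\<in>J. ((\<lambda>i. s * a i)(j := \<theta>)) i * X i x) = (\<Sum>i\<in>J. s * (a i * X i x))"
    using assms by (intro sum.cong) auto
  finally show ?thesis by (simp add: sum_distrib_left)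
qed

text \<open>All exponents are put in the form \<open>t + s * c\<close> with \<open>s\<close> among
  \<open>0\<close>, \<open>1\<close> and \<open>-1\<close>, so that each term becomes a value of a
  joint characteristic function.\<close>

lemma one_plus_cos_iexp:
  "(1 + cos c) *\<^sub>R iexp t = iexp (t + 0 * c) + (1/2) *\<^sub>R iexp (t + 1 * c) + (1/2) *\<^sub>R iexp (t + (-1) * c)"
proof -
  define u where "u = iexp c"
  define v where "v = iexp (- c)"
  have c: "complex_of_real (cos c) = (u + v) / 2"
    by (simp add: cos_exp_eq u_def v_def flip: cos_of_real)
  have e: "iexp (t + 0 * c) = iexp t" "iexp (t + 1 * c) = iexp t * u" "iexp (t + (-1) * c) = iexp t * v"
    unfolding u_def v_def by (simp_all add: exp_add[symmetric] algebra_simps)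
  show ?thesis unfolding e by (simp add: scaleR_conv_of_real c field_simps)
qed

lemma one_plus_sin_iexp:
  "(1 + sin c) *\<^sub>R iexp t = iexp (t + 0 * c) - (\<i> / 2) * iexp (t + 1 * c) + (\<i> / 2) * iexp (t + (-1) * c)"
proof -
  define u where "u = iexp c"
  define v where "v = iexp (- c)"
  have c: "complex_of_real (sin c) = - (\<i> / 2) * (u - v)"
    by (simp add: sin_exp_eq u_def v_def flip: sin_of_real)
  have e: "iexp (t + 0 * c) = iexp t" "iexp (t + 1 * c) = iexp t * u" "iexp (t + (-1) * c) = iexp t * v"
    unfolding u_def v_def by (simp_all add: exp_add[symmetric] algebra_simps)
  show ?thesis unfolding e by (simp add: scaleR_conv_of_real c field_simps)
qed

text \<open>Coordinates are moved one at a time from the exponent into the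
  weight, using that \<open>1 + cos\<close> and \<open>1 + sin\<close> are nonnegative.\<close>

lemma multivariate_char_unique:
  fixes X1 :: "'i \<Rightarrow> 'a \<Rightarrow> real" and X2 :: "'i \<Rightarrow> 'b \<Rightarrow> real"
  assumes fm1: "finite_measure M1" and fm2: "finite_measure M2" and "finite J"
    and "\<And>i. i \<in> J \<Longrightarrow> X1 i \<in> borel_measurable M1" "\<And>i. i \<in> J \<Longrightarrow> X2 i \<in> borel_measurable M2"
    and "w1 \<in> borel_measurable M1" "\<And>x. 0 \<le> w1 x" "\<And>x. w1 x \<le> 1"
    and "w2 \<in> borel_measurable M2" "\<And>x. 0 \<le> w2 x" "\<And>x. w2 x \<le> 1"
    and "\<And>a. (CLINT x|M1. w1 x *\<^sub>R iexp (\<Sum>i\<in>J. a i * X1 i x)) = (CLINT x|M2. w2 x *\<^sub>R iexp (\<Sum>i\<in>J. a i * X2 i x))"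
    and "\<And>i. i \<in> J \<Longrightarrow> A i \<in> sets borel"
  shows "(\<integral>x. w1 x * (\<Prod>i\<in>J. indicator (A i) (X1 i x)) \<partial>M1) = (\<integral>x. w2 x * (\<Prod>i\<in>J. indicator (A i) (X2 i x)) \<partial>M2)"
  using assms(3-)
proof (induction J arbitrary: w1 w2 rule: finite_induct)
  case empty
  have "complex_of_real (\<integral>x. w1 x \<partial>M1) = complex_of_real (\<integral>x. w2 x \<partial>M2)"
    using empty(9) by (simp add: scaleR_conv_of_real)
  then show ?case by simp
next
  case (insert j J)
  interpret M1: finite_measure M1 by (rule fm1)
  interpret M2: finite_measure M2 by (rule fm2)
  have m1[measurable]: "X1 i \<in> borel_measurable M1" if "i \<in> insert j J" for i using insert.prems(1) that .
  have m2[measurable]: "X2 i \<in> borel_measurable M2" if "i \<in> insert j J" for i using insert.prems(2) that .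
  note [measurable] = insert.prems(3,6)
  have Aj[measurable]: "A j \<in> sets borel" using insert.prems(10) by simp
  note w = insert.prems(4,5,7,8)
  let ?w1 = "\<lambda>x. w1 x * indicator (A j) (X1 j x)" and ?w2 = "\<lambda>x. w2 x * indicator (A j) (X2 j x)"
  have xj[measurable]: "X1 j \<in> borel_measurable M1" "X2 j \<in> borel_measurable M2" using m1 m2 by auto
  have "(\<integral>x. ?w1 x * (\<Prod>i\<in>J. indicator (A i) (X1 i x)) \<partial>M1) = (\<integral>x. ?w2 x * (\<Prod>i\<in>J. indicator (A i) (X2 i x)) \<partial>M2)"
  proof (rule insert.IH)
    fix a :: "'i \<Rightarrow> real"
    define C1 where "C1 = (\<lambda>x. \<Sum>i\<in>J. a i * X1 i x)"
    define C2 where "C2 = (\<lambda>x. \<Sum>i\<in>J. a i * X2 i x)"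
    have C1m[measurable]: "C1 \<in> borel_measurable M1" unfolding C1_def using m1 by auto
    have C2m[measurable]: "C2 \<in> borel_measurable M2" unfolding C2_def using m2 by auto
    \<comment> \<open>Scaling the whole remaining linear form by \<open>s\<close> is what provides
      the multiples \<open>0\<close>, \<open>1\<close> and \<open>-1\<close> of it.\<close>
    have key: "(CLINT x|M1. w1 x *\<^sub>R iexp (\<theta> * X1 j x + s * C1 x)) = (CLINT x|M2. w2 x *\<^sub>R iexp (\<theta> * X2 j x + s * C2 x))" for \<theta> s
    proof -
      show ?thesis using insert.prems(9)[of "(\<lambda>i. s * a i)(j := \<theta>)"]
        unfolding sum_insert_fun_upd[OF insert.hyps(1,2)] C1_def C2_def .
    qed
    have wi: "integrable M1 (\<lambda>x. w1 x *\<^sub>R f x)" if "f \<in> borel_measurable M1" "\<And>x. norm (f x) \<le> 2"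
      for f :: "'a \<Rightarrow> 'c::{banach, second_countable_topology}"
    proof (rule M1.integrable_const_bound[where B=2])
      show "AE x in M1. norm (w1 x *\<^sub>R f x) \<le> 2"
      proof (intro AE_I2)
        fix x
        show "norm (w1 x *\<^sub>R f x) \<le> 2"
          using mult_mono[OF w(2)[of x] that(2)[of x]] w(1)[of x] by simp
      qed
    qed (use that in measurable)
    have wi2: "integrable M2 (\<lambda>x. w2 x *\<^sub>R f x)" if "f \<in> borel_measurable M2" "\<And>x. norm (f x) \<le> 2"
      for f :: "'b \<Rightarrow> 'c::{banach, second_countable_topology}"
    proof (rule M2.integrable_const_bound[where B=2])
      show "AE x in M2. norm (w2 x *\<^sub>R f x) \<le> 2"
      proof (intro AE_I2)
        fix x
        show "norm (w2 x *\<^sub>R f x) \<le> 2"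
          using mult_mono[OF w(4)[of x] that(2)[of x]] w(3)[of x] by simp
      qed
    qed (use that in measurable)
    have cs: "cos y \<ge> -1" "cos y \<le> 1" "sin y \<ge> -1" "sin y \<le> 1" for y :: real by auto
    have b2: "norm (1 + cos y) \<le> 2" "norm (1 + sin y) \<le> 2" for y :: real
      using cs[of y] unfolding real_norm_def by linarith+
    \<comment> \<open>The weights \<open>w\<close>, \<open>w * (1 + cos C)\<close> and
      \<open>w * (1 + sin C)\<close> are nonnegative and each yields an identity for the event at
      \<open>j\<close>. In \<open>sp1\<close> and \<open>sp2\<close> the first is subtracted from
      the other two, which recovers \<open>cos C\<close> and \<open>sin C\<close>, and so
      \<open>iexp C\<close>, under the new weight.\<close>
    have e0: "(\<integral>x. w1 x * indicator (A j) (X1 j x) \<partial>M1) = (\<integral>x. w2 x * indicator (A j) (X2 j x) \<partial>M2)"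
      by (rule weighted_char_unique)
        (use wi[of "\<lambda>_. 1::real"] wi2[of "\<lambda>_. 1::real"] w key[of _ 0] in auto)
    have i1: "integrable M1 (\<lambda>x. w1 x *\<^sub>R iexp (\<theta> * X1 j x + s * C1 x))" for \<theta> s by (rule wi) auto
    have i2: "integrable M2 (\<lambda>x. w2 x *\<^sub>R iexp (\<theta> * X2 j x + s * C2 x))" for \<theta> s by (rule wi2) auto
    have ec: "(\<integral>x. (w1 x * (1 + cos (C1 x))) * indicator (A j) (X1 j x) \<partial>M1) = (\<integral>x. (w2 x * (1 + cos (C2 x))) * indicator (A j) (X2 j x) \<partial>M2)"
    proof (rule weighted_char_unique)
      show "integrable M1 (\<lambda>x. w1 x * (1 + cos (C1 x)))" using wi[of "\<lambda>x. 1 + cos (C1 x)"] b2 by simp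
      show "integrable M2 (\<lambda>x. w2 x * (1 + cos (C2 x)))" using wi2[of "\<lambda>x. 1 + cos (C2 x)"] b2 by simp
      show "0 \<le> w1 x * (1 + cos (C1 x))" for x using w(1)[of x] cs(1)[of "C1 x"] by (intro mult_nonneg_nonneg) linarith+
      show "0 \<le> w2 x * (1 + cos (C2 x))" for x using w(3)[of x] cs(1)[of "C2 x"] by (intro mult_nonneg_nonneg) linarith+
      fix \<theta>
      have "(CLINT x|M1. (w1 x * (1 + cos (C1 x))) *\<^sub>R iexp (\<theta> * X1 j x)) =
          (CLINT x|M1. w1 x *\<^sub>R iexp (\<theta> * X1 j x + 0 * C1 x) + (1/2) *\<^sub>R (w1 x *\<^sub>R iexp (\<theta> * X1 j x + 1 * C1 x)) + (1/2) *\<^sub>R (w1 x *\<^sub>R iexp (\<theta> * X1 j x + (-1) * C1 x)))"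
        unfolding scaleR_scaleR[symmetric] one_plus_cos_iexp by (simp only: scaleR_add_right scaleR_left_commute)
      also have "\<dots> = (CLINT x|M1. w1 x *\<^sub>R iexp (\<theta> * X1 j x + 0 * C1 x)) + (1/2) *\<^sub>R (CLINT x|M1. w1 x *\<^sub>R iexp (\<theta> * X1 j x + 1 * C1 x)) + (1/2) *\<^sub>R (CLINT x|M1. w1 x *\<^sub>R iexp (\<theta> * X1 j x + (-1) * C1 x))"
        by (simp only: Bochner_Integration.integral_add integral_scaleR_right i1 integrable_scaleR_right Bochner_Integration.integrable_add)
      also have "\<dots> = (CLINT x|M2. w2 x *\<^sub>R iexp (\<theta> * X2 j x + 0 * C2 x)) + (1/2) *\<^sub>R (CLINT x|M2. w2 x *\<^sub>R iexp (\<theta> * X2 j x + 1 * C2 x)) + (1/2) *\<^sub>R (CLINT x|M2. w2 x *\<^sub>R iexp (\<theta> * X2 j x + (-1) * C2 x))"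
        by (simp only: key)
      also have "\<dots> = (CLINT x|M2. w2 x *\<^sub>R iexp (\<theta> * X2 j x + 0 * C2 x) + (1/2) *\<^sub>R (w2 x *\<^sub>R iexp (\<theta> * X2 j x + 1 * C2 x)) + (1/2) *\<^sub>R (w2 x *\<^sub>R iexp (\<theta> * X2 j x + (-1) * C2 x)))"
        by (simp only: Bochner_Integration.integral_add integral_scaleR_right i2 integrable_scaleR_right Bochner_Integration.integrable_add)
      also have "\<dots> = (CLINT x|M2. (w2 x * (1 + cos (C2 x))) *\<^sub>R iexp (\<theta> * X2 j x))"
        unfolding scaleR_scaleR[symmetric] one_plus_cos_iexp by (simp only: scaleR_add_right scaleR_left_commute)
      finally show "(CLINT x|M1. (w1 x * (1 + cos (C1 x))) *\<^sub>R iexp (\<theta> * X1 j x)) = (CLINT x|M2. (w2 x * (1 + cos (C2 x))) *\<^sub>R iexp (\<theta> * X2 j x))" .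
    qed auto
    have es: "(\<integral>x. (w1 x * (1 + sin (C1 x))) * indicator (A j) (X1 j x) \<partial>M1) = (\<integral>x. (w2 x * (1 + sin (C2 x))) * indicator (A j) (X2 j x) \<partial>M2)"
    proof (rule weighted_char_unique)
      show "integrable M1 (\<lambda>x. w1 x * (1 + sin (C1 x)))" using wi[of "\<lambda>x. 1 + sin (C1 x)"] b2 by simp
      show "integrable M2 (\<lambda>x. w2 x * (1 + sin (C2 x)))" using wi2[of "\<lambda>x. 1 + sin (C2 x)"] b2 by simp
      show "0 \<le> w1 x * (1 + sin (C1 x))" for x using w(1)[of x] cs(3)[of "C1 x"] by (intro mult_nonneg_nonneg) linarith+
      show "0 \<le> w2 x * (1 + sin (C2 x))" for x using w(3)[of x] cs(3)[of "C2 x"] by (intro mult_nonneg_nonneg) linarith+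
      fix \<theta>
      have "(CLINT x|M1. (w1 x * (1 + sin (C1 x))) *\<^sub>R iexp (\<theta> * X1 j x)) =
          (CLINT x|M1. w1 x *\<^sub>R iexp (\<theta> * X1 j x + 0 * C1 x) - (\<i>/2) * (w1 x *\<^sub>R iexp (\<theta> * X1 j x + 1 * C1 x)) + (\<i>/2) * (w1 x *\<^sub>R iexp (\<theta> * X1 j x + (-1) * C1 x)))"
        unfolding scaleR_scaleR[symmetric] one_plus_sin_iexp by (simp only: scaleR_add_right scaleR_diff_right mult_scaleR_right)
      also have "\<dots> = (CLINT x|M1. w1 x *\<^sub>R iexp (\<theta> * X1 j x + 0 * C1 x)) - (\<i>/2) * (CLINT x|M1. w1 x *\<^sub>R iexp (\<theta> * X1 j x + 1 * C1 x)) + (\<i>/2) * (CLINT x|M1. w1 x *\<^sub>R iexp (\<theta> * X1 j x + (-1) * C1 x))"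
        by (simp only: Bochner_Integration.integral_add Bochner_Integration.integral_diff integral_mult_right_zero i1 integrable_mult_right Bochner_Integration.integrable_diff)
      also have "\<dots> = (CLINT x|M2. w2 x *\<^sub>R iexp (\<theta> * X2 j x + 0 * C2 x)) - (\<i>/2) * (CLINT x|M2. w2 x *\<^sub>R iexp (\<theta> * X2 j x + 1 * C2 x)) + (\<i>/2) * (CLINT x|M2. w2 x *\<^sub>R iexp (\<theta> * X2 j x + (-1) * C2 x))"
        by (simp only: key)
      also have "\<dots> = (CLINT x|M2. w2 x *\<^sub>R iexp (\<theta> * X2 j x + 0 * C2 x) - (\<i>/2) * (w2 x *\<^sub>R iexp (\<theta> * X2 j x + 1 * C2 x)) + (\<i>/2) * (w2 x *\<^sub>R iexp (\<theta> * X2 j x + (-1) * C2 x)))"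
        by (simp only: Bochner_Integration.integral_add Bochner_Integration.integral_diff integral_mult_right_zero i2 integrable_mult_right Bochner_Integration.integrable_diff)
      also have "\<dots> = (CLINT x|M2. (w2 x * (1 + sin (C2 x))) *\<^sub>R iexp (\<theta> * X2 j x))"
        unfolding scaleR_scaleR[symmetric] one_plus_sin_iexp by (simp only: scaleR_add_right scaleR_diff_right mult_scaleR_right)
      finally show "(CLINT x|M1. (w1 x * (1 + sin (C1 x))) *\<^sub>R iexp (\<theta> * X1 j x)) = (CLINT x|M2. (w2 x * (1 + sin (C2 x))) *\<^sub>R iexp (\<theta> * X2 j x))" .
    qed auto
    have sp1: "(CLINT x|M1. ?w1 x *\<^sub>R iexp (C1 x)) =
       complex_of_real ((\<integral>x. (w1 x * (1 + cos (C1 x))) * indicator (A j) (X1 j x) \<partial>M1) - (\<integral>x. w1 x * indicator (A j) (X1 j x) \<partial>M1))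
       + \<i> * complex_of_real ((\<integral>x. (w1 x * (1 + sin (C1 x))) * indicator (A j) (X1 j x) \<partial>M1) - (\<integral>x. w1 x * indicator (A j) (X1 j x) \<partial>M1))"
    proof -
      have ii: "integrable M1 (\<lambda>x. w1 x * indicator (A j) (X1 j x))" using wi[of "\<lambda>x. indicator (A j) (X1 j x) :: real"] by (simp add: indicator_def)
      have ic: "integrable M1 (\<lambda>x. (w1 x * (1 + cos (C1 x))) * indicator (A j) (X1 j x))"
        using wi[of "\<lambda>x. (1 + cos (C1 x)) * indicator (A j) (X1 j x) :: real"] b2 by (simp add: mult.assoc indicator_def)
      have is': "integrable M1 (\<lambda>x. (w1 x * (1 + sin (C1 x))) * indicator (A j) (X1 j x))"
        using wi[of "\<lambda>x. (1 + sin (C1 x)) * indicator (A j) (X1 j x) :: real"] b2 by (simp add: mult.assoc indicator_def)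
      have "(CLINT x|M1. ?w1 x *\<^sub>R iexp (C1 x)) =
          (CLINT x|M1. complex_of_real ((w1 x * (1 + cos (C1 x))) * indicator (A j) (X1 j x) - w1 x * indicator (A j) (X1 j x))
             + \<i> * complex_of_real ((w1 x * (1 + sin (C1 x))) * indicator (A j) (X1 j x) - w1 x * indicator (A j) (X1 j x)))"
        by (intro Bochner_Integration.integral_cong refl)
          (simp add: exp_Euler scaleR_conv_of_real algebra_simps flip: cos_of_real sin_of_real)
      also have "\<dots> = (CLINT x|M1. complex_of_real ((w1 x * (1 + cos (C1 x))) * indicator (A j) (X1 j x) - w1 x * indicator (A j) (X1 j x)))
             + \<i> * (CLINT x|M1. complex_of_real ((w1 x * (1 + sin (C1 x))) * indicator (A j) (X1 j x) - w1 x * indicator (A j) (X1 j x)))"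
        using ii ic is' by (subst Bochner_Integration.integral_add) (auto simp del: of_real_diff of_real_mult)
      finally show ?thesis using ii ic is' by (simp only: integral_complex_of_real Bochner_Integration.integral_diff)
    qed
    have sp2: "(CLINT x|M2. ?w2 x *\<^sub>R iexp (C2 x)) =
       complex_of_real ((\<integral>x. (w2 x * (1 + cos (C2 x))) * indicator (A j) (X2 j x) \<partial>M2) - (\<integral>x. w2 x * indicator (A j) (X2 j x) \<partial>M2))
       + \<i> * complex_of_real ((\<integral>x. (w2 x * (1 + sin (C2 x))) * indicator (A j) (X2 j x) \<partial>M2) - (\<integral>x. w2 x * indicator (A j) (X2 j x) \<partial>M2))"
    proof -
      have ii: "integrable M2 (\<lambda>x. w2 x * indicator (A j) (X2 j x))" using wi2[of "\<lambda>x. indicator (A j) (X2 j x) :: real"] by (simp add: indicator_def)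
      have ic: "integrable M2 (\<lambda>x. (w2 x * (1 + cos (C2 x))) * indicator (A j) (X2 j x))"
        using wi2[of "\<lambda>x. (1 + cos (C2 x)) * indicator (A j) (X2 j x) :: real"] b2 by (simp add: mult.assoc indicator_def)
      have is': "integrable M2 (\<lambda>x. (w2 x * (1 + sin (C2 x))) * indicator (A j) (X2 j x))"
        using wi2[of "\<lambda>x. (1 + sin (C2 x)) * indicator (A j) (X2 j x) :: real"] b2 by (simp add: mult.assoc indicator_def)
      have "(CLINT x|M2. ?w2 x *\<^sub>R iexp (C2 x)) =
          (CLINT x|M2. complex_of_real ((w2 x * (1 + cos (C2 x))) * indicator (A j) (X2 j x) - w2 x * indicator (A j) (X2 j x))
             + \<i> * complex_of_real ((w2 x * (1 + sin (C2 x))) * indicator (A j) (X2 j x) - w2 x * indicator (A j) (X2 j x)))"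
        by (intro Bochner_Integration.integral_cong refl)
          (simp add: exp_Euler scaleR_conv_of_real algebra_simps flip: cos_of_real sin_of_real)
      also have "\<dots> = (CLINT x|M2. complex_of_real ((w2 x * (1 + cos (C2 x))) * indicator (A j) (X2 j x) - w2 x * indicator (A j) (X2 j x)))
             + \<i> * (CLINT x|M2. complex_of_real ((w2 x * (1 + sin (C2 x))) * indicator (A j) (X2 j x) - w2 x * indicator (A j) (X2 j x)))"
        using ii ic is' by (subst Bochner_Integration.integral_add) (auto simp del: of_real_diff of_real_mult)
      finally show ?thesis using ii ic is' by (simp only: integral_complex_of_real Bochner_Integration.integral_diff)
    qed
    show "(CLINT x|M1. ?w1 x *\<^sub>R iexp (\<Sum>i\<in>J. a i * X1 i x)) = (CLINT x|M2. ?w2 x *\<^sub>R iexp (\<Sum>i\<in>J. a i * X2 i x))"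
      using sp1 sp2 unfolding e0 ec es by (simp only: C1_def C2_def)
  qed (use insert.prems w in \<open>auto simp: indicator_def\<close>)
  then show ?case using insert.hyps by (simp add: mult.assoc)
qed

text \<open>The cap at \<open>2\<close> gives a bound that is integrable without any moment
  assumption and tends to zero in mean under convergence in probability.\<close>

lemma norm_iexp_diff_le: "norm (iexp x - iexp y) \<le> min 2 \<bar>x - y\<bar>"
proof -
  have "norm (iexp (x - y) - 1) \<le> \<bar>x - y\<bar>"
    using iexp_approx1[of "x - y" 0] by simp
  moreover have "iexp x - iexp y = iexp y * (iexp (x - y) - 1)"
    by (simp add: right_diff_distrib exp_add[symmetric])
  ultimately have "norm (iexp x - iexp y) \<le> \<bar>x - y\<bar>" by (simp add: norm_mult)
  moreover have "norm (iexp x - iexp y) \<le> 2"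
    using norm_triangle_ineq4[of "iexp x" "iexp y"] by simp
  ultimately show ?thesis by simp
qed

context prob_space
begin

lemma integrable_iexp:
  assumes "X \<in> borel_measurable M"
  shows "integrable M (\<lambda>x. iexp (X x))"
  by (rule integrable_const_bound[where B=1]) (use assms in auto)

text \<open>The factorised characteristic function is the one obtained on
  \<open>M \<Otimes>\<^sub>M M\<close> by reading \<open>W\<close> on the first factor and
  \<open>F\<close> on the second. Uniqueness transfers the product form of rectangle probabilities
  back to \<open>M\<close>.\<close>

lemma char_factor_imp_indep_rect:
  fixes W :: "'a \<Rightarrow> real" and Zs :: "('a \<Rightarrow> real) set"
  assumes W: "W \<in> borel_measurable M" and F: "finite F" "\<And>Z. Z \<in> F \<Longrightarrow> Z \<in> borel_measurable M"
    and fac: "\<And>\<theta> a. (CLINT x|M. iexp (\<theta> * W x + (\<Sum>Z\<in>F. a Z * Z x))) = (CLINT x|M. iexp (\<theta> * W x)) * (CLINT x|M. iexp (\<Sum>Z\<in>F. a Z * Z x))"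
    and B: "B \<in> sets borel" and A: "\<And>Z. Z \<in> F \<Longrightarrow> A Z \<in> sets borel"
  shows "prob {x \<in> space M. W x \<in> B \<and> (\<forall>Z\<in>F. Z x \<in> A Z)} = prob {x \<in> space M. W x \<in> B} * prob {x \<in> space M. \<forall>Z\<in>F. Z x \<in> A Z}"
proof -
  interpret PP: pair_prob_space M M ..
  note [measurable] = W B
  \<comment> \<open>\<open>W\<close> may itself occur in \<open>F\<close>; the option type keeps its
    two roles apart.\<close>
  define J where "J = insert None (Some ` F)"
  define X1 where "X1 = (\<lambda>i. case i of None \<Rightarrow> W | Some Z \<Rightarrow> Z)"
  define X2 where "X2 = (\<lambda>i (x::'a \<times> 'a). case i of None \<Rightarrow> W (fst x) | Some Z \<Rightarrow> Z (snd x))"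
  define A' where "A' = (\<lambda>i. case i of None \<Rightarrow> B | Some Z \<Rightarrow> A Z)"
  have sumJ: "(\<Sum>i\<in>J. f i) = f None + (\<Sum>Z\<in>F. f (Some Z))" for f :: "('a \<Rightarrow> real) option \<Rightarrow> real"
    unfolding J_def using F(1) by (simp add: sum.reindex)
  have prodJ: "(\<Prod>i\<in>J. f i) = f None * (\<Prod>Z\<in>F. f (Some Z))" for f :: "('a \<Rightarrow> real) option \<Rightarrow> real"
    unfolding J_def using F(1) by (simp add: prod.reindex)
  have Zm[measurable]: "Z \<in> borel_measurable M" if "Z \<in> F" for Z using F(2) that .
  have pr: "(\<integral>x. u (fst x) * v (snd x) \<partial>(M \<Otimes>\<^sub>M M)) = (\<integral>x. u x \<partial>M) * (\<integral>x. v x \<partial>M)"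
    if [measurable]: "u \<in> borel_measurable M" "v \<in> borel_measurable M" and "\<And>x. norm (u x) \<le> 1" "\<And>x. norm (v x) \<le> 1"
    for u v :: "'a \<Rightarrow> 'c::{real_normed_field,banach,second_countable_topology}"
  proof -
    have "integrable (M \<Otimes>\<^sub>M M) (\<lambda>x. u (fst x) * v (snd x))"
    proof (rule PP.integrable_const_bound[where B=1])
      show "AE x in M \<Otimes>\<^sub>M M. norm (u (fst x) * v (snd x)) \<le> 1"
        using that(3,4) by (intro AE_I2) (auto simp: norm_mult intro!: mult_le_one)
    qed measurable
    then have "(\<integral>x. u (fst x) * v (snd x) \<partial>(M \<Otimes>\<^sub>M M)) = (\<integral>x. (\<integral>y. u x * v y \<partial>M) \<partial>M)"
      by (subst PP.integral_fst'[symmetric]) auto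
    then show ?thesis by simp
  qed
  have "(\<integral>x. 1 * (\<Prod>i\<in>J. indicator (A' i) (X1 i x)) \<partial>M) = (\<integral>x. 1 * (\<Prod>i\<in>J. indicator (A' i) (X2 i x)) \<partial>(M \<Otimes>\<^sub>M M) :: real)"
  proof (rule multivariate_char_unique)
    show "finite J" unfolding J_def using F by simp
    show "finite_measure M" "finite_measure (M \<Otimes>\<^sub>M M)" by unfold_locales
    show "X1 i \<in> borel_measurable M" if "i \<in> J" for i using that by (auto simp: J_def X1_def)
    show "X2 i \<in> borel_measurable (M \<Otimes>\<^sub>M M)" if "i \<in> J" for i
      using that measurable_compose[OF measurable_snd Zm] by (auto simp: J_def X2_def)
    show "A' i \<in> sets borel" if "i \<in> J" for i using that A by (auto simp: J_def A'_def)
    fix a :: "('a \<Rightarrow> real) option \<Rightarrow> real"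
    have e: "iexp (u + v) = iexp u * iexp v" for u v by (simp add: distrib_left exp_add)
    have "(CLINT x|M. 1 *\<^sub>R iexp (\<Sum>i\<in>J. a i * X1 i x)) = (CLINT x|M. iexp (a None * W x)) * (CLINT x|M. iexp (\<Sum>Z\<in>F. a (Some Z) * Z x))"
      unfolding sumJ using fac[of "a None" "\<lambda>Z. a (Some Z)"] by (simp add: X1_def)
    also have "\<dots> = (\<integral>x. iexp (a None * W (fst x)) * iexp (\<Sum>Z\<in>F. a (Some Z) * Z (snd x)) \<partial>(M \<Otimes>\<^sub>M M))"
      by (rule pr[symmetric]) auto
    also have "\<dots> = (CLINT x|M \<Otimes>\<^sub>M M. 1 *\<^sub>R iexp (\<Sum>i\<in>J. a i * X2 i x))"
      unfolding sumJ e[symmetric] by (simp add: X2_def)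
    finally show "(CLINT x|M. 1 *\<^sub>R iexp (\<Sum>i\<in>J. a i * X1 i x)) = (CLINT x|M \<Otimes>\<^sub>M M. 1 *\<^sub>R iexp (\<Sum>i\<in>J. a i * X2 i x))" .
  qed auto
  also have "\<dots> = (\<integral>x. indicator B (W (fst x)) * (\<Prod>Z\<in>F. indicator (A Z) (Z (snd x))) \<partial>(M \<Otimes>\<^sub>M M))"
    by (simp only: prodJ mult_1 X2_def A'_def option.case)
  also have "\<dots> = (\<integral>x. indicator B (W x) \<partial>M) * (\<integral>x. (\<Prod>Z\<in>F. indicator (A Z) (Z x)) \<partial>M :: real)"
  proof (rule pr)
    show "(\<lambda>x. \<Prod>Z\<in>F. indicator (A Z) (Z x) :: real) \<in> borel_measurable M"
    proof (rule borel_measurable_prod)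
      fix Z assume "Z \<in> F"
      note [measurable] = Zm[OF this] A[OF this]
      show "(\<lambda>x. indicator (A Z) (Z x) :: real) \<in> borel_measurable M" by measurable
    qed
    show "norm (\<Prod>Z\<in>F. indicator (A Z) (Z x) :: real) \<le> 1" for x
      unfolding prod_norm[symmetric] by (intro prod_le_1) (auto simp: indicator_def)
  qed auto
  finally have eq: "(\<integral>x. indicator B (W x) * (\<Prod>Z\<in>F. indicator (A Z) (Z x)) \<partial>M) = (\<integral>x. indicator B (W x) \<partial>M) * (\<integral>x. (\<Prod>Z\<in>F. indicator (A Z) (Z x)) \<partial>M :: real)"
    by (simp only: prodJ mult_1 X1_def A'_def option.case)
  have pind: "(\<Prod>Z\<in>F. indicator (A Z) (Z x)) = (if \<forall>Z\<in>F. Z x \<in> A Z then 1 else 0 :: real)" for x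
  proof (cases "\<forall>Z\<in>F. Z x \<in> A Z")
    case False
    then obtain Z where "Z \<in> F" "Z x \<notin> A Z" by auto
    then have "(\<Prod>Z\<in>F. indicator (A Z) (Z x) :: real) = 0" using F(1) by (intro prod_zero bexI[of _ Z]) auto
    then show ?thesis using False by simp
  qed simp
  have mF: "{x \<in> space M. \<forall>Z\<in>F. Z x \<in> A Z} \<in> events"
  proof (rule sets.sets_Collect_finite_All[OF _ F(1)])
    fix Z assume "Z \<in> F"
    note [measurable] = Zm[OF this] A[OF this]
    show "{x \<in> space M. Z x \<in> A Z} \<in> events" by measurable
  qed
  have mB: "{x \<in> space M. W x \<in> B} \<in> events" by measurable
  have mBF: "{x \<in> space M. W x \<in> B \<and> (\<forall>Z\<in>F. Z x \<in> A Z)} \<in> events"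
    using sets.Int[OF mB mF] by (rule back_subst[of "\<lambda>S. S \<in> events"]) auto
  have "(\<integral>x. indicator B (W x) * (\<Prod>Z\<in>F. indicator (A Z) (Z x)) \<partial>M) = (\<integral>x. indicator {x \<in> space M. W x \<in> B \<and> (\<forall>Z\<in>F. Z x \<in> A Z)} x \<partial>M :: real)"
    unfolding pind by (intro Bochner_Integration.integral_cong refl) (auto simp: indicator_def)
  moreover have "(\<integral>x. indicator B (W x) \<partial>M) = (\<integral>x. indicator {x \<in> space M. W x \<in> B} x \<partial>M :: real)"
    by (intro Bochner_Integration.integral_cong refl) (auto simp: indicator_def)
  moreover have "(\<integral>x. (\<Prod>Z\<in>F. indicator (A Z) (Z x)) \<partial>M) = (\<integral>x. indicator {x \<in> space M. \<forall>Z\<in>F. Z x \<in> A Z} x \<partial>M :: real)"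
    unfolding pind by (intro Bochner_Integration.integral_cong refl) (auto simp: indicator_def)
  ultimately show ?thesis using eq mF mB mBF by simp
qed

text \<open>Rectangles over finite subfamilies form an intersection-stable generator, so Dynkin's
  argument passes from finite families to the sigma-algebra of a possibly uncountable
  \<open>Zs\<close>.\<close>

lemma char_factor_imp_indep:
  fixes W :: "'a \<Rightarrow> real" and Zs :: "('a \<Rightarrow> real) set"
  assumes W: "W \<in> borel_measurable M" and Zs: "\<And>Z. Z \<in> Zs \<Longrightarrow> Z \<in> borel_measurable M"
    and fac: "\<And>F \<theta> a. finite F \<Longrightarrow> F \<subseteq> Zs \<Longrightarrow>
       (CLINT x|M. iexp (\<theta> * W x + (\<Sum>Z\<in>F. a Z * Z x))) = (CLINT x|M. iexp (\<theta> * W x)) * (CLINT x|M. iexp (\<Sum>Z\<in>F. a Z * Z x))"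
  shows "indep_set {W -` B \<inter> space M | B. B \<in> sets borel} (sigma_sets (space M) {Z -` B \<inter> space M | Z B. Z \<in> Zs \<and> B \<in> sets borel})"
proof -
  define C where "C = {{x \<in> space M. \<forall>Z\<in>F. Z x \<in> A Z} | F A. finite F \<and> F \<subseteq> Zs \<and> (\<forall>Z\<in>F. A Z \<in> sets borel)}"
  define D where "D = {W -` B \<inter> space M | B. B \<in> sets borel}"
  have D_ev: "D \<subseteq> events" using W by (auto simp: D_def intro: measurable_sets)
  have C_ev: "C \<subseteq> events"
  proof
    fix S assume "S \<in> C"
    then obtain F A where S: "S = {x \<in> space M. \<forall>Z\<in>F. Z x \<in> A Z}" "finite F" "F \<subseteq> Zs" "\<forall>Z\<in>F. A Z \<in> sets borel"
      by (auto simp: C_def)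
    show "S \<in> events" unfolding S(1)
    proof (rule sets.sets_Collect_finite_All[OF _ S(2)])
      fix Z assume "Z \<in> F"
      then have [measurable]: "Z \<in> borel_measurable M" "A Z \<in> sets borel" using S Zs by auto
      show "{x \<in> space M. Z x \<in> A Z} \<in> events" by measurable
    qed
  qed
  have ind: "indep_set D C" unfolding indep_sets2_eq
  proof (intro conjI D_ev C_ev ballI)
    fix a b assume a: "a \<in> D" and b: "b \<in> C"
    obtain B where B: "a = W -` B \<inter> space M" "B \<in> sets borel" using a by (auto simp: D_def)
    obtain F A where S: "b = {x \<in> space M. \<forall>Z\<in>F. Z x \<in> A Z}" "finite F" "F \<subseteq> Zs" "\<forall>Z\<in>F. A Z \<in> sets borel"
      using b by (auto simp: C_def)
    have "a \<inter> b = {x \<in> space M. W x \<in> B \<and> (\<forall>Z\<in>F. Z x \<in> A Z)}" "a = {x \<in> space M. W x \<in> B}" using B(1) S(1) by auto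
    moreover have "Z \<in> borel_measurable M" "A Z \<in> sets borel" if "Z \<in> F" for Z using S Zs that by auto
    ultimately show "prob (a \<inter> b) = prob a * prob b"
      using char_factor_imp_indep_rect[OF W S(2) _ fac[OF S(2,3)] B(2), of A] S(1) by simp
  qed
  have "Int_stable D"
  proof (rule Int_stableI)
    fix a b assume "a \<in> D" "b \<in> D"
    then obtain B B' where "a = W -` B \<inter> space M" "B \<in> sets borel" "b = W -` B' \<inter> space M" "B' \<in> sets borel"
      by (auto simp: D_def)
    then have "a \<inter> b = W -` (B \<inter> B') \<inter> space M" "B \<inter> B' \<in> sets borel" by auto
    then show "a \<inter> b \<in> D" unfolding D_def by blast
  qed
  moreover have "Int_stable C"
  proof (rule Int_stableI)
    fix a b assume "a \<in> C" "b \<in> C"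
    then obtain F A F' A' where a: "a = {x \<in> space M. \<forall>Z\<in>F. Z x \<in> A Z}" "finite F" "F \<subseteq> Zs" "\<forall>Z\<in>F. A Z \<in> sets borel"
      and b: "b = {x \<in> space M. \<forall>Z\<in>F'. Z x \<in> A' Z}" "finite F'" "F' \<subseteq> Zs" "\<forall>Z\<in>F'. A' Z \<in> sets borel"
      unfolding C_def by blast
    \<comment> \<open>The default \<open>UNIV\<close> imposes no condition on a variable that is
      absent from one of the two rectangles.\<close>
    let ?A = "\<lambda>Z. (if Z \<in> F then A Z else UNIV) \<inter> (if Z \<in> F' then A' Z else UNIV)"
    have "a \<inter> b = {x \<in> space M. \<forall>Z\<in>F \<union> F'. Z x \<in> ?A Z}" unfolding a(1) b(1) by auto
    moreover have "\<forall>Z\<in>F \<union> F'. ?A Z \<in> sets borel" using a b by auto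
    moreover have "finite (F \<union> F')" "F \<union> F' \<subseteq> Zs" using a(2,3) b(2,3) by auto
    ultimately show "a \<inter> b \<in> C" unfolding C_def by (intro CollectI exI conjI)
  qed
  ultimately have "indep_set (sigma_sets (space M) D) (sigma_sets (space M) C)"
    by (rule indep_set_sigma_sets[OF ind])
  moreover have "sigma_sets (space M) {Z -` B \<inter> space M | Z B. Z \<in> Zs \<and> B \<in> sets borel} \<subseteq> sigma_sets (space M) C"
  proof (rule sigma_sets_mono')
    show "{Z -` B \<inter> space M | Z B. Z \<in> Zs \<and> B \<in> sets borel} \<subseteq> C"
    proof
      fix S assume "S \<in> {Z -` B \<inter> space M | Z B. Z \<in> Zs \<and> B \<in> sets borel}"
      then obtain Z B where "S = Z -` B \<inter> space M" "Z \<in> Zs" "B \<in> sets borel" by auto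
      then have "S = {x \<in> space M. \<forall>Z'\<in>{Z}. Z' x \<in> (\<lambda>_. B) Z'}" "finite {Z}" "{Z} \<subseteq> Zs" "\<forall>Z'\<in>{Z}. (\<lambda>_. B) Z' \<in> sets borel" by auto
      then show "S \<in> C" unfolding C_def by (intro CollectI exI conjI)
    qed
  qed
  moreover have "D \<subseteq> sigma_sets (space M) D" by auto
  ultimately show ?thesis unfolding indep_sets2_eq D_def[symmetric] by blast
qed

text \<open>A standard normal variable and its translates have equivalent laws.\<close>

lemma prob_pos_shift_std_normal:
  fixes W :: "'a \<Rightarrow> real"
  assumes W[measurable]: "W \<in> borel_measurable M" and law: "distr M borel W = std_normal_distribution"
    and G: "space G = space M" "sets G \<subseteq> events"
    and ind: "indep_set {W -` B \<inter> space M | B. B \<in> sets borel} (sets G)"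
    and A[measurable]: "A \<in> sets (borel \<Otimes>\<^sub>M G)"
    and pos: "prob {\<omega> \<in> space M. (W \<omega>, \<omega>) \<in> A} > 0"
  shows "prob {\<omega> \<in> space M. (W \<omega> - s, \<omega>) \<in> A} > 0"
proof (rule ccontr)
  assume "\<not> ?thesis"
  then have z: "prob {\<omega> \<in> space M. (W \<omega> - s, \<omega>) \<in> A} = 0" using measure_nonneg[of M "{\<omega> \<in> space M. (W \<omega> - s, \<omega>) \<in> A}"] by linarith
  have idm[measurable]: "(\<lambda>\<omega>. \<omega>) \<in> M \<rightarrow>\<^sub>M G" using G by (auto simp: measurable_def intro!: sets.Int)
  let ?N = "std_normal_distribution" and ?Q = "distr M G (\<lambda>\<omega>. \<omega>)"
  interpret Q: prob_space ?Q by (rule prob_space_distr) simp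
  interpret N: prob_space ?N using real_dist_normal_dist by (simp add: real_distribution_def)
  interpret NQ: pair_sigma_finite ?N ?Q ..
  \<comment> \<open>Independence makes the law of the pair \<open>(W \<omega>, \<omega>)\<close> on
    \<open>borel \<Otimes>\<^sub>M G\<close> a product measure, so \<open>A\<close> can be examined
    by sections with \<open>\<omega>\<close> as second coordinate.\<close>
  have joint: "?N \<Otimes>\<^sub>M ?Q = distr M (borel \<Otimes>\<^sub>M G) (\<lambda>\<omega>. (W \<omega>, \<omega>))"
  proof (rule pair_measure_eqI)
    show "sigma_finite_measure ?N" "sigma_finite_measure ?Q" by unfold_locales
    show "sets (?N \<Otimes>\<^sub>M ?Q) = sets (distr M (borel \<Otimes>\<^sub>M G) (\<lambda>\<omega>. (W \<omega>, \<omega>)))"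
      unfolding sets_distr by (rule sets_pair_measure_cong) simp_all
    fix B C assume "B \<in> sets ?N" "C \<in> sets ?Q"
    then have B[measurable]: "B \<in> sets borel" and C[measurable]: "C \<in> sets G" by auto
    have Cs: "C \<subseteq> space M" using sets.sets_into_space[OF C] G(1) by simp
    have "emeasure ?N B = emeasure M (W -` B \<inter> space M)"
      unfolding law[symmetric] by (rule emeasure_distr) measurable
    moreover have "emeasure ?Q C = emeasure M C"
      using Cs by (subst emeasure_distr) (auto simp: Int_absorb2)
    moreover have "emeasure (distr M (borel \<Otimes>\<^sub>M G) (\<lambda>\<omega>. (W \<omega>, \<omega>))) (B \<times> C) = emeasure M ((W -` B \<inter> space M) \<inter> C)"
      by (subst emeasure_distr) (measurable, use Cs in \<open>auto intro!: arg_cong[where f="emeasure M"]\<close>)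
    moreover have "prob ((W -` B \<inter> space M) \<inter> C) = prob (W -` B \<inter> space M) * prob C"
      by (rule indep_setD[OF ind]) (use B C in auto)
    ultimately show "emeasure ?N B * emeasure ?Q C = emeasure (distr M (borel \<Otimes>\<^sub>M G) (\<lambda>\<omega>. (W \<omega>, \<omega>))) (B \<times> C)"
      by (simp add: emeasure_eq_measure ennreal_mult)
  qed
  have sN: "sets (?N \<Otimes>\<^sub>M ?Q) = sets (borel \<Otimes>\<^sub>M G)" by (rule sets_pair_measure_cong) simp_all
  have nn: "std_normal_density x > 0" for x by (simp add: normal_density_pos)
  \<comment> \<open>The normal density is strictly positive, so its null sets are those of Lebesgue
    measure, which translations preserve.\<close>
  have null: "emeasure ?N B = 0 \<longleftrightarrow> emeasure lborel B = 0" if "B \<in> sets borel" for B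
  proof -
    have "emeasure ?N B = 0 \<longleftrightarrow> (AE x in lborel. x \<in> B \<longrightarrow> ennreal (std_normal_density x) = 0)"
      using that null_sets_density_iff[of "\<lambda>x. ennreal (std_normal_density x)" lborel B] by (auto simp: null_sets_def)
    also have "\<dots> \<longleftrightarrow> (AE x in lborel. x \<notin> B)"
      by (intro AE_cong) (metis ennreal_eq_0_iff not_le nn)
    also have "\<dots> \<longleftrightarrow> emeasure lborel B = 0"
      using that by (subst AE_iff_measurable[of B]) auto
    finally show ?thesis .
  qed
  define A' where "A' = (\<lambda>(w, \<omega>). (w - s, \<omega>)) -` A \<inter> space (borel \<Otimes>\<^sub>M G)"
  have A'm[measurable]: "A' \<in> sets (borel \<Otimes>\<^sub>M G)" unfolding A'_def by (rule measurable_sets[OF _ A]) measurable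
  have em: "emeasure (?N \<Otimes>\<^sub>M ?Q) S = emeasure M {\<omega> \<in> space M. (W \<omega>, \<omega>) \<in> S}" if "S \<in> sets (borel \<Otimes>\<^sub>M G)" for S
  proof -
    have "emeasure (?N \<Otimes>\<^sub>M ?Q) S = emeasure M ((\<lambda>\<omega>. (W \<omega>, \<omega>)) -` S \<inter> space M)"
      unfolding joint by (rule emeasure_distr) (use that in measurable)
    also have "(\<lambda>\<omega>. (W \<omega>, \<omega>)) -` S \<inter> space M = {\<omega> \<in> space M. (W \<omega>, \<omega>) \<in> S}" by auto
    finally show ?thesis .
  qed
  have "{\<omega> \<in> space M. (W \<omega>, \<omega>) \<in> A'} = {\<omega> \<in> space M. (W \<omega> - s, \<omega>) \<in> A}"
    using G(1) by (auto simp: A'_def space_pair_measure)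
  then have "emeasure (?N \<Otimes>\<^sub>M ?Q) A' = 0" using em[OF A'm] z by (simp add: emeasure_eq_measure)
  then have "(\<integral>\<^sup>+y. emeasure ?N ((\<lambda>x. (x, y)) -` A') \<partial>?Q) = 0"
    using NQ.emeasure_pair_measure_alt2[of A'] A'm sN by simp
  then have "AE y in ?Q. emeasure ?N ((\<lambda>x. (x, y)) -` A') = 0"
    by (subst (asm) nn_integral_0_iff_AE) (auto intro!: NQ.measurable_emeasure_Pair2 simp: sN)
  \<comment> \<open>Every section of \<open>A'\<close> is a translate of the corresponding section
    of \<open>A\<close>; null sections carry over and integrate to a null set.\<close>
  then have "AE y in ?Q. emeasure ?N ((\<lambda>x. (x, y)) -` A) = 0"
    using AE_space
  proof eventually_elim
    case (elim y)
    have Ay: "(\<lambda>x. (x, y)) -` A \<in> sets borel" using sets_Pair2[OF A, of y] by simp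
    have "(\<lambda>x. (x, y)) -` A' = (\<lambda>x. x - s) -` ((\<lambda>x. (x, y)) -` A)"
      using elim(2) G(1) by (auto simp: A'_def space_pair_measure)
    moreover have "(\<lambda>x. (x, y)) -` A' \<in> sets borel" using sets_Pair2[OF A'm, of y] by simp
    ultimately have "emeasure lborel ((\<lambda>x. x - s) -` ((\<lambda>x. (x, y)) -` A)) = 0" using elim(1) null by simp
    moreover have "emeasure lborel ((\<lambda>x. (x, y)) -` A) = emeasure lborel ((\<lambda>x. x - s) -` ((\<lambda>x. (x, y)) -` A))"
    proof -
      have "emeasure lborel ((\<lambda>x. (x, y)) -` A) = emeasure (distr lborel borel ((+) (- s))) ((\<lambda>x. (x, y)) -` A)"
        by (simp only: lborel_distr_plus)
      also have "\<dots> = emeasure lborel ((+) (- s) -` ((\<lambda>x. (x, y)) -` A) \<inter> space lborel)"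
        by (rule emeasure_distr) (use Ay in auto)
      also have "(+) (- s) -` ((\<lambda>x. (x, y)) -` A) \<inter> space lborel = (\<lambda>x. x - s) -` ((\<lambda>x. (x, y)) -` A)" by auto
      finally show ?thesis .
    qed
    ultimately show ?case using null[OF Ay] by simp
  qed
  then have "(\<integral>\<^sup>+y. emeasure ?N ((\<lambda>x. (x, y)) -` A) \<partial>?Q) = 0"
    by (subst nn_integral_0_iff_AE) (auto intro!: NQ.measurable_emeasure_Pair2 simp: sN)
  then have "emeasure (?N \<Otimes>\<^sub>M ?Q) A = 0"
    using NQ.emeasure_pair_measure_alt2[of A] A sN by simp
  then show False using em[OF A] pos by (simp add: emeasure_eq_measure)
qed

section \<open>Convergence in probability and characteristic functions\<close>

lemma tendsto_in_prob_integral_min: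
  fixes Z :: "nat \<Rightarrow> 'a \<Rightarrow> real"
  assumes [measurable]: "\<And>n. Z n \<in> borel_measurable M" "Z' \<in> borel_measurable M"
    and t: "tendsto_in_prob M Z Z'"
  shows "(\<lambda>n. \<integral>x. min 2 \<bar>Z n x - Z' x\<bar> \<partial>M) \<longlonglongrightarrow> 0"
proof (rule LIMSEQ_I)
  fix r :: real assume r: "r > 0"
  have "(\<lambda>n. prob {x \<in> space M. norm (Z n x - Z' x) > r / 4}) \<longlonglongrightarrow> 0"
    using t[unfolded tendsto_in_prob_def, rule_format, of "r / 4"] r by simp
  then obtain N where N: "\<And>n. n \<ge> N \<Longrightarrow> prob {x \<in> space M. norm (Z n x - Z' x) > r / 4} < r / 4"
    using LIMSEQ_D[of _ 0 "r/4"] r by fastforce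
  show "\<exists>N. \<forall>n\<ge>N. norm ((\<integral>x. min 2 \<bar>Z n x - Z' x\<bar> \<partial>M) - 0) < r"
  proof (intro exI[of _ N] allI impI)
    fix n assume n: "n \<ge> N"
    let ?S = "{x \<in> space M. norm (Z n x - Z' x) > r / 4}"
    have Sm: "?S \<in> events" by measurable
    define S where "S = ?S"
    have Sm: "S \<in> events" unfolding S_def by (rule Sm)
    have iS: "integrable M (indicator S :: 'a \<Rightarrow> real)"
      by (rule integrable_real_indicator[OF Sm]) (simp add: emeasure_eq_measure)
    have "(\<integral>x. min 2 \<bar>Z n x - Z' x\<bar> \<partial>M) \<le> (\<integral>x. r / 4 + 2 * indicator S x \<partial>M)"
    proof (rule integral_mono)
      show "integrable M (\<lambda>x. min 2 \<bar>Z n x - Z' x\<bar>)" by (rule integrable_const_bound[where B=2]) auto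
      show "integrable M (\<lambda>x. r / 4 + 2 * indicator S x)"
        by (intro Bochner_Integration.integrable_add integrable_mult_right integrable_const iS)
      show "min 2 \<bar>Z n x - Z' x\<bar> \<le> r / 4 + 2 * indicator S x" if "x \<in> space M" for x
        using that r by (auto simp: S_def indicator_def min_def)
    qed
    also have "\<dots> = r / 4 + 2 * prob S"
      by (subst Bochner_Integration.integral_add) (auto simp: prob_space iS Sm)
    also have "\<dots> < r" using N[OF n] r unfolding S_def by simp
    finally have "(\<integral>x. min 2 \<bar>Z n x - Z' x\<bar> \<partial>M) < r" .
    moreover have "0 \<le> (\<integral>x. min 2 \<bar>Z n x - Z' x\<bar> \<partial>M)" by (rule Bochner_Integration.integral_nonneg) auto
    ultimately show "norm ((\<integral>x. min 2 \<bar>Z n x - Z' x\<bar> \<partial>M) - 0) < r" by simp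
  qed
qed

lemma norm_char_diff_le:
  fixes Z Z' :: "'a \<Rightarrow> real"
  assumes [measurable]: "Z \<in> borel_measurable M" "Z' \<in> borel_measurable M"
  shows "norm ((CLINT x|M. iexp (Z x)) - (CLINT x|M. iexp (Z' x))) \<le> (\<integral>x. min 2 \<bar>Z x - Z' x\<bar> \<partial>M)"
proof -
  have "(CLINT x|M. iexp (Z x)) - (CLINT x|M. iexp (Z' x)) = (CLINT x|M. iexp (Z x) - iexp (Z' x))"
    by (rule Bochner_Integration.integral_diff[symmetric]) (rule integrable_iexp, measurable)+
  also have "norm \<dots> \<le> (\<integral>x. norm (iexp (Z x) - iexp (Z' x)) \<partial>M)" by (rule integral_norm_bound)
  also have "\<dots> \<le> (\<integral>x. min 2 \<bar>Z x - Z' x\<bar> \<partial>M)"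
  proof (rule integral_mono)
    show "integrable M (\<lambda>x. norm (iexp (Z x) - iexp (Z' x)))"
      by (intro integrable_norm Bochner_Integration.integrable_diff integrable_iexp) measurable
    show "integrable M (\<lambda>x. min 2 \<bar>Z x - Z' x\<bar>)" by (rule integrable_const_bound[where B=2]) auto
  qed (rule norm_iexp_diff_le)
  finally show ?thesis .
qed

lemma tendsto_in_prob_char:
  fixes Z :: "nat \<Rightarrow> 'a \<Rightarrow> real"
  assumes "\<And>n. Z n \<in> borel_measurable M" "Z' \<in> borel_measurable M" and "tendsto_in_prob M Z Z'"
  shows "(\<lambda>n. CLINT x|M. iexp (Z n x)) \<longlonglongrightarrow> (CLINT x|M. iexp (Z' x))"
proof (rule Lim_null[THEN iffD2], rule tendsto_0_le[OF tendsto_in_prob_integral_min[OF assms]])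
  show "\<forall>\<^sub>F n in sequentially. norm ((CLINT x|M. iexp (Z n x)) - (CLINT x|M. iexp (Z' x))) \<le> norm (\<integral>x. min 2 \<bar>Z n x - Z' x\<bar> \<partial>M) * 1"
    using norm_char_diff_le[OF assms(1,2)] by (intro always_eventually allI) (simp add: order_trans[OF _ abs_ge_self])
qed

lemma tendsto_in_prob_subseq:
  fixes Z :: "nat \<Rightarrow> 'a \<Rightarrow> real"
  assumes [measurable]: "\<And>n. Z n \<in> borel_measurable M" "Z' \<in> borel_measurable M" and t: "tendsto_in_prob M Z Z'"
  shows "\<exists>r. strict_mono r \<and> (AE x in M. (\<lambda>n. Z (r n) x) \<longlonglongrightarrow> Z' x)"
proof -
  have "\<exists>r. strict_mono r \<and> (AE x in M. (\<lambda>n. min 2 \<bar>Z (r n) x - Z' x\<bar>) \<longlonglongrightarrow> 0)"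
  proof (rule tendsto_L1_AE_subseq)
    show "integrable M (\<lambda>x. min 2 \<bar>Z n x - Z' x\<bar>)" for n by (rule integrable_const_bound[where B=2]) auto
    show "(\<lambda>n. \<integral>x. norm (min 2 \<bar>Z n x - Z' x\<bar>) \<partial>M) \<longlonglongrightarrow> 0"
      using tendsto_in_prob_integral_min[OF assms] by simp
  qed
  then obtain r where r: "strict_mono r" "AE x in M. (\<lambda>n. min 2 \<bar>Z (r n) x - Z' x\<bar>) \<longlonglongrightarrow> 0" by blast
  have "AE x in M. (\<lambda>n. Z (r n) x) \<longlonglongrightarrow> Z' x" using r(2)
  proof eventually_elim
    case (elim x)
    have "\<forall>\<^sub>F n in sequentially. min 2 \<bar>Z (r n) x - Z' x\<bar> < 1" using order_tendstoD(2)[OF elim] by simp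
    then have "\<forall>\<^sub>F n in sequentially. min 2 \<bar>Z (r n) x - Z' x\<bar> = \<bar>Z (r n) x - Z' x\<bar>" by eventually_elim auto
    then have "(\<lambda>n. \<bar>Z (r n) x - Z' x\<bar>) \<longlonglongrightarrow> 0" by (rule Lim_transform_eventually[OF elim])
    then show ?case by (simp add: LIM_zero_cancel tendsto_rabs_zero_iff)
  qed
  then show ?thesis using r(1) by blast
qed

lemma tendsto_in_prob_add:
  fixes Z W :: "nat \<Rightarrow> 'a \<Rightarrow> real"
  assumes [measurable]: "\<And>n. Z n \<in> borel_measurable M" "Z' \<in> borel_measurable M" "\<And>n. W n \<in> borel_measurable M" "W' \<in> borel_measurable M"
    and t: "tendsto_in_prob M Z Z'" "tendsto_in_prob M W W'"
  shows "tendsto_in_prob M (\<lambda>n x. Z n x + W n x) (\<lambda>x. Z' x + W' x)"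
  unfolding tendsto_in_prob_def
proof (intro allI impI)
  fix \<epsilon> :: real assume e: "\<epsilon> > 0"
  let ?p = "\<lambda>n. prob {x \<in> space M. norm (Z n x - Z' x) > \<epsilon> / 2} + prob {x \<in> space M. norm (W n x - W' x) > \<epsilon> / 2}"
  have "?p \<longlonglongrightarrow> 0 + 0"
    using t[unfolded tendsto_in_prob_def, rule_format, of "\<epsilon> / 2"] e by (intro tendsto_add) simp_all
  then have p0: "?p \<longlonglongrightarrow> 0" by simp
  show "(\<lambda>n. prob {x \<in> space M. \<epsilon> < norm (Z n x + W n x - (Z' x + W' x))}) \<longlonglongrightarrow> 0"
  proof (rule tendsto_sandwich[OF _ _ tendsto_const p0])
    show "\<forall>\<^sub>F n in sequentially. prob {x \<in> space M. \<epsilon> < norm (Z n x + W n x - (Z' x + W' x))} \<le> ?p n"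
    proof (intro always_eventually allI)
      fix n
      have "prob {x \<in> space M. \<epsilon> < norm (Z n x + W n x - (Z' x + W' x))} \<le>
          prob ({x \<in> space M. norm (Z n x - Z' x) > \<epsilon> / 2} \<union> {x \<in> space M. norm (W n x - W' x) > \<epsilon> / 2})"
        by (rule finite_measure_mono) (auto simp: abs_if split: if_splits)
      also have "\<dots> \<le> ?p n" by (rule measure_Un_le) measurable
      finally show "prob {x \<in> space M. \<epsilon> < norm (Z n x + W n x - (Z' x + W' x))} \<le> ?p n" .
    qed
  qed simp
qed

lemma tendsto_in_prob_cmult:
  fixes Z :: "nat \<Rightarrow> 'a \<Rightarrow> real"
  assumes t: "tendsto_in_prob M Z Z'"
  shows "tendsto_in_prob M (\<lambda>n x. c * Z n x) (\<lambda>x. c * Z' x)"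
  unfolding tendsto_in_prob_def
proof (intro allI impI)
  fix \<epsilon> :: real assume e: "\<epsilon> > 0"
  show "(\<lambda>n. prob {x \<in> space M. \<epsilon> < norm (c * Z n x - c * Z' x)}) \<longlonglongrightarrow> 0"
  proof (cases "c = 0")
    case False
    then have "\<epsilon> < norm (c * Z n x - c * Z' x) \<longleftrightarrow> \<epsilon> / \<bar>c\<bar> < norm (Z n x - Z' x)" for n x
      by (simp add: abs_mult pos_divide_less_eq mult.commute flip: right_diff_distrib)
    moreover have "\<epsilon> / \<bar>c\<bar> > 0" using False e by simp
    ultimately show ?thesis using t unfolding tendsto_in_prob_def by simp
  qed (use e in simp)
qed

lemma tendsto_in_prob_cong_AE:
  fixes Z :: "nat \<Rightarrow> 'a \<Rightarrow> real"
  assumes [measurable]: "\<And>n. Z n \<in> borel_measurable M" "\<And>n. W n \<in> borel_measurable M" "Z' \<in> borel_measurable M"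
    and "\<And>n. AE x in M. Z n x = W n x" and t: "tendsto_in_prob M Z Z'"
  shows "tendsto_in_prob M W Z'"
proof -
  have "prob {x \<in> space M. norm (Z n x - Z' x) > \<epsilon>} = prob {x \<in> space M. norm (W n x - Z' x) > \<epsilon>}" for n \<epsilon>
    by (rule finite_measure_eq_AE) (use assms(4)[of n] in \<open>auto elim!: eventually_mono\<close>)
  then show ?thesis using t unfolding tendsto_in_prob_def by simp
qed

end

subsection \<open>Integrals with respect to a Gaussian random measure\<close>

text \<open>Dynkin's pi-lambda theorem inside one interval. The defining properties of a random
  measure concern bounded sets, so complements are taken relative to \<open>{a<..c}\<close>.\<close>

lemma bounded_borel_induct:
  fixes A :: "real set"
  assumes ac: "a \<le> c" and A: "A \<in> sets borel" "A \<subseteq> {a<..c}"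
    and interval: "\<And>v u. a \<le> v \<Longrightarrow> v \<le> u \<Longrightarrow> u \<le> c \<Longrightarrow> Q {v<..u}"
    and compl: "\<And>B. B \<in> sets borel \<Longrightarrow> B \<subseteq> {a<..c} \<Longrightarrow> Q B \<Longrightarrow> Q ({a<..c} - B)"
    and union: "\<And>B. disjoint_family B \<Longrightarrow> (\<And>i::nat. B i \<in> sets borel) \<Longrightarrow> (\<And>i. B i \<subseteq> {a<..c}) \<Longrightarrow> (\<And>i. Q (B i)) \<Longrightarrow> Q (\<Union>i. B i)"
  shows "Q A"
proof -
  have bs: "sets borel = sigma_sets UNIV (range (\<lambda>(a, b). {a <.. b::real}))"
    by (subst borel_sigma_sets_Ioc) simp
  have "Q (A \<inter> {a<..c})"
  proof (rule sigma_sets_induct_disjoint[where G="range (\<lambda>(a, b). {a <.. b::real})" and \<Omega>=UNIV and P="\<lambda>B. Q (B \<inter> {a<..c})"])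
    show "Int_stable (range (\<lambda>(a, b). {a<..b::real}))" by (auto simp: Int_stable_def)
    show "A \<in> sigma_sets UNIV (range (\<lambda>(a, b). {a <.. b}))" using A bs by simp
    have empty: "Q {}" using interval[of a a] ac by simp
    then show "Q ({} \<inter> {a<..c})" by simp
    show "Q (B \<inter> {a<..c})" if "B \<in> range (\<lambda>(a, b). {a<..b})" for B
    proof -
      obtain v u where B: "B = {v<..u}" using \<open>B \<in> _\<close> by auto
      have i: "B \<inter> {a<..c} = {max v a<..min u c}" by (auto simp: B)
      show ?thesis
      proof (cases "max v a \<le> min u c")
        case True
        then show ?thesis unfolding i by (intro interval) auto
      next
        case False
        then have e: "{max v a<..min u c} = {}" by (intro greaterThanAtMost_empty) linarith
        show ?thesis unfolding i e by (rule empty)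
      qed
    qed
    show "Q ((UNIV - B) \<inter> {a<..c})"
      if "B \<in> sigma_sets UNIV (range (\<lambda>(a, b). {a <.. b}))" "Q (B \<inter> {a<..c})" for B
    proof -
      have "(UNIV - B) \<inter> {a<..c} = {a<..c} - B \<inter> {a<..c}" by auto
      moreover have "B \<in> sets borel" unfolding bs by (rule that(1))
      ultimately show ?thesis using compl[of "B \<inter> {a<..c}"] that(2) by auto
    qed
    show "Q ((\<Union>i. B i) \<inter> {a<..c})"
      if "disjoint_family B" "range B \<subseteq> sigma_sets UNIV (range (\<lambda>(a, b). {a <.. b}))" "\<And>i::nat. Q (B i \<inter> {a<..c})" for B
    proof -
      have "(\<Union>i. B i) \<inter> {a<..c} = (\<Union>i. B i \<inter> {a<..c})" by auto
      moreover have "Q (\<Union>i. B i \<inter> {a<..c})"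
      proof (rule union)
        have "B i \<in> sets borel" for i unfolding bs using that(2) by auto
        then show "B i \<inter> {a<..c} \<in> sets borel" for i by auto
      qed (use that in \<open>auto simp: disjoint_family_on_def\<close>)
      ultimately show ?thesis by simp
    qed
  qed auto
  then show ?thesis using A(2) by (simp add: Int_absorb2)
qed

lemma bounded_Ioc: "B \<subseteq> {a<..b::real} \<Longrightarrow> bounded B"
  by (rule bounded_subset[OF bounded_closed_interval[of a b]]) auto

lemma case_bool_family:
  fixes A B :: "real set"
  assumes "A \<in> sets borel" "B \<in> sets borel" "bounded A" "bounded B" "A \<inter> B = {}"
  shows "disjoint_family_on (case_bool A B) UNIV" "\<And>i. case_bool A B i \<in> sets borel" "\<And>i. bounded (case_bool A B i)"
    "(\<Union>i\<in>UNIV. case_bool A B i) = A \<union> B"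
  using assms by (auto simp: disjoint_family_on_def UNIV_bool split: bool.splits)

lemma bounded_subset_Ioc:
  fixes A :: "real set"
  assumes "bounded A"
  obtains m where "m > 0" "A \<subseteq> {-m<..m}"
proof -
  obtain m where "m > 0" "\<forall>x\<in>A. norm x \<le> m" using assms unfolding bounded_pos by auto
  then have "m + 1 > 0" "A \<subseteq> {-(m+1)<..m+1}" by (auto simp: abs_le_iff)
  then show ?thesis using that by blast
qed

locale random_measure = prob_space P for P :: "'w measure" +
  fixes L :: "real \<Rightarrow> 'w \<Rightarrow> real^'d" and N :: "real set \<Rightarrow> 'w \<Rightarrow> real^'d"
  assumes rm: "levy_random_measure P L N"
begin

lemma N_measurable: "A \<in> sets borel \<Longrightarrow> bounded A \<Longrightarrow> N A \<in> borel_measurable P"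
  using rm unfolding levy_random_measure_def by blast

lemma N_interval: "v < u \<Longrightarrow> AE \<omega> in P. N {v<..u} \<omega> = L u \<omega> - L v \<omega>"
  using rm unfolding levy_random_measure_def by blast

lemma N_indep: "disjoint_family A \<Longrightarrow> (\<And>k::nat. A k \<in> sets borel) \<Longrightarrow> (\<And>k. bounded (A k)) \<Longrightarrow> indep_vars (\<lambda>_. borel) (\<lambda>k. N (A k)) UNIV"
  using rm unfolding levy_random_measure_def by blast

lemma N_sums: "disjoint_family A \<Longrightarrow> (\<And>k::nat. A k \<in> sets borel) \<Longrightarrow> bounded (\<Union>k. A k) \<Longrightarrow>
    AE \<omega> in P. (\<lambda>k. N (A k) \<omega>) sums N (\<Union>k. A k) \<omega>"
  using rm bounded_subset[of "\<Union>k. A k"] unfolding levy_random_measure_def by blast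

text \<open>Countable additivity along a sequence of empty sets makes a constant series converge,
  which forces the constant to be zero.\<close>

lemma N_empty: "AE \<omega> in P. N {} \<omega> = 0"
proof -
  have "AE \<omega> in P. (\<lambda>k::nat. N {} \<omega>) sums N {} \<omega>"
    using N_sums[of "\<lambda>_. {}"] by (simp add: disjoint_family_on_def)
  then show ?thesis
  proof eventually_elim
    case (elim \<omega>)
    then have "(\<lambda>k::nat. N {} \<omega>) \<longlonglongrightarrow> 0" by (intro summable_LIMSEQ_zero sums_summable)
    then show ?case by (simp add: LIMSEQ_const_iff)
  qed
qed

text \<open>Padding with empty sets reduces finite families to countable additivity.\<close>

lemma N_finite_UN:
  assumes I: "finite I" and A: "disjoint_family_on A I" "\<And>i. i \<in> I \<Longrightarrow> A i \<in> sets borel" "\<And>i. i \<in> I \<Longrightarrow> bounded (A i)"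
  shows "AE \<omega> in P. N (\<Union>i\<in>I. A i) \<omega> = (\<Sum>i\<in>I. N (A i) \<omega>)"
proof -
  obtain h where h: "bij_betw h {0..<card I} I" using ex_bij_betw_nat_finite[OF I] by auto
  define A' where "A' = (\<lambda>k. if k < card I then A (h k) else {})"
  have hI: "h k \<in> I" if "k < card I" for k using h that by (auto simp: bij_betw_def)
  have hinj: "h k = h k' \<longleftrightarrow> k = k'" if "k < card I" "k' < card I" for k k'
    using h that by (auto simp: bij_betw_def inj_on_def)
  have d: "disjoint_family A'"
    using A(1) hI hinj by (auto simp: disjoint_family_on_def A'_def)
  have im: "I = h ` {..<card I}" using h by (auto simp: bij_betw_def atLeast0LessThan)
  have U: "(\<Union>k. A' k) = (\<Union>i\<in>I. A i)"
  proof -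
    have "(\<Union>k. A' k) = (\<Union>i\<in>h ` {..<card I}. A i)" by (auto simp: A'_def split: if_splits)
    then show ?thesis by (simp only: im[symmetric])
  qed
  have "bounded (\<Union>i\<in>I. A i)" using I A(3) by (intro bounded_UN) auto
  then have bA: "bounded (\<Union>k. A' k)" unfolding U .
  have "A' k \<in> sets borel" for k using A(2) hI by (auto simp: A'_def)
  then have "AE \<omega> in P. (\<lambda>k. N (A' k) \<omega>) sums N (\<Union>k. A' k) \<omega>" by (rule N_sums[OF d _ bA])
  then show ?thesis using N_empty
  proof eventually_elim
    case (elim \<omega>)
    have "(\<lambda>k. N (A' k) \<omega>) sums (\<Sum>k\<in>{..<card I}. N (A' k) \<omega>)"
      by (rule sums_finite) (use elim(2) in \<open>auto simp: A'_def\<close>)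
    then have "N (\<Union>k. A' k) \<omega> = (\<Sum>k\<in>{..<card I}. N (A' k) \<omega>)" using elim(1) sums_unique2 by blast
    also have "\<dots> = (\<Sum>k\<in>{0..<card I}. N (A (h k)) \<omega>)" by (simp add: A'_def atLeast0LessThan)
    also have "\<dots> = (\<Sum>i\<in>I. N (A i) \<omega>)" by (rule sum.reindex_bij_betw[OF h])
    finally show ?case unfolding U .
  qed
qed

lemma N_Un:
  assumes "A \<in> sets borel" "B \<in> sets borel" "bounded A" "bounded B" "A \<inter> B = {}"
  shows "AE \<omega> in P. N (A \<union> B) \<omega> = N A \<omega> + N B \<omega>"
  using N_finite_UN[OF finite case_bool_family(1,2,3)[OF assms]]
  unfolding case_bool_family(4)[OF assms] by (simp add: UNIV_bool add.commute)

lemma N_indep_char: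
  assumes I: "finite I" and A: "disjoint_family_on A I" "\<And>i. i \<in> I \<Longrightarrow> A i \<in> sets borel" "\<And>i. i \<in> I \<Longrightarrow> bounded (A i)"
  shows "(CLINT \<omega>|P. iexp (\<Sum>i\<in>I. \<theta> i \<bullet> N (A i) \<omega>)) = (\<Prod>i\<in>I. CLINT \<omega>|P. iexp (\<theta> i \<bullet> N (A i) \<omega>))"
proof -
  obtain h where h: "bij_betw h {0..<card I} I" using ex_bij_betw_nat_finite[OF I] by auto
  define A' where "A' = (\<lambda>k. if k < card I then A (h k) else {})"
  have hI: "h k \<in> I" if "k < card I" for k using h that by (auto simp: bij_betw_def)
  have hinj: "h k = h k' \<longleftrightarrow> k = k'" if "k < card I" "k' < card I" for k k'
    using h that by (auto simp: bij_betw_def inj_on_def)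
  have d: "disjoint_family A'"
    using A(1) hI hinj by (auto simp: disjoint_family_on_def A'_def)
  have "indep_vars (\<lambda>_. borel) (\<lambda>k. N (A' k)) UNIV"
    using A hI by (intro N_indep d) (auto simp: A'_def)
  then have "indep_vars (\<lambda>_. borel) (\<lambda>k. N (A' k)) {0..<card I}" by (rule indep_vars_subset) simp
  then have iv: "indep_vars (\<lambda>_. borel) (\<lambda>k \<omega>. iexp (\<theta> (h k) \<bullet> N (A' k) \<omega>)) {0..<card I}"
    by (rule indep_vars_compose2) simp
  have m: "N (A' k) \<in> borel_measurable P" for k
    using A hI by (intro N_measurable) (auto simp: A'_def)
  have "(CLINT \<omega>|P. (\<Prod>k\<in>{0..<card I}. iexp (\<theta> (h k) \<bullet> N (A' k) \<omega>))) = (\<Prod>k\<in>{0..<card I}. CLINT \<omega>|P. iexp (\<theta> (h k) \<bullet> N (A' k) \<omega>))"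
  proof (rule indep_vars_lebesgue_integral[OF _ iv])
    show "integrable P (\<lambda>\<omega>. iexp (\<theta> (h k) \<bullet> N (A' k) \<omega>))" for k
      by (rule integrable_iexp) (use m in simp)
  qed simp
  also have "\<dots> = (\<Prod>k\<in>{0..<card I}. CLINT \<omega>|P. iexp (\<theta> (h k) \<bullet> N (A (h k)) \<omega>))"
    by (intro prod.cong) (auto simp: A'_def)
  also have "\<dots> = (\<Prod>i\<in>I. CLINT \<omega>|P. iexp (\<theta> i \<bullet> N (A i) \<omega>))"
    by (rule prod.reindex_bij_betw[OF h])
  also have "(\<lambda>\<omega>. \<Prod>k\<in>{0..<card I}. iexp (\<theta> (h k) \<bullet> N (A' k) \<omega>)) = (\<lambda>\<omega>. iexp (\<Sum>i\<in>I. \<theta> i \<bullet> N (A i) \<omega>))"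
  proof
    fix \<omega>
    have "(\<Prod>k\<in>{0..<card I}. iexp (\<theta> (h k) \<bullet> N (A' k) \<omega>)) = (\<Prod>k\<in>{0..<card I}. iexp (\<theta> (h k) \<bullet> N (A (h k)) \<omega>))"
      by (intro prod.cong) (auto simp: A'_def)
    also have "\<dots> = (\<Prod>i\<in>I. iexp (\<theta> i \<bullet> N (A i) \<omega>))" by (rule prod.reindex_bij_betw[OF h])
    also have "\<dots> = iexp (\<Sum>i\<in>I. \<theta> i \<bullet> N (A i) \<omega>)" by (simp add: exp_sum[OF I, symmetric] sum_distrib_left)
    finally show "(\<Prod>k\<in>{0..<card I}. iexp (\<theta> (h k) \<bullet> N (A' k) \<omega>)) = iexp (\<Sum>i\<in>I. \<theta> i \<bullet> N (A i) \<omega>)" .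
  qed
  finally show ?thesis .
qed

lemma char_cong_AE:
  assumes "AE \<omega> in P. X \<omega> = (Y \<omega> :: real)" "X \<in> borel_measurable P" "Y \<in> borel_measurable P"
  shows "(CLINT \<omega>|P. iexp (X \<omega>)) = (CLINT \<omega>|P. iexp (Y \<omega>))"
  by (rule integral_cong_AE) (use assms in auto)

lemma N_Un_char:
  assumes "A \<in> sets borel" "B \<in> sets borel" "bounded A" "bounded B" "A \<inter> B = {}"
  shows "(CLINT \<omega>|P. iexp (\<theta> \<bullet> N (A \<union> B) \<omega>)) = (CLINT \<omega>|P. iexp (\<theta> \<bullet> N A \<omega>)) * (CLINT \<omega>|P. iexp (\<theta> \<bullet> N B \<omega>))"
proof -
  have m: "N A \<in> borel_measurable P" "N B \<in> borel_measurable P" "N (A \<union> B) \<in> borel_measurable P"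
    using assms by (auto intro!: N_measurable)
  have "(CLINT \<omega>|P. iexp (\<theta> \<bullet> N (A \<union> B) \<omega>)) = (CLINT \<omega>|P. iexp (\<theta> \<bullet> N A \<omega> + \<theta> \<bullet> N B \<omega>))"
    by (rule char_cong_AE) (use N_Un[OF assms] m in \<open>auto simp: inner_add_right elim!: eventually_mono\<close>)
  also have "\<dots> = (CLINT \<omega>|P. iexp (\<theta> \<bullet> N A \<omega>)) * (CLINT \<omega>|P. iexp (\<theta> \<bullet> N B \<omega>))"
    using N_indep_char[OF finite case_bool_family(1,2,3)[OF assms], of "\<lambda>_. \<theta>"]
    by (simp add: UNIV_bool mult.commute add.commute)
  finally show ?thesis .
qed

text \<open>Each \<open>has_levy_integral\<close> brings a random measure of its own; uniqueness up
  to null sets allows one \<open>N\<close> to be fixed for all integrals.\<close>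

lemma N_unique:
  assumes N': "levy_random_measure P L N'" and A: "A \<in> sets borel" "bounded A"
  shows "AE \<omega> in P. N A \<omega> = N' A \<omega>"
proof -
  interpret N': random_measure P L N' by unfold_locales (rule N')
  obtain m where m: "m > 0" "A \<subseteq> {-m<..m}" using bounded_subset_Ioc[OF A(2)] .
  show ?thesis
  proof (rule bounded_borel_induct[where Q="\<lambda>A. AE \<omega> in P. N A \<omega> = N' A \<omega>", OF _ A(1) m(2)])
    show "AE \<omega> in P. N {v<..u} \<omega> = N' {v<..u} \<omega>" if "v \<le> u" for v u
      using N_interval[of v u] N'.N_interval[of v u] N_empty N'.N_empty that by (cases "v = u") auto
    show "AE \<omega> in P. N ({-m<..m} - B) \<omega> = N' ({-m<..m} - B) \<omega>"
      if B: "B \<in> sets borel" "B \<subseteq> {-m<..m}" "AE \<omega> in P. N B \<omega> = N' B \<omega>" for B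
    proof -
      have bd: "bounded B" "bounded ({-m<..m} - B)" using bounded_Ioc[OF B(2)] bounded_Ioc[of "{-m<..m} - B" "-m" m]
        by auto
      have "AE \<omega> in P. N ({-m<..m} - B \<union> B) \<omega> = N ({-m<..m} - B) \<omega> + N B \<omega>"
        "AE \<omega> in P. N' ({-m<..m} - B \<union> B) \<omega> = N' ({-m<..m} - B) \<omega> + N' B \<omega>"
        using B bd by (intro N_Un N'.N_Un; auto)+
      moreover have "{-m<..m} - B \<union> B = {-m<..m}" using B(2) by auto
      moreover have "AE \<omega> in P. N {-m<..m} \<omega> = N' {-m<..m} \<omega>"
        using N_interval[of "-m" m] N'.N_interval[of "-m" m] m(1) by auto
      ultimately show ?thesis using B(3) by auto
    qed
    show "AE \<omega> in P. N (\<Union>i. B i) \<omega> = N' (\<Union>i. B i) \<omega>"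
      if B: "disjoint_family B" "\<And>i::nat. B i \<in> sets borel" "\<And>i. B i \<subseteq> {-m<..m}" "\<And>i. AE \<omega> in P. N (B i) \<omega> = N' (B i) \<omega>" for B
    proof -
      have bd: "bounded (\<Union>i. B i)" using B(3) by (intro bounded_Ioc[of _ "-m" m]) blast
      have "AE \<omega> in P. \<forall>i. N (B i) \<omega> = N' (B i) \<omega>" using B(4) by (subst AE_all_countable) auto
      then show ?thesis using N_sums[OF B(1,2) bd] N'.N_sums[OF B(1,2) bd]
        by eventually_elim (simp add: sums_iff)
    qed
  qed (use m(1) in simp)
qed

text \<open>Both sides turn disjoint unions into products, and the right-hand side never vanishes,
  so relative complements are handled by division.\<close>

lemma N_char:
  assumes char: "\<And>v u. v < u \<Longrightarrow> (CLINT \<omega>|P. iexp (\<theta> \<bullet> N {v<..u} \<omega>)) = exp (complex_of_real (u - v) * \<psi>)"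
    and A: "A \<in> sets borel" "bounded A"
  shows "(CLINT \<omega>|P. iexp (\<theta> \<bullet> N A \<omega>)) = exp (complex_of_real (measure lborel A) * \<psi>)"
proof -
  obtain m where m: "m > 0" "A \<subseteq> {-m<..m}" using bounded_subset_Ioc[OF A(2)] .
  have bd: "bounded B" if "B \<subseteq> {-m<..m}" for B
    using that by (rule bounded_Ioc)
  have fin: "emeasure lborel B < \<infinity>" if "B \<subseteq> {-m<..m}" for B
    by (rule emeasure_bounded_finite[OF bd[OF that]])
  have empty: "(CLINT \<omega>|P. iexp (\<theta> \<bullet> N {} \<omega>)) = 1"
  proof -
    have "(CLINT \<omega>|P. iexp (\<theta> \<bullet> N {} \<omega>)) = (CLINT \<omega>|P. iexp 0)"
      by (rule char_cong_AE) (use N_empty N_measurable[of "{}"] in auto)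
    then show ?thesis by (simp add: prob_space)
  qed
  show ?thesis
  proof (rule bounded_borel_induct[where Q="\<lambda>A. (CLINT \<omega>|P. iexp (\<theta> \<bullet> N A \<omega>)) = exp (complex_of_real (measure lborel A) * \<psi>)", OF _ A(1) m(2)])
    show int: "(CLINT \<omega>|P. iexp (\<theta> \<bullet> N {v<..u} \<omega>)) = exp (complex_of_real (measure lborel {v<..u}) * \<psi>)" if "v \<le> u" for v u
      using char[of v u] empty that by (cases "v = u") auto
    show "(CLINT \<omega>|P. iexp (\<theta> \<bullet> N ({-m<..m} - B) \<omega>)) = exp (complex_of_real (measure lborel ({-m<..m} - B)) * \<psi>)"
      if B: "B \<in> sets borel" "B \<subseteq> {-m<..m}" "(CLINT \<omega>|P. iexp (\<theta> \<bullet> N B \<omega>)) = exp (complex_of_real (measure lborel B) * \<psi>)" for B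
    proof -
      have U: "{-m<..m} - B \<union> B = {-m<..m}" using B(2) by auto
      have "exp (complex_of_real (measure lborel {-m<..m}) * \<psi>) = (CLINT \<omega>|P. iexp (\<theta> \<bullet> N ({-m<..m} - B) \<omega>)) * exp (complex_of_real (measure lborel B) * \<psi>)"
        using N_Un_char[of "{-m<..m} - B" B \<theta>] B bd[of B] bd[of "{-m<..m} - B"] int[of "-m" m] m(1) unfolding U by auto
      moreover have "measure lborel ({-m<..m} - B) = measure lborel {-m<..m} - measure lborel B"
        using B fin[of "{-m<..m}"] by (intro measure_Diff) auto
      moreover have "exp (complex_of_real (x - y) * \<psi>) = exp (complex_of_real x * \<psi>) / exp (complex_of_real y * \<psi>)" for x y
        by (simp add: exp_diff[symmetric] left_diff_distrib)
      ultimately show ?thesis by simp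
    qed
    show "(CLINT \<omega>|P. iexp (\<theta> \<bullet> N (\<Union>i. B i) \<omega>)) = exp (complex_of_real (measure lborel (\<Union>i. B i)) * \<psi>)"
      if B: "disjoint_family B" "\<And>i::nat. B i \<in> sets borel" "\<And>i. B i \<subseteq> {-m<..m}"
        "\<And>i. (CLINT \<omega>|P. iexp (\<theta> \<bullet> N (B i) \<omega>)) = exp (complex_of_real (measure lborel (B i)) * \<psi>)" for B
    proof -
      have Us: "(\<Union>i. B i) \<subseteq> {-m<..m}" using B(3) by auto
      have ms[measurable]: "N (B i) \<in> borel_measurable P" "N (\<Union>i. B i) \<in> borel_measurable P" for i
        using B(2) bd[OF B(3)] bd[OF Us] by (auto intro!: N_measurable)
      have "(\<lambda>n. CLINT \<omega>|P. iexp (\<Sum>i<n. \<theta> \<bullet> N (B i) \<omega>)) \<longlonglongrightarrow> (CLINT \<omega>|P. iexp (\<theta> \<bullet> N (\<Union>i. B i) \<omega>))"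
      proof (rule integral_dominated_convergence[where w="\<lambda>_. 1"])
        show "AE \<omega> in P. (\<lambda>n. iexp (\<Sum>i<n. \<theta> \<bullet> N (B i) \<omega>)) \<longlonglongrightarrow> iexp (\<theta> \<bullet> N (\<Union>i. B i) \<omega>)"
          using N_sums[OF B(1,2) bd[OF Us]]
        proof eventually_elim
          case (elim \<omega>)
          have "(\<lambda>i. \<theta> \<bullet> N (B i) \<omega>) sums (\<theta> \<bullet> N (\<Union>i. B i) \<omega>)"
            by (rule bounded_linear.sums[OF bounded_linear_inner_right elim])
          then show ?case unfolding sums_def by (intro tendsto_intros)
        qed
      qed auto
      moreover have "(CLINT \<omega>|P. iexp (\<Sum>i<n. \<theta> \<bullet> N (B i) \<omega>)) = exp (complex_of_real (\<Sum>i<n. measure lborel (B i)) * \<psi>)" for n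
      proof -
        have "(CLINT \<omega>|P. iexp (\<Sum>i<n. \<theta> \<bullet> N (B i) \<omega>)) = (\<Prod>i<n. CLINT \<omega>|P. iexp (\<theta> \<bullet> N (B i) \<omega>))"
          using B(1,2) bd[OF B(3)] by (intro N_indep_char) (auto simp: disjoint_family_on_def)
        also have "\<dots> = exp (complex_of_real (\<Sum>i<n. measure lborel (B i)) * \<psi>)"
          unfolding B(4) by (simp add: exp_sum[symmetric] sum_distrib_right)
        finally show ?thesis .
      qed
      moreover have "(\<lambda>n. exp (complex_of_real (\<Sum>i<n. measure lborel (B i)) * \<psi>)) \<longlonglongrightarrow> exp (complex_of_real (measure lborel (\<Union>i. B i)) * \<psi>)"
      proof -
        have "(\<lambda>i. measure lborel (B i)) sums measure lborel (\<Union>i. B i)"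
          using B fin[OF Us] by (intro measure_UNION) (auto simp: less_top)
        then show ?thesis unfolding sums_def by (intro tendsto_intros)
      qed
      ultimately show ?thesis using LIMSEQ_unique by simp
    qed
  qed (use m(1) in simp)
qed

section \<open>Integrals of simple integrands and their limits\<close>

definition stoch_integral :: "(real \<Rightarrow> real^'d) \<Rightarrow> 'w \<Rightarrow> real" where
  "stoch_integral h = simple_integral N UNIV h"

lemma simple_integrandD:
  assumes "simple_integrand h"
  shows "finite (range h)" "h -` {x} \<in> sets borel" "x \<noteq> 0 \<Longrightarrow> bounded (h -` {x})" "h \<in> borel_measurable borel"
proof -
  have s: "simple_function borel h" and b: "bounded {u. h u \<noteq> 0}" using assms by (auto simp: simple_integrand_def)
  show "finite (range h)" using simple_functionD(1)[OF s] by simp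
  show "h -` {x} \<in> sets borel" using simple_functionD(2)[OF s, of "{x}"] by simp
  show "bounded (h -` {x})" if "x \<noteq> 0" using b by (rule bounded_subset) (use that in auto)
  show "h \<in> borel_measurable borel" by (rule borel_measurable_simple_function[OF s])
qed

lemma simple_integral_measurable:
  assumes "simple_integrand h" "B \<in> sets borel"
  shows "simple_integral N B h \<in> borel_measurable P"
proof -
  have "N (h -` {x} \<inter> B) \<in> borel_measurable P" if "x \<noteq> 0" for x
    using simple_integrandD(2)[OF assms(1), of x] bounded_subset[OF simple_integrandD(3)[OF assms(1) that], of "h -` {x} \<inter> B"] assms(2)
    by (intro N_measurable) auto
  then show ?thesis unfolding simple_integral_def[abs_def]
    by (intro borel_measurable_sum borel_measurable_inner borel_measurable_const) auto
qed

lemma stoch_integral_measurable: "simple_integrand h \<Longrightarrow> stoch_integral h \<in> borel_measurable P"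
  unfolding stoch_integral_def by (rule simple_integral_measurable) auto

text \<open>Cells and coefficients are given separately and coefficients may repeat or vanish. This
  makes linearity visible, unlike the sum over distinct values in
  \<open>simple_integral\<close>.\<close>

definition step_sum :: "'i set \<Rightarrow> ('i \<Rightarrow> real set) \<Rightarrow> ('i \<Rightarrow> real^'d) \<Rightarrow> real \<Rightarrow> real^'d" where
  "step_sum I A c u = (\<Sum>i\<in>I. indicator (A i) u *\<^sub>R c i)"

lemma step_sum_eq:
  assumes "finite I" "disjoint_family_on A I" "i \<in> I" "u \<in> A i"
  shows "step_sum I A c u = c i"
proof -
  have "step_sum I A c u = (\<Sum>j\<in>I. if j = i then c j else 0)"
    unfolding step_sum_def using assms
    by (intro sum.cong refl) (auto simp: indicator_def disjoint_family_on_def)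
  then show ?thesis using assms by simp
qed

lemma step_sum_eq_0: "(\<And>i. i \<in> I \<Longrightarrow> u \<notin> A i) \<Longrightarrow> step_sum I A c u = 0"
  unfolding step_sum_def by (intro sum.neutral) auto

lemma simple_integrand_step_sum:
  assumes I: "finite I" and A: "\<And>i. i \<in> I \<Longrightarrow> A i \<in> sets borel" "\<And>i. i \<in> I \<Longrightarrow> bounded (A i)"
  shows "simple_integrand (step_sum I A c)"
proof -
  have "simple_function borel (\<lambda>u. \<Sum>i\<in>I. indicator (A i) u *\<^sub>R c i)"
  proof (rule simple_function_sum)
    fix i assume i: "i \<in> I"
    have "simple_function borel (indicator (A i) :: real \<Rightarrow> real)" using A(1)[OF i] by (intro simple_function_indicator) auto
    then show "simple_function borel (\<lambda>u. indicator (A i) u *\<^sub>R c i)"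
      by (rule simple_function_compose1[where g="\<lambda>x. x *\<^sub>R c i"])
  qed
  moreover have "bounded {u. step_sum I A c u \<noteq> 0}"
  proof (rule bounded_subset)
    show "bounded (\<Union>i\<in>I. A i)" using I A(2) by (intro bounded_UN) auto
    show "{u. step_sum I A c u \<noteq> 0} \<subseteq> (\<Union>i\<in>I. A i)" using step_sum_eq_0[of I _ A c] by auto
  qed
  ultimately show ?thesis unfolding simple_integrand_def step_sum_def by simp
qed

lemma stoch_integral_step_sum:
  assumes I: "finite I" and A: "disjoint_family_on A I" "\<And>i. i \<in> I \<Longrightarrow> A i \<in> sets borel" "\<And>i. i \<in> I \<Longrightarrow> bounded (A i)"
  shows "AE \<omega> in P. stoch_integral (step_sum I A c) \<omega> = (\<Sum>i\<in>I. c i \<bullet> N (A i) \<omega>)"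
proof -
  let ?f = "step_sum I A c"
  \<comment> \<open>Such indices have no term in \<open>simple_integral\<close>: the value
    \<open>0\<close> is excluded there, and the coefficient of an empty cell need not be a value of
    the function.\<close>
  define I' where "I' = {i\<in>I. c i \<noteq> 0 \<and> A i \<noteq> {}}"
  have fI': "finite I'" using I by (simp add: I'_def)
  have sf: "simple_integrand ?f" by (rule simple_integrand_step_sum[OF I A(2,3)])
  have fr: "finite (range ?f - {0})" using simple_integrandD(1)[OF sf] by simp
  have pre: "?f -` {x} = (\<Union>i\<in>{i\<in>I'. c i = x}. A i)" if "x \<noteq> 0" for x
  proof
    show "?f -` {x} \<subseteq> (\<Union>i\<in>{i\<in>I'. c i = x}. A i)"
    proof
      fix u assume "u \<in> ?f -` {x}"
      then have u: "?f u = x" by simp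
      have "\<exists>i\<in>I. u \<in> A i"
      proof (rule ccontr)
        assume "\<not> ?thesis"
        then have "?f u = 0" by (intro step_sum_eq_0) auto
        then show False using u that by simp
      qed
      then obtain i where i: "i \<in> I" "u \<in> A i" by auto
      then have "c i = x" using step_sum_eq[OF I A(1) i] u by simp
      then show "u \<in> (\<Union>i\<in>{i\<in>I'. c i = x}. A i)" using i that by (auto simp: I'_def)
    qed
    show "(\<Union>i\<in>{i\<in>I'. c i = x}. A i) \<subseteq> ?f -` {x}"
      using step_sum_eq[OF I A(1)] by (auto simp: I'_def)
  qed
  have cI': "c ` I' \<subseteq> range ?f - {0}"
  proof
    fix x assume "x \<in> c ` I'"
    then obtain i u where "i \<in> I" "x = c i" "c i \<noteq> 0" "u \<in> A i" by (auto simp: I'_def)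
    then have "?f u = x" "x \<noteq> 0" using step_sum_eq[OF I A(1)] by auto
    then show "x \<in> range ?f - {0}" by auto
  qed
  have "AE \<omega> in P. \<forall>x\<in>range ?f - {0}. N (?f -` {x}) \<omega> = (\<Sum>i\<in>{i\<in>I'. c i = x}. N (A i) \<omega>)"
  proof (rule AE_finite_allI[OF fr])
    fix x assume "x \<in> range ?f - {0}"
    then have "x \<noteq> 0" by simp
    show "AE \<omega> in P. N (?f -` {x}) \<omega> = (\<Sum>i\<in>{i\<in>I'. c i = x}. N (A i) \<omega>)"
      unfolding pre[OF \<open>x \<noteq> 0\<close>]
      by (rule N_finite_UN) (use A I in \<open>auto simp: I'_def disjoint_family_on_def\<close>)
  qed
  then show ?thesis using N_empty
  proof eventually_elim
    case (elim \<omega>)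
    have "stoch_integral ?f \<omega> = (\<Sum>x\<in>range ?f - {0}. x \<bullet> (\<Sum>i\<in>{i\<in>I'. c i = x}. N (A i) \<omega>))"
      unfolding stoch_integral_def simple_integral_def using elim(1) by (intro sum.cong) auto
    also have "\<dots> = (\<Sum>x\<in>range ?f - {0}. \<Sum>i\<in>{i\<in>I'. c i = x}. c i \<bullet> N (A i) \<omega>)"
      by (intro sum.cong refl) (auto simp: inner_sum_right)
    also have "\<dots> = (\<Sum>i\<in>I'. c i \<bullet> N (A i) \<omega>)"
      by (rule sum.group[OF fI' fr cI'])
    also have "\<dots> = (\<Sum>i\<in>I. c i \<bullet> N (A i) \<omega>)"
      by (rule sum.mono_neutral_left[OF I]) (use elim(2) in \<open>auto simp: I'_def\<close>)
    finally show ?case .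
  qed
qed

end

context random_measure
begin

lemma stoch_integral_lincomb:
  assumes h1: "simple_integrand h1" and h2: "simple_integrand h2"
  shows "simple_integrand (\<lambda>u. a *\<^sub>R h1 u + b *\<^sub>R h2 u)"
    and "AE \<omega> in P. stoch_integral (\<lambda>u. a *\<^sub>R h1 u + b *\<^sub>R h2 u) \<omega> = a * stoch_integral h1 \<omega> + b * stoch_integral h2 \<omega>"
proof -
  \<comment> \<open>The joint level sets refine both functions at once; the pair
    \<open>(0, 0)\<close> is left out because its level set is unbounded.\<close>
  define I where "I = range h1 \<times> range h2 - {(0, 0)}"
  define A where "A = (\<lambda>(x, y). h1 -` {x} \<inter> h2 -` {y})"
  have I: "finite I" unfolding I_def using simple_integrandD(1)[OF h1] simple_integrandD(1)[OF h2] by auto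
  have dA: "disjoint_family_on A I" by (auto simp: A_def disjoint_family_on_def)
  have mA: "A i \<in> sets borel" if "i \<in> I" for i
    using simple_integrandD(2)[OF h1] simple_integrandD(2)[OF h2] by (auto simp: A_def split: prod.splits)
  have bA: "bounded (A i)" if "i \<in> I" for i
  proof -
    obtain x y where i: "i = (x, y)" by fastforce
    then have "x \<noteq> 0 \<or> y \<noteq> 0" using that by (auto simp: I_def)
    then show ?thesis
      using bounded_subset[OF simple_integrandD(3)[OF h1, of x], of "A i"] bounded_subset[OF simple_integrandD(3)[OF h2, of y], of "A i"]
      by (auto simp: A_def i)
  qed
  have eq: "step_sum I A c = (\<lambda>u. c (h1 u, h2 u))" if "c (0, 0) = 0" for c
  proof
    fix u
    show "step_sum I A c u = c (h1 u, h2 u)"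
    proof (cases "(h1 u, h2 u) = (0, 0)")
      case True
      then have "step_sum I A c u = 0" by (intro step_sum_eq_0) (auto simp: A_def I_def)
      then show ?thesis using True that by simp
    next
      case False
      then have "(h1 u, h2 u) \<in> I" "u \<in> A (h1 u, h2 u)" by (auto simp: I_def A_def)
      then show ?thesis by (rule step_sum_eq[OF I dA])
    qed
  qed
  let ?c = "\<lambda>p. a *\<^sub>R fst p + b *\<^sub>R snd p"
  have e: "step_sum I A ?c = (\<lambda>u. a *\<^sub>R h1 u + b *\<^sub>R h2 u)" "step_sum I A fst = h1" "step_sum I A snd = h2"
    by (simp_all add: eq)
  show "simple_integrand (\<lambda>u. a *\<^sub>R h1 u + b *\<^sub>R h2 u)"
    unfolding e(1)[symmetric] by (rule simple_integrand_step_sum[OF I mA bA])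
  have st: "AE \<omega> in P. stoch_integral (step_sum I A c) \<omega> = (\<Sum>i\<in>I. c i \<bullet> N (A i) \<omega>)" for c
    by (rule stoch_integral_step_sum[OF I dA mA bA])
  show "AE \<omega> in P. stoch_integral (\<lambda>u. a *\<^sub>R h1 u + b *\<^sub>R h2 u) \<omega> = a * stoch_integral h1 \<omega> + b * stoch_integral h2 \<omega>"
    using st[of ?c] st[of fst] st[of snd] unfolding e
    by eventually_elim (simp add: inner_add_left sum.distrib sum_distrib_left)
qed

lemma simple_integral_restrict:
  assumes h: "simple_integrand h" and B: "B \<in> sets borel"
  shows "simple_integrand (\<lambda>u. indicator B u *\<^sub>R h u)"
    and "AE \<omega> in P. stoch_integral (\<lambda>u. indicator B u *\<^sub>R h u) \<omega> = simple_integral N B h \<omega>"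
proof -
  define I where "I = range h - {0}"
  define A where "A = (\<lambda>x. h -` {x} \<inter> B)"
  have I: "finite I" unfolding I_def using simple_integrandD(1)[OF h] by auto
  have dA: "disjoint_family_on A I" by (auto simp: A_def disjoint_family_on_def)
  have mA: "A i \<in> sets borel" if "i \<in> I" for i using simple_integrandD(2)[OF h] B by (auto simp: A_def)
  have bA: "bounded (A i)" if "i \<in> I" for i
    using bounded_subset[OF simple_integrandD(3)[OF h, of i], of "A i"] that by (auto simp: A_def I_def)
  have e: "step_sum I A (\<lambda>x. x) = (\<lambda>u. indicator B u *\<^sub>R h u)"
  proof
    fix u
    show "step_sum I A (\<lambda>x. x) u = indicator B u *\<^sub>R h u"
    proof (cases "u \<in> B \<and> h u \<noteq> 0")
      case True
      then have "h u \<in> I" "u \<in> A (h u)" by (auto simp: I_def A_def)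
      from step_sum_eq[OF I dA this, of "\<lambda>x. x"] show ?thesis using True by simp
    next
      case False
      then have "step_sum I A (\<lambda>x. x) u = 0" by (intro step_sum_eq_0) (auto simp: A_def I_def)
      then show ?thesis using False by auto
    qed
  qed
  show "simple_integrand (\<lambda>u. indicator B u *\<^sub>R h u)"
    unfolding e[symmetric] by (rule simple_integrand_step_sum[OF I mA bA])
  have "AE \<omega> in P. stoch_integral (step_sum I A (\<lambda>x. x)) \<omega> = (\<Sum>i\<in>I. i \<bullet> N (A i) \<omega>)"
    by (rule stoch_integral_step_sum[OF I dA mA bA])
  then show "AE \<omega> in P. stoch_integral (\<lambda>u. indicator B u *\<^sub>R h u) \<omega> = simple_integral N B h \<omega>"
    unfolding e
    by (simp add: simple_integral_def I_def A_def)
qed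

lemma simple_integral_unique:
  assumes N': "levy_random_measure P L N'" and h: "simple_integrand h"
  shows "AE \<omega> in P. simple_integral N' UNIV h \<omega> = stoch_integral h \<omega>"
proof -
  have "AE \<omega> in P. \<forall>x\<in>range h - {0}. N (h -` {x}) \<omega> = N' (h -` {x}) \<omega>"
    by (rule AE_finite_allI) (use simple_integrandD[OF h] in \<open>auto intro!: N_unique[OF N']\<close>)
  then show ?thesis unfolding stoch_integral_def simple_integral_def
    by eventually_elim (auto intro!: sum.cong)
qed

text \<open>Tied to the fixed \<open>N\<close> and to convergence over the whole line, a form stable
  under linear combinations. It leaves the drift uncontrolled, which explains the constant in
  \<open>wiener_integral_zero_const\<close>.\<close>

definition wiener_integral :: "(real \<Rightarrow> real^'d) \<Rightarrow> ('w \<Rightarrow> real) \<Rightarrow> bool" where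
  "wiener_integral g Z \<longleftrightarrow> Z \<in> borel_measurable P \<and>
     (\<exists>h. (\<forall>n. simple_integrand (h n)) \<and> (AE u in lborel. (\<lambda>n. h n u) \<longlonglongrightarrow> g u) \<and>
        tendsto_in_prob P (\<lambda>n. stoch_integral (h n)) Z)"

lemma has_levy_integral_imp_wiener:
  assumes "has_levy_integral P L g Z"
  shows "wiener_integral g Z"
proof -
  obtain N' h where Z: "Z \<in> borel_measurable P" and N': "levy_random_measure P L N'" and h: "\<And>n. simple_integrand (h n)"
    and ae: "AE u in lborel. (\<lambda>n. h n u) \<longlonglongrightarrow> g u" and t: "tendsto_in_prob P (\<lambda>n. simple_integral N' UNIV (h n)) Z"
    using assms unfolding has_levy_integral_def by blast
  interpret N': random_measure P L N' by unfold_locales (rule N')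
  have "tendsto_in_prob P (\<lambda>n. stoch_integral (h n)) Z"
    by (rule tendsto_in_prob_cong_AE[OF _ _ Z simple_integral_unique[OF N' h] t])
      (use N'.simple_integral_measurable[OF h] stoch_integral_measurable[OF h] in auto)
  then show ?thesis unfolding wiener_integral_def using Z h ae by blast
qed

lemma wiener_integral_lincomb:
  assumes 1: "wiener_integral g1 Z1" and 2: "wiener_integral g2 Z2"
  shows "wiener_integral (\<lambda>u. a *\<^sub>R g1 u + b *\<^sub>R g2 u) (\<lambda>\<omega>. a * Z1 \<omega> + b * Z2 \<omega>)"
proof -
  obtain h1 where Z1: "Z1 \<in> borel_measurable P" and h1: "\<And>n. simple_integrand (h1 n)"
    and ae1: "AE u in lborel. (\<lambda>n. h1 n u) \<longlonglongrightarrow> g1 u" and t1: "tendsto_in_prob P (\<lambda>n. stoch_integral (h1 n)) Z1"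
    using 1 unfolding wiener_integral_def by blast
  obtain h2 where Z2: "Z2 \<in> borel_measurable P" and h2: "\<And>n. simple_integrand (h2 n)"
    and ae2: "AE u in lborel. (\<lambda>n. h2 n u) \<longlonglongrightarrow> g2 u" and t2: "tendsto_in_prob P (\<lambda>n. stoch_integral (h2 n)) Z2"
    using 2 unfolding wiener_integral_def by blast
  let ?h = "\<lambda>n u. a *\<^sub>R h1 n u + b *\<^sub>R h2 n u"
  have sh: "simple_integrand (?h n)" for n by (rule stoch_integral_lincomb(1)[OF h1 h2])
  note [measurable] = stoch_integral_measurable[OF h1] stoch_integral_measurable[OF h2] stoch_integral_measurable[OF sh] Z1 Z2
  have "tendsto_in_prob P (\<lambda>n \<omega>. a * stoch_integral (h1 n) \<omega> + b * stoch_integral (h2 n) \<omega>) (\<lambda>\<omega>. a * Z1 \<omega> + b * Z2 \<omega>)"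
    by (intro tendsto_in_prob_add tendsto_in_prob_cmult t1 t2) measurable
  then have "tendsto_in_prob P (\<lambda>n. stoch_integral (?h n)) (\<lambda>\<omega>. a * Z1 \<omega> + b * Z2 \<omega>)"
  proof (rule tendsto_in_prob_cong_AE[rotated 4])
    show "AE x in P. a * stoch_integral (h1 n) x + b * stoch_integral (h2 n) x = stoch_integral (?h n) x" for n
      using stoch_integral_lincomb(2)[OF h1[of n] h2[of n], of a b] by auto
  qed measurable
  moreover have "AE u in lborel. (\<lambda>n. ?h n u) \<longlonglongrightarrow> a *\<^sub>R g1 u + b *\<^sub>R g2 u"
    using ae1 ae2 by eventually_elim (intro tendsto_intros)
  moreover have "(\<lambda>\<omega>. a * Z1 \<omega> + b * Z2 \<omega>) \<in> borel_measurable P" by measurable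
  moreover have "\<forall>n. simple_integrand (?h n)" using sh by blast
  ultimately show ?thesis unfolding wiener_integral_def by (intro conjI exI[of _ ?h])
qed

lemma wiener_integral_simple:
  assumes h: "simple_integrand h"
  shows "wiener_integral h (stoch_integral h)"
  unfolding wiener_integral_def tendsto_in_prob_def
  using h stoch_integral_measurable[OF h] by (auto intro!: exI[of _ "\<lambda>n. h"])

lemma wiener_integral_cong:
  assumes "wiener_integral g Z" "AE u in lborel. g u = g' u" "AE \<omega> in P. Z \<omega> = Z' \<omega>" "Z' \<in> borel_measurable P"
  shows "wiener_integral g' Z'"
proof -
  obtain h where Z: "Z \<in> borel_measurable P" and h: "\<And>n. simple_integrand (h n)"
    and ae: "AE u in lborel. (\<lambda>n. h n u) \<longlonglongrightarrow> g u" and t: "tendsto_in_prob P (\<lambda>n. stoch_integral (h n)) Z"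
    using assms(1) unfolding wiener_integral_def by blast
  note [measurable] = stoch_integral_measurable[OF h] Z assms(4)
  have "prob {x \<in> space P. norm (stoch_integral (h n) x - Z x) > \<epsilon>} = prob {x \<in> space P. norm (stoch_integral (h n) x - Z' x) > \<epsilon>}" for n \<epsilon>
    by (rule finite_measure_eq_AE) (use assms(3) in \<open>auto elim!: eventually_mono\<close>)
  then have "tendsto_in_prob P (\<lambda>n. stoch_integral (h n)) Z'" using t unfolding tendsto_in_prob_def by simp
  moreover have "AE u in lborel. (\<lambda>n. h n u) \<longlonglongrightarrow> g' u" using ae assms(2) by eventually_elim simp
  ultimately show ?thesis unfolding wiener_integral_def using h assms(4) by blast
qed

lemma wiener_integral_sum:
  assumes "finite F" "\<And>i. i \<in> F \<Longrightarrow> wiener_integral (g i) (Z i)"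
  shows "wiener_integral (\<lambda>u. \<Sum>i\<in>F. a i *\<^sub>R g i u) (\<lambda>\<omega>. \<Sum>i\<in>F. a i * Z i \<omega>)"
  using assms
proof (induction F rule: finite_induct)
  case empty
  have s: "simple_integrand (\<lambda>u. 0 :: real^'d)" by (simp add: simple_integrand_def)
  have "stoch_integral (\<lambda>u. 0) = (\<lambda>\<omega>. 0)" by (auto simp: stoch_integral_def simple_integral_def)
  then show ?case using wiener_integral_simple[OF s] by simp
next
  case (insert i F)
  have "wiener_integral (\<lambda>u. a i *\<^sub>R g i u + 1 *\<^sub>R (\<Sum>i\<in>F. a i *\<^sub>R g i u)) (\<lambda>\<omega>. a i * Z i \<omega> + 1 * (\<Sum>i\<in>F. a i * Z i \<omega>))"
    by (rule wiener_integral_lincomb) (use insert in auto)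
  then show ?case using insert.hyps by simp
qed

lemma wiener_integral_increment:
  assumes "v < u" and [measurable]: "L u \<in> borel_measurable P" "L v \<in> borel_measurable P"
  shows "wiener_integral (\<lambda>s. indicator {v<..u} s *\<^sub>R x) (\<lambda>\<omega>. x \<bullet> (L u \<omega> - L v \<omega>))"
proof -
  let ?I = "{()}" and ?A = "\<lambda>_::unit. {v<..u}" and ?c = "\<lambda>_::unit. x"
  have e: "step_sum ?I ?A ?c = (\<lambda>s. indicator {v<..u} s *\<^sub>R x)" by (auto simp: step_sum_def)
  have b: "bounded {v<..u}" by (rule bounded_Ioc[OF order_refl])
  have s: "simple_integrand (step_sum ?I ?A ?c)" by (rule simple_integrand_step_sum) (use b in auto)
  have "AE \<omega> in P. stoch_integral (step_sum ?I ?A ?c) \<omega> = (\<Sum>i\<in>?I. ?c i \<bullet> N (?A i) \<omega>)"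
    by (rule stoch_integral_step_sum) (use b in \<open>auto simp: disjoint_family_on_def\<close>)
  then have "AE \<omega> in P. stoch_integral (step_sum ?I ?A ?c) \<omega> = x \<bullet> (L u \<omega> - L v \<omega>)"
    using N_interval[OF assms(1)] by eventually_elim simp
  then have "wiener_integral (step_sum ?I ?A ?c) (\<lambda>\<omega>. x \<bullet> (L u \<omega> - L v \<omega>))"
    by (rule wiener_integral_cong[OF wiener_integral_simple[OF s], rotated]) auto
  then show ?thesis unfolding e .
qed

end

lemma integral_simple_integrand:
  fixes F :: "real^'d \<Rightarrow> real"
  assumes h: "simple_integrand h" and F: "F 0 = 0"
  shows "integrable lborel (\<lambda>u. F (h u))"
    and "(\<integral>u. F (h u) \<partial>lborel) = (\<Sum>x\<in>range h - {0}. measure lborel (h -` {x}) * F x)"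
proof -
  have s: "simple_function borel h" and b: "bounded {u. h u \<noteq> 0}" using h by (auto simp: simple_integrand_def)
  have fin: "finite (range h - {0})" using simple_functionD(1)[OF s] by simp
  have mA[measurable]: "h -` {x} \<in> sets borel" for x using simple_functionD(2)[OF s, of "{x}"] by simp
  have bA: "bounded (h -` {x})" if "x \<noteq> 0" for x using b by (rule bounded_subset) (use that in auto)
  have e: "F (h u) = (\<Sum>x\<in>range h - {0}. indicator (h -` {x}) u * F x)" for u
  proof -
    have "(\<Sum>x\<in>range h - {0}. indicator (h -` {x}) u * F x) = (\<Sum>x\<in>range h - {0}. if x = h u then F x else 0)"
      by (intro sum.cong) (auto simp: indicator_def)
    then show ?thesis using fin F by auto
  qed
  have i: "integrable lborel (\<lambda>u. indicator (h -` {x}) u * F x)" if "x \<in> range h - {0}" for x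
    using emeasure_bounded_finite[OF bA[of x]] that
    by (intro integrable_mult_left integrable_real_indicator) auto
  show "integrable lborel (\<lambda>u. F (h u))" unfolding e using i by (intro Bochner_Integration.integrable_sum)
  show "(\<integral>u. F (h u) \<partial>lborel) = (\<Sum>x\<in>range h - {0}. measure lborel (h -` {x}) * F x)"
    unfolding e by (subst Bochner_Integration.integral_sum[OF i]) auto
qed

section \<open>Gaussian random measures and their covariance\<close>

locale gaussian_random_measure = random_measure P L N for P :: "'w measure" and L :: "real \<Rightarrow> 'w \<Rightarrow> real^'d" and N +
  fixes b :: "real^'d" and S :: "real^'d^'d"
  assumes S_sym: "transpose S = S" and S_psd: "\<And>x. 0 \<le> x \<bullet> (S *v x)"
    and char: "\<And>\<theta> v u. v < u \<Longrightarrow> (CLINT \<omega>|P. iexp (\<theta> \<bullet> N {v<..u} \<omega>)) =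
        exp (complex_of_real (u - v) * (\<i> * complex_of_real (\<theta> \<bullet> b) - complex_of_real (\<theta> \<bullet> (S *v \<theta>)) / 2))"
begin

definition q :: "real^'d \<Rightarrow> real" where "q x = x \<bullet> (S *v x)"

definition Qf :: "(real \<Rightarrow> real^'d) \<Rightarrow> real" where "Qf h = (\<integral>u. q (h u) \<partial>lborel)"

lemma q_nonneg: "q x \<ge> 0" unfolding q_def by (rule S_psd)

lemma q_0[simp]: "q 0 = 0" by (simp add: q_def)

lemma S_comm: "x \<bullet> (S *v y) = y \<bullet> (S *v x)"
  by (metis S_sym dot_lmul_matrix inner_commute transpose_matrix_vector)

lemma q_add: "q (x + y) = q x + 2 * (x \<bullet> (S *v y)) + q y"
  unfolding q_def using S_comm[of y x] by (simp add: matrix_vector_right_distrib inner_add_left inner_add_right)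

lemma q_scale: "q (c *\<^sub>R x) = c\<^sup>2 * q x"
  unfolding q_def by (simp add: matrix_vector_mult_scaleR power2_eq_square)

lemma continuous_q: "continuous_on UNIV q"
  unfolding q_def by (intro continuous_intros matrix_vector_mult_linear_continuous_on)

lemma S_measurable: "(\<lambda>x. S *v x) \<in> borel_measurable borel"
  by (intro borel_measurable_continuous_onI matrix_vector_mult_linear_continuous_on)

lemma q_measurable: "q \<in> borel_measurable borel"
  by (intro borel_measurable_continuous_onI continuous_q)

text \<open>Young's inequality for the covariance form: \<open>q\<close> is nonnegative at
  \<open>sqrt K\<close> times \<open>x\<close> plus or minus \<open>y\<close> divided by
  \<open>sqrt K\<close>.\<close>

lemma two_abs_S_le:
  assumes "K > 0"
  shows "2 * \<bar>x \<bullet> (S *v y)\<bar> \<le> K * q x + q y / K"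
proof -
  have K: "sqrt K * sqrt K = K" "sqrt K > 0" using assms by auto
  have e: "q (sqrt K *\<^sub>R x + (s / sqrt K) *\<^sub>R y) = K * q x + 2 * s * (x \<bullet> (S *v y)) + s\<^sup>2 * (q y / K)" for s
    unfolding q_add q_scale using K assms
    by (simp add: matrix_vector_mult_scaleR power_divide)
  from e[of 1] e[of "-1"] q_nonneg[of "sqrt K *\<^sub>R x + (1 / sqrt K) *\<^sub>R y"] q_nonneg[of "sqrt K *\<^sub>R x + (-1 / sqrt K) *\<^sub>R y"]
  show ?thesis by (auto simp: abs_le_iff abs_if)
qed

lemma char_stoch_integral:
  assumes h: "simple_integrand h"
  shows "(CLINT \<omega>|P. iexp (stoch_integral h \<omega>)) = exp (\<i> * complex_of_real (\<integral>u. h u \<bullet> b \<partial>lborel) - complex_of_real (Qf h) / 2)"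
proof -
  let ?I = "range h - {0}" and ?\<psi> = "\<lambda>\<theta>. \<i> * complex_of_real (\<theta> \<bullet> b) - complex_of_real (\<theta> \<bullet> (S *v \<theta>)) / 2"
  note hD = simple_integrandD[OF h]
  have "(CLINT \<omega>|P. iexp (stoch_integral h \<omega>)) = (\<Prod>x\<in>?I. CLINT \<omega>|P. iexp (x \<bullet> N (h -` {x}) \<omega>))"
    unfolding stoch_integral_def simple_integral_def using hD
    by (subst N_indep_char[symmetric]) (auto simp: disjoint_family_on_def)
  also have "\<dots> = (\<Prod>x\<in>?I. exp (complex_of_real (measure lborel (h -` {x})) * ?\<psi> x))"
    using hD by (intro prod.cong refl N_char char) auto
  also have "\<dots> = exp (\<Sum>x\<in>?I. complex_of_real (measure lborel (h -` {x})) * ?\<psi> x)"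
    using hD(1) by (simp add: exp_sum)
  also have "(\<Sum>x\<in>?I. complex_of_real (measure lborel (h -` {x})) * ?\<psi> x) =
      \<i> * complex_of_real (\<Sum>x\<in>?I. measure lborel (h -` {x}) * (x \<bullet> b)) - complex_of_real (\<Sum>x\<in>?I. measure lborel (h -` {x}) * q x) / 2"
    by (simp add: q_def sum_distrib_left sum_subtractf sum_divide_distrib right_diff_distrib mult_ac)
  finally show ?thesis
    unfolding Qf_def using integral_simple_integrand(2)[OF h, of "\<lambda>x. x \<bullet> b"] integral_simple_integrand(2)[OF h, of q] by simp
qed

lemma norm_char_stoch_integral: "simple_integrand h \<Longrightarrow> norm (CLINT \<omega>|P. iexp (stoch_integral h \<omega>)) = exp (- Qf h / 2)"
  by (simp add: char_stoch_integral)

text \<open>The characteristic function of a simple integral has modulus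
  \<open>exp (- Qf h / 2)\<close>, whatever the drift. Convergence in probability brings the
  characteristic functions of differences close to \<open>1\<close>, so the approximants are Cauchy
  for \<open>Qf\<close>, and Fatou's lemma passes to the limit.\<close>

lemma wiener_approx_L2:
  assumes Z: "Z \<in> borel_measurable P" and h: "\<And>n. simple_integrand (h n)"
    and ae: "AE u in lborel. (\<lambda>n. h n u) \<longlonglongrightarrow> g u" and g[measurable]: "g \<in> borel_measurable borel"
    and t: "tendsto_in_prob P (\<lambda>n. stoch_integral (h n)) Z" and \<epsilon>: "\<epsilon> > 0"
  shows "\<exists>n0. \<forall>n\<ge>n0. integrable lborel (\<lambda>u. q (h n u - g u)) \<and> (\<integral>u. q (h n u - g u) \<partial>lborel) \<le> \<epsilon>"
proof -
  note [measurable] = stoch_integral_measurable[OF h] Z simple_integrandD(4)[OF h] q_measurable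
  define d where "d = (\<lambda>n. \<integral>x. min 2 \<bar>stoch_integral (h n) x - Z x\<bar> \<partial>P)"
  have d: "d \<longlonglongrightarrow> 0" unfolding d_def by (rule tendsto_in_prob_integral_min[OF _ _ t]) measurable
  \<comment> \<open>Chosen so that a characteristic function within \<open>\<eta>\<close> of
    \<open>1\<close> has modulus above \<open>exp (- \<epsilon> / 2)\<close>, which means a variance
    below \<open>\<epsilon>\<close>.\<close>
  define \<eta> where "\<eta> = 1 - exp (- \<epsilon> / 2)"
  have "\<eta> > 0" using \<epsilon> by (simp add: \<eta>_def)
  then obtain n0 where n0: "\<And>n. n \<ge> n0 \<Longrightarrow> d n < \<eta> / 2"
    using order_tendstoD(2)[OF d, of "\<eta> / 2"] unfolding eventually_sequentially by auto
  have sd: "simple_integrand (\<lambda>u. h m u - h n u)" for m n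
    using stoch_integral_lincomb(1)[OF h h, of 1 m "-1" n] by simp
  have Qs: "Qf (\<lambda>u. h m u - h n u) \<le> \<epsilon>" if mn: "m \<ge> n0" "n \<ge> n0" for m n
  proof -
    have a: "AE \<omega> in P. stoch_integral (\<lambda>u. h m u - h n u) \<omega> = stoch_integral (h m) \<omega> - stoch_integral (h n) \<omega>"
      using stoch_integral_lincomb(2)[OF h h, of 1 m "-1" n] by simp
    note [measurable] = stoch_integral_measurable[OF sd]
    let ?D = "\<lambda>\<omega>. stoch_integral (\<lambda>u. h m u - h n u) \<omega>"
    have "norm ((CLINT \<omega>|P. iexp (?D \<omega>)) - (CLINT \<omega>|P. iexp 0)) \<le> (\<integral>\<omega>. min 2 \<bar>?D \<omega> - 0\<bar> \<partial>P)"
      by (rule norm_char_diff_le) measurable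
    also have "\<dots> \<le> (\<integral>\<omega>. min 2 \<bar>stoch_integral (h m) \<omega> - Z \<omega>\<bar> + min 2 \<bar>stoch_integral (h n) \<omega> - Z \<omega>\<bar> \<partial>P)"
    proof (rule integral_mono_AE)
      show "integrable P (\<lambda>\<omega>. min 2 \<bar>?D \<omega> - 0\<bar>)" by (rule integrable_const_bound[where B=2]) auto
      show "integrable P (\<lambda>\<omega>. min 2 \<bar>stoch_integral (h m) \<omega> - Z \<omega>\<bar> + min 2 \<bar>stoch_integral (h n) \<omega> - Z \<omega>\<bar>)"
        by (rule integrable_const_bound[where B=4]) (auto simp: min_def)
      show "AE \<omega> in P. min 2 \<bar>?D \<omega> - 0\<bar> \<le> min 2 \<bar>stoch_integral (h m) \<omega> - Z \<omega>\<bar> + min 2 \<bar>stoch_integral (h n) \<omega> - Z \<omega>\<bar>"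
        using a by eventually_elim (auto simp: min_def)
    qed
    also have "\<dots> = d m + d n" unfolding d_def
      by (rule Bochner_Integration.integral_add) (rule integrable_const_bound[where B=2]; auto)+
    also have "\<dots> < \<eta>" using n0[OF mn(1)] n0[OF mn(2)] by simp
    finally have "norm ((CLINT \<omega>|P. iexp (?D \<omega>)) - 1) < \<eta>" by (simp add: prob_space)
    then have "1 - \<eta> < norm (CLINT \<omega>|P. iexp (?D \<omega>))"
      using norm_triangle_ineq2[of 1 "CLINT \<omega>|P. iexp (?D \<omega>)"] by (simp add: norm_minus_commute)
    then have "exp (- \<epsilon> / 2) < exp (- Qf (\<lambda>u. h m u - h n u) / 2)"
      unfolding norm_char_stoch_integral[OF sd] \<eta>_def by simp
    then show ?thesis by simp
  qed
  have "integrable lborel (\<lambda>u. q (h n u - g u)) \<and> (\<integral>u. q (h n u - g u) \<partial>lborel) \<le> \<epsilon>" if n: "n \<ge> n0" for n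
  proof -
    have nnQ: "(\<integral>\<^sup>+u. ennreal (q (h m u - h n u)) \<partial>lborel) = ennreal (Qf (\<lambda>u. h m u - h n u))" for m
      unfolding Qf_def by (rule nn_integral_eq_integral) (use integral_simple_integrand(1)[OF sd, of q] q_nonneg in auto)
    have "(\<integral>\<^sup>+u. ennreal (q (h n u - g u)) \<partial>lborel) = (\<integral>\<^sup>+u. liminf (\<lambda>m. ennreal (q (h m u - h n u))) \<partial>lborel)"
      using ae
    proof (intro nn_integral_cong_AE, eventually_elim)
      case (elim u)
      have "(\<lambda>m. q (h m u - h n u)) \<longlonglongrightarrow> q (g u - h n u)"
        using continuous_q elim by (intro continuous_on_tendsto_compose[OF continuous_q] tendsto_intros) auto
      moreover have "q (g u - h n u) = q (h n u - g u)" using q_scale[of "-1" "h n u - g u"] by simp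
      ultimately have "(\<lambda>m. ennreal (q (h m u - h n u))) \<longlonglongrightarrow> ennreal (q (h n u - g u))" by (intro tendsto_ennrealI) simp
      then show ?case by (intro lim_imp_Liminf[symmetric]) auto
    qed
    also have "\<dots> \<le> liminf (\<lambda>m. \<integral>\<^sup>+u. ennreal (q (h m u - h n u)) \<partial>lborel)"
      by (rule nn_integral_liminf) measurable
    also have "\<dots> \<le> liminf (\<lambda>m. ennreal \<epsilon>)"
    proof (rule Liminf_mono)
      show "\<forall>\<^sub>F m in sequentially. (\<integral>\<^sup>+u. ennreal (q (h m u - h n u)) \<partial>lborel) \<le> ennreal \<epsilon>"
        using eventually_ge_at_top[of n0] by eventually_elim (unfold nnQ, use Qs n in \<open>auto intro: ennreal_leI\<close>)
    qed
    also have "\<dots> = ennreal \<epsilon>" by (simp add: Liminf_const)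
    finally have f: "(\<integral>\<^sup>+u. ennreal (q (h n u - g u)) \<partial>lborel) \<le> ennreal \<epsilon>" .
    have i: "integrable lborel (\<lambda>u. q (h n u - g u))"
    proof (rule integrableI_bounded)
      show "(\<integral>\<^sup>+u. ennreal (norm (q (h n u - g u))) \<partial>lborel) < \<infinity>" using le_less_trans[OF f] q_nonneg by simp
    qed measurable
    have "ennreal (\<integral>u. q (h n u - g u) \<partial>lborel) \<le> ennreal \<epsilon>"
      using f by (subst (asm) nn_integral_eq_integral[OF i]) (use q_nonneg in auto)
    then show ?thesis using i \<epsilon> by (simp add: ennreal_le_iff)
  qed
  then show ?thesis by blast
qed

text \<open>For simple approximants the characteristic function factorises up to
  \<open>exp (- \<theta> * c n)\<close>, where \<open>c n\<close> is their covariance with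
  \<open>w\<close>. Mean square convergence sends \<open>c n\<close> to the covariance of the limit,
  which is zero.\<close>

lemma wiener_factor:
  assumes Z: "wiener_integral g Z" and w: "simple_integrand w" and g[measurable]: "g \<in> borel_measurable borel"
    and orth: "(\<integral>u. w u \<bullet> (S *v g u) \<partial>lborel) = 0"
  shows "(CLINT \<omega>|P. iexp (\<theta> * stoch_integral w \<omega> + Z \<omega>)) = (CLINT \<omega>|P. iexp (\<theta> * stoch_integral w \<omega>)) * (CLINT \<omega>|P. iexp (Z \<omega>))"
proof -
  obtain h where Zm: "Z \<in> borel_measurable P" and h: "\<And>n. simple_integrand (h n)"
    and ae: "AE u in lborel. (\<lambda>n. h n u) \<longlonglongrightarrow> g u" and t: "tendsto_in_prob P (\<lambda>n. stoch_integral (h n)) Z"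
    using Z unfolding wiener_integral_def by blast
  have sh: "simple_integrand (\<lambda>u. \<theta> *\<^sub>R w u + 1 *\<^sub>R h n u)" for n by (rule stoch_integral_lincomb(1)[OF w h])
  have sw: "simple_integrand (\<lambda>u. \<theta> *\<^sub>R w u)" using stoch_integral_lincomb(1)[OF w w, of \<theta> 0] by simp
  note [measurable] = stoch_integral_measurable[OF h] Zm simple_integrandD(4)[OF h] q_measurable
    stoch_integral_measurable[OF w] stoch_integral_measurable[OF sh] stoch_integral_measurable[OF sw] simple_integrandD(4)[OF w] S_measurable
  define c where "c = (\<lambda>n. \<integral>u. w u \<bullet> (S *v h n u) \<partial>lborel)"
  have ws: "simple_integrand (\<lambda>u. 1 *\<^sub>R w u + 1 *\<^sub>R h n u)" for n by (rule stoch_integral_lincomb(1)[OF w h])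
  have ci: "integrable lborel (\<lambda>u. w u \<bullet> (S *v h n u))" for n
  proof -
    have "w u \<bullet> (S *v h n u) = (q (1 *\<^sub>R w u + 1 *\<^sub>R h n u) - q (w u) - q (h n u)) / 2" for u by (simp add: q_add)
    note e = this
    show ?thesis unfolding e
      by (intro integrable_divide_zero impI Bochner_Integration.integrable_diff integral_simple_integrand(1)[OF ws]
        integral_simple_integrand(1)[OF w] integral_simple_integrand(1)[OF h] q_0)
  qed
  have cl: "c \<longlonglongrightarrow> 0"
  proof (rule LIMSEQ_I)
    fix r :: real assume r: "r > 0"
    \<comment> \<open>The summand \<open>1\<close> keeps \<open>K\<close> positive when
      \<open>Qf w = 0\<close>. In Young's inequality \<open>Qf w / K\<close> is then below
      \<open>r\<close>, and a mean square error of \<open>r / K\<close> contributes at most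
      \<open>r\<close>.\<close>
    define K where "K = Qf w / r + 1"
    have Qw: "Qf w \<ge> 0" unfolding Qf_def using q_nonneg by simp
    have K: "K > 0" "Qf w / K < r" using r Qw by (auto simp: K_def field_simps intro: add_nonneg_pos)
    have "r / K > 0" using r K by simp
    then obtain n0 where n0: "\<And>n. n \<ge> n0 \<Longrightarrow> integrable lborel (\<lambda>u. q (h n u - g u)) \<and> (\<integral>u. q (h n u - g u) \<partial>lborel) \<le> r / K"
      using wiener_approx_L2[OF Zm h ae g t] by blast
    show "\<exists>no. \<forall>n\<ge>no. norm (c n - 0) < r"
    proof (intro exI[of _ n0] allI impI)
      fix n assume "n \<ge> n0"
      note nn = n0[OF this]
      have iw: "integrable lborel (\<lambda>u. q (w u))" by (rule integral_simple_integrand(1)[OF w]) simp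
      have di: "integrable lborel (\<lambda>u. w u \<bullet> (S *v (h n u - g u)))"
      proof (rule Bochner_Integration.integrable_bound)
        show "integrable lborel (\<lambda>u. q (h n u - g u) + q (w u))" using nn iw by simp
        show "AE u in lborel. norm (w u \<bullet> (S *v (h n u - g u))) \<le> norm (q (h n u - g u) + q (w u))"
        proof (intro AE_I2)
          fix u
          show "norm (w u \<bullet> (S *v (h n u - g u))) \<le> norm (q (h n u - g u) + q (w u))"
            using two_abs_S_le[of 1 "w u" "h n u - g u"] q_nonneg[of "w u"] q_nonneg[of "h n u - g u"] by simp
        qed
        show "(\<lambda>u. w u \<bullet> (S *v (h n u - g u))) \<in> borel_measurable lborel"
          using measurable_compose[OF _ S_measurable, of "\<lambda>u. h n u - g u" lborel] by measurable
      qed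
      have "(\<integral>u. w u \<bullet> (S *v (h n u - g u)) \<partial>lborel) = c n"
      proof -
        have e: "w u \<bullet> (S *v g u) = w u \<bullet> (S *v h n u) - w u \<bullet> (S *v (h n u - g u))" for u
          by (simp add: matrix_vector_mult_diff_distrib inner_diff_right)
        have "(\<integral>u. w u \<bullet> (S *v g u) \<partial>lborel) = c n - (\<integral>u. w u \<bullet> (S *v (h n u - g u)) \<partial>lborel)"
          unfolding e c_def by (rule Bochner_Integration.integral_diff[OF ci di])
        then show ?thesis using orth by simp
      qed
      then have "2 * \<bar>c n\<bar> = 2 * \<bar>\<integral>u. w u \<bullet> (S *v (h n u - g u)) \<partial>lborel\<bar>" by simp
      also have "\<dots> \<le> 2 * (\<integral>u. \<bar>w u \<bullet> (S *v (h n u - g u))\<bar> \<partial>lborel)" using integral_abs_bound by simp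
      also have "\<dots> = (\<integral>u. 2 * \<bar>w u \<bullet> (S *v (h n u - g u))\<bar> \<partial>lborel)" by simp
      also have "\<dots> \<le> (\<integral>u. K * q (h n u - g u) + q (w u) / K \<partial>lborel)"
      proof (rule integral_mono)
        show "integrable lborel (\<lambda>u. 2 * \<bar>w u \<bullet> (S *v (h n u - g u))\<bar>)" using di by simp
        show "integrable lborel (\<lambda>u. K * q (h n u - g u) + q (w u) / K)" using nn iw by simp
        show "2 * \<bar>w u \<bullet> (S *v (h n u - g u))\<bar> \<le> K * q (h n u - g u) + q (w u) / K" for u
          using two_abs_S_le[OF K(1), of "h n u - g u" "w u"] S_comm[of "w u" "h n u - g u"] by simp
      qed
      also have "\<dots> = K * (\<integral>u. q (h n u - g u) \<partial>lborel) + Qf w / K" using nn iw by (simp add: Qf_def)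
      also have "\<dots> \<le> K * (r / K) + Qf w / K" using nn K(1) by (intro add_right_mono mult_left_mono) auto
      also have "\<dots> < 2 * r" using K by simp
      finally show "norm (c n - 0) < r" by simp
    qed
  qed
  have fac: "(CLINT \<omega>|P. iexp (\<theta> * stoch_integral w \<omega> + stoch_integral (h n) \<omega>)) =
      (CLINT \<omega>|P. iexp (\<theta> * stoch_integral w \<omega>)) * (CLINT \<omega>|P. iexp (stoch_integral (h n) \<omega>)) * complex_of_real (exp (- \<theta> * c n))" for n
  proof -
    have "(CLINT \<omega>|P. iexp (\<theta> * stoch_integral w \<omega> + stoch_integral (h n) \<omega>)) = (CLINT \<omega>|P. iexp (stoch_integral (\<lambda>u. \<theta> *\<^sub>R w u + 1 *\<^sub>R h n u) \<omega>))"
    proof (rule char_cong_AE)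
      show "AE \<omega> in P. \<theta> * stoch_integral w \<omega> + stoch_integral (h n) \<omega> = stoch_integral (\<lambda>u. \<theta> *\<^sub>R w u + 1 *\<^sub>R h n u) \<omega>"
        using stoch_integral_lincomb(2)[OF w h[of n], of \<theta> 1] by eventually_elim simp
    qed measurable
    also have "\<dots> = exp (\<i> * complex_of_real (\<integral>u. (\<theta> *\<^sub>R w u + 1 *\<^sub>R h n u) \<bullet> b \<partial>lborel) - complex_of_real (Qf (\<lambda>u. \<theta> *\<^sub>R w u + 1 *\<^sub>R h n u)) / 2)"
      by (rule char_stoch_integral[OF sh])
    also have "(\<integral>u. (\<theta> *\<^sub>R w u + 1 *\<^sub>R h n u) \<bullet> b \<partial>lborel) = (\<integral>u. (\<theta> *\<^sub>R w u) \<bullet> b \<partial>lborel) + (\<integral>u. h n u \<bullet> b \<partial>lborel)"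
      using integral_simple_integrand(1)[OF sw, of "\<lambda>x. x \<bullet> b"] integral_simple_integrand(1)[OF h, of "\<lambda>x. x \<bullet> b" n]
      by (simp add: inner_add_left)
    also have "Qf (\<lambda>u. \<theta> *\<^sub>R w u + 1 *\<^sub>R h n u) = Qf (\<lambda>u. \<theta> *\<^sub>R w u) + 2 * \<theta> * c n + Qf (h n)"
    proof -
      have "q (\<theta> *\<^sub>R w u + 1 *\<^sub>R h n u) = q (\<theta> *\<^sub>R w u) + 2 * \<theta> * (w u \<bullet> (S *v h n u)) + q (h n u)" for u
        by (simp add: q_add)
      then show ?thesis unfolding Qf_def c_def
        using integral_simple_integrand(1)[OF sw, of q] integral_simple_integrand(1)[OF h, of q n] ci[of n] by simp
    qed
    also have "\<i> * complex_of_real ((\<integral>u. (\<theta> *\<^sub>R w u) \<bullet> b \<partial>lborel) + (\<integral>u. h n u \<bullet> b \<partial>lborel)) - complex_of_real (Qf (\<lambda>u. \<theta> *\<^sub>R w u) + 2 * \<theta> * c n + Qf (h n)) / 2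
        = (\<i> * complex_of_real (\<integral>u. (\<theta> *\<^sub>R w u) \<bullet> b \<partial>lborel) - complex_of_real (Qf (\<lambda>u. \<theta> *\<^sub>R w u)) / 2)
          + (\<i> * complex_of_real (\<integral>u. h n u \<bullet> b \<partial>lborel) - complex_of_real (Qf (h n)) / 2) + complex_of_real (- \<theta> * c n)"
      by (simp add: algebra_simps add_divide_distrib)
    also have "exp \<dots> = (CLINT \<omega>|P. iexp (stoch_integral (\<lambda>u. \<theta> *\<^sub>R w u) \<omega>)) * (CLINT \<omega>|P. iexp (stoch_integral (h n) \<omega>)) * complex_of_real (exp (- \<theta> * c n))"
      unfolding exp_add char_stoch_integral[OF sw] char_stoch_integral[OF h] exp_of_real ..
    also have "(CLINT \<omega>|P. iexp (stoch_integral (\<lambda>u. \<theta> *\<^sub>R w u) \<omega>)) = (CLINT \<omega>|P. iexp (\<theta> * stoch_integral w \<omega>))"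
      by (rule char_cong_AE) (use stoch_integral_lincomb(2)[OF w w, of \<theta> 0] in auto)
    finally show ?thesis .
  qed
  have "tendsto_in_prob P (\<lambda>n \<omega>. \<theta> * stoch_integral w \<omega> + stoch_integral (h n) \<omega>) (\<lambda>\<omega>. \<theta> * stoch_integral w \<omega> + Z \<omega>)"
    using t unfolding tendsto_in_prob_def by simp
  then have "(\<lambda>n. CLINT \<omega>|P. iexp (\<theta> * stoch_integral w \<omega> + stoch_integral (h n) \<omega>)) \<longlonglongrightarrow> (CLINT \<omega>|P. iexp (\<theta> * stoch_integral w \<omega> + Z \<omega>))"
    by (rule tendsto_in_prob_char[rotated 2]) measurable
  moreover have "(\<lambda>n. (CLINT \<omega>|P. iexp (\<theta> * stoch_integral w \<omega>)) * (CLINT \<omega>|P. iexp (stoch_integral (h n) \<omega>)) * complex_of_real (exp (- \<theta> * c n)))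
      \<longlonglongrightarrow> (CLINT \<omega>|P. iexp (\<theta> * stoch_integral w \<omega>)) * (CLINT \<omega>|P. iexp (Z \<omega>)) * complex_of_real (exp (- \<theta> * 0))"
    by (intro tendsto_intros cl tendsto_in_prob_char[OF _ _ t]) measurable
  ultimately show ?thesis unfolding fac using LIMSEQ_unique by fastforce
qed

text \<open>The variances of the approximants tend to zero, but their drift integrals need not:
  \<open>b\<close> times the indicator of \<open>{0<..n}\<close> divided by \<open>n\<close> tends
  to \<open>0\<close> pointwise, with vanishing variance and the fixed drift integral
  \<open>b \<bullet> b\<close>. Hence a constant rather than zero.\<close>

lemma wiener_integral_zero_const:
  assumes Z: "wiener_integral (\<lambda>u. 0) Z"
  shows "\<exists>c. AE \<omega> in P. Z \<omega> = c"
proof -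
  have Zm[measurable]: "Z \<in> borel_measurable P" using Z by (simp add: wiener_integral_def)
  have norm1: "norm (CLINT \<omega>|P. iexp (k * Z \<omega>)) = 1" for k
  proof -
    have "wiener_integral (\<lambda>u. k *\<^sub>R 0 + 0 *\<^sub>R 0) (\<lambda>\<omega>. k * Z \<omega> + 0 * Z \<omega>)" by (rule wiener_integral_lincomb[OF Z Z])
    then have "wiener_integral (\<lambda>u. 0) (\<lambda>\<omega>. k * Z \<omega>)" by simp
    then obtain h where h: "\<And>n. simple_integrand (h n)"
      and ae: "AE u in lborel. (\<lambda>n. h n u) \<longlonglongrightarrow> 0" and t: "tendsto_in_prob P (\<lambda>n. stoch_integral (h n)) (\<lambda>\<omega>. k * Z \<omega>)"
      unfolding wiener_integral_def by blast
    have Q: "(\<lambda>n. Qf (h n)) \<longlonglongrightarrow> 0"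
    proof (rule LIMSEQ_I)
      fix r :: real assume r: "r > 0"
      then have "r / 2 > 0" by simp
      have "\<exists>n0. \<forall>n\<ge>n0. integrable lborel (\<lambda>u. q (h n u - 0)) \<and> (\<integral>u. q (h n u - 0) \<partial>lborel) \<le> r / 2"
        by (rule wiener_approx_L2[OF _ h ae _ t \<open>r / 2 > 0\<close>]) auto
      then show "\<exists>no. \<forall>n\<ge>no. norm (Qf (h n) - 0) < r" using r q_nonneg by (auto simp: Qf_def) (smt (verit) field_sum_of_halves)
    qed
    have "(\<lambda>n. norm (CLINT \<omega>|P. iexp (stoch_integral (h n) \<omega>))) \<longlonglongrightarrow> norm (CLINT \<omega>|P. iexp (k * Z \<omega>))"
      by (intro tendsto_norm tendsto_in_prob_char[OF _ _ t]) (use stoch_integral_measurable[OF h] in auto)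
    moreover have "(\<lambda>n. norm (CLINT \<omega>|P. iexp (stoch_integral (h n) \<omega>))) \<longlonglongrightarrow> exp (- 0 / 2)"
      unfolding norm_char_stoch_integral[OF h] by (intro tendsto_intros Q) simp
    ultimately show ?thesis using LIMSEQ_unique by fastforce
  qed
  define \<phi> where "\<phi> = (\<lambda>k. CLINT \<omega>|P. iexp (k * Z \<omega>))"
  \<comment> \<open>A variable on the unit circle whose mean has modulus \<open>1\<close> has
    variance zero and equals its mean.\<close>
  have "AE \<omega> in P. iexp (k * Z \<omega>) = \<phi> k" for k
  proof -
    have i: "integrable P (\<lambda>\<omega>. iexp (k * Z \<omega>))" by (rule integrable_iexp) measurable
    have c2: "(norm (iexp y - z))\<^sup>2 = 1 + (norm z)\<^sup>2 - 2 * Re (iexp y * cnj z)" for y z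
    proof -
      have "(norm (iexp y - z))\<^sup>2 = (norm (iexp y))\<^sup>2 + (norm z)\<^sup>2 - 2 * Re (iexp y * cnj z)"
        unfolding cmod_power2 by (simp add: power2_eq_square algebra_simps)
      then show ?thesis by simp
    qed
    define R where "R = (\<lambda>\<omega>. Re (iexp (k * Z \<omega>) * cnj (\<phi> k)))"
    have iR: "integrable P R" unfolding R_def using i by (intro integrable_Re integrable_mult_left)
    have cR: "(norm (iexp (k * Z \<omega>) - \<phi> k))\<^sup>2 = 1 + (norm (\<phi> k))\<^sup>2 - 2 * R \<omega>" for \<omega>
      unfolding R_def by (rule c2)
    have "(\<integral>\<omega>. (norm (iexp (k * Z \<omega>) - \<phi> k))\<^sup>2 \<partial>P) = 1 + (norm (\<phi> k))\<^sup>2 - 2 * (\<integral>\<omega>. R \<omega> \<partial>P)"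
      unfolding cR using iR by (simp add: prob_space)
    also have "(\<integral>\<omega>. R \<omega> \<partial>P) = Re (CLINT \<omega>|P. iexp (k * Z \<omega>) * cnj (\<phi> k))"
      unfolding R_def by (rule integral_Re) (intro integrable_mult_left i)
    also have "(CLINT \<omega>|P. iexp (k * Z \<omega>) * cnj (\<phi> k)) = \<phi> k * cnj (\<phi> k)" unfolding \<phi>_def by simp
    also have "Re (\<phi> k * cnj (\<phi> k)) = (norm (\<phi> k))\<^sup>2" by (simp add: complex_mult_cnj cmod_power2)
    finally have "(\<integral>\<omega>. (norm (iexp (k * Z \<omega>) - \<phi> k))\<^sup>2 \<partial>P) = 0" using norm1[of k] by (simp add: \<phi>_def)
    moreover have "integrable P (\<lambda>\<omega>. (norm (iexp (k * Z \<omega>) - \<phi> k))\<^sup>2)" unfolding cR using iR by simp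
    ultimately have "AE \<omega> in P. (norm (iexp (k * Z \<omega>) - \<phi> k))\<^sup>2 = 0"
      by (subst (asm) integral_nonneg_eq_0_iff_AE) auto
    then show ?thesis by eventually_elim simp
  qed
  then have ae: "AE \<omega> in P. \<forall>n. iexp ((1 / real (Suc n)) * Z \<omega>) = \<phi> (1 / real (Suc n))"
    unfolding AE_all_countable by blast
  have "\<exists>\<omega>0. \<forall>n. iexp ((1 / real (Suc n)) * Z \<omega>0) = \<phi> (1 / real (Suc n))"
    by (rule eventually_happens'[OF ae_filter_bot ae])
  then obtain \<omega>0 where w0: "\<And>n. iexp ((1 / real (Suc n)) * Z \<omega>0) = \<phi> (1 / real (Suc n))" by blast
  have "AE \<omega> in P. Z \<omega> = Z \<omega>0" using ae
  proof eventually_elim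
    case (elim \<omega>)
    define d where "d = Z \<omega> - Z \<omega>0"
    \<comment> \<open>At the frequency \<open>1 / (n + 1)\<close> the phase lies in
      \<open>(-1, 1)\<close>, where \<open>0\<close> is the only multiple of \<open>2 * pi\<close>.
      As \<open>n\<close> depends on \<open>\<omega>\<close>, all these frequencies were treated
      outside one common null set.\<close>
    obtain n :: nat where n: "real n > \<bar>d\<bar>" using reals_Archimedean2 by blast
    let ?k = "1 / real (Suc n)"
    have "iexp (?k * d) = iexp (?k * Z \<omega>) / iexp (?k * Z \<omega>0)"
      by (simp add: d_def exp_diff[symmetric] right_diff_distrib)
    also have "\<dots> = 1" using elim[rule_format, of n] w0[of n] exp_not_eq_zero by (metis divide_self)
    finally obtain j :: int where j: "?k * d = of_int (2 * j) * pi" unfolding exp_eq_1 by auto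
    have "\<bar>?k * d\<bar> < 1" using n by (simp add: abs_mult field_simps)
    then have "\<bar>real_of_int (2 * j)\<bar> * pi < 1" unfolding j by (simp add: abs_mult)
    have "j = 0"
    proof (rule ccontr)
      assume "j \<noteq> 0"
      then have "1 \<le> \<bar>2 * j\<bar>" by simp
      then have "1 \<le> \<bar>real_of_int (2 * j)\<bar>" by linarith
      then have "1 * pi \<le> \<bar>real_of_int (2 * j)\<bar> * pi" by (rule mult_right_mono) simp
      then show False using \<open>\<bar>real_of_int (2 * j)\<bar> * pi < 1\<close> pi_gt3 by linarith
    qed
    then have "?k * d = 0" using j by simp
    then show ?case by (simp add: d_def)
  qed
  then show ?thesis by blast
qed

end

subsection \<open>Adaptedness and quasi-invariance\<close>

lemma sets_Collect_countable_ball: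
  assumes "countable Q" "\<And>j. j \<in> Q \<Longrightarrow> {x \<in> space M. P j x} \<in> sets M"
  shows "{x \<in> space M. \<forall>j\<in>Q. P j x} \<in> sets M"
proof -
  have "{x \<in> space M. \<forall>j\<in>Q. P j x} = space M - (\<Union>j\<in>Q. space M - {x \<in> space M. P j x})" by auto
  also have "\<dots> \<in> sets M" using assms by (intro sets.Diff sets.top sets.countable_UN') auto
  finally show ?thesis .
qed

context random_measure
begin

text \<open>\<open>F\<close> need not contain the null sets, so measurability is obtained up to
  almost sure equality; in this form it is stable under the operations of
  \<open>bounded_borel_induct\<close>.\<close>

lemma N_adapted:
  assumes F: "space F = space P" "sets F \<subseteq> sets P"
    and inc: "\<And>v u. v < u \<Longrightarrow> u \<le> t \<Longrightarrow> (\<lambda>\<omega>. L u \<omega> - L v \<omega>) \<in> borel_measurable F"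
    and A: "A \<in> sets borel" "bounded A" "A \<subseteq> {..t}"
  shows "\<exists>Y\<in>borel_measurable F. AE \<omega> in P. N A \<omega> = Y \<omega>"
proof -
  obtain m where m: "m > 0" "A \<subseteq> {-m<..m}" using bounded_subset_Ioc[OF A(2)] .
  \<comment> \<open>Subtracting \<open>\<bar>t\<bar>\<close> ensures \<open>a \<le> c\<close> even
    when \<open>t < - m\<close>.\<close>
  define a where "a = - m - \<bar>t\<bar>"
  define c where "c = min m t"
  have ac: "a \<le> c" "c \<le> t" using m(1) by (auto simp: a_def c_def)
  have Ac: "A \<subseteq> {a<..c}"
  proof
    fix x assume "x \<in> A"
    then have "x \<in> {-m<..m}" "x \<in> {..t}" using m(2) A(3) by auto
    then show "x \<in> {a<..c}" by (auto simp: a_def c_def)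
  qed
  show ?thesis
  proof (rule bounded_borel_induct[where Q="\<lambda>A. \<exists>Y\<in>borel_measurable F. AE \<omega> in P. N A \<omega> = Y \<omega>", OF ac(1) A(1) Ac])
    show int: "\<exists>Y\<in>borel_measurable F. AE \<omega> in P. N {v<..u} \<omega> = Y \<omega>" if "v \<le> u" "u \<le> c" for v u
    proof (cases "v = u")
      case True
      then show ?thesis using N_empty by (intro bexI[of _ "\<lambda>_. 0"]) auto
    next
      case False
      then show ?thesis using N_interval[of v u] inc[of v u] that ac(2) by (intro bexI[of _ "\<lambda>\<omega>. L u \<omega> - L v \<omega>"]) auto
    qed
    show "\<exists>Y\<in>borel_measurable F. AE \<omega> in P. N ({a<..c} - B) \<omega> = Y \<omega>"
      if B: "B \<in> sets borel" "B \<subseteq> {a<..c}" "\<exists>Y\<in>borel_measurable F. AE \<omega> in P. N B \<omega> = Y \<omega>" for B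
    proof -
      obtain Y1 where Y1: "Y1 \<in> borel_measurable F" "AE \<omega> in P. N B \<omega> = Y1 \<omega>" using B(3) by blast
      obtain Y2 where Y2: "Y2 \<in> borel_measurable F" "AE \<omega> in P. N {a<..c} \<omega> = Y2 \<omega>" using int[OF ac(1)] by blast
      have bd: "bounded B" "bounded ({a<..c} - B)" using bounded_Ioc[OF B(2)] bounded_Ioc[of "{a<..c} - B" a c] by auto
      have "AE \<omega> in P. N ({a<..c} - B \<union> B) \<omega> = N ({a<..c} - B) \<omega> + N B \<omega>"
        using B bd by (intro N_Un) auto
      moreover have "{a<..c} - B \<union> B = {a<..c}" using B(2) by auto
      ultimately have "AE \<omega> in P. N ({a<..c} - B) \<omega> = Y2 \<omega> - Y1 \<omega>" using Y1(2) Y2(2) by auto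
      then show ?thesis using Y1(1) Y2(1) by (intro bexI[of _ "\<lambda>\<omega>. Y2 \<omega> - Y1 \<omega>"]) auto
    qed
    show "\<exists>Y\<in>borel_measurable F. AE \<omega> in P. N (\<Union>i. B i) \<omega> = Y \<omega>"
      if B: "disjoint_family B" "\<And>i::nat. B i \<in> sets borel" "\<And>i. B i \<subseteq> {a<..c}"
        "\<And>i. \<exists>Y\<in>borel_measurable F. AE \<omega> in P. N (B i) \<omega> = Y \<omega>" for B
    proof -
      obtain Y where Y: "\<And>i. Y i \<in> borel_measurable F" "\<And>i. AE \<omega> in P. N (B i) \<omega> = Y i \<omega>" using B(4) by metis
      have bd: "bounded (\<Union>i. B i)" using B(3) by (intro bounded_Ioc[of _ a c]) blast
      have "AE \<omega> in P. \<forall>i. N (B i) \<omega> = Y i \<omega>" unfolding AE_all_countable using Y(2) by blast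
      then have "AE \<omega> in P. N (\<Union>i. B i) \<omega> = lim (\<lambda>n. \<Sum>i<n. Y i \<omega>)" using N_sums[OF B(1,2) bd]
        by eventually_elim (simp add: sums_def limI)
      moreover note [measurable] = Y(1)
      have "(\<lambda>\<omega>. lim (\<lambda>n. \<Sum>i<n. Y i \<omega>)) \<in> borel_measurable F" by measurable
      ultimately show ?thesis by (rule bexI)
    qed
  qed
qed

lemma simple_integral_adapted:
  assumes F: "space F = space P" "sets F \<subseteq> sets P"
    and inc: "\<And>v u. v < u \<Longrightarrow> u \<le> t \<Longrightarrow> (\<lambda>\<omega>. L u \<omega> - L v \<omega>) \<in> borel_measurable F"
    and h: "simple_integrand h"
  shows "\<exists>Y\<in>borel_measurable F. AE \<omega> in P. simple_integral N {..t} h \<omega> = Y \<omega>"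
proof -
  note hD = simple_integrandD[OF h]
  have "\<exists>Y\<in>borel_measurable F. AE \<omega> in P. N (h -` {x} \<inter> {..t}) \<omega> = Y \<omega>" if "x \<noteq> 0" for x
    using hD(2)[of x] bounded_subset[OF hD(3)[OF that], of "h -` {x} \<inter> {..t}"] by (intro N_adapted[OF F inc]) auto
  then obtain Y where Y: "\<And>x. x \<noteq> 0 \<Longrightarrow> Y x \<in> borel_measurable F" "\<And>x. x \<noteq> 0 \<Longrightarrow> AE \<omega> in P. N (h -` {x} \<inter> {..t}) \<omega> = Y x \<omega>"
    by metis
  have "AE \<omega> in P. \<forall>x\<in>range h - {0}. N (h -` {x} \<inter> {..t}) \<omega> = Y x \<omega>"
    by (rule AE_finite_allI) (use hD(1) Y(2) in auto)
  then have "AE \<omega> in P. simple_integral N {..t} h \<omega> = (\<Sum>x\<in>range h - {0}. x \<bullet> Y x \<omega>)"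
    by eventually_elim (auto simp: simple_integral_def intro!: sum.cong)
  moreover have "(\<lambda>\<omega>. \<Sum>x\<in>range h - {0}. x \<bullet> Y x \<omega>) \<in> borel_measurable F"
    using Y(1) by (intro borel_measurable_sum borel_measurable_inner borel_measurable_const) auto
  ultimately show ?thesis by (rule bexI)
qed

text \<open>A subsequence converges almost surely, and \<open>lim\<close> of the adapted versions is
  measurable, including at points where the sequence diverges.\<close>

lemma tendsto_in_prob_adapted:
  fixes Z :: "nat \<Rightarrow> 'w \<Rightarrow> real"
  assumes Z: "\<And>n. Z n \<in> borel_measurable P" "Z' \<in> borel_measurable P" and t: "tendsto_in_prob P Z Z'"
    and Y: "\<And>n. \<exists>Y\<in>borel_measurable F. AE \<omega> in P. Z n \<omega> = Y \<omega>"
  shows "\<exists>Y\<in>borel_measurable F. AE \<omega> in P. Z' \<omega> = Y \<omega>"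
proof -
  obtain r where r: "strict_mono r" "AE x in P. (\<lambda>n. Z (r n) x) \<longlonglongrightarrow> Z' x"
    using tendsto_in_prob_subseq[OF Z t] by blast
  obtain Y where Y: "\<And>n. Y n \<in> borel_measurable F" "\<And>n. AE \<omega> in P. Z n \<omega> = Y n \<omega>" using Y by metis
  have "AE \<omega> in P. \<forall>n. Z n \<omega> = Y n \<omega>" unfolding AE_all_countable using Y(2) by blast
  then have "AE \<omega> in P. Z' \<omega> = lim (\<lambda>n. Y (r n) \<omega>)" using r(2) by eventually_elim (simp add: limI)
  moreover note [measurable] = Y(1)
  have "(\<lambda>\<omega>. lim (\<lambda>n. Y (r n) \<omega>)) \<in> borel_measurable F" by measurable
  ultimately show ?thesis by (rule bexI)
qed

end

context gaussian_random_measure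
begin

text \<open>The approximants may charge times after \<open>t\<close>. Convergence over the Borel set
  \<open>{..t}\<close>, contained in the notion of integrability, yields an adapted limit; it is an
  integral of the same \<open>g\<close> and so differs from \<open>Z\<close> by a constant.\<close>

lemma has_levy_integral_adapted:
  assumes F: "space F = space P" "sets F \<subseteq> sets P"
    and inc: "\<And>v u. v < u \<Longrightarrow> u \<le> t \<Longrightarrow> (\<lambda>\<omega>. L u \<omega> - L v \<omega>) \<in> borel_measurable F"
    and Z: "has_levy_integral P L g Z" and supp: "\<And>u. u > t \<Longrightarrow> g u = 0"
  shows "\<exists>Y\<in>borel_measurable F. AE \<omega> in P. Z \<omega> = Y \<omega>"
proof -
  obtain N' h where N': "levy_random_measure P L N'" and h: "\<And>n. simple_integrand (h n)"
    and ae: "AE u in lborel. (\<lambda>n. h n u) \<longlonglongrightarrow> g u"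
    and B: "\<And>B. B \<in> sets borel \<Longrightarrow> \<exists>Z'\<in>borel_measurable P. tendsto_in_prob P (\<lambda>n. simple_integral N' B (h n)) Z'"
    using Z unfolding has_levy_integral_def by blast
  interpret N': random_measure P L N' by unfold_locales (rule N')
  have tb: "{..t} \<in> sets borel" by simp
  obtain Z' where Z': "Z' \<in> borel_measurable P" "tendsto_in_prob P (\<lambda>n. simple_integral N' {..t} (h n)) Z'"
    using B[OF tb] by blast
  obtain Y where Y: "Y \<in> borel_measurable F" "AE \<omega> in P. Z' \<omega> = Y \<omega>"
    using tendsto_in_prob_adapted[OF N'.simple_integral_measurable[OF h tb] Z'(1,2) N'.simple_integral_adapted[OF F inc h]] by blast
  let ?h = "\<lambda>n u. indicator {..t} u *\<^sub>R h n u"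
  have sh: "simple_integrand (?h n)" for n by (rule simple_integral_restrict(1)[OF h tb])
  have "tendsto_in_prob P (\<lambda>n. stoch_integral (?h n)) Z'"
  proof (rule tendsto_in_prob_cong_AE[OF N'.simple_integral_measurable[OF h tb] stoch_integral_measurable[OF sh] Z'(1) _ Z'(2)])
    fix n
    show "AE \<omega> in P. simple_integral N' {..t} (h n) \<omega> = stoch_integral (?h n) \<omega>"
      using N'.simple_integral_restrict(2)[OF h[of n] tb] simple_integral_unique[OF N' sh[of n]]
      by eventually_elim (simp add: N'.stoch_integral_def)
  qed
  moreover have "AE u in lborel. (\<lambda>n. ?h n u) \<longlonglongrightarrow> g u"
    using ae
  proof eventually_elim
    case (elim u)
    show ?case
    proof (cases "u \<le> t")
      case False
      then show ?thesis using supp[of u] by simp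
    qed (use elim in simp)
  qed
  moreover have "\<forall>n. simple_integrand (?h n)" using sh by blast
  ultimately have w': "wiener_integral g Z'" unfolding wiener_integral_def
    using Z'(1) by (intro conjI exI[of _ ?h])
  have "wiener_integral (\<lambda>u. 1 *\<^sub>R g u + (-1) *\<^sub>R g u) (\<lambda>\<omega>. 1 * Z \<omega> + (-1) * Z' \<omega>)"
    by (rule wiener_integral_lincomb[OF has_levy_integral_imp_wiener[OF Z] w'])
  then have "wiener_integral (\<lambda>u. 0) (\<lambda>\<omega>. Z \<omega> - Z' \<omega>)" by simp
  then obtain c where "AE \<omega> in P. Z \<omega> - Z' \<omega> = c" using wiener_integral_zero_const by blast
  then have "AE \<omega> in P. Z \<omega> = Y \<omega> + c" using Y(2) by eventually_elim simp
  then show ?thesis using Y(1) by (intro bexI[of _ "\<lambda>\<omega>. Y \<omega> + c"]) auto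
qed

text \<open>Existence of the integral forces mean square integrability, since \<open>g\<close> has
  finite \<open>Qf\<close> distance from a simple function. Integrability of the entries of
  \<open>\<Phi>\<close> is later drawn from this.\<close>

lemma wiener_inner_integrable:
  assumes Z: "wiener_integral g Z" and w: "simple_integrand w" and g[measurable]: "g \<in> borel_measurable borel"
  shows "integrable lborel (\<lambda>u. q (g u))" "integrable lborel (\<lambda>u. w u \<bullet> (S *v g u))"
proof -
  obtain h where Zm: "Z \<in> borel_measurable P" and h: "\<And>n. simple_integrand (h n)"
    and ae: "AE u in lborel. (\<lambda>n. h n u) \<longlonglongrightarrow> g u" and t: "tendsto_in_prob P (\<lambda>n. stoch_integral (h n)) Z"
    using Z unfolding wiener_integral_def by blast
  note [measurable] = q_measurable S_measurable simple_integrandD(4)[OF w]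
  obtain n where n: "integrable lborel (\<lambda>u. q (h n u - g u))"
    using wiener_approx_L2[OF Zm h ae g t zero_less_one] by blast
  have hi: "integrable lborel (\<lambda>u. q (h n u))" using integral_simple_integrand(1)[OF h, of q n] by simp
  have iw: "integrable lborel (\<lambda>u. q (w u))" using integral_simple_integrand(1)[OF w, of q] by simp
  show ig: "integrable lborel (\<lambda>u. q (g u))"
  proof (rule Bochner_Integration.integrable_bound)
    show "integrable lborel (\<lambda>u. 2 * q (h n u) + 2 * q (h n u - g u))" using n hi by simp
    show "AE u in lborel. norm (q (g u)) \<le> norm (2 * q (h n u) + 2 * q (h n u - g u))"
    proof (intro AE_I2)
      fix u
      let ?x = "h n u" and ?y = "(-1) *\<^sub>R (h n u - g u)"
      have "q (g u) = q (?x + ?y)" by simp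
      also have "\<dots> = q ?x + 2 * (?x \<bullet> (S *v ?y)) + q ?y" by (rule q_add)
      also have "\<dots> \<le> 2 * q ?x + 2 * q ?y" using two_abs_S_le[of 1 ?x ?y] by simp
      also have "q ?y = q (h n u - g u)" unfolding q_scale by simp
      finally show "norm (q (g u)) \<le> norm (2 * q (h n u) + 2 * q (h n u - g u))"
        using q_nonneg[of "g u"] by simp
    qed
  qed measurable
  show "integrable lborel (\<lambda>u. w u \<bullet> (S *v g u))"
  proof (rule Bochner_Integration.integrable_bound)
    show "integrable lborel (\<lambda>u. q (g u) + q (w u))" using ig iw by simp
    show "AE u in lborel. norm (w u \<bullet> (S *v g u)) \<le> norm (q (g u) + q (w u))"
    proof (intro AE_I2)
      fix u
      show "norm (w u \<bullet> (S *v g u)) \<le> norm (q (g u) + q (w u))"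
        using two_abs_S_le[of 1 "w u" "g u"] q_nonneg[of "w u"] q_nonneg[of "g u"] by simp
    qed
    show "(\<lambda>u. w u \<bullet> (S *v g u)) \<in> borel_measurable lborel"
      using measurable_compose[OF _ S_measurable, of g lborel] by measurable
  qed
qed

lemma inner_S_sum:
  "x \<bullet> (S *v (\<Sum>i\<in>F. a i *\<^sub>R k i)) = (\<Sum>i\<in>F. a i * (x \<bullet> (S *v k i)))"
  by (induction F rule: infinite_finite_induct)
    (auto simp: matrix_vector_right_distrib inner_add_right matrix_vector_mult_scaleR)

lemma std_normal_normalized:
  assumes w: "simple_integrand w" and v: "Qf w > 0"
  shows "distr P borel (\<lambda>\<omega>. (stoch_integral w \<omega> - (\<integral>u. w u \<bullet> b \<partial>lborel)) / sqrt (Qf w)) = std_normal_distribution"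
proof -
  let ?m = "\<integral>u. w u \<bullet> b \<partial>lborel" and ?s = "sqrt (Qf w)"
  let ?W = "\<lambda>\<omega>. (stoch_integral w \<omega> - ?m) / ?s"
  have s: "?s > 0" "?s * ?s = Qf w" using v by auto
  note [measurable] = stoch_integral_measurable[OF w]
  have sw: "simple_integrand (\<lambda>u. c *\<^sub>R w u)" for c using stoch_integral_lincomb(1)[OF w w, of c 0] by simp
  have rd: "real_distribution (distr P borel ?W)"
    unfolding real_distribution_def real_distribution_axioms_def by (auto intro!: prob_space_distr)
  have "char (distr P borel ?W) \<theta> = char std_normal_distribution \<theta>" for \<theta>
  proof -
    let ?c = "\<theta> / ?s"
    have "char (distr P borel ?W) \<theta> = (CLINT \<omega>|P. iexp (\<theta> * ?W \<omega>))"
      unfolding char_def by (rule integral_distr) auto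
    also have "\<dots> = (CLINT \<omega>|P. iexp (?c * stoch_integral w \<omega>) * iexp (- (?c * ?m)))"
      by (intro Bochner_Integration.integral_cong refl) (simp add: exp_add[symmetric] algebra_simps diff_divide_distrib)
    also have "\<dots> = (CLINT \<omega>|P. iexp (?c * stoch_integral w \<omega>)) * iexp (- (?c * ?m))" by simp
    also have "(CLINT \<omega>|P. iexp (?c * stoch_integral w \<omega>)) = (CLINT \<omega>|P. iexp (stoch_integral (\<lambda>u. ?c *\<^sub>R w u) \<omega>))"
    proof (rule char_cong_AE)
      show "AE \<omega> in P. ?c * stoch_integral w \<omega> = stoch_integral (\<lambda>u. ?c *\<^sub>R w u) \<omega>"
        using stoch_integral_lincomb(2)[OF w w, of ?c 0] by eventually_elim simp
    qed (use stoch_integral_measurable[OF sw] in measurable)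
    also have "\<dots> = exp (\<i> * complex_of_real (\<integral>u. (?c *\<^sub>R w u) \<bullet> b \<partial>lborel) - complex_of_real (Qf (\<lambda>u. ?c *\<^sub>R w u)) / 2)"
      by (rule char_stoch_integral[OF sw])
    also have "(\<integral>u. (?c *\<^sub>R w u) \<bullet> b \<partial>lborel) = ?c * ?m" by simp
    also have "Qf (\<lambda>u. ?c *\<^sub>R w u) = \<theta>\<^sup>2"
      using s v by (simp add: Qf_def q_scale power_divide)
    also have "exp (\<i> * complex_of_real (?c * ?m) - complex_of_real (\<theta>\<^sup>2) / 2) * iexp (- (?c * ?m)) = exp (complex_of_real (- (\<theta>\<^sup>2) / 2))"
      by (simp add: exp_add[symmetric])
    finally show ?thesis by (simp only: char_std_normal_distribution exp_of_real)
  qed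
  then show ?thesis by (intro Levy_uniqueness rd real_dist_normal_dist) auto
qed

text \<open>Quasi-invariance in the direction of the covariance with \<open>stoch_integral w\<close>: the part of
  \<open>U\<close> that is uncorrelated with this variable is independent of it, and the law of the latter is
  equivalent to its translates.\<close>

lemma cameron_martin_shift:
  fixes U :: "'q \<Rightarrow> 'w \<Rightarrow> real^'d" and k :: "'q \<Rightarrow> 'd \<Rightarrow> real \<Rightarrow> real^'d" and Vs :: "('w \<Rightarrow> real) set"
  assumes w: "simple_integrand w" and Q: "countable Q"
    and U: "\<And>j i. j \<in> Q \<Longrightarrow> wiener_integral (k j i) (\<lambda>\<omega>. U j \<omega> $ i)" "\<And>j i. j \<in> Q \<Longrightarrow> k j i \<in> borel_measurable borel"
    and V: "\<And>V. V \<in> Vs \<Longrightarrow> \<exists>\<kappa>. wiener_integral \<kappa> V \<and> \<kappa> \<in> borel_measurable borel \<and> (\<forall>u. w u \<bullet> (S *v \<kappa> u) = 0)"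
    and B: "B \<in> sigma_sets (space P) {V -` A \<inter> space P | V A. V \<in> Vs \<and> A \<in> sets borel}"
    and pos: "prob {\<omega> \<in> B. \<forall>j\<in>Q. norm (U j \<omega> - g j) \<le> \<epsilon>} > 0"
  shows "prob {\<omega> \<in> B. \<forall>j\<in>Q. norm (U j \<omega> - g j - (\<chi> i. \<integral>u. w u \<bullet> (S *v k j i u) \<partial>lborel)) \<le> \<epsilon>} > 0"
proof -
  define c where "c = (\<lambda>j i. \<integral>u. w u \<bullet> (S *v k j i u) \<partial>lborel)"
  define v where "v = Qf w"
  have v0: "v \<ge> 0" unfolding v_def Qf_def using q_nonneg by simp
  have iw: "integrable lborel (\<lambda>u. q (w u))" using integral_simple_integrand(1)[OF w, of q] by simp
  show ?thesis
  proof (cases "v = 0")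
    \<comment> \<open>A direction of variance zero has zero covariance with every
      \<open>U j\<close>, since the weight in Young's inequality is free. The translation is then by
      zero.\<close>
    case True
    have c0: "c j i = 0" if j: "j \<in> Q" for j i
    proof -
      note ii = wiener_inner_integrable[OF U(1)[OF j] w U(2)[OF j], of i]
      have b: "2 * \<bar>c j i\<bar> \<le> K * Qf (k j i)" if K: "K > 0" for K
      proof -
        have "2 * \<bar>c j i\<bar> \<le> 2 * (\<integral>u. \<bar>w u \<bullet> (S *v k j i u)\<bar> \<partial>lborel)" unfolding c_def using integral_abs_bound by simp
        also have "\<dots> = (\<integral>u. 2 * \<bar>w u \<bullet> (S *v k j i u)\<bar> \<partial>lborel)" by simp
        also have "\<dots> \<le> (\<integral>u. K * q (k j i u) + q (w u) / K \<partial>lborel)"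
        proof (rule integral_mono)
          show "integrable lborel (\<lambda>u. 2 * \<bar>w u \<bullet> (S *v k j i u)\<bar>)" using ii(2) by simp
          show "integrable lborel (\<lambda>u. K * q (k j i u) + q (w u) / K)" using ii(1) iw by simp
          show "2 * \<bar>w u \<bullet> (S *v k j i u)\<bar> \<le> K * q (k j i u) + q (w u) / K" for u
            using two_abs_S_le[OF K, of "k j i u" "w u"] S_comm[of "w u" "k j i u"] by simp
        qed
        also have "\<dots> = K * Qf (k j i) + v / K" using ii(1) iw by (simp add: Qf_def v_def)
        finally show ?thesis using True by simp
      qed
      have "\<bar>c j i\<bar> \<le> 0"
      proof (rule field_le_epsilon)
        fix e :: real assume e: "e > 0"
        have "Qf (k j i) \<ge> 0" unfolding Qf_def using q_nonneg by simp
        then have "(e / (Qf (k j i) + 1)) * Qf (k j i) \<le> e" using e by (simp add: field_simps)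
        then show "\<bar>c j i\<bar> \<le> 0 + e" using b[of "e / (Qf (k j i) + 1)"] e \<open>Qf (k j i) \<ge> 0\<close> by simp
      qed
      then show ?thesis by simp
    qed
    have "{\<omega> \<in> B. \<forall>j\<in>Q. norm (U j \<omega> - g j - (\<chi> i. c j i)) \<le> \<epsilon>} = {\<omega> \<in> B. \<forall>j\<in>Q. norm (U j \<omega> - g j) \<le> \<epsilon>}"
    proof -
      have "(\<chi> i. c j i) = 0" if "j \<in> Q" for j using c0[OF that] by (simp add: vec_eq_iff)
      then show ?thesis by auto
    qed
    then show ?thesis using pos by (simp add: c_def)
  next
    case False
    then have v: "v > 0" using v0 by simp
    define \<sigma> where "\<sigma> = sqrt v"
    have \<sigma>: "\<sigma> > 0" "\<sigma> * \<sigma> = v" using v by (auto simp: \<sigma>_def)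
    define m where "m = (\<integral>u. w u \<bullet> b \<partial>lborel)"
    define W where "W = (\<lambda>\<omega>. (stoch_integral w \<omega> - m) / \<sigma>)"
    have law: "distr P borel W = std_normal_distribution"
      unfolding W_def m_def \<sigma>_def v_def by (rule std_normal_normalized[OF w]) (use v v_def in simp)
    have SWm[measurable]: "stoch_integral w \<in> borel_measurable P" by (rule stoch_integral_measurable[OF w])
    have Wm[measurable]: "W \<in> borel_measurable P" unfolding W_def by measurable
    \<comment> \<open>Residual of the regression on \<open>stoch_integral w\<close>:
      \<open>c j i\<close> is the covariance of the two variables and \<open>v\<close> the variance
      of the regressor.\<close>
    define R where "R = (\<lambda>j i \<omega>. U j \<omega> $ i - (c j i / v) * stoch_integral w \<omega>)"
    define Zs where "Zs = Vs \<union> {R j i | j i. j \<in> Q}"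
    have Zs: "\<exists>\<kappa>. wiener_integral \<kappa> Z \<and> \<kappa> \<in> borel_measurable borel \<and> integrable lborel (\<lambda>u. w u \<bullet> (S *v \<kappa> u)) \<and> (\<integral>u. w u \<bullet> (S *v \<kappa> u) \<partial>lborel) = 0"
      if "Z \<in> Zs" for Z
    proof (cases "Z \<in> Vs")
      case True
      then obtain \<kappa> where k: "wiener_integral \<kappa> Z" "\<kappa> \<in> borel_measurable borel" "\<forall>u. w u \<bullet> (S *v \<kappa> u) = 0" using V by blast
      then show ?thesis by (intro exI[of _ \<kappa>]) simp
    next
      case False
      then obtain j i where ji: "j \<in> Q" "Z = R j i" using \<open>Z \<in> Zs\<close> by (auto simp: Zs_def)
      let ?\<kappa> = "\<lambda>u. 1 *\<^sub>R k j i u + (- (c j i / v)) *\<^sub>R w u"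
      have "wiener_integral ?\<kappa> (\<lambda>\<omega>. 1 * U j \<omega> $ i + (- (c j i / v)) * stoch_integral w \<omega>)"
        by (rule wiener_integral_lincomb[OF U(1)[OF ji(1)] wiener_integral_simple[OF w]])
      then have 1: "wiener_integral ?\<kappa> Z" by (simp add: ji(2) R_def)
      have 2: "?\<kappa> \<in> borel_measurable borel"
        using U(2)[OF ji(1), of i] simple_integrandD(4)[OF w] by measurable
      note ii = wiener_inner_integrable[OF U(1)[OF ji(1)] w U(2)[OF ji(1)], of i]
      have e: "w u \<bullet> (S *v ?\<kappa> u) = w u \<bullet> (S *v k j i u) - (c j i / v) * q (w u)" for u
        by (simp add: q_def matrix_vector_mult_diff_distrib matrix_vector_mult_scaleR inner_diff_right)
      have 3: "integrable lborel (\<lambda>u. w u \<bullet> (S *v ?\<kappa> u))" unfolding e using ii(2) iw by simp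
      have 4: "(\<integral>u. w u \<bullet> (S *v ?\<kappa> u) \<partial>lborel) = 0"
        unfolding e using ii(2) iw v by (simp add: c_def v_def Qf_def)
      show ?thesis using 1 2 3 4 by blast
    qed
    have "\<forall>Z\<in>Zs. \<exists>\<kappa>. wiener_integral \<kappa> Z \<and> \<kappa> \<in> borel_measurable borel \<and> integrable lborel (\<lambda>u. w u \<bullet> (S *v \<kappa> u)) \<and> (\<integral>u. w u \<bullet> (S *v \<kappa> u) \<partial>lborel) = 0"
      using Zs by blast
    from bchoice[OF this] obtain \<kappa> where \<kappa>: "\<And>Z. Z \<in> Zs \<Longrightarrow> wiener_integral (\<kappa> Z) Z" "\<And>Z. Z \<in> Zs \<Longrightarrow> \<kappa> Z \<in> borel_measurable borel"
      "\<And>Z. Z \<in> Zs \<Longrightarrow> integrable lborel (\<lambda>u. w u \<bullet> (S *v \<kappa> Z u))" "\<And>Z. Z \<in> Zs \<Longrightarrow> (\<integral>u. w u \<bullet> (S *v \<kappa> Z u) \<partial>lborel) = 0"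
      by blast
    have Zm: "Z \<in> borel_measurable P" if "Z \<in> Zs" for Z using \<kappa>(1)[OF that] by (simp add: wiener_integral_def)
    define gens where "gens = {Z -` A \<inter> space P | Z A. Z \<in> Zs \<and> A \<in> sets borel}"
    define G where "G = sigma (space P) gens"
    have gP: "gens \<subseteq> Pow (space P)" by (auto simp: gens_def)
    have gE: "gens \<subseteq> events" using Zm by (auto simp: gens_def intro: measurable_sets)
    have sG: "space G = space P" "sets G = sigma_sets (space P) gens" using gP by (auto simp: G_def)
    have GE: "sets G \<subseteq> events" unfolding sG(2) by (rule sets.sigma_sets_subset[OF gE])
    \<comment> \<open>Every finite linear combination of residuals and past variables is still
      uncorrelated with \<open>stoch_integral w\<close>; this gives independence of the whole family
      jointly and not just one by one.\<close>
    have ind: "indep_set {stoch_integral w -` A \<inter> space P | A. A \<in> sets borel} (sets G)"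
      unfolding sG(2) gens_def
    proof (rule char_factor_imp_indep[OF SWm Zm])
      fix F \<theta> and a :: "('w \<Rightarrow> real) \<Rightarrow> real"
      assume F: "finite F" "F \<subseteq> Zs"
      have wi: "wiener_integral (\<lambda>u. \<Sum>Z\<in>F. a Z *\<^sub>R \<kappa> Z u) (\<lambda>\<omega>. \<Sum>Z\<in>F. a Z * Z \<omega>)"
        by (rule wiener_integral_sum[OF F(1)]) (use \<kappa>(1) F in auto)
      show "(CLINT x|P. iexp (\<theta> * stoch_integral w x + (\<Sum>Z\<in>F. a Z * Z x))) = (CLINT x|P. iexp (\<theta> * stoch_integral w x)) * (CLINT x|P. iexp (\<Sum>Z\<in>F. a Z * Z x))"
      proof (rule wiener_factor[OF wi w])
        show "(\<lambda>u. \<Sum>Z\<in>F. a Z *\<^sub>R \<kappa> Z u) \<in> borel_measurable borel"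
          using \<kappa>(2) F by (intro borel_measurable_sum borel_measurable_scaleR borel_measurable_const) auto
        have "(\<integral>u. (\<Sum>Z\<in>F. a Z * (w u \<bullet> (S *v \<kappa> Z u))) \<partial>lborel) = (\<Sum>Z\<in>F. \<integral>u. a Z * (w u \<bullet> (S *v \<kappa> Z u)) \<partial>lborel)"
          by (rule Bochner_Integration.integral_sum) (use \<kappa>(3) F in auto)
        also have "\<dots> = 0" using \<kappa>(4) F by (intro sum.neutral) auto
        finally show "(\<integral>u. w u \<bullet> (S *v (\<Sum>Z\<in>F. a Z *\<^sub>R \<kappa> Z u)) \<partial>lborel) = 0"
          unfolding inner_S_sum .
      qed
    qed
    have indW: "indep_set {W -` A \<inter> space P | A. A \<in> sets borel} (sets G)"
    proof -
      have sub: "{W -` A \<inter> space P | A. A \<in> sets borel} \<subseteq> {stoch_integral w -` A \<inter> space P | A. A \<in> sets borel}"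
      proof
        fix X assume "X \<in> {W -` A \<inter> space P | A. A \<in> sets borel}"
        then obtain A where A: "X = W -` A \<inter> space P" "A \<in> sets borel" by blast
        let ?f = "\<lambda>x. (x - m) / \<sigma>"
        have "?f -` A \<in> sets borel" using measurable_sets[of ?f borel borel A] A(2) by simp
        moreover have "X = stoch_integral w -` (?f -` A) \<inter> space P" by (auto simp: A(1) W_def)
        ultimately show "X \<in> {stoch_integral w -` A \<inter> space P | A. A \<in> sets borel}" by blast
      qed
      note i = ind[unfolded indep_sets2_eq]
      show ?thesis unfolding indep_sets2_eq
      proof (intro conjI ballI)
        show "{W -` A \<inter> space P | A. A \<in> sets borel} \<subseteq> events" by (rule order_trans[OF sub]) (use i in simp)
        show "sets G \<subseteq> events" by (rule GE)
        show "prob (x \<inter> y) = prob x * prob y" if "x \<in> {W -` A \<inter> space P | A. A \<in> sets borel}" "y \<in> sets G" for x y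
          using i subsetD[OF sub that(1)] that(2) by simp
      qed
    qed
    have Rm: "R j i \<in> borel_measurable G" if "j \<in> Q" for j i
    proof (rule measurableI)
      fix A :: "real set" assume "A \<in> sets borel"
      then have "R j i -` A \<inter> space P \<in> gens" using that by (auto simp: gens_def Zs_def)
      then show "R j i -` A \<inter> space G \<in> sets G" unfolding sG by (rule sigma_sets.Basic)
    qed simp
    have BG: "B \<in> sets G"
    proof -
      have "sigma_sets (space P) {V -` A \<inter> space P | V A. V \<in> Vs \<and> A \<in> sets borel} \<subseteq> sigma_sets (space P) gens"
        by (rule sigma_sets_mono') (auto simp: gens_def Zs_def)
      then show ?thesis using B unfolding sG by blast
    qed
    \<comment> \<open>Rebuilds \<open>U\<close> from the normal coordinate and the residuals, so
      that a shift of the coordinate alone becomes a shift of the path.\<close>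
    define X where "X = (\<lambda>j (p::real \<times> 'w). (\<chi> i. R j i (snd p) + (c j i / v) * (\<sigma> * fst p + m)) :: real^'d)"
    define A where "A = {p \<in> space (borel \<Otimes>\<^sub>M G). \<forall>j\<in>Q. norm (X j p - g j) \<le> \<epsilon>} \<inter> (UNIV \<times> B)"
    have Am: "A \<in> sets (borel \<Otimes>\<^sub>M G)" unfolding A_def
    proof (rule sets.Int)
      show "UNIV \<times> B \<in> sets (borel \<Otimes>\<^sub>M G)" using BG by simp
      show "{p \<in> space (borel \<Otimes>\<^sub>M G). \<forall>j\<in>Q. norm (X j p - g j) \<le> \<epsilon>} \<in> sets (borel \<Otimes>\<^sub>M G)"
      proof (rule sets_Collect_countable_ball[OF Q])
        fix j assume j: "j \<in> Q"
        have [measurable]: "X j \<in> borel_measurable (borel \<Otimes>\<^sub>M G)"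
        proof (rule borel_measurable_vec)
          fix i
          have [measurable]: "R j i \<in> borel_measurable G" by (rule Rm[OF j])
          show "(\<lambda>p. X j p $ i) \<in> borel_measurable (borel \<Otimes>\<^sub>M G)" unfolding X_def by simp
        qed
        show "{p \<in> space (borel \<Otimes>\<^sub>M G). norm (X j p - g j) \<le> \<epsilon>} \<in> sets (borel \<Otimes>\<^sub>M G)" by measurable
      qed
    qed
    have Bs: "B \<subseteq> space P" using sets.sets_into_space[OF BG] sG(1) by simp
    have sW: "\<sigma> * W \<omega> + m = stoch_integral w \<omega>" for \<omega>
      unfolding W_def using \<sigma>(1)
      by (metis diff_add_cancel less_irrefl nonzero_mult_div_cancel_left times_divide_eq_right)
    have X1: "X j (W \<omega>, \<omega>) = U j \<omega>" for j \<omega>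
      by (simp add: X_def R_def vec_eq_iff sW)
    \<comment> \<open>Lowering \<open>W\<close> by \<open>\<sigma>\<close> lowers
      \<open>stoch_integral w\<close> by \<open>\<sigma> * \<sigma> = v\<close>; the coefficient
      \<open>c j i / v\<close> turns this into exactly \<open>c j i\<close>.\<close>
    have X2: "X j (W \<omega> - \<sigma>, \<omega>) = U j \<omega> - (\<chi> i. c j i)" for j \<omega>
    proof -
      have "\<sigma> * (W \<omega> - \<sigma>) + m = (\<sigma> * W \<omega> + m) - \<sigma> * \<sigma>" by (simp add: algebra_simps)
      also have "\<dots> = stoch_integral w \<omega> - v" by (simp only: sW \<sigma>(2))
      finally have "\<sigma> * (W \<omega> - \<sigma>) + m = stoch_integral w \<omega> - v" .
      then have "X j (W \<omega> - \<sigma>, \<omega>) $ i = U j \<omega> $ i - (c j i / v) * stoch_integral w \<omega> + (c j i / v) * (stoch_integral w \<omega> - v)" for i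
        by (simp add: X_def R_def)
      then show ?thesis using v by (simp add: vec_eq_iff right_diff_distrib)
    qed
    have "{\<omega> \<in> space P. (W \<omega>, \<omega>) \<in> A} = {\<omega> \<in> B. \<forall>j\<in>Q. norm (U j \<omega> - g j) \<le> \<epsilon>}"
      using Bs by (auto simp: A_def X1 space_pair_measure sG(1))
    then have "prob {\<omega> \<in> space P. (W \<omega>, \<omega>) \<in> A} > 0" using pos by simp
    then have "prob {\<omega> \<in> space P. (W \<omega> - \<sigma>, \<omega>) \<in> A} > 0"
      by (rule prob_pos_shift_std_normal[OF Wm law sG(1) GE indW Am])
    moreover have "{\<omega> \<in> space P. (W \<omega> - \<sigma>, \<omega>) \<in> A} = {\<omega> \<in> B. \<forall>j\<in>Q. norm (U j \<omega> - g j - (\<chi> i. c j i)) \<le> \<epsilon>}"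
      using Bs by (auto simp: A_def X2 space_pair_measure sG(1) algebra_simps)
    ultimately show ?thesis by (simp add: c_def)
  qed
qed

end

section \<open>Brownian motion as a Gaussian random measure\<close>

lemma levy_exponent_brownian:
  "levy_exponent b S (null_measure borel) \<theta> = \<i> * complex_of_real (\<theta> \<bullet> b) - complex_of_real (\<theta> \<bullet> (S *v \<theta>)) / 2"
proof -
  have "(CLINT x|null_measure borel. (iexp (\<theta> \<bullet> x) - 1 - \<i> * complex_of_real (\<theta> \<bullet> trunc x))) = 0"
    by (rule integral_eq_zero_AE, rule AE_I'[where N=UNIV]) (auto simp: null_sets_def)
  then show ?thesis by (simp add: levy_exponent_def)
qed

text \<open>Only intervals with end point \<open>0\<close> are computed from \<open>L\<close> and
  its copy. Independence of \<open>N\<close> over disjoint intervals makes the characteristic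
  function multiplicative under splitting, and division by nonzero values settles the other
  intervals.\<close>

lemma gaussian_random_measure_of_levy:
  fixes P :: "'w measure" and L :: "real \<Rightarrow> 'w \<Rightarrow> real^'d"
  assumes P: "prob_space P" and L: "two_sided_levy P L b S (null_measure borel)" and N: "levy_random_measure P L N"
  shows "gaussian_random_measure P L N b S"
proof -
  interpret random_measure P L N
    unfolding random_measure_def random_measure_axioms_def using P N by simp
  define \<psi> where "\<psi> = (\<lambda>\<theta>. \<i> * complex_of_real (\<theta> \<bullet> b) - complex_of_real (\<theta> \<bullet> (S *v \<theta>)) / 2)"
  have Lm[measurable]: "L t \<in> borel_measurable P" for t using L by (simp add: two_sided_levy_def)
  have L0: "AE \<omega> in P. L 0 \<omega> = 0" using L by (simp add: two_sided_levy_def levy_process_def)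
  have charL: "(CLINT \<omega>|P. iexp (\<theta> \<bullet> L t \<omega>)) = exp (complex_of_real t * \<psi> \<theta>)" if "t \<ge> 0" for t \<theta>
    using L that unfolding two_sided_levy_def levy_triplet_def levy_exponent_brownian \<psi>_def by blast
  obtain L' where L': "levy_process P L'" "independent_copy P L L'"
    and neg: "AE \<omega> in P. \<forall>t<0. ((\<lambda>s. L' s \<omega>) \<longlongrightarrow> - L t \<omega>) (at_left (- t))"
    using L unfolding two_sided_levy_def by blast
  have L'm: "L' t \<in> borel_measurable P" if "t \<ge> 0" for t using L'(1) that by (simp add: levy_process_def)
  define E :: "(real \<Rightarrow> real^'d) measure" where "E = (\<Pi>\<^sub>M t\<in>{0..}. borel)"
  have hp: "half_path K \<in> P \<rightarrow>\<^sub>M E" if "\<And>t. t \<ge> 0 \<Longrightarrow> K t \<in> borel_measurable P" for K :: "real \<Rightarrow> 'w \<Rightarrow> real^'d"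
    unfolding half_path_def[abs_def] E_def by (rule measurable_restrict) (use that in auto)
  have same: "distr P E (half_path L') = distr P E (half_path L)"
    using L'(2) by (simp add: independent_copy_def E_def Let_def)
  have charL': "(CLINT \<omega>|P. iexp (\<theta> \<bullet> L' t \<omega>)) = exp (complex_of_real t * \<psi> \<theta>)" if t: "t \<ge> 0" for t \<theta>
  proof -
    have Fm: "(\<lambda>p. iexp (\<theta> \<bullet> p t)) \<in> borel_measurable E"
    proof -
      have [measurable]: "(\<lambda>p. p t) \<in> E \<rightarrow>\<^sub>M borel" unfolding E_def by (rule measurable_component_singleton) (use t in simp)
      show ?thesis by measurable
    qed
    have e: "(CLINT p|distr P E (half_path K). iexp (\<theta> \<bullet> p t)) = (CLINT \<omega>|P. iexp (\<theta> \<bullet> K t \<omega>))"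
      if "\<And>t. t \<ge> 0 \<Longrightarrow> K t \<in> borel_measurable P" for K
      using integral_distr[OF hp[OF that] Fm] t by (simp add: half_path_def)
    have "(CLINT \<omega>|P. iexp (\<theta> \<bullet> L' t \<omega>)) = (CLINT p|distr P E (half_path L'). iexp (\<theta> \<bullet> p t))"
      by (rule e[symmetric]) (rule L'm)
    also have "\<dots> = (CLINT p|distr P E (half_path L). iexp (\<theta> \<bullet> p t))" by (simp only: same)
    also have "\<dots> = (CLINT \<omega>|P. iexp (\<theta> \<bullet> L t \<omega>))" by (rule e) (rule Lm)
    finally show ?thesis using charL[OF t] by simp
  qed
  have charneg: "(CLINT \<omega>|P. iexp (\<theta> \<bullet> - L t \<omega>)) = exp (complex_of_real (- t) * \<psi> \<theta>)" if t: "t < 0" for t \<theta>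
  proof -
    \<comment> \<open>Starts at \<open>0\<close> and stays strictly below \<open>- t\<close>, so it
      remains in the time range of \<open>L'\<close> and realises the left limit that defines
      \<open>L t\<close>.\<close>
    define s where "s = (\<lambda>n::nat. - t * (1 - 1 / real (Suc n)))"
    have s0: "s n \<ge> 0" "s n < - t" for n
    proof -
      have "0 \<le> 1 - 1 / real (Suc n)" "0 < 1 / real (Suc n)" by simp_all
      then show "s n \<ge> 0" "s n < - t"
        using t mult_nonneg_nonneg[of "- t" "1 - 1 / real (Suc n)"] mult_pos_pos[of "- t" "1 / real (Suc n)"]
        unfolding s_def right_diff_distrib by simp_all
    qed
    have sl: "s \<longlonglongrightarrow> - t * (1 - 0)" unfolding s_def by (intro tendsto_intros LIMSEQ_Suc[OF lim_1_over_n])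
    have sl': "filterlim s (at_left (- t)) sequentially"
      unfolding filterlim_at using sl s0(2) by (auto simp: less_le)
    have "(\<lambda>n. CLINT \<omega>|P. iexp (\<theta> \<bullet> L' (s n) \<omega>)) \<longlonglongrightarrow> (CLINT \<omega>|P. iexp (\<theta> \<bullet> - L t \<omega>))"
    proof (rule integral_dominated_convergence[where w="\<lambda>_. 1"])
      show "AE \<omega> in P. (\<lambda>n. iexp (\<theta> \<bullet> L' (s n) \<omega>)) \<longlonglongrightarrow> iexp (\<theta> \<bullet> - L t \<omega>)"
        using neg
      proof eventually_elim
        case (elim \<omega>)
        then have "((\<lambda>s. L' s \<omega>) \<longlongrightarrow> - L t \<omega>) (at_left (- t))" using t by blast
        then have "(\<lambda>n. L' (s n) \<omega>) \<longlonglongrightarrow> - L t \<omega>" by (rule filterlim_compose[OF _ sl'])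
        then show ?case by (intro tendsto_intros)
      qed
      show "(\<lambda>\<omega>. iexp (\<theta> \<bullet> L' (s n) \<omega>)) \<in> borel_measurable P" for n
        using L'm[OF s0(1)] by measurable
    qed auto
    moreover have "(\<lambda>n. CLINT \<omega>|P. iexp (\<theta> \<bullet> L' (s n) \<omega>)) \<longlonglongrightarrow> exp (complex_of_real (- t * (1 - 0)) * \<psi> \<theta>)"
      unfolding charL'[OF s0(1)] by (intro tendsto_intros sl)
    ultimately show ?thesis using LIMSEQ_unique by fastforce
  qed
  define c where "c = (\<lambda>\<theta> v u. CLINT \<omega>|P. iexp (\<theta> \<bullet> N {v<..u} \<omega>))"
  have cN: "c \<theta> v u = (CLINT \<omega>|P. iexp (\<theta> \<bullet> (L u \<omega> - L v \<omega>)))" if "v < u" for \<theta> v u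
    unfolding c_def by (rule char_cong_AE) (use N_interval[OF that] N_measurable[of "{v<..u}"] bounded_Ioc[OF order_refl] in auto)
  have split: "c \<theta> v u = c \<theta> v w * c \<theta> w u" if "v < w" "w < u" for \<theta> v w u
  proof -
    have "{v<..w} \<union> {w<..u} = {v<..u}" using that by auto
    then show ?thesis unfolding c_def
      using N_Un_char[of "{v<..w}" "{w<..u}" \<theta>] bounded_Ioc[OF order_refl] by auto
  qed
  have c0u: "c \<theta> 0 u = exp (complex_of_real u * \<psi> \<theta>)" if "0 < u" for \<theta> u
  proof -
    have "c \<theta> 0 u = (CLINT \<omega>|P. iexp (\<theta> \<bullet> L u \<omega>))"
      unfolding cN[OF that] by (rule char_cong_AE) (use L0 in \<open>auto elim!: eventually_mono\<close>)
    then show ?thesis using charL[of u] that by simp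
  qed
  have cv0: "c \<theta> v 0 = exp (complex_of_real (- v) * \<psi> \<theta>)" if "v < 0" for \<theta> v
  proof -
    have "c \<theta> v 0 = (CLINT \<omega>|P. iexp (\<theta> \<bullet> - L v \<omega>))"
      unfolding cN[OF that] by (rule char_cong_AE) (use L0 in \<open>auto elim!: eventually_mono\<close>)
    then show ?thesis using charneg[OF that] by simp
  qed
  have main: "c \<theta> v u = exp (complex_of_real (u - v) * \<psi> \<theta>)" if vu: "v < u" for \<theta> v u
  proof -
    have d: "exp (complex_of_real (x - y) * \<psi> \<theta>) = exp (complex_of_real x * \<psi> \<theta>) / exp (complex_of_real y * \<psi> \<theta>)" for x y
      by (simp add: exp_diff[symmetric] left_diff_distrib)
    consider "v = 0" | "u = 0" | "0 < v" | "u < 0" | "v < 0" "0 < u" by linarith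
    then show ?thesis
    proof cases
      case 1 then show ?thesis using c0u[of u] vu by simp
    next
      case 2 then show ?thesis using cv0[of v] vu by simp
    next
      case 3
      have "exp (complex_of_real u * \<psi> \<theta>) = exp (complex_of_real v * \<psi> \<theta>) * c \<theta> v u"
        using split[OF 3 vu, of \<theta>] c0u[of v \<theta>] c0u[of u \<theta>] 3 vu by simp
      then show ?thesis unfolding d by simp
    next
      case 4
      have "exp (complex_of_real (- v) * \<psi> \<theta>) = c \<theta> v u * exp (complex_of_real (- u) * \<psi> \<theta>)"
        using split[OF vu 4, of \<theta>] cv0[of v \<theta>] cv0[of u \<theta>] 4 vu by simp
      moreover have "u - v = - v - (- u)" by simp
      ultimately show ?thesis using d[of "- v" "- u"] by simp
    next
      case 5
      have "c \<theta> v u = exp (complex_of_real (- v) * \<psi> \<theta>) * exp (complex_of_real u * \<psi> \<theta>)"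
        using split[OF 5, of \<theta>] cv0[OF 5(1)] c0u[OF 5(2)] by simp
      then show ?thesis by (simp add: exp_add[symmetric] algebra_simps)
    qed
  qed
  show ?thesis
  proof unfold_locales
    show "transpose S = S" "\<And>x. 0 \<le> x \<bullet> (S *v x)" using L by (auto simp: two_sided_levy_def levy_triplet_def)
    show "(CLINT \<omega>|P. iexp (\<theta> \<bullet> N {v<..u} \<omega>)) = exp (complex_of_real (u - v) * (\<i> * complex_of_real (\<theta> \<bullet> b) - complex_of_real (\<theta> \<bullet> (S *v \<theta>)) / 2))"
      if "v < u" for \<theta> v u using main[OF that, of \<theta>] by (simp add: c_def \<psi>_def)
  qed
qed

section \<open>Positive probability of a ball around a path\<close>

context prob_space
begin

lemma prob_pos_cover:
  assumes C: "C \<in> events" "prob C > 0" and D: "countable D" "\<And>d. d \<in> D \<Longrightarrow> E d \<in> events"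
    and cov: "AE \<omega> in M. \<omega> \<in> C \<longrightarrow> (\<exists>d\<in>D. \<omega> \<in> E d)"
  shows "\<exists>d\<in>D. prob (C \<inter> E d) > 0"
proof (rule ccontr)
  assume n: "\<not> ?thesis"
  have "AE \<omega> in M. \<omega> \<notin> C \<inter> E d" if "d \<in> D" for d
  proof -
    have "\<not> prob (C \<inter> E d) > 0" using n that by blast
    then have "prob (C \<inter> E d) = 0" using measure_nonneg[of M "C \<inter> E d"] by linarith
    then show ?thesis using C(1) D(2)[OF that] by (subst AE_iff_measurable[of "C \<inter> E d"]) (auto simp: emeasure_eq_measure dest: sets.sets_into_space)
  qed
  then have "AE \<omega> in M. \<forall>d\<in>D. \<omega> \<notin> C \<inter> E d" by (subst AE_ball_countable[OF D(1)]) auto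
  then have "AE \<omega> in M. \<omega> \<notin> C" using cov by eventually_elim auto
  then have "prob C = 0" using C(1) by (subst (asm) AE_iff_measurable[of C]) (auto simp: emeasure_eq_measure dest: sets.sets_into_space)
  then show False using C(2) by simp
qed

lemma prob_pos_AE_ex:
  assumes C: "C \<in> events" "prob C > 0" and G: "AE \<omega> in M. G \<omega>"
  shows "\<exists>\<omega>\<in>C. G \<omega>"
proof (rule ccontr)
  assume "\<not> ?thesis"
  then have "AE \<omega> in M. \<omega> \<notin> C" using G by (auto elim!: eventually_mono)
  then have "prob C = 0" using C(1) by (subst (asm) AE_iff_measurable[of C]) (auto simp: emeasure_eq_measure dest: sets.sets_into_space)
  then show False using C(2) by simp
qed

text \<open>Countably many balls of radius \<open>\<epsilon> / 2\<close> cover the space, so one of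
  them carries positive probability of the current event; this is repeated for each index in
  \<open>F\<close>.\<close>

lemma prob_pos_small_oscillation:
  fixes U :: "'q \<Rightarrow> 'a \<Rightarrow> real^'d"
  assumes "finite F" and U: "\<And>p. p \<in> F \<Longrightarrow> U p \<in> borel_measurable M" and C: "C \<in> events" "prob C > 0" and \<epsilon>: "\<epsilon> > 0"
  shows "\<exists>C'\<in>events. C' \<subseteq> C \<and> prob C' > 0 \<and> (\<forall>\<omega>\<in>C'. \<forall>\<omega>'\<in>C'. \<forall>p\<in>F. norm (U p \<omega> - U p \<omega>') \<le> \<epsilon>)"
  using assms(1,2)
proof (induction F rule: finite_induct)
  case empty
  then show ?case using C by auto
next
  case (insert p F)
  obtain C' where C': "C' \<in> events" "C' \<subseteq> C" "prob C' > 0" "\<And>\<omega> \<omega>' p. \<omega> \<in> C' \<Longrightarrow> \<omega>' \<in> C' \<Longrightarrow> p \<in> F \<Longrightarrow> norm (U p \<omega> - U p \<omega>') \<le> \<epsilon>"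
    using insert.IH[OF insert.prems] by blast
  obtain D :: "(real^'d) set" where D: "countable D" "\<And>X. open X \<Longrightarrow> X \<noteq> {} \<Longrightarrow> \<exists>d\<in>D. d \<in> X"
    using countable_dense_setE by blast
  have [measurable]: "U p \<in> borel_measurable M" using insert.prems by simp
  define E where "E = (\<lambda>d. {\<omega> \<in> space M. norm (U p \<omega> - d) \<le> \<epsilon> / 2})"
  have Em: "E d \<in> events" for d unfolding E_def by measurable
  have cov: "\<exists>d\<in>D. \<omega> \<in> E d" if "\<omega> \<in> C'" for \<omega>
  proof -
    have "\<exists>d\<in>D. d \<in> ball (U p \<omega>) (\<epsilon> / 2)" by (rule D(2)) (use \<epsilon> in auto)
    then show ?thesis using that sets.sets_into_space[OF C'(1)] by (auto simp: E_def dist_norm intro: less_imp_le)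
  qed
  have "\<exists>d\<in>D. prob (C' \<inter> E d) > 0"
    by (rule prob_pos_cover[OF C'(1,3) D(1) Em]) (use cov in simp)
  then obtain d where d: "prob (C' \<inter> E d) > 0" by blast
  show ?case
  proof (intro bexI[of _ "C' \<inter> E d"] conjI ballI)
    show "C' \<inter> E d \<in> events" using C'(1) Em by auto
    show "C' \<inter> E d \<subseteq> C" using C'(2) by auto
    fix \<omega> \<omega>' r assume w: "\<omega> \<in> C' \<inter> E d" "\<omega>' \<in> C' \<inter> E d" "r \<in> insert p F"
    show "norm (U r \<omega> - U r \<omega>') \<le> \<epsilon>"
    proof (cases "r = p")
      case True
      have "norm (U p \<omega> - d) \<le> \<epsilon> / 2" "norm (U p \<omega>' - d) \<le> \<epsilon> / 2" using w by (auto simp: E_def)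
      then show ?thesis using True norm_triangle_ineq4[of "U p \<omega> - d" "U p \<omega>' - d"] by simp
    next
      case False
      then show ?thesis using C'(4) w by auto
    qed
  qed (rule d)
qed

text \<open>The net is taken inside \<open>Q\<close> itself, since path estimates are available at
  points of \<open>Q\<close> only.\<close>

lemma finite_net_in_interval:
  fixes Q :: "real set"
  assumes Q: "Q \<subseteq> {a..c}" and \<delta>: "\<delta> > 0"
  shows "\<exists>F. finite F \<and> F \<subseteq> Q \<and> (\<forall>q\<in>Q. \<exists>p\<in>F. \<bar>q - p\<bar> < \<delta>)"
proof -
  define cell where "cell = (\<lambda>q. \<lfloor>q / \<delta>\<rfloor>)"
  have fin: "finite (cell ` Q)"
  proof (rule finite_subset)
    show "cell ` Q \<subseteq> {\<lfloor>a / \<delta>\<rfloor>..\<lfloor>c / \<delta>\<rfloor>}"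
    proof
      fix j assume "j \<in> cell ` Q"
      then obtain q where "q \<in> Q" "j = cell q" by blast
      then have "a \<le> q" "q \<le> c" "j = cell q" using Q by auto
      then show "j \<in> {\<lfloor>a / \<delta>\<rfloor>..\<lfloor>c / \<delta>\<rfloor>}"
        using \<delta> by (auto simp: cell_def intro!: floor_mono divide_right_mono)
    qed
  qed simp
  define rep where "rep = (\<lambda>j. SOME q. q \<in> Q \<and> cell q = j)"
  have rep: "rep (cell q) \<in> Q" "cell (rep (cell q)) = cell q" if "q \<in> Q" for q
    using someI[of "\<lambda>q'. q' \<in> Q \<and> cell q' = cell q" q] that by (auto simp: rep_def)
  have "\<bar>q - rep (cell q)\<bar> < \<delta>" if "q \<in> Q" for q
  proof -
    have "\<lfloor>q / \<delta>\<rfloor> = \<lfloor>rep (cell q) / \<delta>\<rfloor>" using rep(2)[OF that] by (simp add: cell_def)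
    then have "\<bar>q / \<delta> - rep (cell q) / \<delta>\<bar> < 1" by linarith
    then show ?thesis using \<delta> by (simp add: abs_if field_simps split: if_splits)
  qed
  then show ?thesis using fin rep(1) by (intro exI[of _ "rep ` cell ` Q"]) auto
qed

text \<open>Replaces separability of the space of continuous functions. A common modulus of
  continuity holds on an event of positive probability, so finitely many times control all of
  \<open>Q\<close>; any good point of the final event serves as centre.\<close>

lemma prob_pos_path_ball:
  fixes U :: "real \<Rightarrow> 'a \<Rightarrow> real^'d"
  assumes Q: "countable Q" "Q \<subseteq> {a..c}" and U: "\<And>q. q \<in> Q \<Longrightarrow> U q \<in> borel_measurable M"
    and G: "AE \<omega> in M. G \<omega>" "\<And>\<omega>. G \<omega> \<Longrightarrow> continuous_on {a..c} (\<lambda>t. U t \<omega>)"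
    and B: "B \<in> events" "prob B > 0" and \<epsilon>: "\<epsilon> > 0"
  shows "\<exists>\<omega>0. G \<omega>0 \<and> prob {\<omega> \<in> B. \<forall>q\<in>Q. norm (U q \<omega> - U q \<omega>0) \<le> \<epsilon>} > 0"
proof -
  \<comment> \<open>Uniform continuity makes these events exhaust almost all of the space. The
    thirds of \<open>\<epsilon>\<close> are spent on moving to a net point, on comparing the two
    paths there, and on moving back.\<close>
  define C where "C = (\<lambda>n::nat. {\<omega> \<in> space M. \<forall>p\<in>Q \<times> Q. \<bar>fst p - snd p\<bar> < 1 / real (Suc n) \<longrightarrow> norm (U (fst p) \<omega> - U (snd p) \<omega>) \<le> \<epsilon> / 3})"
  have Cm: "C n \<in> events" for n unfolding C_def
  proof (rule sets_Collect_countable_ball)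
    show "countable (Q \<times> Q)" using Q(1) by simp
    fix p assume "p \<in> Q \<times> Q"
    then have [measurable]: "U (fst p) \<in> borel_measurable M" "U (snd p) \<in> borel_measurable M" using U by auto
    show "{\<omega> \<in> space M. \<bar>fst p - snd p\<bar> < 1 / real (Suc n) \<longrightarrow> norm (U (fst p) \<omega> - U (snd p) \<omega>) \<le> \<epsilon> / 3} \<in> events" by measurable
  qed
  have "AE \<omega> in M. \<omega> \<in> B \<longrightarrow> (\<exists>n\<in>UNIV. \<omega> \<in> C n)"
    using G(1) AE_space
  proof eventually_elim
    case (elim \<omega>)
    have "uniformly_continuous_on {a..c} (\<lambda>t. U t \<omega>)"
      by (rule compact_uniformly_continuous[OF G(2)[OF elim(1)]]) simp
    then obtain d where d: "d > 0" "\<And>s t. s \<in> {a..c} \<Longrightarrow> t \<in> {a..c} \<Longrightarrow> dist t s < d \<Longrightarrow> dist (U t \<omega>) (U s \<omega>) < \<epsilon> / 3"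
      using \<epsilon> unfolding uniformly_continuous_on_def by (elim allE[of _ "\<epsilon> / 3"]) auto
    obtain n where n: "1 / real (Suc n) < d" using reals_Archimedean[OF d(1)] by (auto simp: inverse_eq_divide)
    have "\<omega> \<in> C n" unfolding C_def
    proof (intro CollectI conjI ballI impI)
      fix p assume p: "p \<in> Q \<times> Q" "\<bar>fst p - snd p\<bar> < 1 / real (Suc n)"
      then have "dist (U (fst p) \<omega>) (U (snd p) \<omega>) < \<epsilon> / 3"
        using Q(2) n by (intro d(2)) (auto simp: dist_real_def)
      then show "norm (U (fst p) \<omega> - U (snd p) \<omega>) \<le> \<epsilon> / 3" by (simp add: dist_norm)
    qed (rule elim(2))
    then show ?case by blast
  qed
  then have "\<exists>n\<in>UNIV. prob (B \<inter> C n) > 0" by (intro prob_pos_cover[OF B] Cm) auto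
  then obtain n where n: "prob (B \<inter> C n) > 0" by blast
  have BC: "B \<inter> C n \<in> events" using B(1) Cm by auto
  have "\<exists>F. finite F \<and> F \<subseteq> Q \<and> (\<forall>q\<in>Q. \<exists>p\<in>F. \<bar>q - p\<bar> < 1 / real (Suc n))"
    by (rule finite_net_in_interval[OF Q(2)]) simp
  then obtain F where F: "finite F" "F \<subseteq> Q" "\<And>q. q \<in> Q \<Longrightarrow> \<exists>p\<in>F. \<bar>q - p\<bar> < 1 / real (Suc n)"
    by blast
  have FU: "\<And>p. p \<in> F \<Longrightarrow> U p \<in> borel_measurable M" using F(2) U by auto
  have "\<epsilon> / 3 > 0" using \<epsilon> by simp
  from prob_pos_small_oscillation[where U=U, OF F(1) FU BC n this]
  obtain C' where C': "C' \<in> events" "C' \<subseteq> B \<inter> C n" "prob C' > 0" "\<And>\<omega> \<omega>' p. \<omega> \<in> C' \<Longrightarrow> \<omega>' \<in> C' \<Longrightarrow> p \<in> F \<Longrightarrow> norm (U p \<omega> - U p \<omega>') \<le> \<epsilon> / 3"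
    by blast
  obtain \<omega>0 where w0: "\<omega>0 \<in> C'" "G \<omega>0" using prob_pos_AE_ex[OF C'(1,3) G(1)] by blast
  have sub: "C' \<subseteq> {\<omega> \<in> B. \<forall>q\<in>Q. norm (U q \<omega> - U q \<omega>0) \<le> \<epsilon>}"
  proof
    fix \<omega> assume w: "\<omega> \<in> C'"
    have "norm (U q \<omega> - U q \<omega>0) \<le> \<epsilon>" if q: "q \<in> Q" for q
    proof -
      obtain p where p: "p \<in> F" "\<bar>q - p\<bar> < 1 / real (Suc n)" using F(3)[OF q] by blast
      have "p \<in> Q" using p F(2) by auto
      have osc: "norm (U q \<omega>' - U p \<omega>') \<le> \<epsilon> / 3" if "\<omega>' \<in> C'" for \<omega>'
      proof -
        have "\<omega>' \<in> C n" using C'(2) that by auto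
        then have "\<forall>r\<in>Q \<times> Q. \<bar>fst r - snd r\<bar> < 1 / real (Suc n) \<longrightarrow> norm (U (fst r) \<omega>' - U (snd r) \<omega>') \<le> \<epsilon> / 3"
          by (simp add: C_def)
        from this[rule_format, of "(q, p)"] show ?thesis using p(2) q \<open>p \<in> Q\<close> by simp
      qed
      have "U q \<omega> - U q \<omega>0 = (U q \<omega> - U p \<omega>) + (U p \<omega> - U p \<omega>0) - (U q \<omega>0 - U p \<omega>0)" by simp
      also have "norm \<dots> \<le> norm (U q \<omega> - U p \<omega>) + norm (U p \<omega> - U p \<omega>0) + norm (U q \<omega>0 - U p \<omega>0)"
        by (meson add_right_mono norm_triangle_ineq norm_triangle_ineq4 order_trans)
      also have "\<dots> \<le> \<epsilon> / 3 + \<epsilon> / 3 + \<epsilon> / 3" by (intro add_mono osc w w0(1) C'(4) p(1))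
      finally show ?thesis by simp
    qed
    then show "\<omega> \<in> {\<omega> \<in> B. \<forall>q\<in>Q. norm (U q \<omega> - U q \<omega>0) \<le> \<epsilon>}" using C'(2) w by auto
  qed
  have "{\<omega> \<in> B. \<forall>q\<in>Q. norm (U q \<omega> - U q \<omega>0) \<le> \<epsilon>} \<in> events"
  proof -
    have "{\<omega> \<in> space M. \<forall>q\<in>Q. norm (U q \<omega> - U q \<omega>0) \<le> \<epsilon>} \<in> events"
    proof (rule sets_Collect_countable_ball[OF Q(1)])
      fix q assume "q \<in> Q"
      then have [measurable]: "U q \<in> borel_measurable M" by (rule U)
      show "{\<omega> \<in> space M. norm (U q \<omega> - U q \<omega>0) \<le> \<epsilon>} \<in> events" by measurable
    qed
    from sets.Int[OF B(1) this] show ?thesis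
      by (rule back_subst[of "\<lambda>S. S \<in> events"]) (use sets.sets_into_space[OF B(1)] in auto)
  qed
  then have "prob C' \<le> prob {\<omega> \<in> B. \<forall>q\<in>Q. norm (U q \<omega> - U q \<omega>0) \<le> \<epsilon>}" by (rule finite_measure_mono[OF sub])
  then show ?thesis using w0(2) C'(3) by (intro exI[of _ \<omega>0]) linarith
qed

end

subsection \<open>Conditional full support\<close>

text \<open>The event \<open>B\<close> where the conditional expectation is nonpositive belongs to
  \<open>F\<close>. If it had positive probability, integrating over it would give both
  \<open>prob (B \<inter> E') > 0\<close> and a value at most \<open>0\<close>. \<open>E\<close> is
  measurable for the completion only, whence the substitute \<open>E'\<close>.\<close>

lemma (in prob_space) cond_exp_indicator_pos:
  assumes F: "space F = space M" "sets F \<subseteq> events"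
    and E: "E \<subseteq> space M" "E' \<in> events" "AE \<omega> in M. \<omega> \<in> E \<longleftrightarrow> \<omega> \<in> E'"
    and pos: "\<And>B. B \<in> sets F \<Longrightarrow> prob B > 0 \<Longrightarrow> prob (B \<inter> E') > 0"
  shows "AE \<omega> in M. real_cond_exp (completion M) F (indicator E) \<omega> > 0"
proof -
  obtain Z where Z: "{x \<in> space M. \<not> (x \<in> E \<longleftrightarrow> x \<in> E')} \<subseteq> Z" "Z \<in> null_sets M"
    using E(3) by (auto simp: eventually_ae_filter)
  have Zs: "Z \<in> sets M" using Z(2) by auto
  have E's: "E' \<subseteq> space M" using E(2) sets.sets_into_space by auto
  have "E = (E' - Z) \<union> (E \<inter> Z)" using Z(1) E(1) E's by blast
  then have Em: "E \<in> sets (completion M)"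
    by (rule sets_completionI[of _ _ "E \<inter> Z" Z]) (use Z(2) Zs E(2) in auto)
  interpret C: prob_space "completion M" by (rule prob_space_completion)
  have subalg: "subalgebra (completion M) F"
    using F by (auto simp: subalgebra_def)
  interpret S: finite_measure_subalgebra "completion M" F by unfold_locales (rule subalg)
  define g where "g = real_cond_exp (completion M) F (indicator E)"
  have gm[measurable]: "g \<in> borel_measurable F" unfolding g_def by (rule borel_measurable_cond_exp)
  define B where "B = {\<omega> \<in> space F. g \<omega> \<le> 0}"
  have BF: "B \<in> sets F" unfolding B_def by measurable
  then have BM: "B \<in> events" using F by auto
  have iE: "integrable (completion M) (indicator E :: 'a \<Rightarrow> real)"
    by (rule integrable_real_indicator[OF Em]) (simp add: C.emeasure_eq_measure)
  have "prob B = 0"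
  proof (rule ccontr)
    assume "prob B \<noteq> 0"
    then have "prob B > 0" using measure_nonneg[of M B] by linarith
    then have p: "prob (B \<inter> E') > 0" by (rule pos[OF BF])
    have "(\<integral>\<omega>\<in>B. indicator E \<omega> \<partial>(completion M)) = (\<integral>\<omega>\<in>B. g \<omega> \<partial>(completion M))"
      unfolding g_def by (rule S.real_cond_exp_intA[OF iE BF])
    also have "\<dots> \<le> 0"
    proof -
      have "0 \<le> (\<integral>\<omega>. - (indicator B \<omega> *\<^sub>R g \<omega>) \<partial>(completion M))"
        by (rule Bochner_Integration.integral_nonneg) (auto simp: B_def indicator_def)
      then show ?thesis unfolding set_lebesgue_integral_def by simp
    qed
    finally have "(\<integral>\<omega>\<in>B. indicator E \<omega> \<partial>(completion M)) \<le> (0::real)" .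
    moreover have "(\<integral>\<omega>\<in>B. indicator E \<omega> \<partial>(completion M)) = prob (B \<inter> E')"
    proof -
      have BE: "B \<inter> E' \<in> sets (completion M)" using BM E(2) by auto
      have "(\<integral>\<omega>\<in>B. indicator E \<omega> \<partial>(completion M)) = (\<integral>\<omega>. indicator (B \<inter> E') \<omega> \<partial>(completion M) :: real)"
        unfolding set_lebesgue_integral_def
      proof (rule integral_cong_AE)
        show "AE x in completion M. indicator B x *\<^sub>R indicator E x = (indicator (B \<inter> E') x :: real)"
          by (rule AE_completion) (use E(3) in \<open>auto simp: indicator_def elim!: eventually_mono\<close>)
        have "B \<in> sets (completion M)" using BM by auto
        then show "(\<lambda>x. indicat_real B x *\<^sub>R indicat_real E x) \<in> borel_measurable (completion M)" using Em by measurable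
      qed (use BE in measurable)
      also have "\<dots> = measure (completion M) (B \<inter> E')"
        using sets.sets_into_space[OF BE] by (simp add: Int_absorb2)
      also have "\<dots> = prob (B \<inter> E')" using BM E(2) by (intro measure_completion) auto
      finally show ?thesis .
    qed
    ultimately show False using p by simp
  qed
  then have "AE \<omega> in M. \<omega> \<notin> B"
    using BM by (subst AE_iff_measurable[of B]) (auto simp: emeasure_eq_measure dest: sets.sets_into_space)
  then show ?thesis using AE_space
  proof eventually_elim
    case (elim \<omega>)
    then show ?case using F(1) by (simp add: B_def g_def)
  qed
qed

text \<open>The margin \<open>1 / (k + 1)\<close> matters: strict bounds at all rationals would
  still allow the supremum to equal \<open>\<epsilon>\<close>.\<close>

lemma SUP_less_iff_rational:
  fixes \<phi> :: "real \<Rightarrow> real"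
  assumes ab: "a < c" and \<phi>: "continuous_on {a..c} \<phi>"
  shows "(SUP t\<in>{a..c}. \<phi> t) < \<epsilon> \<longleftrightarrow> (\<exists>k::nat. \<forall>q\<in>{a..c} \<inter> \<rat>. \<phi> q \<le> \<epsilon> - 1 / real (Suc k))"
proof
  assume l: "(SUP t\<in>{a..c}. \<phi> t) < \<epsilon>"
  obtain k where k: "1 / real (Suc k) < \<epsilon> - (SUP t\<in>{a..c}. \<phi> t)"
    using reals_Archimedean[of "\<epsilon> - (SUP t\<in>{a..c}. \<phi> t)"] l by (auto simp: inverse_eq_divide)
  have bdd: "bdd_above (\<phi> ` {a..c})"
    by (intro bounded_imp_bdd_above compact_imp_bounded compact_continuous_image \<phi>) auto
  have "\<phi> q \<le> \<epsilon> - 1 / real (Suc k)" if "q \<in> {a..c} \<inter> \<rat>" for q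
    using cSUP_upper[OF _ bdd, of q] that k by auto
  then show "\<exists>k::nat. \<forall>q\<in>{a..c} \<inter> \<rat>. \<phi> q \<le> \<epsilon> - 1 / real (Suc k)" by blast
next
  assume "\<exists>k::nat. \<forall>q\<in>{a..c} \<inter> \<rat>. \<phi> q \<le> \<epsilon> - 1 / real (Suc k)"
  then obtain k :: nat where k: "\<And>q. q \<in> {a..c} \<inter> \<rat> \<Longrightarrow> \<phi> q \<le> \<epsilon> - 1 / real (Suc k)" by blast
  have "\<phi> t \<le> \<epsilon> - 1 / real (Suc k)" if t: "t \<in> {a..c}" for t
  proof (rule ccontr)
    assume "\<not> ?thesis"
    define r where "r = \<phi> t - (\<epsilon> - 1 / real (Suc k))"
    have r: "r > 0" using \<open>\<not> _\<close> by (simp add: r_def)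
    obtain d where d: "d > 0" "\<And>s. s \<in> {a..c} \<Longrightarrow> dist s t < d \<Longrightarrow> dist (\<phi> s) (\<phi> t) < r"
      using \<phi> t r unfolding continuous_on_iff by blast
    have "max a (t - d) < min c (t + d)" using t d(1) ab by auto
    then obtain s where s: "s \<in> \<rat>" "max a (t - d) < s" "s < min c (t + d)" using Rats_dense_in_real by blast
    have "dist (\<phi> s) (\<phi> t) < r" by (rule d(2)) (use s in \<open>auto simp: dist_real_def abs_less_iff\<close>)
    moreover have "\<phi> s \<le> \<epsilon> - 1 / real (Suc k)" by (rule k) (use s in auto)
    ultimately show False by (simp add: r_def dist_real_def)
  qed
  then have "(SUP t\<in>{a..c}. \<phi> t) \<le> \<epsilon> - 1 / real (Suc k)" using ab by (intro cSUP_least) auto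
  also have "\<dots> < \<epsilon>" by simp
  finally show "(SUP t\<in>{a..c}. \<phi> t) < \<epsilon>" .
qed

section \<open>The increment filtration\<close>

lemma space_incr_filtration: "space (incr_filtration P L t) = space P"
  unfolding incr_filtration_def by (rule space_measure_of) auto

lemma sets_incr_filtration:
  "sets (incr_filtration P L t) = sigma_sets (space P) {(\<lambda>\<omega>. L u \<omega> - L v \<omega>) -` B \<inter> space P | u v B. v < u \<and> u \<le> t \<and> B \<in> sets borel}"
  unfolding incr_filtration_def by (rule sets_measure_of) auto

lemma sets_incr_filtration_subset:
  fixes L :: "real \<Rightarrow> 'w \<Rightarrow> real^'d"
  assumes "\<And>t. L t \<in> borel_measurable P"
  shows "sets (incr_filtration P L t) \<subseteq> sets P"
  unfolding sets_incr_filtration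
proof (rule sets.sigma_sets_subset, safe)
  fix u v and B :: "(real^'d) set" assume [measurable]: "B \<in> sets borel"
  note [measurable] = assms
  have "(\<lambda>\<omega>. L u \<omega> - L v \<omega>) \<in> borel_measurable P" by measurable
  then show "(\<lambda>\<omega>. L u \<omega> - L v \<omega>) -` B \<inter> space P \<in> sets P" by (rule measurable_sets) measurable
qed

lemma increment_measurable_incr_filtration:
  fixes L :: "real \<Rightarrow> 'w \<Rightarrow> real^'d"
  assumes "v < u" "u \<le> t"
  shows "(\<lambda>\<omega>. L u \<omega> - L v \<omega>) \<in> borel_measurable (incr_filtration P L t)"
proof (rule measurableI)
  fix B :: "(real^'d) set" assume "B \<in> sets borel"
  then show "(\<lambda>\<omega>. L u \<omega> - L v \<omega>) -` B \<inter> space (incr_filtration P L t) \<in> sets (incr_filtration P L t)"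
    unfolding sets_incr_filtration space_incr_filtration using assms by (intro sigma_sets.Basic) blast
qed simp

lemma incr_filtration_mono: "s \<le> t \<Longrightarrow> sets (incr_filtration P L s) \<subseteq> sets (incr_filtration P L t)"
  unfolding sets_incr_filtration by (rule sigma_sets_mono') force

text \<open>The independence criterion speaks of real variables, so the past has to be generated by
  coordinates of increments.\<close>

lemma sets_incr_filtration_components:
  fixes L :: "real \<Rightarrow> 'w \<Rightarrow> real^'d"
  assumes "B \<in> sets (incr_filtration P L t)"
  shows "B \<in> sigma_sets (space P) {V -` A \<inter> space P | V A. V \<in> {\<lambda>\<omega>. (L u \<omega> - L v \<omega>) $ i | u v i. v < u \<and> u \<le> t} \<and> A \<in> sets borel}"
    (is "_ \<in> sigma_sets _ ?gens")
proof -
  define G where "G = sigma (space P) ?gens"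
  have "?gens \<subseteq> Pow (space P)" by auto
  then have G: "space G = space P" "sets G = sigma_sets (space P) ?gens" by (auto simp: G_def)
  have c: "(\<lambda>\<omega>. (L u \<omega> - L v \<omega>) $ i) \<in> borel_measurable G" if "v < u" "u \<le> t" for u v i
  proof (rule measurableI)
    fix A :: "real set" assume "A \<in> sets borel"
    then show "(\<lambda>\<omega>. (L u \<omega> - L v \<omega>) $ i) -` A \<inter> space G \<in> sets G"
      unfolding G using that by (intro sigma_sets.Basic) blast
  qed simp
  have "sets (incr_filtration P L t) \<subseteq> sets G"
    unfolding sets_incr_filtration G(1)[symmetric]
  proof (rule sets.sigma_sets_subset, safe)
    fix u v and B :: "(real^'d) set" assume uv: "v < u" "u \<le> t" and B: "B \<in> sets borel"
    have "(\<lambda>\<omega>. L u \<omega> - L v \<omega>) \<in> borel_measurable G"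
      by (rule borel_measurable_vec) (use c[OF uv] in simp)
    then show "(\<lambda>\<omega>. L u \<omega> - L v \<omega>) -` B \<inter> space G \<in> sets G" using B by (rule measurable_sets)
  qed
  then show ?thesis using assms G(2) by blast
qed

section \<open>The moving average kernel and its covariances with step integrals\<close>

lemma borel_measurable_row: "(\<lambda>A::real^'n^'m. row i A) \<in> borel_measurable borel"
proof -
  have "(\<lambda>A::real^'n^'m. row i A) = (\<lambda>A. A $ i)" by (auto simp: row_def vec_eq_iff)
  moreover have "continuous_on UNIV (\<lambda>A::real^'n^'m. A $ i)" by (intro continuous_intros)
  ultimately show ?thesis using borel_measurable_continuous_onI by metis
qed

text \<open>Before \<open>T\<close> the truncated and the full kernel have the same convolution
  determinant, and vanishing there up to \<open>m > 0\<close> would put the essential support inside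
  \<open>{m..}\<close>.\<close>

lemma ess_supp_0_not_vanish:
  fixes \<Phi> :: "real \<Rightarrow> real^'n::{finite,linorder}^'n::{finite,linorder}"
  assumes ess: "0 \<in> ess_supp (conv_det \<Phi>)" and T: "T > 0" and \<delta>: "\<delta> > 0"
  shows "\<not> vanish_before \<delta> (conv_det (\<lambda>s. indicator {0..<T} s *\<^sub>R \<Phi> s))"
proof
  let ?\<phi> = "\<lambda>s. indicator {0..<T} s *\<^sub>R \<Phi> s"
  assume v: "vanish_before \<delta> (conv_det ?\<phi>)"
  define m where "m = min \<delta> T"
  have m: "m > 0" using T \<delta> by (simp add: m_def)
  have eq: "conv_det ?\<phi> t = conv_det \<Phi> t" if t: "t < T" for t
  proof (cases "t < 0")
    case False
    have "conv_list (map (\<lambda>i u. ?\<phi> u $ i $ p i) (sorted_list_of_set UNIV)) t = conv_list (map (\<lambda>i u. \<Phi> u $ i $ p i) (sorted_list_of_set UNIV)) t" for p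
      by (rule conv_list_cong[where T=t]) (use t False in auto)
    then show ?thesis using False by (simp add: conv_det_def)
  qed (simp add: conv_det_def)
  have "AE x in lborel. x \<notin> {m..} \<longrightarrow> conv_det \<Phi> x = 0"
    using v unfolding vanish_before_def by eventually_elim (auto simp: m_def eq[symmetric])
  then have "ess_supp (conv_det \<Phi>) \<subseteq> {m..}" by (intro ess_supp_smallest(3)) auto
  then show False using ess m by auto
qed

lemma borel_measurable_ma_row:
  fixes \<Phi> \<Psi> :: "real \<Rightarrow> real^'d^'d"
  assumes [measurable]: "\<Phi> \<in> borel_measurable borel" "\<Psi> \<in> borel_measurable borel"
  shows "(\<lambda>u. indicator {..t} u *\<^sub>R row i (ma_kernel \<Phi> \<Psi> t u)) \<in> borel_measurable borel"
proof -
  have "(\<lambda>u. ma_kernel \<Phi> \<Psi> t u) \<in> borel_measurable borel" unfolding ma_kernel_def by measurable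
  then have [measurable]: "(\<lambda>u. row i (ma_kernel \<Phi> \<Psi> t u)) \<in> borel_measurable borel"
    by (rule measurable_compose[OF _ borel_measurable_row])
  show ?thesis by measurable
qed

lemma row_nth: "row i A $ j = A $ i $ j"
  by (simp add: row_def)

lemma matrix_inv_vec_cancel:
  fixes S :: "real^'d^'d"
  assumes "det S \<noteq> 0"
  shows "S *v (matrix_inv S *v x) = x"
proof -
  have "\<exists>S'. S ** S' = mat 1 \<and> S' ** S = mat 1"
    using assms unfolding invertible_det_nz[symmetric] invertible_def .
  from someI_ex[OF this] have "S ** matrix_inv S = mat 1" by (simp add: matrix_inv_def)
  then show ?thesis by (simp add: matrix_vector_mul_assoc)
qed

text \<open>For \<open>u > t0 \<ge> 0\<close> neither \<open>\<Psi> (- u)\<close> nor the kernel at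
  time \<open>t0\<close> contributes. The half-open \<open>{0..<T - t0}\<close> is the image of
  \<open>{t0<..T}\<close> under the reversal \<open>T - u\<close>.\<close>

lemma ma_increment_kernel_eq:
  fixes \<Phi> \<Psi> :: "real \<Rightarrow> real^'d^'d"
  assumes \<Phi>0: "\<And>t. t < 0 \<Longrightarrow> \<Phi> t = 0" and \<Psi>0: "\<And>t. t < 0 \<Longrightarrow> \<Psi> t = 0"
    and t0: "0 \<le> t0" "t0 < u" and q: "t0 \<le> q" "q \<le> T"
  shows "(indicator {..q} u *\<^sub>R row i (ma_kernel \<Phi> \<Psi> q u) - indicator {..t0} u *\<^sub>R row i (ma_kernel \<Phi> \<Psi> t0 u)) $ j =
    (indicator {0..<T - t0} (q - u) *\<^sub>R \<Phi> (q - u)) $ i $ j"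
proof (cases "u \<le> q")
  case True
  then show ?thesis using t0 q \<Psi>0[of "- u"] by (simp add: row_nth ma_kernel_def)
next
  case False
  then show ?thesis using t0 q by (simp add: row_nth)
qed

text \<open>The coefficients \<open>matrix_inv S *v x k\<close> cancel the covariance matrix, so
  that the covariance of the increment with the step integral is a plain convolution of the kernel
  with the steps \<open>x k\<close>, in time counted from \<open>t0\<close>.\<close>

lemma ma_step_covariance:
  fixes \<Phi> \<Psi> :: "real \<Rightarrow> real^'d^'d" and S :: "real^'d^'d" and x :: "nat \<Rightarrow> real^'d"
  assumes sym: "\<And>x y. x \<bullet> (S *v y) = y \<bullet> (S *v x)" and S: "det S \<noteq> 0"
    and \<Phi>0: "\<And>t. t < 0 \<Longrightarrow> \<Phi> t = 0" and \<Psi>0: "\<And>t. t < 0 \<Longrightarrow> \<Psi> t = 0"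
    and t0: "0 \<le> t0" "t0 < T" and q: "t0 \<le> q" "q \<le> T"
    and c: "\<And>j. causal (T - t0) (\<lambda>s. (indicator {0..<T - t0} s *\<^sub>R \<Phi> s) $ i $ j)"
  shows "(\<integral>u. (\<Sum>k<n. indicator {t0 + real k * (T - t0) / real n<..t0 + real (Suc k) * (T - t0) / real n} u *\<^sub>R (matrix_inv S *v x k)) \<bullet>
        (S *v (indicator {..q} u *\<^sub>R row i (ma_kernel \<Phi> \<Psi> q u) - indicator {..t0} u *\<^sub>R row i (ma_kernel \<Phi> \<Psi> t0 u))) \<partial>lborel)
    = (\<Sum>j\<in>UNIV. convolve (\<lambda>s. (indicator {0..<T - t0} s *\<^sub>R \<Phi> s) $ i $ j)
        (\<lambda>u. \<Sum>k<n. indicator {real k * (T - t0) / real n<..real (Suc k) * (T - t0) / real n} u * x k $ j) (q - t0))"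
    (is "(\<integral>u. ?w u \<bullet> (S *v ?K u) \<partial>lborel) = (\<Sum>j\<in>UNIV. convolve (?\<phi> j) (?h j) (q - t0))")
proof -
  have h0: "?h j s = 0" if "s \<le> 0" for j s
  proof (rule sum.neutral, rule ballI)
    fix k
    have "0 \<le> real k * (T - t0) / real n" using t0 by simp
    then have "s \<notin> {real k * (T - t0) / real n<..real (Suc k) * (T - t0) / real n}" using that by auto
    then show "indicator {real k * (T - t0) / real n<..real (Suc k) * (T - t0) / real n} s * x k $ j = 0" by simp
  qed
  have Sw: "(S *v ?w u) $ j = ?h j (u - t0)" for u j
  proof -
    have "S *v ?w u = (\<Sum>k<n. indicator {t0 + real k * (T - t0) / real n<..t0 + real (Suc k) * (T - t0) / real n} u *\<^sub>R x k)"
      by (simp only: linear_sum[OF matrix_vector_mul_linear] matrix_vector_mult_scaleR matrix_inv_vec_cancel[OF S])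
    then show ?thesis
      by (simp only: sum_component vector_scaleR_component) (intro sum.cong refl, simp add: indicator_def algebra_simps)
  qed
  have eq: "?w u \<bullet> (S *v ?K u) = (\<Sum>j\<in>UNIV. ?\<phi> j (q - t0 - (u - t0)) * ?h j (u - t0))" for u
  proof -
    have "?w u \<bullet> (S *v ?K u) = ?K u \<bullet> (S *v ?w u)" by (rule sym)
    also have "\<dots> = (\<Sum>j\<in>UNIV. ?K u $ j * (S *v ?w u) $ j)" by (simp only: inner_vec_def inner_real_def)
    also have "\<dots> = (\<Sum>j\<in>UNIV. ?K u $ j * ?h j (u - t0))" by (simp only: Sw)
    also have "\<dots> = (\<Sum>j\<in>UNIV. ?\<phi> j (q - t0 - (u - t0)) * ?h j (u - t0))"
    proof (rule sum.cong[OF refl])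
      fix j
      show "?K u $ j * ?h j (u - t0) = ?\<phi> j (q - t0 - (u - t0)) * ?h j (u - t0)"
      proof (cases "u \<le> t0")
        case True
        then show ?thesis using h0[of "u - t0" j] by simp
      next
        case False
        then show ?thesis using ma_increment_kernel_eq[OF \<Phi>0 \<Psi>0 t0(1) _ q, where u=u and i=i and j=j] by simp
      qed
    qed
    finally show ?thesis .
  qed
  have int: "integrable lborel (\<lambda>s. ?\<phi> j (q - t0 - s) * ?h j s)" for j
  proof (rule integrable_convolve_bounded)
    show "integrable lborel (?\<phi> j)" by (rule causalD(1)[OF c])
    show "?h j \<in> borel_measurable borel" by measurable
    show "\<bar>?h j u\<bar> \<le> (\<Sum>k<n. \<bar>x k $ j\<bar>)" for u
      by (rule order_trans[OF sum_abs sum_mono]) (auto simp: indicator_def)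
  qed
  have "(\<integral>u. ?w u \<bullet> (S *v ?K u) \<partial>lborel) = (\<integral>u. (\<lambda>s. \<Sum>j\<in>UNIV. ?\<phi> j (q - t0 - s) * ?h j s) (u - t0) \<partial>lborel)"
    unfolding eq ..
  also have "\<dots> = (\<integral>s. (\<Sum>j\<in>UNIV. ?\<phi> j (q - t0 - s) * ?h j s) \<partial>lborel)"
    by (rule integral_shift)
  also have "\<dots> = (\<Sum>j\<in>UNIV. \<integral>s. ?\<phi> j (q - t0 - s) * ?h j s \<partial>lborel)"
    by (rule Bochner_Integration.integral_sum[OF int])
  finally show ?thesis unfolding convolve_def .
qed

text \<open>Pairing the increment with the integral of the constant
  \<open>matrix_inv S *v axis j 1\<close> over \<open>{t0<..T}\<close> singles out one entry of
  \<open>\<Phi>\<close>, reversed in time; finiteness of this covariance is its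
  integrability.\<close>

lemma (in gaussian_random_measure) wiener_ma_kernel_causal:
  assumes S: "det S \<noteq> 0"
    and \<Phi>m: "\<Phi> \<in> borel_measurable borel" and \<Psi>m: "\<Psi> \<in> borel_measurable borel"
    and \<Phi>0: "\<And>t. t < 0 \<Longrightarrow> \<Phi> t = 0" and \<Psi>0: "\<And>t. t < 0 \<Longrightarrow> \<Psi> t = 0"
    and t0: "0 \<le> t0" "t0 < T"
    and Z: "wiener_integral (\<lambda>u. indicator {..T} u *\<^sub>R row i (ma_kernel \<Phi> \<Psi> T u) - indicator {..t0} u *\<^sub>R row i (ma_kernel \<Phi> \<Psi> t0 u)) Z"
  shows "causal (T - t0) (\<lambda>s. (indicator {0..<T - t0} s *\<^sub>R \<Phi> s) $ i $ j)"
proof -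
  let ?K = "\<lambda>u. indicator {..T} u *\<^sub>R row i (ma_kernel \<Phi> \<Psi> T u) - indicator {..t0} u *\<^sub>R row i (ma_kernel \<Phi> \<Psi> t0 u)"
  let ?y = "matrix_inv S *v axis j 1"
  let ?w = "step_sum {()} (\<lambda>_. {t0<..T}) (\<lambda>_. ?y)"
  have w: "simple_integrand ?w"
    by (rule simple_integrand_step_sum) (use bounded_Ioc[OF order_refl, of t0 T] in auto)
  note [measurable] = borel_measurable_ma_row[OF \<Phi>m \<Psi>m]
  have "?K \<in> borel_measurable borel" by measurable
  from wiener_inner_integrable(2)[OF Z w this]
  have i: "integrable lborel (\<lambda>u. ?w u \<bullet> (S *v ?K u))" .
  have "?w u \<bullet> (S *v ?K u) = (indicator {0..<T - t0} (T - u) *\<^sub>R \<Phi> (T - u)) $ i $ j" for u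
  proof -
    have "?w u \<bullet> (S *v ?K u) = indicator {t0<..T} u * (?y \<bullet> (S *v ?K u))" by (simp add: step_sum_def)
    also have "?y \<bullet> (S *v ?K u) = ?K u \<bullet> axis j 1" unfolding S_comm[of ?y] matrix_inv_vec_cancel[OF S] ..
    also have "\<dots> = ?K u $ j" by (simp only: inner_axis) simp
    also have "indicator {t0<..T} u * \<dots> = (indicator {0..<T - t0} (T - u) *\<^sub>R \<Phi> (T - u)) $ i $ j"
    proof (cases "t0 < u")
      case True
      then show ?thesis using ma_increment_kernel_eq[OF \<Phi>0 \<Psi>0 t0(1) True _ order_refl, where T=T and i=i and j=j] t0(2)
        by (auto simp: indicator_def)
    qed (auto simp: indicator_def)
    finally show ?thesis .
  qed
  with i have "integrable lborel (\<lambda>u. (indicator {0..<T - t0} (T - u) *\<^sub>R \<Phi> (T - u)) $ i $ j)" by simp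
  from integrable_reflect[OF this, of T]
  have "integrable lborel (\<lambda>s. (indicator {0..<T - t0} s *\<^sub>R \<Phi> s) $ i $ j)" by simp
  then show ?thesis unfolding causal_def by (auto simp: indicator_def split: if_splits)
qed

text \<open>The error is split evenly: \<open>\<epsilon> / 2\<close> for staying near a reference
  path, over which there is no control, and \<open>\<epsilon> / 2\<close> for realising the gap
  between that path and the target by a translation.\<close>

lemma increments_ball_pos:
  fixes P :: "'w measure" and L Y X :: "real \<Rightarrow> 'w \<Rightarrow> real^'d::{finite,linorder}"
    and \<Phi> \<Psi> :: "real \<Rightarrow> real^'d::{finite,linorder}^'d::{finite,linorder}"
  assumes P: "prob_space P" and L: "two_sided_levy P L b S (null_measure borel)"
    and \<Phi>m: "\<Phi> \<in> borel_measurable borel" and \<Psi>m: "\<Psi> \<in> borel_measurable borel"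
    and \<Phi>0: "\<And>t. t < 0 \<Longrightarrow> \<Phi> t = 0" and \<Psi>0: "\<And>t. t < 0 \<Longrightarrow> \<Psi> t = 0"
    and X: "moving_average P L \<Phi> \<Psi> X" and S: "det S \<noteq> 0"
    and ess: "0 \<in> ess_supp (conv_det \<Phi>)"
    and Y: "modification P {0..T} X Y" "continuous_process P {0..T} Y"
    and t0: "0 \<le> t0" "t0 < T" and f: "continuous_on {t0..T} f" "f t0 = 0" and \<epsilon>: "\<epsilon> > 0"
    and B: "B \<in> sets (incr_filtration P L t0)" "measure P B > 0"
  shows "measure P {\<omega> \<in> B. \<forall>q\<in>{t0..T} \<inter> \<rat>. norm (Y q \<omega> - Y t0 \<omega> - f q) \<le> \<epsilon>} > 0"
proof -
  interpret prob_space P by (rule P)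
  have Xint: "has_levy_integral P L (\<lambda>u. indicator {..t} u *\<^sub>R row i (ma_kernel \<Phi> \<Psi> t u)) (\<lambda>\<omega>. X t \<omega> $ i)" if "t \<ge> 0" for t i
    using X that by (simp add: moving_average_def has_matrix_levy_integral_def)
  obtain N where N: "levy_random_measure P L N"
    using Xint[OF order_refl] unfolding has_levy_integral_def by blast
  interpret gaussian_random_measure P L N b S by (rule gaussian_random_measure_of_levy[OF P L N])
  have Lm: "L t \<in> borel_measurable P" for t using L by (simp add: two_sided_levy_def)
  have Ym: "Y t \<in> borel_measurable P" if "t \<in> {0..T}" for t using Y(2) that by (simp add: continuous_process_def)
  define K where "K = (\<lambda>q i u. indicator {..q} u *\<^sub>R row i (ma_kernel \<Phi> \<Psi> q u) - indicator {..t0} u *\<^sub>R row i (ma_kernel \<Phi> \<Psi> t0 u))"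
  define U where "U = (\<lambda>q \<omega>. Y q \<omega> - Y t0 \<omega>)"
  define T' where "T' = T - t0"
  define \<phi> where "\<phi> = (\<lambda>s. indicator {0..<T'} s *\<^sub>R \<Phi> s)"
  have T': "T' > 0" using t0 by (simp add: T'_def)
  have Km: "K q i \<in> borel_measurable borel" for q i
    unfolding K_def by (intro borel_measurable_diff borel_measurable_ma_row \<Phi>m \<Psi>m)
  have Um: "U q \<in> borel_measurable P" if "q \<in> {t0..T}" for q
    unfolding U_def using that t0 by (intro borel_measurable_diff Ym) auto
  have UI: "wiener_integral (K q i) (\<lambda>\<omega>. U q \<omega> $ i)" if q: "q \<in> {t0..T}" for q i
  proof -
    have "wiener_integral (\<lambda>u. 1 *\<^sub>R (indicator {..q} u *\<^sub>R row i (ma_kernel \<Phi> \<Psi> q u)) + (-1) *\<^sub>R (indicator {..t0} u *\<^sub>R row i (ma_kernel \<Phi> \<Psi> t0 u)))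
        (\<lambda>\<omega>. 1 * X q \<omega> $ i + (-1) * X t0 \<omega> $ i)"
      using q t0 by (intro wiener_integral_lincomb has_levy_integral_imp_wiener Xint) auto
    then show ?thesis
    proof (rule wiener_integral_cong)
      have "AE \<omega> in P. Y q \<omega> = X q \<omega>" "AE \<omega> in P. Y t0 \<omega> = X t0 \<omega>"
        using Y(1) q t0 by (auto simp: modification_def)
      then show "AE \<omega> in P. 1 * X q \<omega> $ i + (-1) * X t0 \<omega> $ i = U q \<omega> $ i"
        by eventually_elim (simp add: U_def)
      show "(\<lambda>\<omega>. U q \<omega> $ i) \<in> borel_measurable P" by (rule borel_measurable_vec_nth[OF Um[OF q]])
    qed (simp add: K_def)
  qed
  have c: "causal T' (\<lambda>s. \<phi> s $ i $ j)" for i j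
    unfolding \<phi>_def T'_def
    by (rule wiener_ma_kernel_causal[OF S \<Phi>m \<Psi>m \<Phi>0 \<Psi>0 t0]) (use UI[of T i] t0 in \<open>simp_all add: K_def\<close>)
  have nz: "\<not> vanish_before \<delta> (conv_det \<phi>)" if "\<delta> > 0" for \<delta>
    unfolding \<phi>_def by (rule ess_supp_0_not_vanish[OF ess T' that])
  define Q where "Q = {t0..T} \<inter> \<rat>"
  have Q: "countable Q" "Q \<subseteq> {t0..T}" using countable_rat by (auto simp: Q_def)
  define G where "G = (\<lambda>\<omega>. continuous_on {0..T} (\<lambda>t. Y t \<omega>))"
  have GU: "continuous_on {t0..T} (\<lambda>t. U t \<omega>)" if "G \<omega>" for \<omega>
    unfolding U_def using that t0 unfolding G_def
    by (intro continuous_intros) (rule continuous_on_subset, auto)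
  have BP: "B \<in> events" using B(1) sets_incr_filtration_subset[of L P t0, OF Lm] by auto
  have \<epsilon>2: "\<epsilon> / 2 > 0" using \<epsilon> by simp
  have "\<exists>\<omega>0. G \<omega>0 \<and> prob {\<omega> \<in> B. \<forall>q\<in>Q. norm (U q \<omega> - U q \<omega>0) \<le> \<epsilon> / 2} > 0"
  proof (rule prob_pos_path_ball[OF Q _ _ GU BP B(2) \<epsilon>2])
    show "AE \<omega> in P. G \<omega>" using Y(2) by (simp add: continuous_process_def G_def)
  qed (use Um Q in auto)
  then obtain \<omega>0 where \<omega>0: "G \<omega>0" "prob {\<omega> \<in> B. \<forall>q\<in>Q. norm (U q \<omega> - U q \<omega>0) \<le> \<epsilon> / 2} > 0" by blast
  \<comment> \<open>What the translation has to supply; it starts at \<open>0\<close> because both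
    \<open>f\<close> and the increments do.\<close>
  define h where "h = (\<lambda>s. f (t0 + s) - U (t0 + s) \<omega>0)"
  have hc: "continuous_on {0..T'} h"
    unfolding h_def
  proof (intro continuous_intros)
    have im: "(\<lambda>s. t0 + s) ` {0..T'} \<subseteq> {t0..T}" by (auto simp: T'_def)
    show "continuous_on {0..T'} (\<lambda>s. f (t0 + s))"
      by (rule continuous_on_compose2[OF f(1) _ im]) (intro continuous_intros)
    show "continuous_on {0..T'} (\<lambda>s. U (t0 + s) \<omega>0)"
      by (rule continuous_on_compose2[OF GU[OF \<omega>0(1)] _ im]) (intro continuous_intros)
  qed
  have h0: "h 0 = 0" by (simp add: h_def U_def f(2))
  from uniform_dense_convolution_range[OF T' c nz hc h0 \<epsilon>2] obtain n :: nat and x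
    where nx: "n > 0 \<and> (\<forall>t\<in>{0..T'}. norm (h t - (\<chi> i. \<Sum>j\<in>UNIV. convolve (\<lambda>t. \<phi> t $ i $ j)
        (\<lambda>u. \<Sum>k<n. indicator {real k * T' / real n<..real (Suc k) * T' / real n} u * x k $ j) t)) < \<epsilon> / 2)"
    by blast
  define w where "w = step_sum {..<n} (\<lambda>k. {t0 + real k * T' / real n<..t0 + real (Suc k) * T' / real n}) (\<lambda>k. matrix_inv S *v x k)"
  have w: "simple_integrand w"
    unfolding w_def by (rule simple_integrand_step_sum) (use bounded_Ioc[OF order_refl] in auto)
  \<comment> \<open>The past is generated by increments up to \<open>t0\<close>, which are thus
    uncorrelated with the integral of \<open>w\<close>; the translation leaves \<open>B\<close> in
    place.\<close>
  have w0: "w u = 0" if "u \<le> t0" for u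
    unfolding w_def
  proof (rule step_sum_eq_0)
    fix k
    have "0 \<le> real k * T' / real n" using T' by simp
    then show "u \<notin> {t0 + real k * T' / real n<..t0 + real (Suc k) * T' / real n}" using that by auto
  qed
  define m where "m = (\<lambda>q. (\<chi> i. \<integral>u. w u \<bullet> (S *v K q i u) \<partial>lborel))"
  have near: "norm (f q - U q \<omega>0 - m q) \<le> \<epsilon> / 2" if "q \<in> Q" for q
  proof -
    have q: "t0 \<le> q" "q \<le> T" using that Q(2) by auto
    have "(\<integral>u. w u \<bullet> (S *v K q i u) \<partial>lborel) = (\<Sum>j\<in>UNIV. convolve (\<lambda>t. \<phi> t $ i $ j)
        (\<lambda>u. \<Sum>k<n. indicator {real k * T' / real n<..real (Suc k) * T' / real n} u * x k $ j) (q - t0))" for i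
      unfolding w_def step_sum_def K_def T'_def \<phi>_def
      by (rule ma_step_covariance[OF S_comm S \<Phi>0 \<Psi>0 t0 q]) (use c in \<open>simp_all add: \<phi>_def T'_def\<close>)
    then show ?thesis using nx[THEN conjunct2, rule_format, of "q - t0"] q by (simp add: m_def h_def T'_def)
  qed
  define Vs where "Vs = {\<lambda>\<omega>. (L u \<omega> - L v \<omega>) $ i | u v i. v < u \<and> u \<le> t0}"
  have "prob {\<omega> \<in> B. \<forall>q\<in>Q. norm (U q \<omega> - U q \<omega>0 - m q) \<le> \<epsilon> / 2} > 0"
    unfolding m_def
  proof (rule cameron_martin_shift[OF w Q(1) _ Km _ _ \<omega>0(2), where Vs=Vs])
    show "wiener_integral (K q i) (\<lambda>\<omega>. U q \<omega> $ i)" if "q \<in> Q" for q i using UI Q(2) that by blast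
    show "B \<in> sigma_sets (space P) {V -` A \<inter> space P | V A. V \<in> Vs \<and> A \<in> sets borel}"
      unfolding Vs_def by (rule sets_incr_filtration_components[OF B(1)])
    fix V assume "V \<in> Vs"
    then obtain u v i where V: "V = (\<lambda>\<omega>. (L u \<omega> - L v \<omega>) $ i)" "v < u" "u \<le> t0" by (auto simp: Vs_def)
    let ?\<kappa> = "\<lambda>s. indicator {v<..u} s *\<^sub>R (axis i 1 :: real^'d::{finite,linorder})"
    have "wiener_integral ?\<kappa> (\<lambda>\<omega>. axis i 1 \<bullet> (L u \<omega> - L v \<omega>))"
      by (rule wiener_integral_increment[OF V(2) Lm Lm])
    then have "wiener_integral ?\<kappa> V" by (simp only: V(1) inner_axis' inner_real_def mult_1)
    moreover have "?\<kappa> \<in> borel_measurable borel" by measurable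
    moreover have "w s \<bullet> (S *v ?\<kappa> s) = 0" for s
      using w0[of s] V(3) by (cases "s \<le> t0") (auto simp: indicator_def)
    ultimately show "\<exists>\<kappa>. wiener_integral \<kappa> V \<and> \<kappa> \<in> borel_measurable borel \<and> (\<forall>u. w u \<bullet> (S *v \<kappa> u) = 0)" by blast
  qed
  also have "\<dots> \<le> prob {\<omega> \<in> B. \<forall>q\<in>{t0..T} \<inter> \<rat>. norm (Y q \<omega> - Y t0 \<omega> - f q) \<le> \<epsilon>}"
  proof (rule finite_measure_mono)
    show "{\<omega> \<in> B. \<forall>q\<in>Q. norm (U q \<omega> - U q \<omega>0 - m q) \<le> \<epsilon> / 2} \<subseteq> {\<omega> \<in> B. \<forall>q\<in>{t0..T} \<inter> \<rat>. norm (Y q \<omega> - Y t0 \<omega> - f q) \<le> \<epsilon>}"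
    proof safe
      fix \<omega> q assume a: "\<forall>q\<in>Q. norm (U q \<omega> - U q \<omega>0 - m q) \<le> \<epsilon> / 2" and q: "q \<in> {t0..T}" "q \<in> \<rat>"
      have "Y q \<omega> - Y t0 \<omega> - f q = (U q \<omega> - U q \<omega>0 - m q) - (f q - U q \<omega>0 - m q)" by (simp add: U_def)
      also have "norm \<dots> \<le> norm (U q \<omega> - U q \<omega>0 - m q) + norm (f q - U q \<omega>0 - m q)" by (rule norm_triangle_ineq4)
      also have "\<dots> \<le> \<epsilon>" using a near[of q] q by (force simp: Q_def)
      finally show "norm (Y q \<omega> - Y t0 \<omega> - f q) \<le> \<epsilon>" .
    qed
    have "{\<omega> \<in> space P. \<forall>q\<in>Q. norm (U q \<omega> - f q) \<le> \<epsilon>} \<in> events"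
    proof (rule sets_Collect_countable_ball[OF Q(1)])
      fix q assume "q \<in> Q"
      then have [measurable]: "U q \<in> borel_measurable P" using Um Q(2) by blast
      show "{\<omega> \<in> space P. norm (U q \<omega> - f q) \<le> \<epsilon>} \<in> events" by measurable
    qed
    then have "B \<inter> {\<omega> \<in> space P. \<forall>q\<in>Q. norm (U q \<omega> - f q) \<le> \<epsilon>} \<in> events" using BP by blast
    also have "B \<inter> {\<omega> \<in> space P. \<forall>q\<in>Q. norm (U q \<omega> - f q) \<le> \<epsilon>} = {\<omega> \<in> B. \<forall>q\<in>{t0..T} \<inter> \<rat>. norm (Y q \<omega> - Y t0 \<omega> - f q) \<le> \<epsilon>}"
      using sets.sets_into_space[OF BP] by (auto simp: Q_def U_def)
    finally show "{\<omega> \<in> B. \<forall>q\<in>{t0..T} \<inter> \<rat>. norm (Y q \<omega> - Y t0 \<omega> - f q) \<le> \<epsilon>} \<in> events" .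
  qed
  finally show ?thesis .
qed

lemma conditional_full_support_brownian:
  fixes P :: "'w measure" and L Y X :: "real \<Rightarrow> 'w \<Rightarrow> real^'d::{finite,linorder}"
    and \<Phi> \<Psi> :: "real \<Rightarrow> real^'d::{finite,linorder}^'d::{finite,linorder}"
  assumes P: "prob_space P" and L: "two_sided_levy P L b S (null_measure borel)"
    and \<Phi>m: "\<Phi> \<in> borel_measurable borel" and \<Psi>m: "\<Psi> \<in> borel_measurable borel"
    and \<Phi>0: "\<And>t. t < 0 \<Longrightarrow> \<Phi> t = 0" and \<Psi>0: "\<And>t. t < 0 \<Longrightarrow> \<Psi> t = 0"
    and X: "moving_average P L \<Phi> \<Psi> X" and S: "det S \<noteq> 0"
    and ess: "0 \<in> ess_supp (conv_det \<Phi>)"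
    and Y: "modification P {0..T} X Y" "continuous_process P {0..T} Y"
    and ad: "adapted_process (incr_filtration P L) {0..T} Y"
  shows "conditional_full_support P (incr_filtration P L) T Y"
  unfolding conditional_full_support_def
proof (intro conjI Y(2) ad ballI allI impI, elim conjE)
  fix t0 :: real and f :: "real \<Rightarrow> real^'d::{finite,linorder}" and \<epsilon> :: real
  assume t0: "t0 \<in> {0..<T}" and f: "continuous_on {t0..T} f" "f t0 = 0" and \<epsilon>: "\<epsilon> > 0"
  have t: "0 \<le> t0" "t0 < T" using t0 by auto
  interpret prob_space P by (rule P)
  have Lm: "L t \<in> borel_measurable P" for t using L by (simp add: two_sided_levy_def)
  let ?E = "{\<omega> \<in> space P. (SUP t\<in>{t0..T}. norm (Y t \<omega> - Y t0 \<omega> - f t)) < \<epsilon>}"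
  define Q where "Q = {t0..T} \<inter> \<rat>"
  define E where "E = (\<lambda>r. {\<omega> \<in> space P. \<forall>q\<in>Q. norm (Y q \<omega> - Y t0 \<omega> - f q) \<le> r})"
  \<comment> \<open>Measurable substitute for the supremum event, which agrees with it only where
    the path is continuous.\<close>
  define E' where "E' = (\<Union>k. E (\<epsilon> - 1 / real (Suc k)))"
  have Q: "countable Q" using countable_rat by (auto simp: Q_def)
  have Em: "E r \<in> events" for r
    unfolding E_def
  proof (rule sets_Collect_countable_ball[OF Q])
    fix q assume "q \<in> Q"
    then have [measurable]: "Y q \<in> borel_measurable P" "Y t0 \<in> borel_measurable P"
      using Y(2) t by (auto simp: continuous_process_def Q_def)
    show "{\<omega> \<in> space P. norm (Y q \<omega> - Y t0 \<omega> - f q) \<le> r} \<in> events" by measurable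
  qed
  then have E'm: "E' \<in> events" unfolding E'_def by blast
  have "AE \<omega> in P. continuous_on {0..T} (\<lambda>t. Y t \<omega>)" using Y(2) by (simp add: continuous_process_def)
  then have ae: "AE \<omega> in P. \<omega> \<in> ?E \<longleftrightarrow> \<omega> \<in> E'" using AE_space
  proof eventually_elim
    case (elim \<omega>)
    have "continuous_on {t0..T} (\<lambda>t. Y t \<omega>)" by (rule continuous_on_subset[OF elim(1)]) (use t in auto)
    then have "continuous_on {t0..T} (\<lambda>t. norm (Y t \<omega> - Y t0 \<omega> - f t))" by (intro continuous_intros f)
    from SUP_less_iff_rational[OF t(2) this, of \<epsilon>] elim(2) show ?case
      by (simp add: E'_def E_def Q_def)
  qed
  show "AE \<omega> in P. real_cond_exp (completion P) (incr_filtration P L t0) (indicator ?E) \<omega> > 0"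
  proof (rule cond_exp_indicator_pos[OF space_incr_filtration sets_incr_filtration_subset[OF Lm] _ E'm ae])
    fix B assume B: "B \<in> sets (incr_filtration P L t0)" "prob B > 0"
    \<comment> \<open>Leaves the margin
      \<open>\<epsilon> / 2 \<le> \<epsilon> - 1 / (k + 1)\<close>, so the closed ball of radius
      \<open>\<epsilon> / 2\<close> lies in \<open>E'\<close>.\<close>
    obtain k where k: "1 / real (Suc k) < \<epsilon> / 2"
      using reals_Archimedean[of "\<epsilon> / 2"] \<epsilon> by (auto simp: inverse_eq_divide)
    have BP: "B \<in> events" using B(1) sets_incr_filtration_subset[of L P t0, OF Lm] by auto
    have "0 < prob {\<omega> \<in> B. \<forall>q\<in>{t0..T} \<inter> \<rat>. norm (Y q \<omega> - Y t0 \<omega> - f q) \<le> \<epsilon> / 2}"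
      by (rule increments_ball_pos[OF P L \<Phi>m \<Psi>m \<Phi>0 \<Psi>0 X S ess Y t f _ B]) (use \<epsilon> in auto)
    also have "\<dots> \<le> prob (B \<inter> E')"
    proof (rule finite_measure_mono)
      have "\<omega> \<in> E (\<epsilon> - 1 / real (Suc k))"
        if \<omega>: "\<omega> \<in> B" "\<forall>q\<in>{t0..T} \<inter> \<rat>. norm (Y q \<omega> - Y t0 \<omega> - f q) \<le> \<epsilon> / 2" for \<omega>
      proof -
        have "\<omega> \<in> space P" using \<omega>(1) sets.sets_into_space[OF BP] by blast
        moreover have "norm (Y q \<omega> - Y t0 \<omega> - f q) \<le> \<epsilon> - 1 / real (Suc k)" if "q \<in> Q" for q
          using \<omega>(2) that k unfolding Q_def by (intro order_trans[OF bspec[OF \<omega>(2)]]) auto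
        ultimately show ?thesis by (simp add: E_def)
      qed
      then show "{\<omega> \<in> B. \<forall>q\<in>{t0..T} \<inter> \<rat>. norm (Y q \<omega> - Y t0 \<omega> - f q) \<le> \<epsilon> / 2} \<subseteq> B \<inter> E'"
        unfolding E'_def by blast
    qed (use BP E'm in blast)
    finally show "prob (B \<inter> E') > 0" .
  qed auto
qed

text \<open>The natural version of \<open>X t\<close> is adapted but need not have continuous paths. Taking left limits
  along rationals produces a continuous modification without enlarging the filtration by null sets.\<close>

lemma moving_average_adapted_modification:
  fixes P :: "'w measure" and L X :: "real \<Rightarrow> 'w \<Rightarrow> real^'d" and \<Phi> \<Psi> :: "real \<Rightarrow> real^'d^'d"
  assumes P: "prob_space P" and L: "two_sided_levy P L b S (null_measure borel)"
    and X: "moving_average P L \<Phi> \<Psi> X" and cm: "has_continuous_modification P {0..} X"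
  obtains Y where "modification P {0..} X Y" "continuous_process P {0..} Y" "adapted_process (incr_filtration P L) {0..} Y"
proof -
  interpret prob_space P by (rule P)
  have Xint: "has_levy_integral P L (\<lambda>u. indicator {..t} u *\<^sub>R row i (ma_kernel \<Phi> \<Psi> t u)) (\<lambda>\<omega>. X t \<omega> $ i)" if "t \<ge> 0" for t i
    using X that by (simp add: moving_average_def has_matrix_levy_integral_def)
  obtain N where N: "levy_random_measure P L N"
    using Xint[OF order_refl] unfolding has_levy_integral_def by blast
  interpret gaussian_random_measure P L N b S by (rule gaussian_random_measure_of_levy[OF P L N])
  have Lm: "L t \<in> borel_measurable P" for t using L by (simp add: two_sided_levy_def)
  let ?F = "incr_filtration P L"
  have "\<exists>Z\<in>borel_measurable (?F t). AE \<omega> in P. X t \<omega> $ i = Z \<omega>" if "t \<ge> 0" for t i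
    by (rule has_levy_integral_adapted[OF space_incr_filtration sets_incr_filtration_subset[OF Lm] _ Xint[OF that], of t])
      (auto intro: increment_measurable_incr_filtration)
  then obtain Z where Z: "\<And>t i. t \<ge> 0 \<Longrightarrow> Z t i \<in> borel_measurable (?F t)" "\<And>t i. t \<ge> 0 \<Longrightarrow> AE \<omega> in P. X t \<omega> $ i = Z t i \<omega>"
    by metis
  define V where "V = (\<lambda>t \<omega>. \<chi> i. Z t i \<omega>)"
  have Vm: "V t \<in> borel_measurable (?F t)" if "t \<ge> 0" for t
    by (rule borel_measurable_vec) (simp add: V_def Z(1)[OF that])
  have VX: "AE \<omega> in P. V t \<omega> = X t \<omega>" if "t \<ge> 0" for t
  proof -
    have "AE \<omega> in P. \<forall>i\<in>UNIV. X t \<omega> $ i = Z t i \<omega>" by (rule AE_finite_allI) (simp_all add: Z(2)[OF that])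
    then show ?thesis by eventually_elim (simp add: V_def vec_eq_iff)
  qed
  obtain C where C: "modification P {0..} X C" "continuous_process P {0..} C"
    using cm by (auto simp: has_continuous_modification_def)
  \<comment> \<open>\<open>r t n < t\<close> keeps the sampled values in the sigma-algebra of time
    \<open>t\<close>, and \<open>max 0\<close> keeps the sampling times nonnegative.\<close>
  have "\<exists>r::nat \<Rightarrow> real. \<forall>n. r n \<in> \<rat> \<and> max 0 (t - 1 / real (Suc n)) < r n \<and> r n < t" if "t > 0" for t
  proof (intro choice allI)
    fix n
    show "\<exists>y. y \<in> \<rat> \<and> max 0 (t - 1 / real (Suc n)) < y \<and> y < t"
      using Rats_dense_in_real[of "max 0 (t - 1 / real (Suc n))" t] that by auto
  qed
  then obtain r where r: "\<And>t n. t > 0 \<Longrightarrow> r t n \<in> \<rat>" "\<And>t n. t > 0 \<Longrightarrow> max 0 (t - 1 / real (Suc n)) < r t n" "\<And>t n. t > 0 \<Longrightarrow> r t n < t"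
    by metis
  have rlim: "r t \<longlonglongrightarrow> t" if "t > 0" for t
  proof (rule tendsto_sandwich)
    have "(\<lambda>n. t - 1 / real (Suc n)) \<longlonglongrightarrow> t - 0" by (intro tendsto_intros LIMSEQ_Suc[OF lim_1_over_n])
    then show "(\<lambda>n. t - 1 / real (Suc n)) \<longlonglongrightarrow> t" by simp
  qed (use r(2,3)[OF that] in \<open>auto intro!: always_eventually less_imp_le\<close>)
  \<comment> \<open>\<open>lim\<close> is measurable even where the sequence diverges, so
    \<open>Y\<close> is adapted without exceptional sets. Time \<open>0\<close> has no admissible
    times to its left and takes \<open>V 0\<close> itself.\<close>
  define Y where "Y = (\<lambda>t \<omega>. if t \<le> 0 then V 0 \<omega> else lim (\<lambda>n. V (r t n) \<omega>))"
  have mono: "g \<in> borel_measurable (?F t)" if "g \<in> borel_measurable (?F s)" "s \<le> t" for g :: "'w \<Rightarrow> real^'d" and s t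
    by (rule borel_measurable_subalgebra[OF incr_filtration_mono[OF that(2)] _ that(1)]) (simp add: space_incr_filtration)
  have Ym: "Y t \<in> borel_measurable (?F t)" if t: "t \<ge> 0" for t
  proof (cases "t = 0")
    case True
    then show ?thesis using Vm[of 0] by (simp add: Y_def)
  next
    case False
    have "V (r t n) \<in> borel_measurable (?F t)" for n
      using r[of t n] t False by (intro mono[OF Vm]) auto
    then have "(\<lambda>\<omega>. lim (\<lambda>n. V (r t n) \<omega>)) \<in> borel_measurable (?F t)" by (rule borel_measurable_lim_metric)
    then show ?thesis using t False by (simp add: Y_def)
  qed
  \<comment> \<open>Countably many times share one null set; outside it, and where \<open>C\<close>
    is continuous, \<open>Y\<close> equals \<open>C\<close> at all times simultaneously.\<close>
  have "AE \<omega> in P. \<forall>q\<in>\<rat> \<inter> {0..}. V q \<omega> = C q \<omega>"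
  proof (subst AE_ball_countable)
    show "\<forall>q\<in>\<rat> \<inter> {0..}. AE \<omega> in P. V q \<omega> = C q \<omega>"
    proof
      fix q :: real assume "q \<in> \<rat> \<inter> {0..}"
      then have "AE \<omega> in P. C q \<omega> = X q \<omega>" "AE \<omega> in P. V q \<omega> = X q \<omega>" using C(1) VX by (auto simp: modification_def)
      then show "AE \<omega> in P. V q \<omega> = C q \<omega>" by eventually_elim simp
    qed
  qed (use countable_rat in auto)
  moreover have "AE \<omega> in P. continuous_on {0..} (\<lambda>t. C t \<omega>)" using C(2) by (simp add: continuous_process_def)
  ultimately have YC: "AE \<omega> in P. continuous_on {0..} (\<lambda>t. C t \<omega>) \<and> (\<forall>t\<in>{0..}. Y t \<omega> = C t \<omega>)"
  proof eventually_elim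
    case (elim \<omega>)
    have "Y t \<omega> = C t \<omega>" if t: "t \<ge> 0" for t
    proof (cases "t = 0")
      case True
      then show ?thesis using elim(1) by (simp add: Y_def)
    next
      case False
      then have t': "t > 0" using t by simp
      have r0: "0 \<le> r t n" for n using r(2)[OF t', of n] by simp
      have "(\<lambda>n. C (r t n) \<omega>) \<longlonglongrightarrow> C t \<omega>"
        by (rule continuous_on_tendsto_compose[OF elim(2) rlim[OF t']]) (use t r0 in auto)
      then have "(\<lambda>n. V (r t n) \<omega>) \<longlonglongrightarrow> C t \<omega>" using elim(1) r(1)[OF t'] r0 by simp
      then show ?thesis using t' by (simp add: Y_def limI)
    qed
    then show ?case using elim(2) by simp
  qed
  show ?thesis
  proof
    show "modification P {0..} X Y"
      unfolding modification_def
    proof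
      fix t :: real assume t: "t \<in> {0..}"
      then have "AE \<omega> in P. C t \<omega> = X t \<omega>" using C(1) by (simp add: modification_def)
      with YC show "AE \<omega> in P. Y t \<omega> = X t \<omega>" by eventually_elim (use t in auto)
    qed
    have "AE \<omega> in P. continuous_on {0..} (\<lambda>t. Y t \<omega>)"
      using YC
    proof eventually_elim
      case (elim \<omega>)
      then show ?case using continuous_on_cong[of "{0..}" "{0..}" "\<lambda>t. Y t \<omega>" "\<lambda>t. C t \<omega>"] by simp
    qed
    moreover have "Y t \<in> borel_measurable P" if "t \<ge> 0" for t
      by (rule borel_measurable_subalgebra[OF sets_incr_filtration_subset[OF Lm] _ Ym[OF that]]) (simp add: space_incr_filtration)
    ultimately show "continuous_process P {0..} Y" by (simp add: continuous_process_def)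
    show "adapted_process (incr_filtration P L) {0..} Y" using Ym by (simp add: adapted_process_def)
  qed
qed

theorem theorem2p7:
  fixes P :: "'w measure"
    and L :: "real \<Rightarrow> 'w \<Rightarrow> real^'d::{finite,linorder}"
    and b :: "real^'d::{finite,linorder}" and S :: "real^'d::{finite,linorder}^'d::{finite,linorder}" and \<Lambda> :: "(real^'d::{finite,linorder}) measure"
    and \<Phi> \<Psi> :: "real \<Rightarrow> real^'d::{finite,linorder}^'d::{finite,linorder}"
    and X :: "real \<Rightarrow> 'w \<Rightarrow> real^'d::{finite,linorder}"
    and A :: "real \<Rightarrow> real \<Rightarrow> 'w \<Rightarrow> real^'d::{finite,linorder}"
  assumes "prob_space P"
    and "two_sided_levy P L b S \<Lambda>"
    and "\<Phi> \<in> borel_measurable borel" and "\<Psi> \<in> borel_measurable borel"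
    and "\<And>t. t < 0 \<Longrightarrow> \<Phi> t = 0" and "\<And>t. t < 0 \<Longrightarrow> \<Psi> t = 0"
    and "ma_integrable b S \<Lambda> \<Phi> \<Psi>"
    and "moving_average P L \<Phi> \<Psi> X"
    and "det S \<noteq> 0" and "\<Lambda> = null_measure borel"
    and "has_continuous_modification P {0..} X"
    and "\<And>t0 t. 0 \<le> t0 \<Longrightarrow> t0 \<le> t \<Longrightarrow>
           has_matrix_levy_integral P L {..t0} (\<lambda>u. \<Phi> (t - u) - \<Phi> (t0 - u)) (A t0 t)"
    and "\<And>t0. 0 \<le> t0 \<Longrightarrow> has_continuous_modification P {t0..} (A t0)"
    and "0 \<in> ess_supp (conv_det \<Phi>)"
  shows "(\<exists>Y. modification P {0..} X Y \<and>
              (\<forall>T>0. conditional_full_support P (incr_filtration P L) T Y)) \<and>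
         (\<forall>T>0. \<forall>Y. modification P {0..T} X Y \<and> continuous_process P {0..T} Y \<and>
              adapted_process (incr_filtration P L) {0..T} Y \<longrightarrow>
              conditional_full_support P (incr_filtration P L) T Y)"
proof (intro conjI allI impI, goal_cases)
  have L: "two_sided_levy P L b S (null_measure borel)" using assms(2,10) by simp
  case 1
  obtain Y where Y: "modification P {0..} X Y" "continuous_process P {0..} Y" "adapted_process (incr_filtration P L) {0..} Y"
    using moving_average_adapted_modification[OF assms(1) L assms(8,11)] .
  have "conditional_full_support P (incr_filtration P L) T Y" for T
  proof (rule conditional_full_support_brownian[OF assms(1) L assms(3-6,8,9,14)])
    show "modification P {0..T} X Y" using Y(1) by (simp add: modification_def)
    show "continuous_process P {0..T} Y"
      using Y(2) by (auto simp: continuous_process_def elim!: eventually_mono continuous_on_subset)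
    show "adapted_process (incr_filtration P L) {0..T} Y" using Y(3) by (simp add: adapted_process_def)
  qed
  then show ?case using Y(1) by blast
next
  have L: "two_sided_levy P L b S (null_measure borel)" using assms(2,10) by simp
  case (2 T Y)
  then show ?case
    using conditional_full_support_brownian[OF assms(1) L assms(3-6,8,9,14)] by blast
qed

end
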